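(* Let $G=N\rtimes H$, $M$, $\mathcal U$, $D$, $D_0$, $\alpha$, $A_0=D_0\rtimes_\alpha G$, $A=D\rtimes_\alpha G$ and $p=\chi_M$ be as in the context, with $\mathcal U$ having finite quotients and $H$ acting effectively on $M$. Assume that the regular representation of $D\rtimes_\alpha G$ onto $D\rtimes_{\alpha,r}G$ is an isomorphism. Then $pA_0p$ has a unique $C^*$-norm, and $pAp$ is its enveloping $C^*$-algebra.
   Context: $G=N\rtimes H$ is a discrete group which is a semidirect product with normal subgroup $N$ and quotient group $H$ (regarded as a subgroup of $G$, acting on $N$ by conjugation), and $M\neq\{e\}$ is a normal subgroup of $N$. Put $\mathcal U=\{aMa^{-1}:a\in H\}$. Standing assumptions: (filter base) for all $U,V\in\mathcal U$ there is $W\in\mathcal U$ with $W\subseteq U\cap V$; (separating) $\bigcap_{U\in\mathcal U}U=\{e\}$; (finite quotients) $|U/V|<\infty$ whenever $V\subseteq U$ in $\mathcal U$; (effective) for each $a\ne e$ in $H$ there is $s\in M$ with $asa^{-1}\neq s$. For $g=xa\in G$ with $x\in N$, $a\in H$, let $\beta_g:N\to N$, $\beta_g(y)=xaya^{-1}$, and let $\alpha_g(f)=f\circ\beta_{g^{-1}}$ for $f\in\ell^\infty(N)$. Let $\mathcal P=\{\chi_{xU}:x\in N,U\in\mathcal U\}\subseteq\ell^\infty(N)$, let $D=C^*(\mathcal P)\subseteq\ell^\infty(N)$, and let $D_0=\operatorname{span}\mathcal P$, a dense $\alpha$-invariant $*$-subalgebra of $D$. $\alpha$ restricts to an action of $G$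 on $D$. $A=D\rtimes_\alpha G$ is the full $C^*$-crossed product and $D\rtimes_{\alpha,r}G$ the reduced one; $i_D:D\to M(A)$ and $i_G:G\to UM(A)$ are the canonical maps, suppressed from the notation. $A_0=D_0\rtimes_\alpha G:=\operatorname{span} i_G(G)i_D(D_0)\subseteq A$ is the algebraic crossed product, a $*$-subalgebra. $p=\chi_M\in D_0$, regarded as a projection in $A_0$. A $C^*$-algebra $B$ containing a $*$-algebra $B_0$ as a dense $*$-subalgebra is the enveloping $C^*$-algebra of $B_0$ if every $*$-homomorphism of $B_0$ into $\mathcal B(X)$, for any Hilbert space $X$, extends (uniquely) to a $*$-homomorphism of $B$. *)

theory Defs
  imports "HOL-Analysis.Analysis" "HOL-Algebra.Coset"
begin

section \<open>Complex Hilbert spaces\<close>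

text \<open>
  The real Hilbert space structure underlying a complex Hilbert space is the library's one
  (\<^class>\<open>real_inner\<close> and \<^class>\<open>complete_space\<close>), so that norm, convergence and bounded
  linearity are available. The complex inner product is linear in its first argument.
\<close>

class complex_hilbert_space = real_inner + complete_space +
  fixes scaleC :: "complex \<Rightarrow> 'a \<Rightarrow> 'a" (infixr \<open>*\<^sub>C\<close> 75)
    and cinner :: "'a \<Rightarrow> 'a \<Rightarrow> complex"
  assumes scaleC_add_right: "c *\<^sub>C (x + y) = c *\<^sub>C x + c *\<^sub>C y"
    and scaleC_add_left: "(c + d) *\<^sub>C x = c *\<^sub>C x + d *\<^sub>C x"
    and scaleC_scaleC: "c *\<^sub>C d *\<^sub>C x = (c * d) *\<^sub>C x"
    and scaleC_of_real: "complex_of_real r *\<^sub>C x = r *\<^sub>R x"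
    and cinner_add_left: "cinner (x + y) z = cinner x z + cinner y z"
    and cinner_scaleC_left: "cinner (c *\<^sub>C x) y = c * cinner x y"
    and cinner_commute: "cinner x y = cnj (cinner y x)"
    and inner_eq_Re_cinner: "x \<bullet> y = Re (cinner x y)"


section \<open>The Hilbert space of square-summable functions\<close>

typedef 'i ell2 = "{f :: 'i \<Rightarrow> complex. (\<lambda>i. (cmod (f i))\<^sup>2) summable_on UNIV}"
  by (rule exI[of _ "\<lambda>_. 0"]) simp

lemma Rep_ell2_summable: "(\<lambda>i. (cmod (Rep_ell2 x i))\<^sup>2) summable_on UNIV"
  using Rep_ell2[of x] by simp

lemma ell2_add:
  assumes "(\<lambda>i. (cmod (f i))\<^sup>2) summable_on UNIV" "(\<lambda>i. (cmod (g i))\<^sup>2) summable_on UNIV"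
  shows "(\<lambda>i. (cmod (f i + g i))\<^sup>2) summable_on UNIV"
proof (rule summable_on_comparison_test)
  show "(\<lambda>i. 2 * (cmod (f i))\<^sup>2 + 2 * (cmod (g i))\<^sup>2) summable_on UNIV"
    by (intro summable_on_add summable_on_cmult_right assms)
  fix i
  have "(cmod (f i + g i))\<^sup>2 \<le> (cmod (f i) + cmod (g i))\<^sup>2"
    by (simp add: norm_triangle_ineq power_mono)
  also have "\<dots> \<le> 2 * (cmod (f i))\<^sup>2 + 2 * (cmod (g i))\<^sup>2"
    using sum_squares_bound[of "cmod (f i)" "cmod (g i)"] by (simp add: power2_sum)
  finally show "(cmod (f i + g i))\<^sup>2 \<le> 2 * (cmod (f i))\<^sup>2 + 2 * (cmod (g i))\<^sup>2" .
qed simp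

lemma ell2_scale:
  assumes "(\<lambda>i. (cmod (f i))\<^sup>2) summable_on UNIV"
  shows "(\<lambda>i. (cmod (c * f i))\<^sup>2) summable_on UNIV"
  unfolding norm_mult power_mult_distrib by (intro summable_on_cmult_right assms)

lemma ell2_mult_summable:
  assumes "(\<lambda>i. (cmod (f i))\<^sup>2) summable_on UNIV" "(\<lambda>i. (cmod (g i))\<^sup>2) summable_on UNIV"
  shows "(\<lambda>i. f i * cnj (g i)) summable_on UNIV"
proof -
  have "(\<lambda>i. cmod (f i * cnj (g i))) summable_on UNIV"
  proof (rule summable_on_comparison_test)
    show "(\<lambda>i. (cmod (f i))\<^sup>2 + (cmod (g i))\<^sup>2) summable_on UNIV"
      by (intro summable_on_add assms)
    fix i
    have "2 * (cmod (f i) * cmod (g i)) \<le> (cmod (f i))\<^sup>2 + (cmod (g i))\<^sup>2"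
      using sum_squares_bound[of "cmod (f i)" "cmod (g i)"] by simp
    moreover have "0 \<le> cmod (f i) * cmod (g i)" by simp
    ultimately have "cmod (f i) * cmod (g i) \<le> (cmod (f i))\<^sup>2 + (cmod (g i))\<^sup>2"
      by linarith
    then show "cmod (f i * cnj (g i)) \<le> (cmod (f i))\<^sup>2 + (cmod (g i))\<^sup>2"
      by (simp add: norm_mult)
  qed simp
  then show ?thesis
    by (rule abs_summable_summable)
qed

instantiation ell2 :: (type) real_vector
begin
definition "0 = Abs_ell2 (\<lambda>_. 0)"
definition "x + y = Abs_ell2 (\<lambda>i. Rep_ell2 x i + Rep_ell2 y i)"
definition "x - y = Abs_ell2 (\<lambda>i. Rep_ell2 x i - Rep_ell2 y i)"
definition "- x = Abs_ell2 (\<lambda>i. - Rep_ell2 x i)"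
definition "r *\<^sub>R x = Abs_ell2 (\<lambda>i. complex_of_real r * Rep_ell2 x i)"

lemma Rep_ell2_zero [simp]: "Rep_ell2 0 i = 0"
  by (simp add: zero_ell2_def Abs_ell2_inverse)

lemma Rep_ell2_add [simp]: "Rep_ell2 (x + y) i = Rep_ell2 x i + Rep_ell2 y i"
  by (simp add: plus_ell2_def Abs_ell2_inverse ell2_add Rep_ell2_summable)

lemma Rep_ell2_uminus [simp]: "Rep_ell2 (- x) i = - Rep_ell2 x i"
  by (simp add: uminus_ell2_def Abs_ell2_inverse Rep_ell2_summable)

lemma Rep_ell2_diff [simp]: "Rep_ell2 (x - y) i = Rep_ell2 x i - Rep_ell2 y i"
  using ell2_add[of "Rep_ell2 x" "\<lambda>i. - Rep_ell2 y i"]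
  by (simp add: minus_ell2_def Abs_ell2_inverse Rep_ell2_summable)

lemma Rep_ell2_scaleR [simp]: "Rep_ell2 (r *\<^sub>R x) i = complex_of_real r * Rep_ell2 x i"
  using ell2_scale[of "Rep_ell2 x" "complex_of_real r"]
  by (simp add: scaleR_ell2_def Abs_ell2_inverse Rep_ell2_summable)

lemma ell2_eqI: "(\<And>i. Rep_ell2 x i = Rep_ell2 y i) \<Longrightarrow> x = y"
  by (simp add: Rep_ell2_inject[symmetric] ext)

instance
  by standard (rule ell2_eqI, simp add: algebra_simps)+
end

definition ell2_cinner :: "'i ell2 \<Rightarrow> 'i ell2 \<Rightarrow> complex" where
  "ell2_cinner x y = (\<Sum>\<^sub>\<infinity>i. Rep_ell2 x i * cnj (Rep_ell2 y i))"

lemma ell2_cinner_summable: "(\<lambda>i. Rep_ell2 x i * cnj (Rep_ell2 y i)) summable_on UNIV"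
  by (intro ell2_mult_summable Rep_ell2_summable)

lemma ell2_cinner_self: "ell2_cinner x x = complex_of_real (\<Sum>\<^sub>\<infinity>i. (cmod (Rep_ell2 x i))\<^sup>2)"
  unfolding ell2_cinner_def complex_norm_square[symmetric]
  by (intro infsumI has_sum_bounded_linear[OF bounded_linear_of_real] has_sum_infsum
        Rep_ell2_summable)

lemma ell2_cinner_add: "ell2_cinner (x + y) z = ell2_cinner x z + ell2_cinner y z"
  by (simp add: ell2_cinner_def ring_distribs infsum_add ell2_cinner_summable)

lemma ell2_cinner_commute: "ell2_cinner x y = cnj (ell2_cinner y x)"
  by (simp add: ell2_cinner_def mult.commute flip: infsum_cnj)

instantiation ell2 :: (type) real_inner
begin
definition "x \<bullet> y = Re (ell2_cinner x y)"
definition "norm (x :: 'a ell2) = sqrt (x \<bullet> x)"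
definition "sgn (x :: 'a ell2) = x /\<^sub>R norm x"
definition "dist (x :: 'a ell2) y = norm (x - y)"
definition [code del]:
  "(uniformity :: ('a ell2 \<times> 'a ell2) filter) = (INF e\<in>{0<..}. principal {(x, y). dist x y < e})"
definition [code del]:
  "open (U :: 'a ell2 set) \<longleftrightarrow> (\<forall>x\<in>U. eventually (\<lambda>(x', y). x' = x \<longrightarrow> y \<in> U) uniformity)"

instance
proof
  fix x y z :: "'a ell2" and r :: real
  show "x \<bullet> y = y \<bullet> x"
    using ell2_cinner_commute[of x y] by (simp add: inner_ell2_def)
  show "(x + y) \<bullet> z = x \<bullet> z + y \<bullet> z"
    by (simp add: inner_ell2_def ell2_cinner_add)
  have "ell2_cinner (r *\<^sub>R x) y = complex_of_real r * ell2_cinner x y"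
    by (simp add: ell2_cinner_def mult.assoc infsum_cmult_right')
  then show "(r *\<^sub>R x) \<bullet> y = r * (x \<bullet> y)"
    by (simp add: inner_ell2_def)
  show "0 \<le> x \<bullet> x"
    by (simp add: inner_ell2_def ell2_cinner_self infsum_nonneg)
  show "x \<bullet> x = 0 \<longleftrightarrow> x = 0"
  proof
    assume "x \<bullet> x = 0"
    then have "(\<Sum>\<^sub>\<infinity>i. (cmod (Rep_ell2 x i))\<^sup>2) = 0"
      by (simp add: inner_ell2_def ell2_cinner_self)
    then have "(cmod (Rep_ell2 x i))\<^sup>2 = 0" for i
      using nonneg_infsum_le_0D[of "\<lambda>i. (cmod (Rep_ell2 x i))\<^sup>2" UNIV i]
      by (simp add: Rep_ell2_summable)
    then show "x = 0" by (intro ell2_eqI) simp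
  qed (simp add: inner_ell2_def ell2_cinner_def)
qed (simp_all add: norm_ell2_def sgn_ell2_def dist_ell2_def uniformity_ell2_def open_ell2_def)
end

lemma norm_ell2_sq: "(norm x)\<^sup>2 = (\<Sum>\<^sub>\<infinity>i. (cmod (Rep_ell2 x i))\<^sup>2)"
  by (simp add: norm_ell2_def inner_ell2_def ell2_cinner_self infsum_nonneg)

lemma sum_cmod_le_norm_ell2:
  assumes "finite F"
  shows "(\<Sum>i\<in>F. (cmod (Rep_ell2 x i))\<^sup>2) \<le> (norm x)\<^sup>2"
  unfolding norm_ell2_sq by (rule finite_sum_le_infsum) (use assms Rep_ell2_summable in auto)

lemma cmod_le_norm_ell2: "cmod (Rep_ell2 x i) \<le> norm x"
  using sum_cmod_le_norm_ell2[of "{i}" x] by (simp add: power2_le_iff_abs_le)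

instance ell2 :: (type) complete_space
proof
  fix X :: "nat \<Rightarrow> 'a ell2"
  assume X: "Cauchy X"
  have "Cauchy (\<lambda>n. Rep_ell2 (X n) i)" for i
  proof (rule metric_CauchyI)
    fix e :: real assume "0 < e"
    then obtain K where K: "\<And>m n. m \<ge> K \<Longrightarrow> n \<ge> K \<Longrightarrow> dist (X m) (X n) < e"
      using metric_CauchyD[OF X] by blast
    have "dist (Rep_ell2 (X m) i) (Rep_ell2 (X n) i) < e" if "m \<ge> K" "n \<ge> K" for m n
      using cmod_le_norm_ell2[of "X m - X n" i] K[OF that] by (simp add: dist_norm)
    then show "\<exists>M. \<forall>m\<ge>M. \<forall>n\<ge>M. dist (Rep_ell2 (X m) i) (Rep_ell2 (X n) i) < e"
      by blast
  qed
  then have "\<forall>i. \<exists>l. (\<lambda>n. Rep_ell2 (X n) i) \<longlonglongrightarrow> l"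
    by (simp add: Cauchy_convergent_iff convergent_def)
  then obtain f where f: "\<And>i. (\<lambda>n. Rep_ell2 (X n) i) \<longlonglongrightarrow> f i"
    by metis
  have bound: "(\<Sum>i\<in>F. (cmod (Rep_ell2 (X m) i - f i))\<^sup>2) \<le> e\<^sup>2"
    if K: "\<And>m n. m \<ge> K \<Longrightarrow> n \<ge> K \<Longrightarrow> dist (X m) (X n) < e" and "m \<ge> K" "finite F" for e K m F
  proof (rule tendsto_le[OF _ tendsto_const])
    show "(\<lambda>n. \<Sum>i\<in>F. (cmod (Rep_ell2 (X m) i - Rep_ell2 (X n) i))\<^sup>2)
        \<longlonglongrightarrow> (\<Sum>i\<in>F. (cmod (Rep_ell2 (X m) i - f i))\<^sup>2)"
      by (intro tendsto_intros f)
    have "(\<Sum>i\<in>F. (cmod (Rep_ell2 (X m) i - Rep_ell2 (X n) i))\<^sup>2) \<le> e\<^sup>2" if "n \<ge> K" for n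
    proof -
      have "(\<Sum>i\<in>F. (cmod (Rep_ell2 (X m - X n) i))\<^sup>2) \<le> (norm (X m - X n))\<^sup>2"
        by (rule sum_cmod_le_norm_ell2) fact
      also have "\<dots> \<le> e\<^sup>2"
        using K[OF \<open>m \<ge> K\<close> that] by (intro power_mono) (simp_all add: dist_norm)
      finally show ?thesis by simp
    qed
    then show "\<forall>\<^sub>F n in sequentially.
        (\<Sum>i\<in>F. (cmod (Rep_ell2 (X m) i - Rep_ell2 (X n) i))\<^sup>2) \<le> e\<^sup>2"
      unfolding eventually_sequentially by blast
  qed simp
  obtain K1 where K1: "\<And>m n. m \<ge> K1 \<Longrightarrow> n \<ge> K1 \<Longrightarrow> dist (X m) (X n) < 1"
    using metric_CauchyD[OF X, of 1] by auto
  have "(\<lambda>i. (cmod (Rep_ell2 (X K1) i - f i))\<^sup>2) summable_on UNIV"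
    by (rule nonneg_bdd_above_summable_on)
       (auto intro!: bdd_aboveI2[where M = "1\<^sup>2"] bound[OF K1])
  then have diff: "(\<lambda>i. (cmod (f i - Rep_ell2 (X K1) i))\<^sup>2) summable_on UNIV"
    by (simp add: norm_minus_commute)
  have "(\<lambda>i. (cmod (f i))\<^sup>2) summable_on UNIV"
    using ell2_add[OF diff Rep_ell2_summable[of "X K1"]] by simp
  then have Rep: "Rep_ell2 (Abs_ell2 f) = f"
    by (simp add: Abs_ell2_inverse)
  have "X \<longlonglongrightarrow> Abs_ell2 f"
  proof (rule metric_LIMSEQ_I)
    fix e :: real assume "0 < e"
    then obtain K where K: "\<And>m n. m \<ge> K \<Longrightarrow> n \<ge> K \<Longrightarrow> dist (X m) (X n) < e / 2"
      using metric_CauchyD[OF X, of "e / 2"] by auto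
    have "dist (X m) (Abs_ell2 f) < e" if "m \<ge> K" for m
    proof -
      have "(norm (X m - Abs_ell2 f))\<^sup>2 \<le> (e / 2)\<^sup>2"
        unfolding norm_ell2_sq
        by (rule infsum_le_finite_sums[OF Rep_ell2_summable])
           (use bound[OF K that] in \<open>simp add: Rep\<close>)
      then have "norm (X m - Abs_ell2 f) \<le> e / 2"
        using \<open>0 < e\<close> by (simp add: power2_le_iff_abs_le)
      then show ?thesis
        using \<open>0 < e\<close> by (simp add: dist_norm)
    qed
    then show "\<exists>no. \<forall>n\<ge>no. dist (X n) (Abs_ell2 f) < e" by blast
  qed
  then show "convergent X" by (rule convergentI)
qed

instantiation ell2 :: (type) complex_hilbert_space
begin
definition "c *\<^sub>C x = Abs_ell2 (\<lambda>i. c * Rep_ell2 x i)"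
definition "cinner = (ell2_cinner :: 'a ell2 \<Rightarrow> _)"

lemma Rep_ell2_scaleC [simp]: "Rep_ell2 (c *\<^sub>C x) i = c * Rep_ell2 x i"
  using ell2_scale[of "Rep_ell2 x" c]
  by (simp add: scaleC_ell2_def Abs_ell2_inverse Rep_ell2_summable)

instance
proof
  fix x y z :: "'a ell2" and c d :: complex and r :: real
  show "cinner x y = cnj (cinner y x)"
    unfolding cinner_ell2_def by (rule ell2_cinner_commute)
  show "cinner (c *\<^sub>C x) y = c * cinner x y"
    by (simp add: cinner_ell2_def ell2_cinner_def mult.assoc infsum_cmult_right')
qed (auto intro!: ell2_eqI simp: algebra_simps cinner_ell2_def ell2_cinner_add inner_ell2_def)
end


section \<open>Star-algebras and C*-algebras\<close>

text \<open>Algebras are complex, associative and not assumed unital.\<close>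

record 'a star_alg = "'a partial_object" +
  sa_zero :: 'a
  sa_add :: "'a \<Rightarrow> 'a \<Rightarrow> 'a"
  sa_mult :: "'a \<Rightarrow> 'a \<Rightarrow> 'a"
  sa_scale :: "complex \<Rightarrow> 'a \<Rightarrow> 'a"
  sa_star :: "'a \<Rightarrow> 'a"

record 'a normed_star_alg = "'a star_alg" +
  sa_norm :: "'a \<Rightarrow> real"

definition sa_diff :: "('a, 'b) star_alg_scheme \<Rightarrow> 'a \<Rightarrow> 'a \<Rightarrow> 'a" where
  "sa_diff S x y = sa_add S x (sa_scale S (-1) y)"

locale star_algebra =
  fixes S :: "('a, 'b) star_alg_scheme"
  assumes additive_group: "comm_group \<lparr>carrier = carrier S, mult = sa_add S, one = sa_zero S\<rparr>"
    and scale_closed: "x \<in> carrier S \<Longrightarrow> sa_scale S c x \<in> carrier S"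
    and scale_add_right: "\<lbrakk>x \<in> carrier S; y \<in> carrier S\<rbrakk> \<Longrightarrow>
          sa_scale S c (sa_add S x y) = sa_add S (sa_scale S c x) (sa_scale S c y)"
    and scale_add_left: "x \<in> carrier S \<Longrightarrow>
          sa_scale S (c + d) x = sa_add S (sa_scale S c x) (sa_scale S d x)"
    and scale_scale: "x \<in> carrier S \<Longrightarrow> sa_scale S c (sa_scale S d x) = sa_scale S (c * d) x"
    and scale_one: "x \<in> carrier S \<Longrightarrow> sa_scale S 1 x = x"
    and mult_closed: "\<lbrakk>x \<in> carrier S; y \<in> carrier S\<rbrakk> \<Longrightarrow> sa_mult S x y \<in> carrier S"
    and mult_assoc: "\<lbrakk>x \<in> carrier S; y \<in> carrier S; z \<in> carrier S\<rbrakk> \<Longrightarrow>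
          sa_mult S (sa_mult S x y) z = sa_mult S x (sa_mult S y z)"
    and mult_add_left: "\<lbrakk>x \<in> carrier S; y \<in> carrier S; z \<in> carrier S\<rbrakk> \<Longrightarrow>
          sa_mult S (sa_add S x y) z = sa_add S (sa_mult S x z) (sa_mult S y z)"
    and mult_add_right: "\<lbrakk>x \<in> carrier S; y \<in> carrier S; z \<in> carrier S\<rbrakk> \<Longrightarrow>
          sa_mult S x (sa_add S y z) = sa_add S (sa_mult S x y) (sa_mult S x z)"
    and mult_scale_left: "\<lbrakk>x \<in> carrier S; y \<in> carrier S\<rbrakk> \<Longrightarrow>
          sa_mult S (sa_scale S c x) y = sa_scale S c (sa_mult S x y)"
    and mult_scale_right: "\<lbrakk>x \<in> carrier S; y \<in> carrier S\<rbrakk> \<Longrightarrow>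
          sa_mult S x (sa_scale S c y) = sa_scale S c (sa_mult S x y)"
    and star_closed: "x \<in> carrier S \<Longrightarrow> sa_star S x \<in> carrier S"
    and star_star: "x \<in> carrier S \<Longrightarrow> sa_star S (sa_star S x) = x"
    and star_add: "\<lbrakk>x \<in> carrier S; y \<in> carrier S\<rbrakk> \<Longrightarrow>
          sa_star S (sa_add S x y) = sa_add S (sa_star S x) (sa_star S y)"
    and star_scale: "x \<in> carrier S \<Longrightarrow> sa_star S (sa_scale S c x) = sa_scale S (cnj c) (sa_star S x)"
    and star_mult: "\<lbrakk>x \<in> carrier S; y \<in> carrier S\<rbrakk> \<Longrightarrow>
          sa_star S (sa_mult S x y) = sa_mult S (sa_star S y) (sa_star S x)"

definition linear_subspace :: "('a, 'b) star_alg_scheme \<Rightarrow> 'a set \<Rightarrow> bool" where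
  "linear_subspace S L \<longleftrightarrow> L \<subseteq> carrier S \<and> sa_zero S \<in> L \<and>
     (\<forall>x\<in>L. \<forall>y\<in>L. sa_add S x y \<in> L) \<and> (\<forall>c. \<forall>x\<in>L. sa_scale S c x \<in> L)"

definition star_subalgebra :: "('a, 'b) star_alg_scheme \<Rightarrow> 'a set \<Rightarrow> bool" where
  "star_subalgebra S B \<longleftrightarrow> linear_subspace S B \<and>
     (\<forall>x\<in>B. \<forall>y\<in>B. sa_mult S x y \<in> B) \<and> (\<forall>x\<in>B. sa_star S x \<in> B)"

definition sa_span :: "('a, 'b) star_alg_scheme \<Rightarrow> 'a set \<Rightarrow> 'a set" where
  "sa_span S X = \<Inter>{L. linear_subspace S L \<and> X \<subseteq> L}"

definition sa_closure :: "('a, 'b) normed_star_alg_scheme \<Rightarrow> 'a set \<Rightarrow> 'a set" where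
  "sa_closure S X = {x \<in> carrier S. \<forall>e>0. \<exists>y\<in>X. sa_norm S (sa_diff S x y) < e}"

definition generated_cstar :: "('a, 'b) normed_star_alg_scheme \<Rightarrow> 'a set \<Rightarrow> 'a set" where
  "generated_cstar S X = \<Inter>{B. star_subalgebra S B \<and> sa_closure S B \<subseteq> B \<and> X \<subseteq> B}"

definition star_hom ::
  "('a, 'b) star_alg_scheme \<Rightarrow> ('c, 'd) star_alg_scheme \<Rightarrow> ('a \<Rightarrow> 'c) \<Rightarrow> bool" where
  "star_hom S T \<phi> \<longleftrightarrow> \<phi> \<in> carrier S \<rightarrow> carrier T \<and>
     (\<forall>x\<in>carrier S. \<forall>y\<in>carrier S. \<phi> (sa_add S x y) = sa_add T (\<phi> x) (\<phi> y)) \<and>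
     (\<forall>c. \<forall>x\<in>carrier S. \<phi> (sa_scale S c x) = sa_scale T c (\<phi> x)) \<and>
     (\<forall>x\<in>carrier S. \<forall>y\<in>carrier S. \<phi> (sa_mult S x y) = sa_mult T (\<phi> x) (\<phi> y)) \<and>
     (\<forall>x\<in>carrier S. \<phi> (sa_star S x) = sa_star T (\<phi> x))"

definition cstar_norm :: "('a, 'b) star_alg_scheme \<Rightarrow> ('a \<Rightarrow> real) \<Rightarrow> bool" where
  "cstar_norm S \<nu> \<longleftrightarrow>
     (\<forall>x\<in>carrier S. 0 \<le> \<nu> x \<and> (\<nu> x = 0 \<longleftrightarrow> x = sa_zero S)) \<and>
     (\<forall>c. \<forall>x\<in>carrier S. \<nu> (sa_scale S c x) = cmod c * \<nu> x) \<and>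
     (\<forall>x\<in>carrier S. \<forall>y\<in>carrier S. \<nu> (sa_add S x y) \<le> \<nu> x + \<nu> y) \<and>
     (\<forall>x\<in>carrier S. \<forall>y\<in>carrier S. \<nu> (sa_mult S x y) \<le> \<nu> x * \<nu> y) \<and>
     (\<forall>x\<in>carrier S. \<nu> (sa_mult S (sa_star S x) x) = (\<nu> x)\<^sup>2)"

definition cstar_algebra :: "('a, 'b) normed_star_alg_scheme \<Rightarrow> bool" where
  "cstar_algebra S \<longleftrightarrow> star_algebra S \<and> cstar_norm S (sa_norm S) \<and>
     (\<forall>X. (\<forall>n. X n \<in> carrier S) \<and>
          (\<forall>e>0. \<exists>K. \<forall>m\<ge>K. \<forall>n\<ge>K. sa_norm S (sa_diff S (X m) (X n)) < e) \<longrightarrow>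
          (\<exists>x\<in>carrier S. (\<lambda>n. sa_norm S (sa_diff S (X (n :: nat)) x)) \<longlonglongrightarrow> 0))"

definition has_unique_cstar_norm :: "('a, 'b) star_alg_scheme \<Rightarrow> bool" where
  "has_unique_cstar_norm S \<longleftrightarrow> (\<exists>!\<nu>. \<nu> \<in> extensional (carrier S) \<and> cstar_norm S \<nu>)"

text \<open>The C*-algebra of all bounded operators on a Hilbert space.\<close>

definition cadjoint :: "('x::complex_hilbert_space \<Rightarrow> 'x) \<Rightarrow> 'x \<Rightarrow> 'x" where
  "cadjoint T = (THE T'. \<forall>x y. cinner (T x) y = cinner x (T' y))"

definition bounded_ops :: "('x::complex_hilbert_space \<Rightarrow> 'x) normed_star_alg" where
  "bounded_ops =
     \<lparr>carrier = {T. bounded_linear T \<and> (\<forall>c x. T (c *\<^sub>C x) = c *\<^sub>C T x)},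
      sa_zero = (\<lambda>_. 0),
      sa_add = (\<lambda>S T x. S x + T x),
      sa_mult = (\<circ>),
      sa_scale = (\<lambda>c T x. c *\<^sub>C T x),
      sa_star = cadjoint,
      sa_norm = onorm\<rparr>"

text \<open>
  A C*-algebra \<open>B\<close> is the enveloping C*-algebra of its subset \<open>B0\<close>, with respect to
  representations on the Hilbert space \<open>'x\<close>; the usual notion quantifies over all Hilbert spaces,
  so theorems about it have to leave \<open>'x\<close> arbitrary.
\<close>

definition enveloping_cstar ::
  "'x::complex_hilbert_space itself \<Rightarrow> ('a, 'b) normed_star_alg_scheme \<Rightarrow> 'a set \<Rightarrow> bool" where
  "enveloping_cstar _ B B0 \<longleftrightarrow>
     cstar_algebra B \<and> star_subalgebra B B0 \<and> sa_closure B B0 = carrier B \<and>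
     (\<forall>\<phi> :: 'a \<Rightarrow> 'x \<Rightarrow> 'x. star_hom (B\<lparr>carrier := B0\<rparr>) bounded_ops \<phi> \<longrightarrow>
        (\<exists>!\<Phi>. \<Phi> \<in> extensional (carrier B) \<and> star_hom B bounded_ops \<Phi> \<and> (\<forall>b\<in>B0. \<Phi> b = \<phi> b)))"

definition corner :: "('a, 'b) star_alg_scheme \<Rightarrow> 'a \<Rightarrow> 'a set \<Rightarrow> 'a set" where
  "corner S p B = (\<lambda>x. sa_mult S p (sa_mult S x p)) ` B"

text \<open>
  Bounded families of operators indexed by \<open>R\<close> (that is, the C*-algebraic direct product of \<open>R\<close>
  copies of the bounded operators); families are extended by zero off \<open>R\<close>.
\<close>

definition op_families :: "'r set \<Rightarrow> ('r \<Rightarrow> 'x::complex_hilbert_space \<Rightarrow> 'x) normed_star_alg" where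
  "op_families R =
     \<lparr>carrier = {F. (\<forall>\<rho>\<in>R. F \<rho> \<in> carrier bounded_ops) \<and> (\<forall>\<rho>. \<rho> \<notin> R \<longrightarrow> F \<rho> = (\<lambda>_. 0)) \<and>
                    bdd_above ((\<lambda>\<rho>. onorm (F \<rho>)) ` R)},
      sa_zero = (\<lambda>_ _. 0),
      sa_add = (\<lambda>E F \<rho> x. E \<rho> x + F \<rho> x),
      sa_mult = (\<lambda>E F \<rho>. E \<rho> \<circ> F \<rho>),
      sa_scale = (\<lambda>c F \<rho> x. c *\<^sub>C F \<rho> x),
      sa_star = (\<lambda>F \<rho>. cadjoint (F \<rho>)),
      sa_norm = (\<lambda>F. SUP \<rho>\<in>R. onorm (F \<rho>))\<rparr>"


section \<open>The groups\<close>

definition conj_family :: "('g, 'm) monoid_scheme \<Rightarrow> 'g set \<Rightarrow> 'g set \<Rightarrow> 'g set set" where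
  "conj_family G H M = (\<lambda>a. (\<lambda>s. a \<otimes>\<^bsub>G\<^esub> s \<otimes>\<^bsub>G\<^esub> inv\<^bsub>G\<^esub> a) ` M) ` H"

locale semidirect_setting = group G
  for G (structure) and N H M :: "'g set" +
  assumes N_normal: "N \<lhd> G"
    and H_subgroup: "subgroup H G"
    and N_Int_H: "N \<inter> H = {\<one>}"
    and N_mult_H: "N <#> H = carrier G"
    and M_normal: "M \<lhd> G\<lparr>carrier := N\<rparr>"
    and M_nontrivial: "M \<noteq> {\<one>}"
    and filter_base:
      "\<lbrakk>U \<in> conj_family G H M; V \<in> conj_family G H M\<rbrakk> \<Longrightarrow> \<exists>W\<in>conj_family G H M. W \<subseteq> U \<inter> V"
    and separating: "\<Inter>(conj_family G H M) = {\<one>}"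

definition finite_quotients :: "('g, 'm) monoid_scheme \<Rightarrow> 'g set \<Rightarrow> 'g set \<Rightarrow> bool" where
  "finite_quotients G H M \<longleftrightarrow>
     (\<forall>U\<in>conj_family G H M. \<forall>V\<in>conj_family G H M. V \<subseteq> U \<longrightarrow>
        finite (carrier (G\<lparr>carrier := U\<rparr> Mod V)))"

definition acts_effectively :: "('g, 'm) monoid_scheme \<Rightarrow> 'g set \<Rightarrow> 'g set \<Rightarrow> bool" where
  "acts_effectively G H M \<longleftrightarrow>
     (\<forall>a\<in>H. a \<noteq> \<one>\<^bsub>G\<^esub> \<longrightarrow> (\<exists>s\<in>M. a \<otimes>\<^bsub>G\<^esub> s \<otimes>\<^bsub>G\<^esub> inv\<^bsub>G\<^esub> a \<noteq> s))"


section \<open>The action on D\<close>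

text \<open>Functions on \<open>N\<close> are represented as functions on the whole type that vanish off \<open>N\<close>.\<close>

definition ell_infinity :: "'g set \<Rightarrow> ('g \<Rightarrow> complex) normed_star_alg" where
  "ell_infinity N =
     \<lparr>carrier = {f. bounded (f ` N) \<and> (\<forall>y. y \<notin> N \<longrightarrow> f y = 0)},
      sa_zero = (\<lambda>_. 0),
      sa_add = (\<lambda>f h y. f y + h y),
      sa_mult = (\<lambda>f h y. f y * h y),
      sa_scale = (\<lambda>c f y. c * f y),
      sa_star = (\<lambda>f y. cnj (f y)),
      sa_norm = (\<lambda>f. SUP y\<in>N. cmod (f y))\<rparr>"

definition act_pt :: "('g, 'm) monoid_scheme \<Rightarrow> 'g set \<Rightarrow> 'g set \<Rightarrow> 'g \<Rightarrow> 'g \<Rightarrow> 'g" where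
  "act_pt G N H g y = (THE z. \<exists>x\<in>N. \<exists>a\<in>H. g = x \<otimes>\<^bsub>G\<^esub> a \<and>
     z = x \<otimes>\<^bsub>G\<^esub> a \<otimes>\<^bsub>G\<^esub> y \<otimes>\<^bsub>G\<^esub> inv\<^bsub>G\<^esub> a)"

definition act_fun ::
  "('g, 'm) monoid_scheme \<Rightarrow> 'g set \<Rightarrow> 'g set \<Rightarrow> 'g \<Rightarrow> ('g \<Rightarrow> complex) \<Rightarrow> 'g \<Rightarrow> complex" where
  "act_fun G N H g f = (\<lambda>y. if y \<in> N then f (act_pt G N H (inv\<^bsub>G\<^esub> g) y) else 0)"

definition coset_indicators ::
  "('g, 'm) monoid_scheme \<Rightarrow> 'g set \<Rightarrow> 'g set \<Rightarrow> 'g set \<Rightarrow> ('g \<Rightarrow> complex) set" where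
  "coset_indicators G N H M = {indicator (x <#\<^bsub>G\<^esub> U) |x U. x \<in> N \<and> U \<in> conj_family G H M}"

definition D_alg :: "('g, 'm) monoid_scheme \<Rightarrow> 'g set \<Rightarrow> 'g set \<Rightarrow> 'g set \<Rightarrow> ('g \<Rightarrow> complex) set" where
  "D_alg G N H M = generated_cstar (ell_infinity N) (coset_indicators G N H M)"

definition D0_alg :: "('g, 'm) monoid_scheme \<Rightarrow> 'g set \<Rightarrow> 'g set \<Rightarrow> 'g set \<Rightarrow> ('g \<Rightarrow> complex) set" where
  "D0_alg G N H M = sa_span (ell_infinity N) (coset_indicators G N H M)"


section \<open>The full crossed product\<close>

text \<open>
  Covariant representations are pairs \<open>(\<pi>, u)\<close>; as usual for the definition of the full crossed
  product, \<open>\<pi>\<close> may be degenerate. Only the values of \<open>\<pi>\<close> on \<open>D\<close> and of \<open>u\<close> on \<open>G\<close> matter.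
\<close>

definition unitary_op :: "('x::complex_hilbert_space \<Rightarrow> 'x) \<Rightarrow> bool" where
  "unitary_op T \<longleftrightarrow> T \<in> carrier bounded_ops \<and> T \<circ> cadjoint T = id \<and> cadjoint T \<circ> T = id"

definition covariant_reps ::
  "('g, 'm) monoid_scheme \<Rightarrow> 'g set \<Rightarrow> 'g set \<Rightarrow> 'g set \<Rightarrow>
   ((('g \<Rightarrow> complex) \<Rightarrow> 'x::complex_hilbert_space \<Rightarrow> 'x) \<times> ('g \<Rightarrow> 'x \<Rightarrow> 'x)) set" where
  "covariant_reps G N H M = {(\<pi>, u).
     star_hom ((ell_infinity N)\<lparr>carrier := D_alg G N H M\<rparr>) bounded_ops \<pi> \<and>
     (\<forall>s\<in>carrier G. unitary_op (u s)) \<and>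
     (\<forall>s\<in>carrier G. \<forall>t\<in>carrier G. u (s \<otimes>\<^bsub>G\<^esub> t) = u s \<circ> u t) \<and>
     (\<forall>s\<in>carrier G. \<forall>d\<in>D_alg G N H M. \<pi> (act_fun G N H s d) = u s \<circ> \<pi> d \<circ> cadjoint (u s))}"

text \<open>
  The full crossed product is realised as the closed span of the elements \<open>i_G s i_D d\<close>, where
  \<open>(i_D, i_G)\<close> is the product of all covariant representations on the Hilbert space
  \<open>\<ell>\<^sup>2(G \<times> \<nat>)\<close>. This gives the usual universal norm (the supremum over the covariant representations
  on all Hilbert spaces): the norm of an operator in a covariant representation is the supremum of
  its norms on the invariant subspaces generated by single vectors. Such a subspace is the closed
  span of at most \<open>\<bar>G \<times> \<nat>\<bar>\<close> vectors, because \<open>D\<close> is generated by the coset indicators of \<open>xaMa\<inverse>\<close>,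
  which are indexed by \<open>xa \<in> G\<close>. Hence it embeds into \<open>\<ell>\<^sup>2(G \<times> \<nat>)\<close>, where the representation extends
  by \<open>0\<close> (for \<open>D\<close>) and the identity (for \<open>G\<close>) on the orthogonal complement.
\<close>

type_synonym 'g univ_space = "('g \<times> nat) ell2"

type_synonym 'g univ_rep =
  "(('g \<Rightarrow> complex) \<Rightarrow> 'g univ_space \<Rightarrow> 'g univ_space) \<times> ('g \<Rightarrow> 'g univ_space \<Rightarrow> 'g univ_space)"

type_synonym 'g univ_family = "'g univ_rep \<Rightarrow> 'g univ_space \<Rightarrow> 'g univ_space"

definition i_D ::
  "('g, 'm) monoid_scheme \<Rightarrow> 'g set \<Rightarrow> 'g set \<Rightarrow> 'g set \<Rightarrow> ('g \<Rightarrow> complex) \<Rightarrow> 'g univ_family" where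
  "i_D G N H M d = (\<lambda>\<rho>. if \<rho> \<in> covariant_reps G N H M then fst \<rho> d else (\<lambda>_. 0))"

definition i_G ::
  "('g, 'm) monoid_scheme \<Rightarrow> 'g set \<Rightarrow> 'g set \<Rightarrow> 'g set \<Rightarrow> 'g \<Rightarrow> 'g univ_family" where
  "i_G G N H M s = (\<lambda>\<rho>. if \<rho> \<in> covariant_reps G N H M then snd \<rho> s else (\<lambda>_. 0))"

definition alg_crossed_product ::
  "('g, 'm) monoid_scheme \<Rightarrow> 'g set \<Rightarrow> 'g set \<Rightarrow> 'g set \<Rightarrow> ('g \<Rightarrow> complex) set \<Rightarrow>
   'g univ_family set" where
  "alg_crossed_product G N H M E =
     (let F = op_families (covariant_reps G N H M) in
      sa_span F {sa_mult F (i_G G N H M s) (i_D G N H M d) |s d. s \<in> carrier G \<and> d \<in> E})"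

definition full_crossed_product ::
  "('g, 'm) monoid_scheme \<Rightarrow> 'g set \<Rightarrow> 'g set \<Rightarrow> 'g set \<Rightarrow> 'g univ_family normed_star_alg" where
  "full_crossed_product G N H M =
     (let F = op_families (covariant_reps G N H M) in
      F\<lparr>carrier := sa_closure F (alg_crossed_product G N H M (D_alg G N H M))\<rparr>)"


section \<open>The reduced crossed product\<close>

text \<open>
  The regular representation is induced from the faithful representation of \<open>D\<close> on \<open>\<ell>\<^sup>2(N)\<close> by
  multiplication operators: on \<open>\<ell>\<^sup>2(G \<times> N)\<close> the function \<open>d\<close> acts in the fibre over \<open>g\<close> as
  multiplication by \<open>\<alpha>\<^bsub>g\<inverse>\<^esub>(d) = d \<circ> \<beta>\<^bsub>g\<^esub>\<close>, and \<open>s\<close> acts by left translation in \<open>G\<close>.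
  The space \<open>\<ell>\<^sup>2(G \<times> N)\<close> is regarded as a subspace of \<open>\<ell>\<^sup>2\<close> of the whole type; on the complement
  \<open>D\<close> acts as zero, so the products \<open>reg_G s \<circ> reg_D d\<close> vanish there.
\<close>

type_synonym 'g reg_space = "('g \<times> 'g) ell2"

definition reg_D ::
  "('g, 'm) monoid_scheme \<Rightarrow> 'g set \<Rightarrow> 'g set \<Rightarrow> ('g \<Rightarrow> complex) \<Rightarrow> 'g reg_space \<Rightarrow> 'g reg_space" where
  "reg_D G N H d \<xi> = Abs_ell2 (\<lambda>(g, y).
     if g \<in> carrier G \<and> y \<in> N then d (act_pt G N H g y) * Rep_ell2 \<xi> (g, y) else 0)"

definition reg_G :: "('g, 'm) monoid_scheme \<Rightarrow> 'g \<Rightarrow> 'g reg_space \<Rightarrow> 'g reg_space" where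
  "reg_G G s \<xi> = Abs_ell2 (\<lambda>(g, y).
     Rep_ell2 \<xi> (if g \<in> carrier G then inv\<^bsub>G\<^esub> s \<otimes>\<^bsub>G\<^esub> g else g, y))"

definition reduced_crossed_product ::
  "('g, 'm) monoid_scheme \<Rightarrow> 'g set \<Rightarrow> 'g set \<Rightarrow> 'g set \<Rightarrow>
   ('g reg_space \<Rightarrow> 'g reg_space) normed_star_alg" where
  "reduced_crossed_product G N H M =
     bounded_ops\<lparr>carrier := sa_closure bounded_ops (sa_span bounded_ops
       {reg_G G s \<circ> reg_D G N H d |s d. s \<in> carrier G \<and> d \<in> D_alg G N H M})\<rparr>"

definition regular_representation ::
  "('g, 'm) monoid_scheme \<Rightarrow> 'g set \<Rightarrow> 'g set \<Rightarrow> 'g set \<Rightarrow>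
   ('g univ_family \<Rightarrow> 'g reg_space \<Rightarrow> 'g reg_space) \<Rightarrow> bool" where
  "regular_representation G N H M \<Lambda> \<longleftrightarrow>
     star_hom (full_crossed_product G N H M) (reduced_crossed_product G N H M) \<Lambda> \<and>
     (\<forall>s\<in>carrier G. \<forall>d\<in>D_alg G N H M.
        \<Lambda> (sa_mult (full_crossed_product G N H M) (i_G G N H M s) (i_D G N H M d)) =
        reg_G G s \<circ> reg_D G N H d)"

end

theory Submission
  imports Defs "HOL-Library.Function_Algebras" "HOL-Computational_Algebra.Polynomial"
begin

text \<open>
  The norm of \<open>A\<close> restricts to a C*-norm on the corner \<open>p A\<^sub>0 p\<close>. That it is the only one follows from two
  bounds for an arbitrary C*-norm \<open>\<nu>\<close> on the corner.

  \<^emph>\<open>The norm of \<open>A\<close> bounds \<open>\<nu>\<close> from above.\<close> Every positive functional \<open>f\<close> on the corner satisfies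
  \<open>f (b\<^sup>* b) \<le> \<parallel>b\<parallel>\<^sup>2 f p\<close>, where \<open>\<parallel>b\<parallel>\<close> is the norm in \<open>A\<close> (\<open>posfun_corner_le\<close>). For \<open>f\<close> extends to the
  positive functional \<open>c \<mapsto> f (p c p)\<close> on all of \<open>A\<^sub>0\<close>: the projection of the coset \<open>x a M a\<inverse>\<close> is the conjugate
  of \<open>p\<close> by the unitary of \<open>x a\<close>, and because quotients of the groups in \<open>\<U>\<close> are finite, the range projection of an
  element of \<open>A\<^sub>0\<close> lies below a finite sum of such projections (\<open>posfun_corner_extend\<close>). The
  Gelfand-Naimark-Segal construction then works although \<open>A\<^sub>0\<close> has no norm to begin with: elements of \<open>D\<^sub>0\<close>
  are finite linear combinations of orthogonal projections, so that they act as bounded operators, and the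
  group acts by unitaries. The result is a covariant representation (\<open>gns_covariant\<close>), on which the norm of \<open>A\<close>
  is by definition an upper bound. Since in a unital C*-normed algebra the norm of \<open>b\<^sup>* b\<close> is attained by a state
  (\<open>norming_positive_functional\<close>), it follows that \<open>\<nu> b \<le> \<parallel>b\<parallel>\<close>. Applied to the functionals
  \<open>b \<mapsto> \<langle>\<phi> b v, v\<rangle>\<close>, the same estimate shows that every representation \<open>\<phi>\<close> of the corner is
  contractive (\<open>hom_corner_bounded\<close>), so that it extends to \<open>p A p\<close>.

  \<^emph>\<open>The reduced norm bounds \<open>\<nu>\<close> from below.\<close> Effectiveness makes the action of \<open>G\<close> on \<open>N\<close>
  topologically free, so that finitely many elements of \<open>G\<close> move some small coset near \<open>\<one>\<close> off itself
  (\<open>free_coset\<close>). Compressing \<open>b\<close> to the projection \<open>q\<close> of this coset leaves a scalar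
  multiple \<open>\<tau> b q\<close>, where \<open>\<tau>\<close> is the vector functional of a basis vector in the regular
  representation \<open>\<Lambda>\<close>. As \<open>\<nu> q = 1\<close>, this gives \<open>\<bar>\<tau> b\<bar> \<le> \<nu> b\<close>, and a positive functional that is dominated by
  a C*-norm defines a representation that is dominated by it (\<open>posfun_bound\<close>). The representations of the vector functionals
  exhaust \<open>\<Lambda>\<close>, hence \<open>\<parallel>\<Lambda> b\<parallel> \<le> \<nu> b\<close> (\<open>lnorm_le_cstar_norm\<close>).

  If \<open>\<Lambda>\<close> is an isomorphism, it is isometric (\<open>fnorm_le_lnorm\<close>), and the two bounds agree.
\<close>

section \<open>C*-seminorms on complex star-algebras\<close>

text \<open>
  The ambient algebras are types, so that ring normalization applies to them; the algebras of interest are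
  subsets, which need not contain the unit of the type.
\<close>

class complex_star_algebra = ring_1 +
  fixes scl :: "complex \<Rightarrow> 'a \<Rightarrow> 'a" (infixr \<open>\<odot>\<close> 75)
    and adj :: "'a \<Rightarrow> 'a"
  assumes scl_add_right: "c \<odot> (x + y) = c \<odot> x + c \<odot> y"
    and scl_add_left: "(c + d) \<odot> x = c \<odot> x + d \<odot> x"
    and scl_scl [simp]: "c \<odot> d \<odot> x = (c * d) \<odot> x"
    and scl_one [simp]: "1 \<odot> x = x"
    and scl_mult_left [simp]: "(c \<odot> x) * y = c \<odot> (x * y)"
    and scl_mult_right [simp]: "x * (c \<odot> y) = c \<odot> (x * y)"
    and adj_adj [simp]: "adj (adj x) = x"
    and adj_add [simp]: "adj (x + y) = adj x + adj y"
    and adj_scl [simp]: "adj (c \<odot> x) = cnj c \<odot> adj x"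
    and adj_mult [simp]: "adj (x * y) = adj y * adj x"
begin

lemma scl_0_left [simp]: "0 \<odot> x = 0"
  using scl_add_left[of 0 0 x] by simp

lemma scl_0_right [simp]: "c \<odot> 0 = 0"
  using scl_add_right[of c 0 0] by simp

lemma scl_minus_right [simp]: "c \<odot> (- x) = - (c \<odot> x)"
  using scl_add_right[of c x "- x"] by (simp add: eq_neg_iff_add_eq_0 add.commute)

lemma scl_minus_left [simp]: "(- c) \<odot> x = - (c \<odot> x)"
  using scl_add_left[of c "- c" x] by (simp add: eq_neg_iff_add_eq_0 add.commute)

lemma scl_diff_right: "c \<odot> (x - y) = c \<odot> x - c \<odot> y"
  using scl_add_right[of c x "- y"] by simp

lemma scl_diff_left: "(c - d) \<odot> x = c \<odot> x - d \<odot> x"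
  using scl_add_left[of c "- d" x] by simp

lemma adj_0 [simp]: "adj 0 = 0"
  using adj_add[of 0 0] by simp

lemma adj_minus [simp]: "adj (- x) = - adj x"
  using adj_add[of x "- x"] by (simp add: eq_neg_iff_add_eq_0 add.commute)

lemma adj_diff [simp]: "adj (x - y) = adj x - adj y"
  using adj_add[of x "- y"] by simp

lemma adj_1 [simp]: "adj 1 = 1"
  using adj_mult[of "adj 1" 1] by simp

lemma adj_sum: "adj (sum f A) = (\<Sum>i\<in>A. adj (f i))"
  by (induction A rule: infinite_finite_induct) simp_all

lemmas scl_distribs = scl_add_right scl_add_left scl_diff_right scl_diff_left

end

instantiation complex :: complex_star_algebra
begin
definition scl_complex :: "complex \<Rightarrow> complex \<Rightarrow> complex" where "scl_complex c x = c * x"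
definition adj_complex :: "complex \<Rightarrow> complex" where "adj_complex x = cnj x"
instance
  by standard (simp_all add: scl_complex_def adj_complex_def algebra_simps)
end

instantiation "fun" :: (type, complex_star_algebra) complex_star_algebra
begin
definition scl_fun :: "complex \<Rightarrow> ('a \<Rightarrow> 'b) \<Rightarrow> 'a \<Rightarrow> 'b" where "scl_fun c x = (\<lambda>i. c \<odot> x i)"
definition adj_fun :: "('a \<Rightarrow> 'b) \<Rightarrow> 'a \<Rightarrow> 'b" where "adj_fun x = (\<lambda>i. adj (x i))"
instance
  by standard (simp_all add: scl_fun_def adj_fun_def scl_add_right scl_add_left fun_eq_iff)
end

lemma scl_fun_apply [simp]: "(c \<odot> x) i = c \<odot> x i"
  and adj_fun_apply [simp]: "adj x i = adj (x i)"
  by (simp_all add: scl_fun_def adj_fun_def)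

locale star_sub =
  fixes S :: "'a::complex_star_algebra set"
  assumes zero_mem [simp, intro]: "0 \<in> S"
    and add_mem [simp, intro]: "\<lbrakk>x \<in> S; y \<in> S\<rbrakk> \<Longrightarrow> x + y \<in> S"
    and mult_mem [simp, intro]: "\<lbrakk>x \<in> S; y \<in> S\<rbrakk> \<Longrightarrow> x * y \<in> S"
    and scl_mem [simp, intro]: "x \<in> S \<Longrightarrow> c \<odot> x \<in> S"
    and adj_mem [simp, intro]: "x \<in> S \<Longrightarrow> adj x \<in> S"
begin

lemma minus_mem [simp, intro]: "x \<in> S \<Longrightarrow> - x \<in> S"
  using scl_mem[of x "-1"] by simp

lemma diff_mem [simp, intro]: "\<lbrakk>x \<in> S; y \<in> S\<rbrakk> \<Longrightarrow> x - y \<in> S"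
  using add_mem[of x "- y"] by simp

lemma sum_mem [intro]: "(\<And>i. i \<in> A \<Longrightarrow> f i \<in> S) \<Longrightarrow> sum f A \<in> S"
  by (induction A rule: infinite_finite_induct) auto

end

locale cstar_seminormed = star_sub S for S :: "'a::complex_star_algebra set" +
  fixes \<nu> :: "'a \<Rightarrow> real"
  assumes nu_nonneg [simp]: "x \<in> S \<Longrightarrow> 0 \<le> \<nu> x"
    and nu_scl: "x \<in> S \<Longrightarrow> \<nu> (c \<odot> x) = cmod c * \<nu> x"
    and nu_add: "\<lbrakk>x \<in> S; y \<in> S\<rbrakk> \<Longrightarrow> \<nu> (x + y) \<le> \<nu> x + \<nu> y"
    and nu_mult: "\<lbrakk>x \<in> S; y \<in> S\<rbrakk> \<Longrightarrow> \<nu> (x * y) \<le> \<nu> x * \<nu> y"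
    and nu_cstar: "x \<in> S \<Longrightarrow> \<nu> (adj x * x) = (\<nu> x)\<^sup>2"
begin

lemma nu_zero [simp]: "\<nu> 0 = 0"
  using nu_scl[of 0 0] by simp

lemma nu_minus [simp]: "x \<in> S \<Longrightarrow> \<nu> (- x) = \<nu> x"
  using nu_scl[of x "-1"] by simp

lemma nu_diff: "\<lbrakk>x \<in> S; y \<in> S\<rbrakk> \<Longrightarrow> \<nu> (x - y) \<le> \<nu> x + \<nu> y"
  using nu_add[of x "- y"] by simp

lemma nu_diff_commute: "\<lbrakk>x \<in> S; y \<in> S\<rbrakk> \<Longrightarrow> \<nu> (x - y) = \<nu> (y - x)"
  using nu_minus[of "x - y"] by simp

lemma nu_le_adj: assumes "x \<in> S" shows "\<nu> x \<le> \<nu> (adj x)"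
proof (cases "\<nu> x = 0")
  case False
  have "\<nu> x * \<nu> x \<le> \<nu> (adj x) * \<nu> x"
    using nu_cstar[OF assms] nu_mult[of "adj x" x] assms by (simp add: power2_eq_square)
  then show ?thesis
    using False nu_nonneg[OF assms] by (simp add: mult_le_cancel_right)
qed (use assms in simp)

lemma nu_adj [simp]: "x \<in> S \<Longrightarrow> \<nu> (adj x) = \<nu> x"
  using nu_le_adj[of x] nu_le_adj[of "adj x"] by simp

lemma nu_square: "\<lbrakk>x \<in> S; adj x = x\<rbrakk> \<Longrightarrow> \<nu> (x * x) = (\<nu> x)\<^sup>2"
  using nu_cstar[of x] by simp

lemma nu_triangle_reverse: "\<lbrakk>x \<in> S; y \<in> S\<rbrakk> \<Longrightarrow> \<bar>\<nu> x - \<nu> y\<bar> \<le> \<nu> (x - y)"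
  using nu_add[of "x - y" y] nu_add[of "y - x" x] nu_diff_commute[of x y] by simp

end

locale cstar_normed = cstar_seminormed +
  assumes nu_eq_zero: "\<lbrakk>x \<in> S; \<nu> x = 0\<rbrakk> \<Longrightarrow> x = 0"

lemma (in cstar_normed) eq_zero_if_le: "\<lbrakk>\<nu> x \<le> 0; x \<in> S\<rbrakk> \<Longrightarrow> x = 0"
  using nu_nonneg[of x] nu_eq_zero[of x] by linarith

definition (in cstar_seminormed) cauchy_seq :: "(nat \<Rightarrow> 'a) \<Rightarrow> bool" where
  "cauchy_seq X \<longleftrightarrow> (\<forall>e>0. \<exists>K. \<forall>m\<ge>K. \<forall>n\<ge>K. \<nu> (X m - X n) < e)"

locale cstar_complete = cstar_normed +
  assumes complete: "\<lbrakk>\<And>n. X n \<in> S; cauchy_seq X\<rbrakk> \<Longrightarrow> \<exists>x\<in>S. (\<lambda>n. \<nu> (X (n :: nat) - x)) \<longlonglongrightarrow> 0"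

subsection \<open>Square roots by iteration\<close>

text \<open>
  The iteration \<open>y \<mapsto> (h + y\<^sup>2) / 2\<close>, started at \<open>0\<close>, converges to \<open>1 - (1 - h)\<^sup>1\<^sup>/\<^sup>2\<close> whenever
  \<open>\<parallel>h\<parallel> < 1\<close>: on the ball of radius \<open>1 - (1 - \<parallel>h\<parallel>)\<^sup>1\<^sup>/\<^sup>2 < 1\<close>, which it preserves, it is a contraction.
  The numbers \<open>a n\<close> and \<open>d n\<close> stand for the norms of the iterates and of their increments.
\<close>

lemma sqrt_iteration_bounds:
  fixes a d :: "nat \<Rightarrow> real"
  assumes L: "0 \<le> L" "L < 1"
    and a: "a 0 = 0" "\<And>n. a (Suc n) \<le> (L + a n * a n) / 2" "\<And>n. 0 \<le> a n"
    and d: "d 0 \<le> L / 2" "\<And>n. d (Suc n) \<le> (a (Suc n) * d n + d n * a n) / 2" "\<And>n. 0 \<le> d n"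
  obtains r where "0 \<le> r" "r < 1" "\<And>n. a n \<le> r" "\<And>n. d n \<le> r ^ Suc n"
proof -
  define r where "r = 1 - sqrt (1 - L)"
  have r: "0 \<le> r" "r < 1"
    using L by (simp_all add: r_def)
  have req: "r = (L + r * r) / 2"
    using L by (simp add: r_def algebra_simps)
  have ar: "a n \<le> r" for n
  proof (induction n)
    case (Suc n)
    have "a n * a n \<le> r * r"
      using Suc a(3)[of n] by (intro mult_mono) auto
    then show ?case using a(2)[of n] req by simp
  qed (simp add: a r)
  have dr: "d n \<le> r ^ Suc n" for n
  proof (induction n)
    case 0
    have "r - L / 2 = r * r / 2" using req by (simp add: field_simps)
    moreover have "0 \<le> r * r / 2" by simp
    ultimately have "L / 2 \<le> r" by linarith
    then show ?case using d(1) by simp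
  next
    case (Suc n)
    have "a (Suc n) * d n \<le> r * r ^ Suc n" "d n * a n \<le> r ^ Suc n * r"
      using Suc ar d(3)[of n] a(3) r by (intro mult_mono; simp)+
    moreover have "2 * d (Suc n) \<le> a (Suc n) * d n + d n * a n"
      using d(2)[of n] by simp
    ultimately have "2 * d (Suc n) \<le> r * r ^ Suc n + r ^ Suc n * r"
      by linarith
    then show ?case by simp
  qed
  from r ar dr show thesis by (rule that)
qed

lemma (in cstar_seminormed) cauchy_if_geometric_increments:
  assumes yS: "\<And>m. y m \<in> S" and r: "0 \<le> r" "r < 1" and inc: "\<And>m. \<nu> (y (Suc m) - y m) \<le> r ^ Suc m"
  shows "cauchy_seq y"
proof -
  have tail: "\<nu> (y (m + k) - y m) \<le> r ^ m / (1 - r)" for m k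
  proof -
    have "\<nu> (y (m + k) - y m) \<le> (\<Sum>i<k. r ^ Suc (m + i))"
    proof (induction k)
      case (Suc k)
      have "\<nu> (y (m + Suc k) - y m) \<le> \<nu> (y (Suc (m + k)) - y (m + k)) + \<nu> (y (m + k) - y m)"
        using nu_add[of "y (Suc (m + k)) - y (m + k)" "y (m + k) - y m"] yS by simp
      then show ?case using Suc inc[of "m + k"] by simp
    qed simp
    also have "\<dots> = r ^ Suc m * (\<Sum>i<k. r ^ i)"
      by (simp add: sum_distrib_left power_add mult.assoc)
    also have "\<dots> \<le> r ^ m * (1 / (1 - r))"
    proof (rule mult_mono)
      show "r ^ Suc m \<le> r ^ m" using r by (simp add: mult_left_le_one_le)
      have "(\<Sum>i<k. r ^ i) \<le> (\<Sum>i. r ^ i)"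
        using r by (intro sum_le_suminf summable_geometric) auto
      then show "(\<Sum>i<k. r ^ i) \<le> 1 / (1 - r)"
        using r suminf_geometric[of r] by simp
    qed (use r in \<open>auto intro: sum_nonneg\<close>)
    finally show ?thesis by simp
  qed
  show ?thesis
    unfolding cauchy_seq_def
  proof (intro allI impI)
    fix e :: real assume e: "0 < e"
    have "(\<lambda>m. r ^ m / (1 - r)) \<longlonglongrightarrow> 0 / (1 - r)"
      using r by (intro tendsto_divide LIMSEQ_realpow_zero tendsto_const) auto
    then have "\<forall>\<^sub>F m in sequentially. r ^ m / (1 - r) < e"
      using e by (intro order_tendstoD(2)) auto
    then obtain K where K: "\<And>m. m \<ge> K \<Longrightarrow> r ^ m / (1 - r) < e"
      by (auto simp: eventually_sequentially)
    have "\<nu> (y m - y k) < e" if "m \<ge> K" "k \<ge> K" for m k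
    proof (cases "m \<le> k")
      case True
      then show ?thesis
        using tail[of m "k - m"] K[OF that(1)] nu_diff_commute[of "y m" "y k"] yS by simp
    next
      case False
      then show ?thesis
        using tail[of k "m - k"] K[OF that(2)] by simp
    qed
    then show "\<exists>K. \<forall>m\<ge>K. \<forall>n\<ge>K. \<nu> (y m - y n) < e" by blast
  qed
qed

lemma le_zero_if_le_null_sequence:
  fixes a :: real
  assumes "\<And>n. a \<le> f n" "f \<longlonglongrightarrow> 0"
  shows "a \<le> 0"
  using LIMSEQ_le_const[OF assms(2)] assms(1) by blast

text \<open>
  For self-adjoint \<open>x\<close> of norm less than \<open>1\<close>, completeness provides a self-adjoint \<open>s\<close> that plays the role of
  \<open>1 - (1 - x\<^sup>2)\<^sup>1\<^sup>/\<^sup>2\<close>. Then \<open>x + \<i> (1 - s)\<close> is unitary in the unitization, which bounds any C*-seminorm of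
  \<open>x\<close> by \<open>1\<close>; the C*-identity reduces the general case to this one.
\<close>

lemma (in cstar_complete) contractive:
  assumes n: "cstar_seminormed S n" and b: "b \<in> S"
  shows "n b \<le> \<nu> b"
proof -
  interpret n: cstar_seminormed S n by fact
  have half: "cmod (1/2) = 1/2" by simp
  have unit_ball: "n x \<le> 1" if x: "x \<in> S" "adj x = x" "\<nu> x < 1" for x
  proof -
    define y where "y = rec_nat 0 (\<lambda>_ z. (1/2 :: complex) \<odot> (x * x + z * z))"
    have y0: "y 0 = 0" and ySuc: "y (Suc m) = (1/2) \<odot> (x * x + y m * y m)" for m
      by (simp_all add: y_def)
    have yS: "y m \<in> S" for m
      by (induction m) (auto simp: y0 ySuc x)
    have yadj: "adj (y m) = y m" for m
      by (induction m) (simp_all add: y0 ySuc x)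
    have ycomm: "x * y m = y m * x" for m
    proof (induction m)
      case (Suc m)
      then have "x * (y m * y m) = y m * y m * x"
        by (metis mult.assoc)
      then show ?case by (simp add: ySuc algebra_simps)
    qed (simp add: y0)
    have L: "0 \<le> \<nu> (x * x)" "\<nu> (x * x) < 1"
    proof -
      show "\<nu> (x * x) < 1"
        using x nu_square[of x] nu_nonneg[of x] by (simp add: power_less_one_iff)
    qed (use x in simp)
    obtain r where r: "0 \<le> r" "r < 1" "\<And>m. \<nu> (y m) \<le> r" "\<And>m. \<nu> (y (Suc m) - y m) \<le> r ^ Suc m"
    proof (rule sqrt_iteration_bounds[OF L, of "\<lambda>m. \<nu> (y m)" "\<lambda>m. \<nu> (y (Suc m) - y m)"])
      show "\<nu> (y (Suc m)) \<le> (\<nu> (x * x) + \<nu> (y m) * \<nu> (y m)) / 2" for m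
        using nu_add[of "x * x" "y m * y m"] nu_mult[of "y m" "y m"] x yS
        by (simp add: ySuc nu_scl)
      show "\<nu> (y (Suc 0) - y 0) \<le> \<nu> (x * x) / 2"
        using x by (simp add: y0 ySuc nu_scl)
      show "\<nu> (y (Suc (Suc m)) - y (Suc m)) \<le>
          (\<nu> (y (Suc m)) * \<nu> (y (Suc m) - y m) + \<nu> (y (Suc m) - y m) * \<nu> (y m)) / 2" for m
      proof -
        let ?a = "y (Suc m)" and ?b = "y m"
        have "y (Suc (Suc m)) - ?a = (1/2) \<odot> (?a * (?a - ?b) + (?a - ?b) * ?b)"
          unfolding ySuc[of "Suc m"]
          by (subst (3) ySuc) (simp add: scl_distribs algebra_simps)
        then have "\<nu> (y (Suc (Suc m)) - ?a) = \<nu> (?a * (?a - ?b) + (?a - ?b) * ?b) / 2"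
          using yS by (simp add: nu_scl)
        also have "\<dots> \<le> (\<nu> (?a * (?a - ?b)) + \<nu> ((?a - ?b) * ?b)) / 2"
          using yS by (simp add: nu_add)
        also have "\<dots> \<le> (\<nu> ?a * \<nu> (?a - ?b) + \<nu> (?a - ?b) * \<nu> ?b) / 2"
          using yS by (intro divide_right_mono add_mono nu_mult) auto
        finally show ?thesis .
      qed
    qed (use y0 yS in auto)
    have cauchy: "cauchy_seq y"
      using r yS by (intro cauchy_if_geometric_increments[where r = r]) auto
    obtain z where z: "z \<in> S" and lim: "(\<lambda>m. \<nu> (y m - z)) \<longlonglongrightarrow> 0"
      using complete[OF yS cauchy] by blast
    have zadj: "adj z = z"
    proof -
      have "\<nu> (adj z - z) \<le> 2 * \<nu> (y m - z)" for m
      proof -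
        have "\<nu> (adj z - z) = \<nu> ((y m - z) - adj (y m - z))"
          by (simp add: yadj)
        also have "\<dots> \<le> \<nu> (y m - z) + \<nu> (adj (y m - z))"
          using yS z by (intro nu_diff) auto
        also have "\<nu> (adj (y m - z)) = \<nu> (y m - z)"
          using yS z by (intro nu_adj) auto
        finally show ?thesis by simp
      qed
      then have "\<nu> (adj z - z) \<le> 0"
        using tendsto_mult_right_zero[OF lim, of 2] by (rule le_zero_if_le_null_sequence)
      then show ?thesis using eq_zero_if_le[of "adj z - z"] z x by simp
    qed
    have zcomm: "x * z = z * x"
    proof -
      have "\<nu> (x * z - z * x) \<le> 2 * \<nu> x * \<nu> (y m - z)" for m
      proof -
        have "x * z - z * x = (y m - z) * x - x * (y m - z)"
          by (simp add: algebra_simps ycomm)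
        also have "\<nu> \<dots> \<le> \<nu> ((y m - z) * x) + \<nu> (x * (y m - z))"
          using x yS z by (intro nu_diff) auto
        also have "\<dots> \<le> \<nu> (y m - z) * \<nu> x + \<nu> x * \<nu> (y m - z)"
          using x yS z by (intro add_mono nu_mult) auto
        finally show ?thesis by (simp add: algebra_simps)
      qed
      then have "\<nu> (x * z - z * x) \<le> 0"
        using tendsto_mult_right_zero[OF lim, of "2 * \<nu> x"] by (rule le_zero_if_le_null_sequence)
      then show ?thesis using eq_zero_if_le[of "x * z - z * x"] z x by simp
    qed
    have zeq: "z + z = x * x + z * z"
    proof -
      have "\<nu> (z + z - (x * x + z * z)) \<le> 2 * \<nu> (y (Suc m) - z) + (r + \<nu> z) * \<nu> (y m - z)" for m
      proof -
        have "y (Suc m) + y (Suc m) = x * x + y m * y m"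
          by (simp add: ySuc flip: scl_add_left)
        then have "z + z - (x * x + z * z) = (y m * (y m - z) + (y m - z) * z) - (2::complex) \<odot> (y (Suc m) - z)"
          using scl_add_left[of 1 1 "y (Suc m) - z"] by (simp add: algebra_simps)
        also have "\<nu> \<dots> \<le> \<nu> (y m * (y m - z) + (y m - z) * z) + \<nu> ((2::complex) \<odot> (y (Suc m) - z))"
          using yS z by (intro nu_diff) auto
        also have "\<dots> \<le> (\<nu> (y m * (y m - z)) + \<nu> ((y m - z) * z)) + 2 * \<nu> (y (Suc m) - z)"
          using yS z by (intro add_mono nu_add) (auto simp: nu_scl)
        also have "\<dots> \<le> (\<nu> (y m) * \<nu> (y m - z) + \<nu> (y m - z) * \<nu> z) + 2 * \<nu> (y (Suc m) - z)"
          using yS z by (intro add_mono nu_mult) auto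
        also have "\<dots> \<le> (r * \<nu> (y m - z) + \<nu> (y m - z) * \<nu> z) + 2 * \<nu> (y (Suc m) - z)"
          using yS z r(3) by (intro add_mono mult_right_mono) auto
        finally show ?thesis by (simp add: algebra_simps)
      qed
      moreover have "(\<lambda>m. 2 * \<nu> (y (Suc m) - z) + (r + \<nu> z) * \<nu> (y m - z)) \<longlonglongrightarrow> 0"
        by (intro tendsto_add_zero tendsto_mult_right_zero lim LIMSEQ_Suc[OF lim])
      ultimately have "\<nu> (z + z - (x * x + z * z)) \<le> 0"
        by (rule le_zero_if_le_null_sequence)
      then show ?thesis using eq_zero_if_le[of "z + z - (x * x + z * z)"] z x by simp
    qed
    \<comment> \<open>The element \<open>u = x + \<i> (1 - z)\<close> of the unitization is unitary.\<close>
    define u where "u = x + \<i> \<odot> (1 - z)"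
    define v where "v = x - \<i> \<odot> (1 - z)"
    have uadj: "adj u = v" "adj v = u"
      by (simp_all add: u_def v_def x zadj)
    have vu: "v * u = 1"
    proof -
      have "v * u = x * x + \<i> \<odot> (x * (1 - z) - (1 - z) * x) + (1 - z) * (1 - z)"
        unfolding u_def v_def by (simp add: algebra_simps scl_distribs)
      also have "x * (1 - z) - (1 - z) * x = 0"
        by (simp add: algebra_simps zcomm)
      also have "x * x + \<i> \<odot> 0 + (1 - z) * (1 - z) = 1 + ((x * x + z * z) - (z + z))"
        by (simp add: algebra_simps)
      finally show ?thesis by (simp add: zeq)
    qed
    have uv: "u * v = 1"
    proof -
      have "u * v = x * x - \<i> \<odot> (x * (1 - z) - (1 - z) * x) + (1 - z) * (1 - z)"
        unfolding u_def v_def by (simp add: algebra_simps scl_distribs)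
      also have "x * (1 - z) - (1 - z) * x = 0"
        by (simp add: algebra_simps zcomm)
      also have "x * x - \<i> \<odot> 0 + (1 - z) * (1 - z) = 1 + ((x * x + z * z) - (z + z))"
        by (simp add: algebra_simps)
      finally show ?thesis by (simp add: zeq)
    qed
    have uS: "u * x \<in> S" "v * x \<in> S"
      unfolding u_def v_def using x z by (auto simp: algebra_simps)
    have iso: "n (w * x) = n x" if "adj w * w = 1" "w * x \<in> S" for w
    proof -
      have "(n (w * x))\<^sup>2 = n (adj (w * x) * (w * x))"
        using that n.nu_cstar[of "w * x"] by simp
      also have "adj (w * x) * (w * x) = adj x * (adj w * w) * x"
        by (simp only: adj_mult mult.assoc)
      also have "n \<dots> = (n x)\<^sup>2"
        using that x n.nu_cstar[of x] by simp
      finally show ?thesis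
        using n.nu_nonneg[OF that(2)] n.nu_nonneg[of x] x by simp
    qed
    have "u * x + v * x = (2::complex) \<odot> (x * x)"
      using scl_add_left[of 1 1 "x * x"] by (simp add: u_def v_def algebra_simps)
    then have "2 * n (x * x) = n (u * x + v * x)"
      using x by (simp add: n.nu_scl)
    also have "\<dots> \<le> n (u * x) + n (v * x)"
      using uS by (intro n.nu_add)
    also have "\<dots> = 2 * n x"
      using iso[of u] iso[of v] uS uv vu uadj by simp
    finally have "n x * n x \<le> 1 * n x"
      using x n.nu_square[of x] by (simp add: power2_eq_square)
    then show ?thesis
      using n.nu_nonneg[of x] x mult_right_le_imp_le[of "n x" "n x" 1]
      by (cases "n x = 0") (auto simp: order_less_le)
  qed
  have sa: "n x \<le> \<nu> x" if x: "x \<in> S" "adj x = x" for x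
  proof (rule field_le_epsilon)
    fix e :: real assume e: "0 < e"
    let ?t = "\<nu> x + e"
    have t: "?t > 0" using e nu_nonneg[OF x(1)] by simp
    have "n (complex_of_real (1 / ?t) \<odot> x) \<le> 1"
    proof (rule unit_ball)
      have "\<nu> (complex_of_real (1 / ?t) \<odot> x) = \<nu> x / ?t"
        using t x unfolding nu_scl[OF x(1)] norm_of_real by simp
      then show "\<nu> (complex_of_real (1 / ?t) \<odot> x) < 1"
        using t e by (simp add: divide_less_eq)
    qed (use x in \<open>auto simp del: of_real_divide\<close>)
    then show "n x \<le> ?t"
      using t x unfolding n.nu_scl[OF x(1)] norm_of_real by (simp add: field_simps)
  qed
  have "(n b)\<^sup>2 \<le> (\<nu> b)\<^sup>2"
    using sa[of "adj b * b"] b n.nu_cstar[OF b] nu_cstar[OF b] by simp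
  then show ?thesis
    using nu_nonneg[OF b] by (rule power2_le_imp_le)
qed

section \<open>Polynomial functional calculus\<close>

lemma smult_sum_right: "smult c (sum f A) = (\<Sum>i\<in>A. smult c (f i))"
  by (induction A rule: infinite_finite_induct) (simp_all add: smult_add_right)

text \<open>
  For a self-adjoint element \<open>h\<close> of a C*-normed algebra, the norm of \<open>q (h)\<close> is such a function of the polynomial \<open>q\<close>;
  the last condition is what remains of the C*-identity for \<open>p (h) + \<i> q (h)\<close>. In an incomplete algebra
  square roots exist only approximately.
\<close>

locale poly_cnorm =
  fixes N :: "real poly \<Rightarrow> real"
  assumes N_nonneg: "0 \<le> N p"
    and N_add: "N (p + q) \<le> N p + N q"
    and N_smult: "N (smult c p) = \<bar>c\<bar> * N p"
    and N_mult: "N (p * q) \<le> N p * N q"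
    and N_one: "N 1 \<le> 1"
    and N_diff_squares: "N (p * p - q * q) \<le> N (p * p + q * q)"
begin

lemma N_zero [simp]: "N 0 = 0"
  using N_smult[of 0 0] by simp

lemma N_minus [simp]: "N (- p) = N p"
  using N_smult[of "-1" p] by simp

lemma N_diff: "N (p - q) \<le> N p + N q"
  using N_add[of p "- q"] by simp

lemma N_const: "N [:c:] \<le> \<bar>c\<bar>"
  using N_smult[of c 1] N_one mult_left_mono[of "N 1" 1 "\<bar>c\<bar>"] by simp

text \<open>
  The norm criterion for positivity: a self-adjoint element is positive if and only if its distance to
  some constant \<open>T \<ge> 0\<close> is at most \<open>T\<close>.
\<close>

definition pos :: "real poly \<Rightarrow> bool" where
  "pos q \<longleftrightarrow> (\<exists>T\<ge>0. N ([:T:] - q) \<le> T)"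

lemma smult_two: "smult 2 q = q + (q :: real poly)"
  using smult_add_left[of 1 1 q] by simp

lemma approx_sqrt_near_one:
  assumes "N h < 1" "0 < e"
  shows "\<exists>s. N (s * s - (1 - h)) < e"
proof -
  define y where "y = rec_nat 0 (\<lambda>_ z. smult (1/2) (h + z * z))"
  have y0: "y 0 = 0" and ySuc: "y (Suc m) = smult (1/2) (h + y m * y m)" for m
    by (simp_all add: y_def)
  obtain r where r: "0 \<le> r" "r < 1" "\<And>m. N (y m) \<le> r" "\<And>m. N (y (Suc m) - y m) \<le> r ^ Suc m"
  proof (rule sqrt_iteration_bounds[of "N h" "\<lambda>m. N (y m)" "\<lambda>m. N (y (Suc m) - y m)"])
    show "N (y (Suc m)) \<le> (N h + N (y m) * N (y m)) / 2" for m
      using N_add[of h "y m * y m"] N_mult[of "y m" "y m"] by (simp add: ySuc N_smult del: smult_add_right)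
    show "N (y (Suc 0) - y 0) \<le> N h / 2"
      by (simp add: y0 ySuc N_smult)
    show "N (y (Suc (Suc m)) - y (Suc m)) \<le>
        (N (y (Suc m)) * N (y (Suc m) - y m) + N (y (Suc m) - y m) * N (y m)) / 2" for m
    proof -
      let ?a = "y (Suc m)" and ?b = "y m"
      have "y (Suc (Suc m)) - ?a = smult (1/2) (?a * (?a - ?b) + (?a - ?b) * ?b)"
        unfolding ySuc[of "Suc m"]
        by (subst (3) ySuc) (simp add: smult_add_right smult_diff_right algebra_simps)
      then have "N (y (Suc (Suc m)) - ?a) = N (?a * (?a - ?b) + (?a - ?b) * ?b) / 2"
        by (simp add: N_smult del: smult_add_right)
      also have "\<dots> \<le> (N (?a * (?a - ?b)) + N ((?a - ?b) * ?b)) / 2"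
        using N_add[of "?a * (?a - ?b)" "(?a - ?b) * ?b"] by simp
      also have "\<dots> \<le> (N ?a * N (?a - ?b) + N (?a - ?b) * N ?b) / 2"
        by (intro divide_right_mono add_mono N_mult) auto
      finally show ?thesis .
    qed
  qed (use y0 assms N_nonneg in auto)
  have "(\<lambda>m. 2 * r ^ Suc m) \<longlonglongrightarrow> 0"
    using r by (intro tendsto_mult_right_zero LIMSEQ_Suc LIMSEQ_realpow_zero) auto
  then have "\<forall>\<^sub>F m in sequentially. 2 * r ^ Suc m < e"
    using assms by (intro order_tendstoD(2)) auto
  then obtain m where m: "2 * r ^ Suc m < e"
    by (auto simp: eventually_sequentially)
  have "smult 2 (y (Suc m)) = h + y m * y m"
    by (simp add: ySuc)
  then have "(1 - y m) * (1 - y m) - (1 - h) = smult 2 (y (Suc m)) - smult 2 (y m)"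
    using smult_add_left[of 1 1 "y m"] by (simp add: algebra_simps)
  also have "\<dots> = smult 2 (y (Suc m) - y m)"
    by (simp add: smult_diff_right)
  finally have "N ((1 - y m) * (1 - y m) - (1 - h)) < e"
    using r(4)[of m] m by (simp add: N_smult)
  then show ?thesis by blast
qed

lemma approx_sqrt:
  assumes "pos q" "0 < d" "0 < e"
  shows "\<exists>s. N (s * s - (q + [:d:])) < e"
proof -
  obtain T where T: "0 \<le> T" "N ([:T:] - q) \<le> T"
    using assms unfolding pos_def by blast
  let ?R = "T + d"
  have R: "?R > 0" using T assms by simp
  let ?h = "smult (1 / ?R) ([:T:] - q)"
  have "N ?h = N ([:T:] - q) / ?R"
    using R by (simp add: N_smult del: smult_diff_right)
  also have "\<dots> < 1"
    using T assms R by (simp add: divide_less_eq)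
  finally obtain s where s: "N (s * s - (1 - ?h)) < e / ?R"
    using approx_sqrt_near_one[of ?h "e / ?R"] assms R by auto
  let ?s = "smult (sqrt ?R) s"
  have "smult ?R (1 - ?h) = q + [:d:]"
  proof -
    have "smult ?R (1 - ?h) = smult ?R 1 - ([:T:] - q)"
      using R by (simp add: smult_diff_right)
    also have "smult ?R 1 = [:T:] + [:d:]" by (simp add: one_pCons)
    finally show ?thesis by simp
  qed
  moreover have "?s * ?s = smult ?R (s * s)"
    using R by simp
  ultimately have "?s * ?s - (q + [:d:]) = smult ?R (s * s - (1 - ?h))"
    by (simp only: smult_diff_right)
  then have "N (?s * ?s - (q + [:d:])) = ?R * N (s * s - (1 - ?h))"
    using R by (simp only: N_smult)
  also have "\<dots> < e"
    using s R by (simp add: less_divide_eq mult.commute)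
  finally show ?thesis by blast
qed

lemma N_le_if_pos:
  assumes "pos ([:b:] - q)" "pos ([:b:] + q)" "0 \<le> b"
  shows "N q \<le> b"
proof (rule field_le_epsilon)
  fix e :: real assume e: "0 < e"
  let ?d = "e / 2"
  obtain s where s: "N (s * s - ([:b:] - q + [:?d:])) < e / 4"
    using approx_sqrt[OF assms(1), of ?d "e / 4"] e by auto
  obtain r where r: "N (r * r - ([:b:] + q + [:?d:])) < e / 4"
    using approx_sqrt[OF assms(2), of ?d "e / 4"] e by auto
  let ?A = "s * s - ([:b:] - q + [:?d:])" and ?B = "r * r - ([:b:] + q + [:?d:])"
  have "smult 2 q = (r * r - s * s) + (?A - ?B)"
    by (simp add: smult_two)
  then have "2 * N q = N ((r * r - s * s) + (?A - ?B))"
    using N_smult[of 2 q] by simp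
  also have "\<dots> \<le> N (r * r - s * s) + (N ?A + N ?B)"
    by (intro order_trans[OF N_add] add_left_mono N_diff)
  also have "N (r * r - s * s) \<le> N (r * r + s * s)"
    by (rule N_diff_squares)
  also have "r * r + s * s = (?A + ?B) + ([:b + ?d:] + [:b + ?d:])"
  proof -
    have "?A = s * s - ([:b + ?d:] - q)" "?B = r * r - ([:b + ?d:] + q)" by simp_all
    then show ?thesis by (simp only: algebra_simps)
  qed
  also have "N \<dots> \<le> (N ?A + N ?B) + (\<bar>b + ?d\<bar> + \<bar>b + ?d\<bar>)"
    by (intro order_trans[OF N_add] add_mono N_add N_const)
  finally have "2 * N q \<le> \<dots> + (N ?A + N ?B)" by simp
  then show "N q \<le> b + e" using s r assms(3) e by simp
qed

lemma pos_add: "pos p \<Longrightarrow> pos q \<Longrightarrow> pos (p + q)"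
  unfolding pos_def
proof (elim exE conjE)
  fix T U assume *: "0 \<le> T" "N ([:T:] - p) \<le> T" "0 \<le> U" "N ([:U:] - q) \<le> U"
  have "N (([:T:] - p) + ([:U:] - q)) \<le> T + U"
    using * by (intro order_trans[OF N_add]) simp
  moreover have "([:T:] - p) + ([:U:] - q) = [:T + U:] - (p + q)" by simp
  ultimately show "\<exists>V\<ge>0. N ([:V:] - (p + q)) \<le> V"
    using * by (intro exI[of _ "T + U"]) simp
qed

lemma pos_smult: "pos p \<Longrightarrow> 0 \<le> c \<Longrightarrow> pos (smult c p)"
  unfolding pos_def
proof (elim exE conjE)
  fix T assume *: "0 \<le> T" "N ([:T:] - p) \<le> T" "0 \<le> c"
  have "N (smult c ([:T:] - p)) \<le> c * T"
    using * by (simp add: N_smult mult_left_mono del: smult_diff_right)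
  then show "\<exists>V\<ge>0. N ([:V:] - smult c p) \<le> V"
    using * by (intro exI[of _ "c * T"]) (simp add: smult_diff_right)
qed

lemma pos_if_near:
  assumes "N p \<le> d"
  shows "pos ([:d:] + p)"
  unfolding pos_def using assms N_nonneg[of p] by (intro exI[of _ d]) simp

lemma pos_const: "0 \<le> c \<Longrightarrow> pos [:c:]"
  using pos_if_near[of 0 c] by simp

lemma N_minus_le_if_pos:
  assumes "\<And>d. 0 < d \<Longrightarrow> pos (q + [:d:])"
  shows "N ([:N q:] - q) \<le> N q"
proof (rule field_le_epsilon)
  fix d :: real assume d: "0 < d"
  show "N ([:N q:] - q) \<le> N q + d"
  proof (rule N_le_if_pos)
    have "[:N q + d:] - ([:N q:] - q) = q + [:d:]"
      by (simp add: poly_eq_iff coeff_pCons split: nat.split)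
    then show "pos ([:N q + d:] - ([:N q:] - q))"
      using assms[OF d] by (simp only:)
    have "pos ([:N q:] + - q)"
      by (rule pos_if_near) simp
    moreover have "pos [:N q + d:]"
      using N_nonneg[of q] d by (intro pos_const) simp
    ultimately show "pos ([:N q + d:] + ([:N q:] - q))"
      using pos_add[of "[:N q + d:]" "[:N q:] + - q"] by simp
  qed (use N_nonneg[of q] d in simp)
qed

lemma pos_limit:
  assumes "\<And>d. 0 < d \<Longrightarrow> \<exists>p. pos p \<and> N (q - p) \<le> d"
  shows "pos q"
proof -
  have "pos (q + [:d:])" if "0 < d" for d
  proof -
    obtain p where p: "pos p" "N (q - p) \<le> d" using assms[OF \<open>0 < d\<close>] by blast
    have "pos (p + ([:d:] + (q - p)))"
      by (rule pos_add[OF p(1) pos_if_near[OF p(2)]])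
    then show ?thesis by (simp add: add.commute)
  qed
  then show ?thesis
    using N_minus_le_if_pos N_nonneg unfolding pos_def by blast
qed

lemma pos_square: "pos (s * s)"
proof -
  let ?T = "N s * N s + 1"
  have T: "?T > 0" by (simp add: add_nonneg_pos)
  let ?h = "smult (1 / ?T) (s * s)" and ?g = "smult (1 / sqrt ?T) s"
  have gg: "?g * ?g = ?h" using T by (simp add: real_sqrt_mult_self field_simps)
  have "N ?h = N (s * s) / ?T" using T by (simp add: N_smult)
  also have "\<dots> < 1"
    using N_mult[of s s] T by (simp add: divide_less_eq)
  finally have h: "N ?h < 1" .
  have "N (1 - ?h) \<le> 1"
  proof (rule field_le_epsilon)
    fix e :: real assume e: "0 < e"
    obtain r where r: "N (r * r - (1 - ?h)) < e / 4"
      using approx_sqrt_near_one[OF h, of "e / 4"] e by auto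
    let ?D = "r * r - (1 - ?h)"
    \<comment> \<open>\<open>r\<^sup>2\<close> is half the sum of \<open>r\<^sup>2 + g\<^sup>2\<close> and \<open>r\<^sup>2 - g\<^sup>2\<close>, and the former is nearly \<open>1\<close>.\<close>
    have "smult 2 (r * r) = (r * r + ?g * ?g) + (r * r - ?g * ?g)"
      using smult_add_left[of 1 1 "r * r"] by simp
    then have "2 * N (r * r) = N ((r * r + ?g * ?g) + (r * r - ?g * ?g))"
      using N_smult[of 2 "r * r"] by simp
    also have "\<dots> \<le> 2 * N (r * r + ?g * ?g)"
      using N_add[of "r * r + ?g * ?g" "r * r - ?g * ?g"] N_diff_squares[of r ?g] by simp
    also have "r * r + ?g * ?g = 1 + ?D"
      unfolding gg by simp
    also have "N (1 + ?D) \<le> 1 + e / 4"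
      using N_add[of 1 ?D] N_one r by simp
    finally have "N (r * r) \<le> 1 + e / 4" by simp
    moreover have "N (1 - ?h) \<le> N (r * r) + N ?D"
      using N_diff[of "r * r" ?D] by simp
    ultimately show "N (1 - ?h) \<le> 1 + e"
      using r e by simp
  qed
  moreover have "[:?T:] - s * s = smult ?T (1 - ?h)"
  proof -
    have "smult ?T (1 - ?h) = smult ?T 1 - s * s"
      using T by (simp add: smult_diff_right)
    then show ?thesis by (simp add: one_pCons)
  qed
  ultimately have "N ([:?T:] - s * s) \<le> ?T"
    using T mult_left_mono[of "N (1 - ?h)" 1 ?T] N_smult[of ?T "1 - ?h"] by simp
  then show ?thesis
    using T unfolding pos_def by (intro exI[of _ ?T]) simp
qed

lemma pos_mult_aux:
  assumes "pos p" "pos q" "0 < d"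
  shows "pos ((p + [:d:]) * (q + [:d:]))"
proof (rule pos_limit)
  fix e :: real assume e: "0 < e"
  let ?p = "p + [:d:]" and ?q = "q + [:d:]"
  define e1 where "e1 = min 1 (e / (N ?p + N ?q + 2))"
  have D: "N ?p + N ?q + 2 > 0" using N_nonneg[of ?p] N_nonneg[of ?q] by simp
  have e1: "0 < e1" "e1 \<le> 1" "e1 * (N ?p + N ?q + 2) \<le> e"
  proof -
    have "e1 * (N ?p + N ?q + 2) \<le> e / (N ?p + N ?q + 2) * (N ?p + N ?q + 2)"
      using D by (intro mult_right_mono) (auto simp: e1_def)
    then show "e1 * (N ?p + N ?q + 2) \<le> e" using D by simp
  qed (use D e in \<open>auto simp: e1_def\<close>)
  obtain s where s: "N (s * s - ?p) < e1" using approx_sqrt[OF assms(1,3) e1(1)] by blast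
  obtain r where r: "N (r * r - ?q) < e1" using approx_sqrt[OF assms(2,3) e1(1)] by blast
  have "?p * ?q - (s * r) * (s * r) = - ((s * s - ?p) * (r * r - ?q) + ?p * (r * r - ?q) + (s * s - ?p) * ?q)"
    by (simp add: algebra_simps)
  then have "N (?p * ?q - (s * r) * (s * r)) = N ((s * s - ?p) * (r * r - ?q) + ?p * (r * r - ?q) + (s * s - ?p) * ?q)"
    by (simp only: N_minus)
  also have "\<dots> \<le> N ((s * s - ?p) * (r * r - ?q)) + N (?p * (r * r - ?q)) + N ((s * s - ?p) * ?q)"
    by (intro order_trans[OF N_add] add_mono order_refl N_add)
  also have "\<dots> \<le> N (s * s - ?p) * N (r * r - ?q) + N ?p * N (r * r - ?q) + N (s * s - ?p) * N ?q"
    by (intro add_mono N_mult)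
  also have "\<dots> \<le> e1 * 1 + N ?p * e1 + e1 * N ?q"
    using s r e1 N_nonneg by (intro add_mono mult_mono) (auto intro: less_imp_le order_trans)
  also have "\<dots> \<le> e1 * (N ?p + N ?q + 2)"
    using e1 by (simp add: algebra_simps)
  finally show "\<exists>p'. pos p' \<and> N (?p * ?q - p') \<le> e"
    using e1 pos_square[of "s * r"] by (intro exI[of _ "(s * r) * (s * r)"]) auto
qed

text \<open>
  Positive polynomials are, after a small shift, approximately squares, and products of squares are squares.
\<close>

lemma pos_mult:
  assumes "pos p" "pos q"
  shows "pos (p * q)"
proof (rule pos_limit)
  fix e :: real assume e: "0 < e"
  have D: "N p + N q + 1 > 0" using N_nonneg[of p] N_nonneg[of q] by simp
  define d where "d = min 1 (e / (N p + N q + 1))"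
  have d: "0 < d" "d \<le> 1" "d * (N p + N q + 1) \<le> e"
  proof -
    have "d * (N p + N q + 1) \<le> e / (N p + N q + 1) * (N p + N q + 1)"
      using D by (intro mult_right_mono) (auto simp: d_def)
    then show "d * (N p + N q + 1) \<le> e" using D by simp
  qed (use D e in \<open>auto simp: d_def\<close>)
  have "p * q - (p + [:d:]) * (q + [:d:]) = - (smult d p + (smult d q + [:d * d:]))"
    by (simp add: algebra_simps)
  then have "N (p * q - (p + [:d:]) * (q + [:d:])) = N (smult d p + (smult d q + [:d * d:]))"
    by (simp only: N_minus)
  also have "\<dots> \<le> N (smult d p) + (N (smult d q) + N [:d * d:])"
    by (intro order_trans[OF N_add] add_mono order_refl N_add)
  also have "\<dots> \<le> d * N p + (d * N q + d * d)"
    using d N_const[of "d * d"] by (simp add: N_smult)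
  also have "\<dots> \<le> d * (N p + N q + 1)"
    using d by (simp add: algebra_simps mult_left_le)
  finally show "\<exists>p'. pos p' \<and> N (p * q - p') \<le> e"
    using pos_mult_aux[OF assms d(1)] d(3) by (intro exI conjI) auto
qed

lemma pos_power: "pos p \<Longrightarrow> pos (p ^ n)"
  by (induction n) (auto intro: pos_mult pos_const simp: one_pCons)

lemma pos_sum: "(\<And>i. i \<in> A \<Longrightarrow> pos (f i)) \<Longrightarrow> pos (sum f A)"
  by (induction A rule: infinite_finite_induct) (auto intro: pos_add simp: pos_const[of 0, simplified])

end

subsection \<open>Bernstein coefficients\<close>

text \<open>
  In the basis \<open>(m choose k) t\<^sup>k (1 - t)\<^sup>m\<^sup>-\<^sup>k\<close> the monomial \<open>t\<^sup>j\<close> has the coefficients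
  \<open>k (k - 1) \<dots> (k - j + 1) / (m (m - 1) \<dots> (m - j + 1))\<close>, which tend to \<open>(k / m)\<^sup>j\<close> uniformly in \<open>k\<close>.
\<close>

definition bern_ratio :: "nat \<Rightarrow> nat \<Rightarrow> nat \<Rightarrow> real" where
  "bern_ratio m k j = (\<Prod>i<j. (real k - real i) / (real m - real i))"

lemma bern_ratio_binomial:
  assumes "j \<le> m" "k \<le> m"
  shows "real (m choose k) * bern_ratio m k j = (if j \<le> k then real ((m - j) choose (k - j)) else 0)"
  using assms(1)
proof (induction j)
  case (Suc j)
  then have IH: "real (m choose k) * bern_ratio m k j = (if j \<le> k then real ((m - j) choose (k - j)) else 0)"
    by simp
  have step: "real (m choose k) * bern_ratio m k (Suc j) =
      real (m choose k) * bern_ratio m k j * ((real k - real j) / (real m - real j))"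
    by (simp add: bern_ratio_def)
  show ?case
  proof (cases "Suc j \<le> k")
    case True
    have "Suc (k - Suc j) * ((m - j) choose Suc (k - Suc j)) = (m - j) * ((m - j - 1) choose (k - Suc j))"
      using Suc_times_binomial_eq[of "m - Suc j" "k - Suc j"] Suc.prems
      by (simp add: Suc_diff_Suc mult.commute)
    then have E: "(k - j) * ((m - j) choose (k - j)) = (m - j) * ((m - Suc j) choose (k - Suc j))"
      using True Suc.prems by (simp add: Suc_diff_Suc)
    have "real (k - j) * real ((m - j) choose (k - j)) = real (m - j) * real ((m - Suc j) choose (k - Suc j))"
      by (simp only: of_nat_mult[symmetric] E)
    then show ?thesis
      using True Suc.prems unfolding step IH by (simp add: of_nat_diff field_simps)
  next
    case False
    then show ?thesis
      using step IH by (cases "k = j") auto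
  qed
qed (simp add: bern_ratio_def)

lemma power_eq_bernstein_sum:
  fixes x y :: "'a::{comm_ring_1}"
  assumes "x + y = 1" "j \<le> m"
  shows "x ^ j = (\<Sum>k\<le>m. of_nat (if j \<le> k then (m - j) choose (k - j) else 0) * x ^ k * y ^ (m - k))"
proof -
  have "x ^ j = x ^ j * (x + y) ^ (m - j)"
    using assms by simp
  also have "\<dots> = (\<Sum>i\<le>m - j. of_nat ((m - j) choose i) * x ^ (i + j) * y ^ (m - j - i))"
    by (simp add: binomial_ring sum_distrib_left power_add mult_ac)
  also have "\<dots> = (\<Sum>k\<in>{j..m}. of_nat ((m - j) choose (k - j)) * x ^ k * y ^ (m - k))"
    by (rule sum.reindex_bij_witness[of _ "\<lambda>k. k - j" "\<lambda>i. i + j"]) (use assms in \<open>auto simp: add.commute\<close>)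
  also have "\<dots> = (\<Sum>k\<le>m. of_nat (if j \<le> k then (m - j) choose (k - j) else 0) * x ^ k * y ^ (m - k))"
    by (rule sum.mono_neutral_cong_left) auto
  finally show ?thesis .
qed

lemma bern_ratio_close:
  "0 < e \<Longrightarrow> \<exists>M. \<forall>m\<ge>M. \<forall>k\<le>m. \<bar>bern_ratio m k j - (real k / real m) ^ j\<bar> < e"
proof (induction j arbitrary: e)
  case 0
  then show ?case by (simp add: bern_ratio_def)
next
  case (Suc j)
  let ?e = "min 1 (e / 2)"
  obtain M where M: "\<And>m k. m \<ge> M \<Longrightarrow> k \<le> m \<Longrightarrow> \<bar>bern_ratio m k j - (real k / real m) ^ j\<bar> < ?e"
    using Suc.IH[of ?e] Suc.prems by auto
  obtain M' :: nat where M': "real M' > 8 * real j / e" using reals_Archimedean2 by blast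
  have "\<bar>bern_ratio m k (Suc j) - (real k / real m) ^ Suc j\<bar> < e"
    if m: "m \<ge> max M (max M' (2 * j + 1))" and k: "k \<le> m" for m k
  proof -
    let ?b = "bern_ratio m k j" and ?t = "real k / real m" and ?u = "(real k - real j) / (real m - real j)"
    have m0: "real m > 0" "real m - real j > 0" "real m \<le> 2 * (real m - real j)" using m by auto
    have t: "0 \<le> ?t" "?t \<le> 1" using k m0 by auto
    have b: "\<bar>?b - ?t ^ j\<bar> < ?e" using M m k by auto
    have "?t ^ j \<le> 1" "0 \<le> ?t ^ j" using t by (auto simp: power_le_one)
    with b have b2: "\<bar>?b\<bar> \<le> 2" by linarith
    have "?u - ?t = - (real j * (real m - real k)) / (real m * (real m - real j))"
      using m0 by (simp add: field_simps)
    then have "\<bar>?u - ?t\<bar> = real j * (real m - real k) / (real m * (real m - real j))"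
      using m0 k by (simp add: abs_mult)
    also have "\<dots> \<le> real j * real m / (real m * (real m / 2))"
      using m0 k by (intro frac_le mult_mono) auto
    also have "\<dots> = 2 * real j / real m" using m0 by (simp add: field_simps)
    also have "\<dots> < e / 4"
    proof -
      have "8 * real j / e < real m" using M' m by linarith
      then show ?thesis using m0 Suc.prems by (simp add: field_simps)
    qed
    finally have u: "\<bar>?u - ?t\<bar> < e / 4" .
    have "bern_ratio m k (Suc j) - ?t ^ Suc j = ?b * (?u - ?t) + (?b - ?t ^ j) * ?t"
      by (simp add: bern_ratio_def algebra_simps)
    then have "\<bar>bern_ratio m k (Suc j) - ?t ^ Suc j\<bar> \<le> \<bar>?b * (?u - ?t)\<bar> + \<bar>(?b - ?t ^ j) * ?t\<bar>"
      by (simp only: abs_triangle_ineq)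
    also have "\<dots> \<le> 2 * \<bar>?u - ?t\<bar> + \<bar>?b - ?t ^ j\<bar> * 1"
      unfolding abs_mult using b2 t by (intro add_mono mult_mono) auto
    also have "\<dots> < e" using u b by simp
    finally show ?thesis .
  qed
  then show ?case by blast
qed


context poly_cnorm
begin

lemma pos_pcompose_if_positive:
  assumes Y: "pos Y" "pos (1 - Y)" and q: "\<And>t. 0 \<le> t \<Longrightarrow> t \<le> 1 \<Longrightarrow> 0 \<le> poly q t"
  shows "pos (pcompose q Y)"
proof (rule pos_limit)
  fix d :: real assume d: "0 < d"
  define S where "S = (\<Sum>j\<le>degree q. \<bar>coeff q j\<bar>) + 1"
  have S: "S > 0" unfolding S_def by (simp add: add_nonneg_pos sum_nonneg)
  have "\<forall>j. \<exists>M. \<forall>m\<ge>M. \<forall>k\<le>m. \<bar>bern_ratio m k j - (real k / real m) ^ j\<bar> < d / S"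
    using bern_ratio_close d S by simp
  then obtain Mf where Mf: "\<And>j m k. m \<ge> Mf j \<Longrightarrow> k \<le> m \<Longrightarrow> \<bar>bern_ratio m k j - (real k / real m) ^ j\<bar> < d / S"
    by metis
  define m where "m = Suc ((\<Sum>j\<le>degree q. Mf j) + degree q)"
  have m: "m \<ge> Mf j" "m \<ge> j" if "j \<le> degree q" for j
  proof -
    have "Mf j \<le> (\<Sum>j\<le>degree q. Mf j)"
      using that by (intro member_le_sum) auto
    then show "m \<ge> Mf j" by (simp add: m_def)
  qed (use that in \<open>simp add: m_def\<close>)
  have m_pos: "0 < m" by (simp add: m_def)
  define b where "b k = (\<Sum>j\<le>degree q. coeff q j * bern_ratio m k j)" for k
  have b: "0 \<le> b k + d" if k: "k \<le> m" for k
  proof -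
    let ?t = "real k / real m"
    have "0 \<le> poly q ?t"
      using k m_pos by (intro q) (auto simp: field_simps)
    also have "poly q ?t = (\<Sum>j\<le>degree q. coeff q j * ?t ^ j)"
      by (simp add: poly_altdef)
    also have "\<dots> = b k + (\<Sum>j\<le>degree q. coeff q j * (?t ^ j - bern_ratio m k j))"
      by (simp add: b_def sum.distrib[symmetric] algebra_simps)
    also have "(\<Sum>j\<le>degree q. coeff q j * (?t ^ j - bern_ratio m k j)) \<le> (\<Sum>j\<le>degree q. \<bar>coeff q j\<bar> * (d / S))"
    proof (rule sum_mono)
      fix j assume "j \<in> {..degree q}"
      then have "\<bar>?t ^ j - bern_ratio m k j\<bar> \<le> d / S"
        using Mf[OF m(1) k, of j] by (simp add: abs_minus_commute)
      then have "\<bar>coeff q j * (?t ^ j - bern_ratio m k j)\<bar> \<le> \<bar>coeff q j\<bar> * (d / S)"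
        unfolding abs_mult by (intro mult_left_mono) auto
      then show "coeff q j * (?t ^ j - bern_ratio m k j) \<le> \<bar>coeff q j\<bar> * (d / S)"
        by linarith
    qed
    also have "\<dots> = (S - 1) * (d / S)"
      by (simp only: S_def sum_distrib_right[symmetric]) simp
    also have "\<dots> \<le> d" using S d by (simp add: field_simps)
    finally show ?thesis by simp
  qed
  let ?B = "\<lambda>k. smult (real (m choose k)) (Y ^ k * (1 - Y) ^ (m - k))"
  have mono: "Y ^ j = (\<Sum>k\<le>m. smult (bern_ratio m k j) (?B k))" if "j \<le> degree q" for j
  proof -
    have "Y ^ j = (\<Sum>k\<le>m. of_nat (if j \<le> k then (m - j) choose (k - j) else 0) * Y ^ k * (1 - Y) ^ (m - k))"
      using m[OF that] by (intro power_eq_bernstein_sum) auto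
    also have "\<dots> = (\<Sum>k\<le>m. smult (bern_ratio m k j) (?B k))"
    proof (rule sum.cong)
      fix k assume "k \<in> {..m}"
      then have "(bern_ratio m k j) * real (m choose k) = real (if j \<le> k then (m - j) choose (k - j) else 0)"
        using bern_ratio_binomial[of j m k] m[OF that] by (simp add: mult.commute)
      then show "of_nat (if j \<le> k then (m - j) choose (k - j) else 0) * Y ^ k * (1 - Y) ^ (m - k) =
          smult (bern_ratio m k j) (?B k)"
        by (simp add: of_nat_poly)
    qed simp
    finally show ?thesis .
  qed
  have "pcompose q Y = (\<Sum>j\<le>degree q. smult (coeff q j) (Y ^ j))"
    by (simp add: pcompose_altdef poly_altdef coeff_map_poly degree_map_poly)
  also have "\<dots> = (\<Sum>j\<le>degree q. \<Sum>k\<le>m. smult (coeff q j * bern_ratio m k j) (?B k))"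
    by (intro sum.cong refl) (subst mono, simp_all add: smult_sum_right mult.assoc)
  also have "\<dots> = (\<Sum>k\<le>m. \<Sum>j\<le>degree q. smult (coeff q j * bern_ratio m k j) (?B k))"
    by (rule sum.swap)
  also have "\<dots> = (\<Sum>k\<le>m. smult (b k) (?B k))"
    by (simp add: b_def smult_sum sum_distrib_right)
  finally have q_eq: "pcompose q Y = (\<Sum>k\<le>m. smult (b k) (?B k))" .
  have one: "1 = (\<Sum>k\<le>m. ?B k)"
    using mono[of 0] by (simp add: bern_ratio_def)
  have "[:d:] = smult d 1" by (simp add: one_pCons)
  also have "\<dots> = (\<Sum>k\<le>m. smult d (?B k))"
    by (subst one) (rule smult_sum_right)
  finally have "pcompose q Y + [:d:] = (\<Sum>k\<le>m. smult (b k) (?B k)) + (\<Sum>k\<le>m. smult d (?B k))"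
    using q_eq by (simp only:)
  also have "\<dots> = (\<Sum>k\<le>m. smult (b k + d) (?B k))"
    by (simp only: sum.distrib[symmetric] smult_add_left)
  finally have "pos (pcompose q Y + [:d:])"
    using b Y by (auto intro!: pos_sum pos_smult pos_mult pos_power simp del: smult_smult)
  moreover have "N (pcompose q Y - (pcompose q Y + [:d:])) \<le> d"
    using N_const[of d] d N_minus[of "[:d:]"] by simp
  ultimately show "\<exists>p. pos p \<and> N (pcompose q Y - p) \<le> d" by blast
qed

text \<open>\<open>pos ([:- a, 1:])\<close> and \<open>pos [:b, -1:]\<close> say that the variable lies between \<open>a\<close> and \<open>b\<close>.\<close>

lemma pos_if_nonneg_on_interval:
  assumes ab: "a < b" "pos [:- a, 1:]" "pos [:b, - 1:]"
    and q: "\<And>t. a \<le> t \<Longrightarrow> t \<le> b \<Longrightarrow> 0 \<le> poly q t"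
  shows "pos q"
proof -
  let ?Y = "smult (1 / (b - a)) [:- a, 1:]" and ?q = "pcompose q [:a, b - a:]"
  have "1 - ?Y = smult (1 / (b - a)) [:b, - 1:]"
    using ab by (simp add: one_pCons field_simps)
  then have Y: "pos (1 - ?Y)" "pos ?Y"
    using ab pos_smult[of "[:b, - 1:]" "1 / (b - a)"] pos_smult[of "[:- a, 1:]" "1 / (b - a)"]
    by (simp_all only:) simp_all
  have "pos (pcompose ?q ?Y)"
  proof (rule pos_pcompose_if_positive[OF Y(2,1)])
    fix t :: real assume t: "0 \<le> t" "t \<le> 1"
    have "0 \<le> t * (b - a)" "t * (b - a) \<le> 1 * (b - a)"
      using t ab by (intro mult_nonneg_nonneg mult_right_mono; simp)+
    then show "0 \<le> poly ?q t"
      using q[of "a + t * (b - a)"] by (simp add: poly_pcompose)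
  qed
  moreover have "pcompose ?q ?Y = q"
    using ab by (simp add: pcompose_assoc[symmetric] pcompose_pCons pcompose_idR)
  ultimately show ?thesis by simp
qed

text \<open>
  The norm of \<open>q (h)\<close> is thus controlled by the values of \<open>q\<close> on any interval that contains the spectrum of \<open>h\<close>,
  which replaces the spectral theorem.
\<close>

lemma N_le_on_interval:
  assumes ab: "a < b" "pos [:- a, 1:]" "pos [:b, - 1:]"
    and q: "\<And>t. a \<le> t \<Longrightarrow> t \<le> b \<Longrightarrow> \<bar>poly q t\<bar> \<le> c"
  shows "N q \<le> c"
proof (rule N_le_if_pos)
  show "pos ([:c:] - q)" "pos ([:c:] + q)"
    using q by (auto intro!: pos_if_nonneg_on_interval[OF ab] simp: abs_le_iff algebra_simps; force)+
  show "0 \<le> c" using q[of a] ab by (auto intro: order_trans[OF abs_ge_zero])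
qed

end

lemma weierstrass_poly:
  fixes f :: "real \<Rightarrow> real"
  assumes "continuous_on {a..b} f" "0 < e"
  shows "\<exists>q. \<forall>t\<in>{a..b}. \<bar>f t - poly q t\<bar> < e"
proof -
  obtain g where g: "real_polynomial_function g" "\<And>t. t \<in> {a..b} \<Longrightarrow> \<bar>f t - g t\<bar> < e"
    using Stone_Weierstrass_real_polynomial_function[OF compact_Icc assms] by blast
  obtain c n where "g = (\<lambda>t. \<Sum>i\<le>n. c i * t ^ i)"
    using g(1) unfolding real_polynomial_function_iff_sum by blast
  then have "poly (\<Sum>i\<le>n. monom (c i) i) = g"
    by (simp add: fun_eq_iff poly_sum poly_monom)
  with g(2) show ?thesis by (metis)
qed

locale cstar_unital = cstar_seminormed +
  fixes e :: 'a
  assumes e_mem [simp, intro]: "e \<in> S"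
    and e_left [simp]: "x \<in> S \<Longrightarrow> e * x = x"
    and e_right [simp]: "x \<in> S \<Longrightarrow> x * e = x"
begin

lemma adj_e [simp]: "adj e = e"
proof -
  have "adj (adj e * e) = adj e * e"
    by (simp only: adj_mult adj_adj)
  then show ?thesis
    using e_right[OF adj_mem[OF e_mem]] by (simp only: adj_adj)
qed

lemma nu_e_le_1: "\<nu> e \<le> 1"
proof -
  have "\<nu> e * \<nu> e = \<nu> e * 1" using nu_square[of e] by (simp add: power2_eq_square)
  then show ?thesis unfolding mult_cancel_left by auto
qed

abbreviation re_scl :: "real \<Rightarrow> 'a \<Rightarrow> 'a" (infixr \<open>\<bullet>\<^sub>R\<close> 75) where
  "t \<bullet>\<^sub>R h \<equiv> complex_of_real t \<odot> h"

definition pev :: "'a \<Rightarrow> real poly \<Rightarrow> 'a" where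
  "pev h q = fold_coeffs (\<lambda>a y. a \<bullet>\<^sub>R e + h * y) q 0"

lemma pev_0 [simp]: "pev h 0 = 0"
  by (simp add: pev_def)

lemma pev_pCons: "pev h (pCons a q) = a \<bullet>\<^sub>R e + h * pev h q"
  by (cases "q = 0 \<and> a = 0") (auto simp: pev_def)

lemma pev_mem [simp, intro]: "h \<in> S \<Longrightarrow> pev h q \<in> S"
  by (induction q) (auto simp: pev_pCons)

lemma pev_const: "pev h [:c:] = c \<bullet>\<^sub>R e"
  by (simp add: pev_pCons)

lemma pev_one: "pev h 1 = e"
  by (simp add: one_pCons pev_const)

lemma pev_var: "h \<in> S \<Longrightarrow> pev h [:0, 1:] = h"
  by (simp add: pev_pCons)

lemma pev_add: "pev h (p + q) = pev h p + pev h q"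
proof (induction p arbitrary: q)
  case (pCons a p)
  show ?case
    by (cases q) (simp add: pev_pCons pCons.IH scl_distribs distrib_left)
qed simp

lemma pev_smult: "pev h (smult c p) = c \<bullet>\<^sub>R pev h p"
  by (induction p) (simp_all add: pev_pCons scl_distribs)

lemma pev_minus: "pev h (- p) = - pev h p"
  using pev_smult[of h "-1" p] by simp

lemma pev_diff: "pev h (p - q) = pev h p - pev h q"
  using pev_add[of h p "- q"] by (simp add: pev_minus)

lemma pev_mult: "h \<in> S \<Longrightarrow> pev h (p * q) = pev h p * pev h q"
  by (induction p) (simp_all add: pev_pCons pev_add pev_smult distrib_right mult.assoc)

lemma pev_commute: "h \<in> S \<Longrightarrow> h * pev h q = pev h q * h"
  using pev_mult[of h "[:0, 1:]" q] pev_mult[of h q "[:0, 1:]"] by (simp add: pev_var mult.commute)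

lemma adj_pev: "\<lbrakk>h \<in> S; adj h = h\<rbrakk> \<Longrightarrow> adj (pev h q) = pev h q"
  by (induction q) (simp_all add: pev_pCons pev_commute)

lemma poly_cnorm_pev:
  assumes h: "h \<in> S" "adj h = h"
  shows "poly_cnorm (\<lambda>q. \<nu> (pev h q))"
proof
  fix p q and c :: real
  show "0 \<le> \<nu> (pev h p)" using h by simp
  show "\<nu> (pev h (p + q)) \<le> \<nu> (pev h p) + \<nu> (pev h q)"
    using h by (simp add: pev_add nu_add)
  show "\<nu> (pev h (smult c p)) = \<bar>c\<bar> * \<nu> (pev h p)"
    using h by (simp add: pev_smult nu_scl)
  show "\<nu> (pev h (p * q)) \<le> \<nu> (pev h p) * \<nu> (pev h q)"
    using h by (simp add: pev_mult nu_mult)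
  show "\<nu> (pev h 1) \<le> 1" by (simp add: pev_one nu_e_le_1)
  let ?s = "pev h p" and ?r = "pev h q"
  define u where "u = ?s + \<i> \<odot> ?r"
  have comm: "?s * ?r = ?r * ?s"
    using h by (metis pev_mult mult.commute)
  have au: "adj u = ?s - \<i> \<odot> ?r" using h by (simp add: u_def adj_pev)
  have uS: "u \<in> S" using h by (auto simp: u_def)
  have uu: "adj u * u = ?s * ?s + ?r * ?r"
    unfolding au by (simp add: u_def algebra_simps scl_distribs comm)
  have "u * u + adj u * adj u = (?s * ?s - ?r * ?r) + (?s * ?s - ?r * ?r)"
    unfolding au by (simp add: u_def algebra_simps scl_distribs comm)
  then have "u * u + adj u * adj u = (2::complex) \<odot> (?s * ?s - ?r * ?r)"
    using scl_add_left[of 1 1 "?s * ?s - ?r * ?r"] by simp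
  then have "2 * \<nu> (?s * ?s - ?r * ?r) = \<nu> (u * u + adj u * adj u)"
    using h by (simp add: nu_scl)
  also have "\<dots> \<le> \<nu> u * \<nu> u + \<nu> (adj u) * \<nu> (adj u)"
    using uS by (intro order_trans[OF nu_add] add_mono nu_mult) auto
  also have "\<dots> = 2 * \<nu> (adj u * u)"
    using uS nu_cstar[of u] by (simp add: power2_eq_square)
  finally show "\<nu> (pev h (p * p - q * q)) \<le> \<nu> (pev h (p * p + q * q))"
    using h by (simp add: uu pev_mult pev_add pev_diff)
qed

definition posS :: "'a \<Rightarrow> bool" where
  "posS h \<longleftrightarrow> h \<in> S \<and> adj h = h \<and> (\<exists>T\<ge>0. \<nu> (T \<bullet>\<^sub>R e - h) \<le> T)"

lemma posS_mem: "posS h \<Longrightarrow> h \<in> S"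
  and posS_adj: "posS h \<Longrightarrow> adj h = h"
  by (simp_all add: posS_def)

lemma pos_pev_iff:
  assumes h: "h \<in> S" "adj h = h"
  shows "poly_cnorm.pos (\<lambda>q. \<nu> (pev h q)) q \<longleftrightarrow> posS (pev h q)"
  using h unfolding poly_cnorm.pos_def[OF poly_cnorm_pev[OF h]] posS_def
  by (simp add: pev_diff pev_const adj_pev)

lemma posS_add: assumes "posS h" "posS k" shows "posS (h + k)"
proof -
  obtain T U where *: "0 \<le> T" "\<nu> (T \<bullet>\<^sub>R e - h) \<le> T" "0 \<le> U" "\<nu> (U \<bullet>\<^sub>R e - k) \<le> U"
    and S: "h \<in> S" "k \<in> S" "adj h = h" "adj k = k"
    using assms by (auto simp: posS_def)
  have "\<nu> ((T \<bullet>\<^sub>R e - h) + (U \<bullet>\<^sub>R e - k)) \<le> T + U"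
    using * S by (intro order_trans[OF nu_add]) auto
  moreover have "(T \<bullet>\<^sub>R e - h) + (U \<bullet>\<^sub>R e - k) = (T + U) \<bullet>\<^sub>R e - (h + k)"
    by (simp add: scl_distribs)
  ultimately show ?thesis
    using * S unfolding posS_def by (auto intro!: exI[of _ "T + U"])
qed

lemma posS_scl: assumes "posS h" "0 \<le> c" shows "posS (c \<bullet>\<^sub>R h)"
proof -
  obtain T where *: "0 \<le> T" "\<nu> (T \<bullet>\<^sub>R e - h) \<le> T" and S: "h \<in> S" "adj h = h"
    using assms by (auto simp: posS_def)
  have "\<nu> (c \<bullet>\<^sub>R (T \<bullet>\<^sub>R e - h)) \<le> c * T"
    using * S assms by (simp add: nu_scl mult_left_mono del: scl_scl)
  then have "\<nu> ((c * T) \<bullet>\<^sub>R e - c \<bullet>\<^sub>R h) \<le> c * T"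
    by (simp add: scl_diff_right)
  then show ?thesis
    using * S assms unfolding posS_def by (auto intro!: exI[of _ "c * T"])
qed

lemma posS_near:
  assumes "h \<in> S" "adj h = h" "\<nu> h \<le> d"
  shows "posS (d \<bullet>\<^sub>R e + h)"
  unfolding posS_def using assms order_trans[OF nu_nonneg[of h], of d] by (auto intro!: exI[of _ d])

lemma posS_const: "0 \<le> c \<Longrightarrow> posS (c \<bullet>\<^sub>R e)"
  using posS_near[of 0 c] by simp

lemma posS_square: "\<lbrakk>h \<in> S; adj h = h\<rbrakk> \<Longrightarrow> posS (h * h)"
  using poly_cnorm.pos_square[OF poly_cnorm_pev, of h "[:0, 1:]"]
  by (simp only: pos_pev_iff pev_mult pev_var)

lemma nu_le_if_posS:
  assumes "h \<in> S" "adj h = h" "posS (b \<bullet>\<^sub>R e - h)" "posS (b \<bullet>\<^sub>R e + h)" "0 \<le> b"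
  shows "\<nu> h \<le> b"
  using poly_cnorm.N_le_if_pos[OF poly_cnorm_pev[OF assms(1,2)], of b "[:0, 1:]"] assms
  by (simp only: pos_pev_iff pev_diff pev_add pev_const pev_var)

lemma
  assumes h: "h \<in> S" "adj h = h" and ab: "a < b" "posS (h - a \<bullet>\<^sub>R e)" "posS (b \<bullet>\<^sub>R e - h)"
  shows nu_pev_le: "(\<And>t. a \<le> t \<Longrightarrow> t \<le> b \<Longrightarrow> \<bar>poly q t\<bar> \<le> c) \<Longrightarrow> \<nu> (pev h q) \<le> c"
    and posS_pev: "(\<And>t. a \<le> t \<Longrightarrow> t \<le> b \<Longrightarrow> 0 \<le> poly q t) \<Longrightarrow> posS (pev h q)"
proof -
  interpret N: poly_cnorm "\<lambda>q. \<nu> (pev h q)" by (rule poly_cnorm_pev[OF h])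
  have *: "N.pos [:- a, 1:]" "N.pos [:b, - 1:]"
    using ab h by (simp_all add: pos_pev_iff pev_pCons)
  show "(\<And>t. a \<le> t \<Longrightarrow> t \<le> b \<Longrightarrow> \<bar>poly q t\<bar> \<le> c) \<Longrightarrow> \<nu> (pev h q) \<le> c"
    by (rule N.N_le_on_interval[OF ab(1) *])
  show "(\<And>t. a \<le> t \<Longrightarrow> t \<le> b \<Longrightarrow> 0 \<le> poly q t) \<Longrightarrow> posS (pev h q)"
    using N.pos_if_nonneg_on_interval[OF ab(1) *] h by (simp add: pos_pev_iff)
qed

subsection \<open>Positivity of \<open>c\<^sup>* c\<close>\<close>

lemma posS_add_adj_products:
  assumes y: "y \<in> S"
  shows "posS (y * adj y + adj y * y)"
proof -
  let ?h = "y + adj y" and ?k = "\<i> \<odot> (y - adj y)"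
  have "posS ((1/2) \<bullet>\<^sub>R (?h * ?h + ?k * ?k))"
    using y by (intro posS_scl posS_add posS_square) (auto simp: algebra_simps scl_distribs)
  moreover have "?h * ?h + ?k * ?k = 2 \<bullet>\<^sub>R (y * adj y + adj y * y)"
    using scl_add_left[of 1 1 "y * adj y + adj y * y"] by (simp add: algebra_simps scl_distribs)
  ultimately show ?thesis by simp
qed

text \<open>
  The spectra of \<open>y\<^sup>* y\<close> and \<open>y y\<^sup>*\<close> agree up to \<open>0\<close>, which makes \<open>y\<^sup>* y\<close> small if it is bounded above by a
  small constant \<open>d\<close>. Without spectra: \<open>y y\<^sup>* \<ge> - d\<close> because \<open>y y\<^sup>* + y\<^sup>* y \<ge> 0\<close>, and with \<open>z = y\<^sup>* y\<close> and
  \<open>R = \<parallel>z\<parallel>\<close> the norm of \<open>2 R z = z (R + z) + y\<^sup>* (R - y y\<^sup>*) y\<close> can be estimated termwise.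
\<close>

lemma nu_le_if_posS_minus:
  assumes y: "y \<in> S" and d: "0 < d" and pos: "posS (d \<bullet>\<^sub>R e - adj y * y)"
  shows "\<nu> (adj y * y) \<le> 3 * d"
proof -
  define z a R where "z = adj y * y" and "a = y * adj y" and "R = \<nu> z"
  have S: "z \<in> S" "a \<in> S" "adj z = z" "adj a = a" using y by (auto simp: z_def a_def)
  have R0: "0 \<le> R" using S by (simp add: R_def)
  have Ry: "R = (\<nu> y)\<^sup>2" using y by (simp add: R_def z_def nu_cstar)
  have Ra: "\<nu> a = R" using nu_cstar[of "adj y"] y by (simp add: a_def Ry)
  have "posS ((a + z) + (d \<bullet>\<^sub>R e - z))"
    using posS_add_adj_products[OF y] pos unfolding a_def z_def by (rule posS_add)
  then have ad: "posS (d \<bullet>\<^sub>R e + a)" by (simp add: add.commute)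
  have nuRa: "\<nu> (R \<bullet>\<^sub>R e - a) \<le> R + d"
  proof (rule nu_le_if_posS)
    show "posS ((R + d) \<bullet>\<^sub>R e - (R \<bullet>\<^sub>R e - a))"
      using ad by (simp add: scl_distribs algebra_simps)
    have "posS (R \<bullet>\<^sub>R e + - a)" using S Ra by (intro posS_near) auto
    moreover have "posS ((R + d) \<bullet>\<^sub>R e)" using R0 d by (intro posS_const) auto
    ultimately have "posS ((R + d) \<bullet>\<^sub>R e + (R \<bullet>\<^sub>R e + - a))"
      by (rule posS_add[rotated])
    then show "posS ((R + d) \<bullet>\<^sub>R e + (R \<bullet>\<^sub>R e - a))" by simp
  qed (use S R0 d in auto)
  have "(R \<bullet>\<^sub>R e - z) * z = adj y * (R \<bullet>\<^sub>R e - a) * y"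
    using y S by (simp add: a_def z_def algebra_simps)
  then have "\<nu> ((R \<bullet>\<^sub>R e - z) * z) \<le> \<nu> (adj y) * \<nu> (R \<bullet>\<^sub>R e - a) * \<nu> y"
    using y S by (simp only:) (intro order_trans[OF nu_mult] mult_right_mono nu_mult; auto)
  also have "\<dots> = R * \<nu> (R \<bullet>\<^sub>R e - a)"
    using y by (simp add: Ry power2_eq_square mult_ac)
  also have "\<dots> \<le> R * (R + d)"
    using nuRa R0 by (rule mult_left_mono)
  finally have 1: "\<nu> ((R \<bullet>\<^sub>R e - z) * z) \<le> R * (R + d)" .
  define M where "M = max (R * R / 4) (d * (R + d))"
  have 2: "\<nu> (pev z [:0, R, 1:]) \<le> M"
  proof (rule nu_pev_le[of z "- R" d])
    have "posS (R \<bullet>\<^sub>R e + z)" using S by (intro posS_near) (auto simp: R_def)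
    then show "posS (z - (- R) \<bullet>\<^sub>R e)" by (simp add: add.commute)
    show "posS (d \<bullet>\<^sub>R e - z)" using pos by (simp add: z_def)
    fix t assume t: "- R \<le> t" "t \<le> d"
    have lo: "0 \<le> t * (R + t) + R * R / 4"
    proof -
      have "0 \<le> (t + R / 2) * (t + R / 2)" by simp
      then show ?thesis by (simp add: algebra_simps)
    qed
    have hi: "t * (R + t) \<le> d * (R + d)"
    proof (cases "0 \<le> t")
      case True
      then show ?thesis using t R0 d by (intro mult_mono) auto
    next
      case False
      then have "t * (R + t) \<le> 0" using t by (intro mult_nonpos_nonneg) auto
      also have "0 \<le> d * (R + d)" using d R0 by simp
      finally show ?thesis .
    qed
    have "poly [:0, R, 1:] t = t * (R + t)" by simp
    then show "\<bar>poly [:0, R, 1:] t\<bar> \<le> M"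
      using lo hi by (simp add: M_def abs_le_iff del: poly_pCons) linarith
  qed (use S R0 d in auto)
  have "(2 * R) \<bullet>\<^sub>R z = pev z [:0, R, 1:] + (R \<bullet>\<^sub>R e - z) * z"
    using S scl_add_left[of R R z] by (simp add: pev_pCons algebra_simps)
  then have "2 * R * R = \<nu> (pev z [:0, R, 1:] + (R \<bullet>\<^sub>R e - z) * z)"
    using nu_scl[of z "complex_of_real (2 * R)"] S R0 by (simp add: R_def norm_mult)
  also have "\<dots> \<le> M + R * (R + d)"
    using 1 2 S by (intro order_trans[OF nu_add] add_mono) auto
  finally have main: "2 * R * R \<le> M + R * (R + d)" .
  have "R \<le> 3 * d"
  proof (rule ccontr)
    assume "\<not> R \<le> 3 * d"
    then have gt: "3 * d < R" by simp
    then have Rd: "3 * d * R < R * R" using d by (intro mult_strict_right_mono) auto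
    have dd: "3 * d * d \<le> d * R" using gt d by simp
    show False
    proof (cases "R * R / 4 \<le> d * (R + d)")
      case True
      then have "R * R \<le> 2 * (d * R) + d * d" using main by (simp add: M_def algebra_simps)
      moreover have "0 < d * d" using d by simp
      ultimately show False using Rd dd by (simp add: algebra_simps)
    next
      case False
      then have "R * R * 3 / 4 \<le> d * R" using main by (simp add: M_def algebra_simps)
      moreover have "0 < d * R" using gt d by simp
      ultimately show False using Rd by (simp add: algebra_simps)
    qed
  qed
  then show ?thesis by (simp add: R_def z_def)
qed

text \<open>
  If the square of \<open>g\<close> is close to the negative part \<open>w\<close> of \<open>x = c\<^sup>* c\<close>, then \<open>y = c g (x)\<close> satisfies
  \<open>y\<^sup>* y = x g (x)\<^sup>2\<close>, which is close to \<open>- w\<^sup>2\<close>. So \<open>y\<^sup>* y\<close> is bounded above by a small constant; hence it is small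
  in norm, and so is \<open>w\<close>.
\<close>

theorem posS_adj_mult_self:
  assumes c: "c \<in> S"
  shows "posS (adj c * c)"
proof -
  define x L where "x = adj c * c" and "L = \<nu> x + 1"
  have x: "x \<in> S" "adj x = x" using c by (auto simp: x_def)
  have L: "0 < L" using nu_nonneg[OF x(1)] by (simp add: L_def)
  have "posS (L \<bullet>\<^sub>R e + x)" "posS (L \<bullet>\<^sub>R e + - x)"
    using x by (intro posS_near; simp add: L_def)+
  then have ab: "posS (x - (- L) \<bullet>\<^sub>R e)" "posS (L \<bullet>\<^sub>R e - x)"
    by (simp_all add: add.commute)
  have LL: "- L < L" using L by simp
  note nu_le = nu_pev_le[OF x LL ab] and pos = posS_pev[OF x LL ab]
  have key: "\<nu> (pev x [:L, -1:]) \<le> L + \<eta> + sqrt (\<eta> * (4 * L + 1))" if \<eta>: "0 < \<eta>" "\<eta> \<le> 1" for \<eta>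
  proof -
    \<comment> \<open>\<open>g\<^sup>2\<close> approximates the negative part \<open>w\<close> of the variable.\<close>
    define w :: "real \<Rightarrow> real" where "w t = max (- t) 0" for t
    define \<delta> where "\<delta> = min 1 (\<eta> / (1 + 2 * sqrt L))"
    have sL: "0 \<le> sqrt L" using L by simp
    have \<delta>: "0 < \<delta>" "\<delta> \<le> 1" "\<delta> * (1 + 2 * sqrt L) \<le> \<eta>"
    proof -
      have "0 < 1 + 2 * sqrt L" using sL by linarith
      moreover have "\<delta> \<le> \<eta> / (1 + 2 * sqrt L)" by (simp add: \<delta>_def)
      ultimately show "\<delta> * (1 + 2 * sqrt L) \<le> \<eta>" by (simp add: le_divide_eq)
      show "0 < \<delta>" using \<eta> sL by (simp add: \<delta>_def add_pos_nonneg)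
    qed (simp add: \<delta>_def)
    have "continuous_on {-L..L} (\<lambda>t. sqrt (w t))"
      unfolding w_def by (intro continuous_intros)
    then obtain g where g: "\<And>t. t \<in> {-L..L} \<Longrightarrow> \<bar>sqrt (w t) - poly g t\<bar> < \<delta>"
      using weierstrass_poly[OF _ \<delta>(1)] by blast
    define r where "r = g * g"
    have r: "\<bar>poly r t - w t\<bar> \<le> \<eta>" if t: "- L \<le> t" "t \<le> L" for t
    proof -
      let ?m = "sqrt (w t)" and ?g = "poly g t"
      have w: "0 \<le> w t" "w t \<le> L" using t L by (auto simp: w_def)
      have m: "0 \<le> ?m" "?m \<le> sqrt L" using w by auto
      have gm: "\<bar>?g - ?m\<bar> \<le> \<delta>" using g[of t] t by auto
      have "poly r t - w t = (?g - ?m) * (?g - ?m + 2 * ?m)"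
        using w by (simp add: r_def algebra_simps)
      then have "\<bar>poly r t - w t\<bar> = \<bar>?g - ?m\<bar> * \<bar>?g - ?m + 2 * ?m\<bar>"
        by (simp add: abs_mult)
      also have "\<dots> \<le> \<delta> * (1 + 2 * sqrt L)"
      proof (rule mult_mono)
        show "\<bar>?g - ?m + 2 * ?m\<bar> \<le> 1 + 2 * sqrt L" using gm m \<delta>(2) by linarith
      qed (use gm \<delta> in auto)
      finally show ?thesis using \<delta> by simp
    qed
    let ?X = "[:0, 1:] :: real poly"
    have tw: "t * w t = - (w t * w t)" for t by (simp add: w_def max_def)
    have Xr: "\<nu> (pev x (?X * r)) \<le> 3 * (L * \<eta>)"
    proof -
      let ?y = "c * pev x g"
      have y: "adj ?y * ?y = pev x (?X * r)"
      proof -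
        have "adj ?y * ?y = pev x g * (x * pev x g)"
          using x by (simp add: adj_pev x_def mult.assoc)
        also have "\<dots> = x * (pev x g * pev x g)"
          using x pev_commute[of x g] by (metis mult.assoc)
        also have "\<dots> = pev x (?X * r)"
          using x unfolding r_def by (simp only: pev_mult pev_var)
        finally show ?thesis .
      qed
      have "posS ((L * \<eta>) \<bullet>\<^sub>R e - adj ?y * ?y)"
      proof -
        have "0 \<le> poly ([:L * \<eta>:] - ?X * r) t" if t: "- L \<le> t" "t \<le> L" for t
        proof -
          have "t * poly r t - t * w t \<le> \<bar>t\<bar> * \<bar>poly r t - w t\<bar>"
            by (metis abs_ge_self abs_mult right_diff_distrib)
          also have "\<dots> \<le> L * \<eta>"
            using t r[OF t] L by (intro mult_mono) (auto simp: abs_le_iff)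
          finally have "t * poly r t \<le> L * \<eta> - w t * w t" by (simp add: tw)
          also have "\<dots> \<le> L * \<eta>" by simp
          finally show ?thesis by simp
        qed
        from pos[OF this] show ?thesis
          unfolding y by (simp only: pev_diff pev_const)
      qed
      then have "\<nu> (adj ?y * ?y) \<le> 3 * (L * \<eta>)"
        using c x L \<eta> by (intro nu_le_if_posS_minus) auto
      then show ?thesis by (simp only: y)
    qed
    have rr: "\<nu> (pev x (r * r + ?X * r)) \<le> \<eta> * (\<eta> + L)"
    proof (rule nu_le)
      fix t assume t: "- L \<le> t" "t \<le> L"
      have "poly (r * r + ?X * r) t = (poly r t - w t) * ((poly r t - w t) + (2 * w t + t))"
        using tw[of t] by (simp add: algebra_simps)
      then have "\<bar>poly (r * r + ?X * r) t\<bar> = \<bar>poly r t - w t\<bar> * \<bar>(poly r t - w t) + (2 * w t + t)\<bar>"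
        by (simp only: abs_mult)
      also have "\<dots> \<le> \<eta> * (\<eta> + L)"
      proof (rule mult_mono)
        have "\<bar>2 * w t + t\<bar> \<le> L" using t by (auto simp: w_def)
        then show "\<bar>(poly r t - w t) + (2 * w t + t)\<bar> \<le> \<eta> + L"
          using r[OF t] by linarith
      qed (use r[OF t] \<eta> in auto)
      finally show "\<bar>poly (r * r + ?X * r) t\<bar> \<le> \<eta> * (\<eta> + L)" .
    qed
    have "(\<nu> (pev x r))\<^sup>2 = \<nu> (pev x (r * r))"
      using x by (simp add: pev_mult nu_square adj_pev)
    also have "pev x (r * r) = pev x (r * r + ?X * r) - pev x (?X * r)"
      by (simp only: pev_add) simp
    also have "\<nu> \<dots> \<le> \<eta> * (\<eta> + L) + 3 * (L * \<eta>)"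
      using x rr Xr by (intro order_trans[OF nu_diff] add_mono) auto
    also have "\<dots> \<le> \<eta> * (4 * L + 1)"
      using \<eta> mult_left_mono[of \<eta> 1 \<eta>] by (simp add: algebra_simps)
    finally have nr: "\<nu> (pev x r) \<le> sqrt (\<eta> * (4 * L + 1))"
      by (rule real_le_rsqrt)
    have "\<nu> (pev x ([:L, -1:] - r)) \<le> L + \<eta>"
    proof (rule nu_le)
      fix t assume t: "- L \<le> t" "t \<le> L"
      have "poly ([:L, -1:] - r) t = (L - t - w t) - (poly r t - w t)" by simp
      moreover have "\<bar>L - t - w t\<bar> \<le> L" using t by (auto simp: w_def)
      ultimately show "\<bar>poly ([:L, -1:] - r) t\<bar> \<le> L + \<eta>"
        using r[OF t] by linarith
    qed
    moreover have "\<nu> (pev x [:L, -1:]) \<le> \<nu> (pev x ([:L, -1:] - r)) + \<nu> (pev x r)"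
      using nu_add[of "pev x ([:L, -1:] - r)" "pev x r"] x by (simp add: pev_diff)
    ultimately show ?thesis using nr by simp
  qed
  have "\<nu> (L \<bullet>\<^sub>R e - x) \<le> L"
  proof (rule field_le_epsilon)
    fix d :: real assume d: "0 < d"
    define \<eta> where "\<eta> = min (min 1 (d / 2)) ((d / 2)\<^sup>2 / (4 * L + 1))"
    have L1: "0 < 4 * L + 1" using L by simp
    have \<eta>: "0 < \<eta>" "\<eta> \<le> 1" using d L1 by (auto simp: \<eta>_def)
    have \<eta>3: "\<eta> \<le> d / 2" unfolding \<eta>_def by (rule order_trans[OF min.cobounded1 min.cobounded2])
    have "\<eta> \<le> (d / 2)\<^sup>2 / (4 * L + 1)" by (simp add: \<eta>_def)
    then have "\<eta> * (4 * L + 1) \<le> (d / 2)\<^sup>2" using L1 by (simp add: le_divide_eq)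
    then have "sqrt (\<eta> * (4 * L + 1)) \<le> d / 2"
      using d by (intro real_le_lsqrt) auto
    then have "\<nu> (pev x [:L, -1:]) \<le> L + d"
      using key[OF \<eta>(1,2)] \<eta>3 by simp
    then show "\<nu> (L \<bullet>\<^sub>R e - x) \<le> L + d"
      using x by (simp add: pev_pCons)
  qed
  then show ?thesis
    using x L unfolding posS_def x_def[symmetric] by (auto intro!: exI[of _ L])
qed

end

context cstar_unital
begin

subsection \<open>States that attain the norm\<close>

definition self_adjoint :: "'a set" where
  "self_adjoint = {h \<in> S. adj h = h}"

text \<open>
  Such a cone is the cone of positive elements of an order with order unit \<open>e\<close>. A maximal one gives a total
  order, which determines a functional.
\<close>

definition proper_cone :: "'a set \<Rightarrow> bool" where
  "proper_cone Q \<longleftrightarrow> Q \<subseteq> self_adjoint \<and> {h. posS h} \<subseteq> Q \<and>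
     (\<forall>u\<in>Q. \<forall>v\<in>Q. u + v \<in> Q) \<and> (\<forall>t\<ge>0. \<forall>u\<in>Q. t \<bullet>\<^sub>R u \<in> Q) \<and> - e \<notin> Q"

lemma proper_cone_extend:
  assumes Q: "Q \<subseteq> self_adjoint" "{h. posS h} \<subseteq> Q" "\<And>u v. u \<in> Q \<Longrightarrow> v \<in> Q \<Longrightarrow> u + v \<in> Q"
      "\<And>t u. 0 \<le> t \<Longrightarrow> u \<in> Q \<Longrightarrow> t \<bullet>\<^sub>R u \<in> Q"
    and v: "v \<in> self_adjoint" and ne: "\<And>q t. q \<in> Q \<Longrightarrow> 0 \<le> t \<Longrightarrow> - e \<noteq> q + t \<bullet>\<^sub>R v"
  shows "proper_cone {q + t \<bullet>\<^sub>R v |q t. q \<in> Q \<and> 0 \<le> t}" (is "proper_cone ?Q")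
    and "v \<in> {q + t \<bullet>\<^sub>R v |q t. q \<in> Q \<and> 0 \<le> t}"
    and "Q \<subseteq> {q + t \<bullet>\<^sub>R v |q t. q \<in> Q \<and> 0 \<le> t}"
proof -
  have z: "0 \<in> Q" using posS_const[of 0] Q(2) by auto
  then show "v \<in> ?Q" by (intro CollectI exI[of _ 0] exI[of _ 1]) simp
  show sub: "Q \<subseteq> ?Q"
  proof
    fix q assume "q \<in> Q"
    then show "q \<in> ?Q" by (intro CollectI exI[of _ q] exI[of _ 0]) simp
  qed
  show "proper_cone ?Q"
    unfolding proper_cone_def
  proof (intro conjI ballI allI impI)
    show "?Q \<subseteq> self_adjoint"
      using Q(1) v by (auto simp: self_adjoint_def)
    show "{h. posS h} \<subseteq> ?Q" using Q(2) sub by blast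
    show "- e \<notin> ?Q" using ne by blast
    fix u w assume "u \<in> ?Q" "w \<in> ?Q"
    then obtain q t q' t' where "u = q + t \<bullet>\<^sub>R v" "w = q' + t' \<bullet>\<^sub>R v" "q \<in> Q" "q' \<in> Q" "0 \<le> t" "0 \<le> t'"
      by blast
    then show "u + w \<in> ?Q"
      using Q(3) by (intro CollectI exI[of _ "q + q'"] exI[of _ "t + t'"]) (simp add: scl_distribs)
  next
    fix s :: real and u assume s: "0 \<le> s" and "u \<in> ?Q"
    then obtain q t where "u = q + t \<bullet>\<^sub>R v" "q \<in> Q" "0 \<le> t"
      by blast
    then show "s \<bullet>\<^sub>R u \<in> ?Q"
      using Q(4) s by (intro CollectI exI[of _ "s \<bullet>\<^sub>R q"] exI[of _ "s * t"]) (simp add: scl_distribs)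
  qed
qed

lemma maximal_proper_cone:
  assumes "proper_cone Q"
  obtains K where "proper_cone K" "Q \<subseteq> K" "\<And>v. v \<in> self_adjoint \<Longrightarrow> v \<in> K \<or> - v \<in> K"
proof -
  let ?A = "{K. proper_cone K \<and> Q \<subseteq> K}"
  have "\<exists>K\<in>?A. \<forall>X\<in>?A. K \<subseteq> X \<longrightarrow> X = K"
  proof (rule subset_Zorn_nonempty)
    show "?A \<noteq> {}" using assms by blast
    fix C assume C: "C \<noteq> {}" "subset.chain ?A C"
    then have CA: "\<And>K. K \<in> C \<Longrightarrow> proper_cone K \<and> Q \<subseteq> K"
      by (auto simp: subset.chain_def)
    obtain K0 where K0: "K0 \<in> C" using C by blast
    show "\<Union>C \<in> ?A"
      unfolding mem_Collect_eq proper_cone_def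
    proof (intro conjI ballI allI impI)
      show "\<Union>C \<subseteq> self_adjoint"
        using CA unfolding proper_cone_def by (intro Union_least) (simp only:)
      show "- e \<notin> \<Union>C"
        using CA unfolding proper_cone_def by (metis UnionE)
      show "{h. posS h} \<subseteq> \<Union>C" "Q \<subseteq> \<Union>C"
        using CA[OF K0] K0 by (auto simp: proper_cone_def)
      fix u v assume "u \<in> \<Union>C" "v \<in> \<Union>C"
      then obtain K1 K2 where "K1 \<in> C" "u \<in> K1" "K2 \<in> C" "v \<in> K2" by blast
      moreover from this have "K1 \<subseteq> K2 \<or> K2 \<subseteq> K1" using C unfolding subset_chain_def by blast
      ultimately obtain K where "K \<in> C" "u \<in> K" "v \<in> K" by blast
      moreover from this have "u + v \<in> K" using CA[of K] by (simp add: proper_cone_def)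
      ultimately show "u + v \<in> \<Union>C" by blast
    next
      fix t :: real and u assume t: "0 \<le> t" and "u \<in> \<Union>C"
      then obtain K where "K \<in> C" "u \<in> K" by blast
      moreover from this have "t \<bullet>\<^sub>R u \<in> K" using CA[of K] t by (simp add: proper_cone_def)
      ultimately show "t \<bullet>\<^sub>R u \<in> \<Union>C" by blast
    qed
  qed
  then obtain K where K1: "K \<in> ?A" and m: "\<forall>X\<in>?A. K \<subseteq> X \<longrightarrow> X = K"
    by (rule bexE)
  have K: "proper_cone K" "Q \<subseteq> K" using K1 by simp_all
  have max: "X = K" if "proper_cone X" "K \<subseteq> X" for X
    using m[rule_format, of X] that K(2) by simp
  have Kp: "K \<subseteq> self_adjoint" "{h. posS h} \<subseteq> K" "\<And>u v. u \<in> K \<Longrightarrow> v \<in> K \<Longrightarrow> u + v \<in> K"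
      "\<And>t u. 0 \<le> t \<Longrightarrow> u \<in> K \<Longrightarrow> t \<bullet>\<^sub>R u \<in> K" "- e \<notin> K"
    using K(1) by (simp_all add: proper_cone_def)
  have ex: "\<exists>q\<in>K. \<exists>t>0. - e = q + t \<bullet>\<^sub>R v" if v: "v \<in> self_adjoint" "v \<notin> K" for v
  proof (rule ccontr)
    assume no: "\<not> ?thesis"
    have "- e \<noteq> q + t \<bullet>\<^sub>R v" if "q \<in> K" "0 \<le> t" for q t
      using no that Kp(5) by (cases "t = 0") (auto simp: order_less_le)
    note ext = proper_cone_extend[OF Kp(1-4) v(1) this]
    show False using max[OF ext(1,3)] ext(2) v(2) by simp
  qed
  have "v \<in> K \<or> - v \<in> K" if v: "v \<in> self_adjoint" for v
  proof (rule ccontr)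
    assume "\<not> ?thesis"
    moreover have "- v \<in> self_adjoint" using v by (auto simp: self_adjoint_def)
    ultimately obtain q t q' t' where *: "q \<in> K" "q' \<in> K" "0 < t" "0 < t'"
        "- e = q + t \<bullet>\<^sub>R v" "- e = q' + t' \<bullet>\<^sub>R (- v)"
      using ex[OF v] ex[of "- v"] by blast
    have "t' \<bullet>\<^sub>R (- e) + t \<bullet>\<^sub>R (- e) = t' \<bullet>\<^sub>R (q + t \<bullet>\<^sub>R v) + t \<bullet>\<^sub>R (q' + t' \<bullet>\<^sub>R (- v))"
      using * by (simp only:)
    then have "- ((t' + t) \<bullet>\<^sub>R e) = t' \<bullet>\<^sub>R q + t \<bullet>\<^sub>R q'"
      by (simp add: scl_distribs mult.commute)
    then have "(1 / (t' + t)) \<bullet>\<^sub>R (- ((t' + t) \<bullet>\<^sub>R e)) = (1 / (t' + t)) \<bullet>\<^sub>R (t' \<bullet>\<^sub>R q + t \<bullet>\<^sub>R q')"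
      by (rule arg_cong)
    moreover have "(1 / (t' + t)) \<bullet>\<^sub>R (- ((t' + t) \<bullet>\<^sub>R e)) = - e"
    proof -
      have "1 / (t' + t) * (t' + t) = 1" using * by simp
      then have "complex_of_real (1 / (t' + t)) * complex_of_real (t' + t) = 1"
        by (simp only: of_real_mult[symmetric] of_real_1)
      then show ?thesis by (simp only: scl_minus_right scl_scl scl_one)
    qed
    moreover have "(1 / (t' + t)) \<bullet>\<^sub>R (t' \<bullet>\<^sub>R q + t \<bullet>\<^sub>R q') \<in> K"
      using * by (intro Kp(3,4)) auto
    ultimately show False using Kp(5) by simp
  qed
  with K show thesis by (intro that)
qed

definition positive_functional :: "('a \<Rightarrow> complex) \<Rightarrow> bool" where
  "positive_functional f \<longleftrightarrow> (\<forall>u\<in>S. \<forall>v\<in>S. f (u + v) = f u + f v) \<and>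
     (\<forall>k. \<forall>u\<in>S. f (k \<odot> u) = k * f u) \<and> (\<forall>u\<in>S. 0 \<le> Re (f (adj u * u)) \<and> Im (f (adj u * u)) = 0)"

lemma minus_e_not_pos:
  assumes "0 < \<nu> e"
  shows "\<not> posS (- e)"
proof
  have nue: "\<nu> e = 1"
  proof -
    have "\<nu> e * \<nu> e = 1 * \<nu> e" using nu_square[of e] by (simp add: power2_eq_square)
    then show ?thesis using assms by (simp only: mult_cancel_right) auto
  qed
  assume "posS (- e)"
  then obtain T where T: "0 \<le> T" "\<nu> (T \<bullet>\<^sub>R e - (- e)) \<le> T"
    unfolding posS_def by blast
  have "T \<bullet>\<^sub>R e - (- e) = (T + 1) \<bullet>\<^sub>R e" by (simp add: scl_distribs)
  then have "\<nu> (T \<bullet>\<^sub>R e - (- e)) = T + 1"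
    using T nu_scl[of e "complex_of_real (T + 1)"] nue by (simp del: of_real_add)
  then show False using T by simp
qed

text \<open>
  The element \<open>x - \<parallel>x\<parallel> e\<close> with \<open>x = c\<^sup>* c\<close> can be added to the positive cone without making it
  improper, because \<open>x \<le> b e\<close> and \<open>x \<ge> 0\<close> imply \<open>\<parallel>x\<parallel> \<le> b\<close>. The functional of a maximal proper cone that contains it is
  at least \<open>\<parallel>x\<parallel>\<close> at \<open>x\<close>.
\<close>

theorem norming_positive_functional:
  assumes c: "c \<in> S" and pos: "0 < \<nu> (adj c * c)"
  obtains f where "positive_functional f" "f e = 1" "\<nu> (adj c * c) \<le> Re (f (adj c * c))"
proof -
  define x where "x = adj c * c"
  have x: "x \<in> S" "adj x = x" using c by (auto simp: x_def)
  have nux: "0 < \<nu> x" using pos by (simp add: x_def)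
  have "\<nu> x \<le> \<nu> e * \<nu> x" using nu_mult[of e x] x by simp
  then have "0 < \<nu> e" using nux nu_nonneg[of e] by (cases "\<nu> e = 0") auto
  note me = minus_e_not_pos[OF this]
  let ?v = "x - \<nu> x \<bullet>\<^sub>R e"
  have v: "?v \<in> self_adjoint" using x by (auto simp: self_adjoint_def)
  have ne: "- e \<noteq> q + t \<bullet>\<^sub>R ?v" if q: "posS q" and t: "0 \<le> t" for q t
  proof
    assume eq: "- e = q + t \<bullet>\<^sub>R ?v"
    have "t \<noteq> 0" using eq q me by auto
    then have t: "0 < t" using t by simp
    let ?b = "\<nu> x - 1 / t" and ?b' = "max 0 (\<nu> x - 1 / t)"
    have "(1 / t) \<bullet>\<^sub>R q = (1 / t) \<bullet>\<^sub>R (- e - t \<bullet>\<^sub>R ?v)"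
      using eq by simp
    also have "\<dots> = ?b \<bullet>\<^sub>R e - x"
      using t by (simp add: scl_distribs)
    finally have "posS (?b \<bullet>\<^sub>R e - x)"
      using posS_scl[OF q, of "1 / t"] t by simp
    moreover have "posS ((?b' - ?b) \<bullet>\<^sub>R e)" by (intro posS_const) simp
    ultimately have "posS ((?b \<bullet>\<^sub>R e - x) + (?b' - ?b) \<bullet>\<^sub>R e)" by (rule posS_add)
    moreover have "(?b \<bullet>\<^sub>R e - x) + (?b' - ?b) \<bullet>\<^sub>R e = ?b' \<bullet>\<^sub>R e - x"
      unfolding of_real_diff[of ?b'] scl_diff_left[of _ _ e] by simp
    ultimately have b1: "posS (?b' \<bullet>\<^sub>R e - x)" by (simp only:)
    have b2: "posS (?b' \<bullet>\<^sub>R e + x)"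
      unfolding x_def by (intro posS_add posS_adj_mult_self c posS_const) simp
    have "\<nu> x \<le> ?b'"
      using x b1 b2 by (intro nu_le_if_posS) auto
    then show False using nux t by (simp add: max_def split: if_splits)
  qed
  have P: "{h. posS h} \<subseteq> self_adjoint"
    by (auto simp: self_adjoint_def posS_mem posS_adj)
  define Q where "Q = {q + t \<bullet>\<^sub>R ?v |q t. q \<in> {h. posS h} \<and> 0 \<le> t}"
  have Q: "proper_cone Q" "?v \<in> Q"
    unfolding Q_def
    by (rule proper_cone_extend[OF P order_refl _ _ v]; simp only: mem_Collect_eq posS_add posS_scl ne not_False_eq_True)+
  obtain K where K: "proper_cone K" and QK: "Q \<subseteq> K" and tot: "\<And>v. v \<in> self_adjoint \<Longrightarrow> v \<in> K \<or> - v \<in> K"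
    using Q(1) by (rule maximal_proper_cone) blast
  have vK: "?v \<in> K" using Q(2) QK by blast
  have Kp: "K \<subseteq> self_adjoint" "\<And>h. posS h \<Longrightarrow> h \<in> K" "\<And>u v. u \<in> K \<Longrightarrow> v \<in> K \<Longrightarrow> u + v \<in> K"
      "\<And>t u. 0 \<le> t \<Longrightarrow> u \<in> K \<Longrightarrow> t \<bullet>\<^sub>R u \<in> K" "- e \<notin> K"
    using K by (auto simp add: proper_cone_def)
  have const: "0 \<le> t" if "t \<bullet>\<^sub>R e \<in> K" for t
  proof (rule ccontr)
    assume "\<not> 0 \<le> t"
    then have "- 1 / t * t = - 1" "0 \<le> - 1 / t" by (simp_all add: divide_nonneg_neg)
    then have "complex_of_real (- 1 / t) * complex_of_real t = - 1"
      by (simp only: of_real_mult[symmetric] of_real_1 of_real_minus)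
    then have "(- 1 / t) \<bullet>\<^sub>R (t \<bullet>\<^sub>R e) = - e"
      by (simp only: scl_scl scl_minus_left scl_one)
    then show False using Kp(4)[of "- 1 / t" "t \<bullet>\<^sub>R e"] that Kp(5) \<open>0 \<le> - 1 / t\<close> by simp
  qed
  \<comment> \<open>The order on self-adjoint elements given by \<open>K\<close> is total, so it determines a cut of the reals.\<close>
  define f0 where "f0 v = Sup {t. v - t \<bullet>\<^sub>R e \<in> K}" for v
  have cmp: "s \<le> t" if "v - s \<bullet>\<^sub>R e \<in> K" "t \<bullet>\<^sub>R e - v \<in> K" for v s t
  proof -
    have "(v - s \<bullet>\<^sub>R e) + (t \<bullet>\<^sub>R e - v) = (t - s) \<bullet>\<^sub>R e" by (simp add: scl_distribs)
    then show ?thesis using Kp(3)[OF that] const[of "t - s"] by simp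
  qed
  have nonempty: "- \<nu> v \<in> {t. v - t \<bullet>\<^sub>R e \<in> K}" and upper: "\<nu> v \<bullet>\<^sub>R e - v \<in> K" if "v \<in> self_adjoint" for v
    using that posS_near[of v "\<nu> v"] posS_near[of "- v" "\<nu> v"]
    by (auto simp: self_adjoint_def add.commute intro: Kp(2))
  have bdd: "bdd_above {t. v - t \<bullet>\<^sub>R e \<in> K}" if "v \<in> self_adjoint" for v
    using cmp upper[OF that] by (intro bdd_aboveI[of _ "\<nu> v"]) blast
  have L1: "t \<le> f0 v" if "v \<in> self_adjoint" "v - t \<bullet>\<^sub>R e \<in> K" for v t
    unfolding f0_def using bdd[OF that(1)] that(2) by (intro cSup_upper) auto
  have L2: "f0 v \<le> t" if "v \<in> self_adjoint" "t \<bullet>\<^sub>R e - v \<in> K" for v t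
    unfolding f0_def using nonempty[OF that(1)] that(2) cmp by (intro cSup_least) blast+
  have sa: "v - t \<bullet>\<^sub>R e \<in> self_adjoint" if "v \<in> self_adjoint" for v t
    using that by (auto simp: self_adjoint_def)
  have L3: "v - t \<bullet>\<^sub>R e \<in> K" if "v \<in> self_adjoint" "t < f0 v" for v t
    using tot[OF sa[OF that(1), of t]] L2[OF that(1), of t] that(2) by auto
  have L4: "t \<bullet>\<^sub>R e - v \<in> K" if "v \<in> self_adjoint" "f0 v < t" for v t
    using tot[OF sa[OF that(1), of t]] L1[OF that(1), of t] that(2) by auto
  have add: "f0 (u + v) = f0 u + f0 v" if u: "u \<in> self_adjoint" and v: "v \<in> self_adjoint" for u v
  proof (rule antisym)
    have uv: "u + v \<in> self_adjoint" using u v by (auto simp: self_adjoint_def)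
    show "f0 (u + v) \<le> f0 u + f0 v"
    proof (rule field_le_epsilon)
      fix d :: real assume "0 < d"
      then have "((f0 u + d / 2) \<bullet>\<^sub>R e - u) + ((f0 v + d / 2) \<bullet>\<^sub>R e - v) \<in> K"
        using u v by (intro Kp(3) L4) auto
      moreover have "((f0 u + d / 2) \<bullet>\<^sub>R e - u) + ((f0 v + d / 2) \<bullet>\<^sub>R e - v) =
          ((f0 u + d / 2) + (f0 v + d / 2)) \<bullet>\<^sub>R e - (u + v)"
        unfolding of_real_add[of "f0 u + d / 2"] scl_add_left[of _ _ e] by simp
      ultimately have "f0 (u + v) \<le> (f0 u + d / 2) + (f0 v + d / 2)"
        using L2[OF uv] by metis
      then show "f0 (u + v) \<le> f0 u + f0 v + d" by simp
    qed
    show "f0 u + f0 v \<le> f0 (u + v)"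
    proof (rule field_le_epsilon)
      fix d :: real assume "0 < d"
      then have "(u - (f0 u - d / 2) \<bullet>\<^sub>R e) + (v - (f0 v - d / 2) \<bullet>\<^sub>R e) \<in> K"
        using u v by (intro Kp(3) L3) auto
      moreover have "(u - (f0 u - d / 2) \<bullet>\<^sub>R e) + (v - (f0 v - d / 2) \<bullet>\<^sub>R e) =
          (u + v) - ((f0 u - d / 2) + (f0 v - d / 2)) \<bullet>\<^sub>R e"
        unfolding of_real_add[of "f0 u - d / 2"] scl_add_left[of _ _ e] by simp
      ultimately have "(f0 u - d / 2) + (f0 v - d / 2) \<le> f0 (u + v)"
        using L1[OF uv] by metis
      then show "f0 u + f0 v \<le> f0 (u + v) + d" by simp
    qed
  qed
  have K0: "0 \<in> K" using Kp(2)[OF posS_const[of 0]] by simp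
  have z: "0 \<in> self_adjoint" by (simp add: self_adjoint_def)
  have f00: "f0 0 = 0" using add[OF z z] by simp
  have minus: "f0 (- v) = - f0 v" if "v \<in> self_adjoint" for v
    using add[of v "- v"] that f00 by (auto simp: self_adjoint_def)
  have scl_pos: "t * f0 v \<le> f0 (t \<bullet>\<^sub>R v)" if v: "v \<in> self_adjoint" and t: "0 < t" for t v
  proof (rule field_le_epsilon)
    fix d :: real assume d: "0 < d"
    have "v - (f0 v - d / t) \<bullet>\<^sub>R e \<in> K" using d t by (intro L3[OF v]) auto
    then have "t \<bullet>\<^sub>R (v - (f0 v - d / t) \<bullet>\<^sub>R e) \<in> K" using t by (intro Kp(4)) auto
    moreover have "t \<bullet>\<^sub>R (v - (f0 v - d / t) \<bullet>\<^sub>R e) = t \<bullet>\<^sub>R v - (t * f0 v - d) \<bullet>\<^sub>R e"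
      using t by (simp add: scl_distribs right_diff_distrib)
    moreover have "t \<bullet>\<^sub>R v \<in> self_adjoint" using v by (auto simp: self_adjoint_def)
    ultimately show "t * f0 v \<le> f0 (t \<bullet>\<^sub>R v) + d" using L1[of "t \<bullet>\<^sub>R v" "t * f0 v - d"] by simp
  qed
  have scl: "f0 (t \<bullet>\<^sub>R v) = t * f0 v" if v: "v \<in> self_adjoint" for t v
  proof -
    have mv: "- v \<in> self_adjoint" and tv: "s \<bullet>\<^sub>R v \<in> self_adjoint" for s
      using v by (auto simp: self_adjoint_def)
    have pos: "f0 (s \<bullet>\<^sub>R v) = s * f0 v" if "0 < s" for s
      using scl_pos[OF v that] scl_pos[OF mv that] minus[OF v] minus[OF tv[of s]] by simp
    consider "t = 0" | "0 < t" | "0 < - t" by linarith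
    then show ?thesis
    proof cases
      case 3
      then show ?thesis using pos[OF 3] minus[OF tv[of t]] by simp
    qed (use pos f00 in auto)
  qed
  define hr where "hr u = (1/2) \<odot> (u + adj u)" for u :: 'a
  define hi where "hi u = (- \<i> / 2) \<odot> (u - adj u)" for u :: 'a
  have hrs: "hr u \<in> self_adjoint" "hi u \<in> self_adjoint" if "u \<in> S" for u
    using that by (auto simp: hr_def hi_def self_adjoint_def scl_distribs)
  define f where "f u = complex_of_real (f0 (hr u)) + \<i> * complex_of_real (f0 (hi u))" for u
  have f_add: "f (u + v) = f u + f v" if "u \<in> S" "v \<in> S" for u v
  proof -
    have "hr (u + v) = hr u + hr v" "hi (u + v) = hi u + hi v"
      by (simp_all add: hr_def hi_def scl_distribs)
    then show ?thesis using add hrs that by (simp add: f_def distrib_left)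
  qed
  have f_scl: "f (k \<odot> u) = k * f u" if u: "u \<in> S" for k u
  proof -
    obtain a b where k: "k = complex_of_real a + \<i> * complex_of_real b"
      by (metis complex_eq)
    have "hr (k \<odot> u) = a \<bullet>\<^sub>R hr u + (- b) \<bullet>\<^sub>R hi u" "hi (k \<odot> u) = b \<bullet>\<^sub>R hr u + a \<bullet>\<^sub>R hi u"
      by (simp_all add: hr_def hi_def k scl_distribs algebra_simps)
    moreover have "f0 (s \<bullet>\<^sub>R hr u + t \<bullet>\<^sub>R hi u) = s * f0 (hr u) + t * f0 (hi u)" for s t
      using hrs[OF u] by (subst add) (auto simp: scl self_adjoint_def)
    ultimately have "f0 (hr (k \<odot> u)) = a * f0 (hr u) + (- b) * f0 (hi u)" "f0 (hi (k \<odot> u)) = b * f0 (hr u) + a * f0 (hi u)"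
      by (simp_all only:)
    then show ?thesis by (simp add: f_def k complex_eq_iff)
  qed
  have f_sa: "f h = complex_of_real (f0 h)" if "h \<in> self_adjoint" for h
  proof -
    have "hr h = h" "hi h = 0"
      using that scl_add_left[of "1/2" "1/2" h] by (simp_all add: hr_def hi_def self_adjoint_def scl_distribs)
    then show ?thesis by (simp add: f_def f00)
  qed
  have xs: "x \<in> self_adjoint" and es: "e \<in> self_adjoint"
    using x by (simp_all add: self_adjoint_def)
  have fpos: "0 \<le> Re (f (adj u * u)) \<and> Im (f (adj u * u)) = 0" if "u \<in> S" for u
  proof -
    have "adj u * u \<in> self_adjoint" using that by (auto simp: self_adjoint_def)
    moreover have "adj u * u - 0 \<bullet>\<^sub>R e \<in> K" using Kp(2)[OF posS_adj_mult_self[OF that]] by simp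
    ultimately show ?thesis using L1[of "adj u * u" 0] f_sa by simp
  qed
  have "positive_functional f"
    unfolding positive_functional_def using f_add f_scl fpos by blast
  moreover have "f e = 1"
    using L1[OF es, of 1] L2[OF es, of 1] K0 f_sa[OF es] by simp
  moreover have "\<nu> x \<le> Re (f x)"
    using L1[OF xs vK] f_sa[OF xs] by simp
  ultimately show thesis using that unfolding x_def by blast
qed

end

section \<open>Operators on complex Hilbert spaces\<close>

lemma scaleC_minus_one: "(- 1) *\<^sub>C x = - (x :: 'x::complex_hilbert_space)"
  using scaleC_of_real[of "-1" x] by simp

lemma scaleC_one [simp]: "1 *\<^sub>C x = (x :: 'x::complex_hilbert_space)"
  using scaleC_of_real[of 1 x] by simp

lemma scaleC_zero_left [simp]: "0 *\<^sub>C x = (0 :: 'x::complex_hilbert_space)"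
  using scaleC_of_real[of 0 x] by simp

lemma scaleC_zero_right [simp]: "c *\<^sub>C 0 = (0 :: 'x::complex_hilbert_space)"
  using scaleC_add_right[of c 0 "0::'x"] by simp

lemma scaleC_minus_right [simp]: "c *\<^sub>C (- x) = - (c *\<^sub>C (x :: 'x::complex_hilbert_space))"
  using scaleC_add_right[of c x "- x"] by (simp add: eq_neg_iff_add_eq_0 add.commute)

lemma cinner_add_right: "cinner x (y + z) = cinner x y + cinner x (z :: 'x::complex_hilbert_space)"
  by (metis cinner_add_left cinner_commute complex_cnj_add)

lemma cinner_scaleC_right: "cinner x (c *\<^sub>C y) = cnj c * cinner x (y :: 'x::complex_hilbert_space)"
  by (metis cinner_scaleC_left cinner_commute complex_cnj_mult)

lemma cinner_zero_left [simp]: "cinner 0 (y :: 'x::complex_hilbert_space) = 0"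
  using cinner_add_left[of 0 0 y] by simp

lemma cinner_zero_right [simp]: "cinner (y :: 'x::complex_hilbert_space) 0 = 0"
  using cinner_add_right[of y 0 0] by simp

lemma cinner_minus_left [simp]: "cinner (- x) y = - cinner x (y :: 'x::complex_hilbert_space)"
  using cinner_scaleC_left[of "-1" x y] by (simp add: scaleC_minus_one)

lemma cinner_minus_right [simp]: "cinner x (- y) = - cinner x (y :: 'x::complex_hilbert_space)"
  using cinner_scaleC_right[of x "-1" y] by (simp add: scaleC_minus_one)

lemma cinner_diff_left: "cinner (x - y) z = cinner x z - cinner y (z :: 'x::complex_hilbert_space)"
  using cinner_add_left[of x "- y" z] by simp

lemma cinner_diff_right: "cinner z (x - y) = cinner z x - cinner z (y :: 'x::complex_hilbert_space)"
  using cinner_add_right[of z x "- y"] by simp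

lemma cinner_sum_left: "cinner (sum f A) y = (\<Sum>i\<in>A. cinner (f i) (y :: 'x::complex_hilbert_space))"
  by (induction A rule: infinite_finite_induct) (simp_all add: cinner_add_left)

lemma cinner_sum_right: "cinner y (sum f A) = (\<Sum>i\<in>A. cinner (y :: 'x::complex_hilbert_space) (f i))"
  by (induction A rule: infinite_finite_induct) (simp_all add: cinner_add_right)

lemma scaleC_sum_right: "c *\<^sub>C sum f A = (\<Sum>i\<in>A. c *\<^sub>C (f i :: 'x::complex_hilbert_space))"
  by (induction A rule: infinite_finite_induct) (simp_all add: scaleC_add_right)

lemma cinner_self: "cinner x x = complex_of_real ((norm (x :: 'x::complex_hilbert_space))\<^sup>2)"
proof -
  have "Im (cinner x x) = 0"
    using cinner_commute[of x x] by (metis cnj.simps(2) add.inverse_inverse equal_neg_zero)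
  then show ?thesis
    using inner_eq_Re_cinner[of x x] by (simp add: complex_eq_iff power2_norm_eq_inner)
qed

lemma norm_scaleC: "norm (c *\<^sub>C x) = cmod c * norm (x :: 'x::complex_hilbert_space)"
proof -
  have "complex_of_real ((norm (c *\<^sub>C x))\<^sup>2) = complex_of_real ((cmod c * norm x)\<^sup>2)"
    unfolding cinner_self[symmetric, of "c *\<^sub>C x"] cinner_scaleC_left cinner_scaleC_right
    by (simp only: cinner_self power_mult_distrib of_real_mult complex_norm_square mult_ac)
  then show ?thesis by (simp add: power2_eq_iff_nonneg flip: of_real_power)
qed

lemma cmod_cinner_le: "cmod (cinner x y) \<le> norm x * norm (y :: 'x::complex_hilbert_space)"
proof -
  obtain c where c: "cmod c = 1" "c * cinner x y = complex_of_real (cmod (cinner x y))"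
  proof (cases "cinner x y = 0")
    case False
    let ?c = "cnj (cinner x y) / complex_of_real (cmod (cinner x y))"
    have "?c * cinner x y = complex_of_real (cmod (cinner x y))"
      using False complex_norm_square[of "cinner x y"]
      by (simp add: field_simps power2_eq_square)
    moreover have "cmod ?c = 1" using False by (simp add: norm_divide)
    ultimately show thesis by (rule that[rotated])
  qed (use that[of 1] in simp)
  have "cmod (cinner x y) = Re (cinner (c *\<^sub>C x) y)"
    using c by (simp add: cinner_scaleC_left)
  also have "\<dots> = (c *\<^sub>C x) \<bullet> y" by (simp add: inner_eq_Re_cinner)
  also have "\<dots> \<le> norm x * norm y"
    using norm_cauchy_schwarz[of "c *\<^sub>C x" y] c by (simp add: norm_scaleC)
  finally show ?thesis .
qed

lemma scaleR_eq_scaleC: "r *\<^sub>R x = complex_of_real r *\<^sub>C (x :: 'x::complex_hilbert_space)"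
  by (simp add: scaleC_of_real)

lemma bounded_linear_cinner_left: "bounded_linear (\<lambda>x. cinner x (y :: 'x::complex_hilbert_space))"
  by (rule bounded_linear_intro[where K = "norm y"])
     (simp_all add: cinner_add_left scaleR_eq_scaleC cinner_scaleC_left scaleR_conv_of_real cmod_cinner_le)

lemma bounded_linear_cinner_right: "bounded_linear (\<lambda>y. cinner (x :: 'x::complex_hilbert_space) y)"
  by (rule bounded_linear_intro[where K = "norm x"])
     (use cmod_cinner_le[of x] in \<open>simp_all add: cinner_add_right scaleR_eq_scaleC cinner_scaleC_right
        scaleR_conv_of_real mult.commute\<close>)

lemmas tendsto_cinner_left = bounded_linear.tendsto[OF bounded_linear_cinner_left]
lemmas tendsto_cinner_right = bounded_linear.tendsto[OF bounded_linear_cinner_right]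

lemma bounded_linear_scaleC: "bounded_linear (\<lambda>x. c *\<^sub>C (x :: 'x::complex_hilbert_space))"
  by (rule bounded_linear_intro[where K = "cmod c"])
     (simp_all add: scaleC_add_right scaleR_eq_scaleC scaleC_scaleC mult.commute norm_scaleC)

lemma cinner_eqI: "(\<And>y. cinner x y = cinner x' (y :: 'x::complex_hilbert_space)) \<Longrightarrow> x = x'"
proof -
  assume "\<And>y. cinner x y = cinner x' y"
  then have "cinner (x - x') (x - x') = 0" by (simp add: cinner_diff_left)
  then show "x = x'" by (simp add: cinner_self)
qed

lemma cinner_eqI2: "(\<And>y. cinner y x = cinner (y :: 'x::complex_hilbert_space) x') \<Longrightarrow> x = x'"
  by (metis cinner_eqI cinner_commute)

definition csubspace :: "'x::complex_hilbert_space set \<Rightarrow> bool" where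
  "csubspace V \<longleftrightarrow> 0 \<in> V \<and> (\<forall>x\<in>V. \<forall>y\<in>V. x + y \<in> V) \<and> (\<forall>c. \<forall>x\<in>V. c *\<^sub>C x \<in> V)"

lemma csubspaceD:
  assumes "csubspace V"
  shows "0 \<in> V" "x \<in> V \<Longrightarrow> y \<in> V \<Longrightarrow> x + y \<in> V" "x \<in> V \<Longrightarrow> c *\<^sub>C x \<in> V"
    "x \<in> V \<Longrightarrow> r *\<^sub>R x \<in> V" "x \<in> V \<Longrightarrow> - x \<in> V" "x \<in> V \<Longrightarrow> y \<in> V \<Longrightarrow> x - y \<in> V"
proof -
  show *: "0 \<in> V" "\<And>x y. x \<in> V \<Longrightarrow> y \<in> V \<Longrightarrow> x + y \<in> V" "\<And>c x. x \<in> V \<Longrightarrow> c *\<^sub>C x \<in> V"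
    using assms by (simp_all add: csubspace_def)
  show "x \<in> V \<Longrightarrow> r *\<^sub>R x \<in> V" by (simp add: scaleR_eq_scaleC *)
  show m: "\<And>x. x \<in> V \<Longrightarrow> - x \<in> V" using *(3)[of _ "-1"] by (simp add: scaleC_minus_one)
  show "x \<in> V \<Longrightarrow> y \<in> V \<Longrightarrow> x - y \<in> V" using *(2)[of x "- y"] m by simp
qed

text \<open>
  A bounded functional on a subspace \<open>V\<close> is represented by the minimizer of
  \<open>\<parallel>y\<parallel>\<^sup>2 - 2 Re (f y)\<close> over the closure of \<open>V\<close>; minimizing sequences are Cauchy by the parallelogram law.
\<close>

lemma riesz_on_subspace:
  fixes V :: "'x::complex_hilbert_space set"
  assumes V: "csubspace V" and f_add: "\<And>x y. x \<in> V \<Longrightarrow> y \<in> V \<Longrightarrow> f (x + y) = f x + f y"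
    and f_scale: "\<And>c x. x \<in> V \<Longrightarrow> f (c *\<^sub>C x) = c * f x"
    and f_bound: "\<And>x. x \<in> V \<Longrightarrow> cmod (f x) \<le> C * norm x"
  shows "\<exists>z\<in>closure V. \<forall>y\<in>V. f y = cinner y z"
proof -
  note V = csubspaceD[OF V]
  define \<phi> where "\<phi> y = (norm y)\<^sup>2 - 2 * Re (f y)" for y
  have \<phi>_ge: "- (C\<^sup>2) \<le> \<phi> y" if "y \<in> V" for y
  proof -
    have "Re (f y) \<le> C * norm y" using f_bound[OF that] complex_Re_le_cmod order_trans by blast
    moreover have "0 \<le> (norm y - C)\<^sup>2" by simp
    ultimately show ?thesis by (simp add: \<phi>_def power2_eq_square algebra_simps)
  qed
  define m where "m = Inf (\<phi> ` V)"
  have bdd: "bdd_below (\<phi> ` V)" using \<phi>_ge by (intro bdd_belowI2[of _ "- (C\<^sup>2)"])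
  have m_le: "m \<le> \<phi> y" if "y \<in> V" for y
    unfolding m_def using that bdd by (intro cInf_lower) auto
  have "\<exists>y\<in>V. \<phi> y < m + inverse (real (Suc n))" for n
    using cInf_lessD[of "\<phi> ` V" "m + inverse (real (Suc n))"] V(1) unfolding m_def by auto
  then obtain Y where Y: "\<And>n. Y n \<in> V" "\<And>n. \<phi> (Y n) < m + inverse (real (Suc n))"
    by metis
  have parallel: "(norm (x - y))\<^sup>2 \<le> 2 * (\<phi> x - m) + 2 * (\<phi> y - m)" if "x \<in> V" "y \<in> V" for x y
  proof -
    let ?h = "(1/2) *\<^sub>R (x + y)"
    have h: "?h \<in> V" using that V by auto
    have "f ?h = f x / 2 + f y / 2"
      using that V by (simp add: scaleR_eq_scaleC f_scale f_add)
    moreover have "(norm (x - y))\<^sup>2 = 2 * (norm x)\<^sup>2 + 2 * (norm y)\<^sup>2 - 4 * (norm ?h)\<^sup>2"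
      by (simp add: power2_norm_eq_inner algebra_simps inner_commute)
    ultimately have "(norm (x - y))\<^sup>2 = 2 * \<phi> x + 2 * \<phi> y - 4 * \<phi> ?h"
      by (simp add: \<phi>_def)
    then show ?thesis using m_le[OF h] by simp
  qed
  have "Cauchy Y"
  proof (rule metric_CauchyI)
    fix e :: real assume e: "0 < e"
    then have "0 < e\<^sup>2 / 4" by simp
    then obtain n0 where n0: "inverse (real (Suc n0)) < e\<^sup>2 / 4" using reals_Archimedean by blast
    have "dist (Y i) (Y j) < e" if "i \<ge> n0" "j \<ge> n0" for i j
    proof -
      have inv: "inverse (real (Suc k)) \<le> inverse (real (Suc n0))" if "k \<ge> n0" for k
        using that by (intro le_imp_inverse_le) auto
      have "\<phi> (Y k) - m < e\<^sup>2 / 4" if "k \<ge> n0" for k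
        using Y(2)[of k] n0 inv[OF that] by linarith
      from this[OF that(1)] this[OF that(2)] have "(norm (Y i - Y j))\<^sup>2 < e\<^sup>2"
        using parallel[OF Y(1) Y(1), of i j] by simp
      then show ?thesis using e by (simp add: dist_norm power_less_imp_less_base)
    qed
    then show "\<exists>M. \<forall>m\<ge>M. \<forall>n\<ge>M. dist (Y m) (Y n) < e" by blast
  qed
  then obtain z where z: "Y \<longlonglongrightarrow> z" by (auto simp: Cauchy_convergent_iff convergent_def)
  have zV: "z \<in> closure V" using Y(1) z closure_sequential by blast
  have Re_eq: "Re (f w) = w \<bullet> z" if w: "w \<in> V" for w
  proof -
    have ineq: "0 \<le> 2 * t * (z \<bullet> w - Re (f w)) + t\<^sup>2 * (norm w)\<^sup>2" for t
    proof (rule LIMSEQ_le_const)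
      have "(\<lambda>n. 2 * t * (Y n \<bullet> w - Re (f w)) + t\<^sup>2 * (norm w)\<^sup>2)
          \<longlonglongrightarrow> 2 * t * (z \<bullet> w - Re (f w)) + t\<^sup>2 * (norm w)\<^sup>2"
        by (intro tendsto_intros z)
      from tendsto_add[OF LIMSEQ_inverse_real_of_nat this]
      show "(\<lambda>n. inverse (real (Suc n)) + (2 * t * (Y n \<bullet> w - Re (f w)) + t\<^sup>2 * (norm w)\<^sup>2))
          \<longlonglongrightarrow> 2 * t * (z \<bullet> w - Re (f w)) + t\<^sup>2 * (norm w)\<^sup>2"
        by (simp only: add_0)
      have "0 \<le> inverse (real (Suc n)) + (2 * t * (Y n \<bullet> w - Re (f w)) + t\<^sup>2 * (norm w)\<^sup>2)" for n
      proof -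
        have "f (Y n + t *\<^sub>R w) = f (Y n) + complex_of_real t * f w"
          using Y(1) w V by (simp add: f_add scaleR_eq_scaleC f_scale)
        moreover have "(norm (Y n + t *\<^sub>R w))\<^sup>2 = (norm (Y n))\<^sup>2 + 2 * t * (Y n \<bullet> w) + t\<^sup>2 * (norm w)\<^sup>2"
          unfolding power2_norm_eq_inner by (simp add: algebra_simps inner_commute power2_eq_square)
        ultimately have "\<phi> (Y n + t *\<^sub>R w) = \<phi> (Y n) + 2 * t * (Y n \<bullet> w - Re (f w)) + t\<^sup>2 * (norm w)\<^sup>2"
          by (simp add: \<phi>_def algebra_simps)
        moreover have "m \<le> \<phi> (Y n + t *\<^sub>R w)" using Y(1) w V by (intro m_le) auto
        ultimately show ?thesis using Y(2)[of n] by simp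
      qed
      then show "\<exists>N. \<forall>n\<ge>N. 0 \<le> inverse (real (Suc n)) + (2 * t * (Y n \<bullet> w - Re (f w)) + t\<^sup>2 * (norm w)\<^sup>2)"
        by blast
    qed
    define a b where "a = z \<bullet> w - Re (f w)" and "b = (norm w)\<^sup>2"
    have b: "0 \<le> b" by (simp add: b_def)
    have "a = 0"
    proof (rule ccontr)
      assume a: "a \<noteq> 0"
      have "0 \<le> 2 * (- a / (b + 1)) * a + (- a / (b + 1))\<^sup>2 * b"
        using ineq[of "- a / (b + 1)"] by (simp add: a_def b_def)
      also have "\<dots> = (a\<^sup>2 / (b + 1)) * (b / (b + 1) - 2)"
        using b by (simp add: field_simps power2_eq_square add_nonneg_eq_0_iff)
      also have "\<dots> < 0"
      proof (rule mult_pos_neg)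
        show "0 < a\<^sup>2 / (b + 1)" using a b by simp
        have "b / (b + 1) \<le> 1" using b by simp
        then show "b / (b + 1) - 2 < 0" by simp
      qed
      finally show False by simp
    qed
    then show ?thesis by (simp add: a_def inner_commute)
  qed
  have "f w = cinner w z" if w: "w \<in> V" for w
  proof (rule complex_eqI)
    show "Re (f w) = Re (cinner w z)" using Re_eq[OF w] by (simp add: inner_eq_Re_cinner)
    have "Re (f (\<i> *\<^sub>C w)) = Re (cinner (\<i> *\<^sub>C w) z)"
      using Re_eq V(3)[OF w] by (simp add: inner_eq_Re_cinner)
    then show "Im (f w) = Im (cinner w z)" using w by (simp add: f_scale cinner_scaleC_left)
  qed
  then show ?thesis using zV by blast
qed

abbreviation bop :: "('x::complex_hilbert_space \<Rightarrow> 'x) \<Rightarrow> bool" where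
  "bop T \<equiv> T \<in> carrier bounded_ops"

lemma bop_iff: "bop T \<longleftrightarrow> bounded_linear T \<and> (\<forall>c x. T (c *\<^sub>C x) = c *\<^sub>C T x)"
  by (simp add: bounded_ops_def)

lemma bop_bounded_linear: "bop T \<Longrightarrow> bounded_linear T"
  and bop_scaleC: "bop T \<Longrightarrow> T (c *\<^sub>C x) = c *\<^sub>C T x"
  by (simp_all add: bop_iff)

lemma bop_add: "bop T \<Longrightarrow> T (x + y) = T x + T y"
  and bop_diff: "bop T \<Longrightarrow> T (x - y) = T x - T y"
  and bop_0: "bop T \<Longrightarrow> T 0 = 0"
  and bop_sum: "bop T \<Longrightarrow> T (sum g A) = (\<Sum>i\<in>A. T (g i))"
  using bop_bounded_linear[of T] bounded_linear.linear[of T]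
  by (simp_all add: linear_add linear_diff linear_neg linear_0 linear_sum)

lemma bop_norm_le: "bop T \<Longrightarrow> norm (T x) \<le> onorm T * norm x"
  by (rule onorm[OF bop_bounded_linear])

lemma bopI:
  assumes "\<And>x y. T (x + y) = T x + T y" "\<And>c x. T (c *\<^sub>C x) = c *\<^sub>C T x" "\<And>x. norm (T x) \<le> K * norm x"
  shows "bop (T :: 'x::complex_hilbert_space \<Rightarrow> 'x)"
  unfolding bop_iff using assms
  by (auto intro!: bounded_linear_intro[where K = K] simp: scaleR_eq_scaleC mult.commute)

lemma bop_zero: "bop (\<lambda>_. 0)"
  by (rule bopI[where K = 0]) simp_all

lemma bop_id: "bop id"
  by (rule bopI[where K = 1]) simp_all

lemma bop_plus: "\<lbrakk>bop S; bop T\<rbrakk> \<Longrightarrow> bop (\<lambda>x. S x + T x)"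
  unfolding bop_iff by (auto intro: bounded_linear_add simp: scaleC_add_right)

lemma bop_scale: "bop T \<Longrightarrow> bop (\<lambda>x. c *\<^sub>C T x)"
  unfolding bop_iff
  by (auto intro: bounded_linear_compose[OF bounded_linear_scaleC] simp: scaleC_scaleC mult.commute)

lemma bop_comp: "\<lbrakk>bop S; bop T\<rbrakk> \<Longrightarrow> bop (S \<circ> T)"
  unfolding bop_iff by (auto intro: bounded_linear_compose simp: o_def)

lemma onorm_nonneg [simp]: "bop T \<Longrightarrow> 0 \<le> onorm T"
  by (rule onorm_pos_le[OF bop_bounded_linear])

lemma adjoint_exists:
  assumes T: "bop T"
  shows "\<exists>!T'. \<forall>x y. cinner (T x) y = cinner x (T' y)"
proof -
  have "\<exists>z. \<forall>x. cinner (T x) y = cinner x z" for y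
  proof -
    have "cmod (cinner (T x) y) \<le> onorm T * norm y * norm x" for x
    proof -
      have "cmod (cinner (T x) y) \<le> norm (T x) * norm y" by (rule cmod_cinner_le)
      also have "\<dots> \<le> onorm T * norm x * norm y"
        by (intro mult_right_mono bop_norm_le T) simp
      finally show ?thesis by (simp add: mult_ac)
    qed
    then show ?thesis
      using riesz_on_subspace[of UNIV "\<lambda>x. cinner (T x) y" "onorm T * norm y"]
      by (simp add: csubspace_def bop_add[OF T] bop_scaleC[OF T] cinner_add_left cinner_scaleC_left)
  qed
  then obtain T' where "\<forall>x y. cinner (T x) y = cinner x (T' y)" by metis
  then show ?thesis by (metis cinner_eqI2 ext)
qed

lemma cinner_cadjoint: "bop T \<Longrightarrow> cinner (T x) y = cinner x (cadjoint T y)"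
  using theI'[OF adjoint_exists] unfolding cadjoint_def by blast

lemma cinner_cadjoint2: "bop T \<Longrightarrow> cinner (cadjoint T x) y = cinner x (T y)"
  by (metis cinner_cadjoint cinner_commute)

lemma cadjoint_eqI: "\<lbrakk>bop T; \<And>x y. cinner (T x) y = cinner x (T' y)\<rbrakk> \<Longrightarrow> cadjoint T = T'"
  using adjoint_exists[of T] unfolding cadjoint_def by (intro the1_equality) auto

lemma norm_cadjoint_le:
  assumes T: "bop T"
  shows "norm (cadjoint T y) \<le> onorm T * norm y"
proof (cases "cadjoint T y = 0")
  case False
  let ?z = "cadjoint T y"
  have "(norm ?z)\<^sup>2 = cmod (cinner ?z ?z)" by (simp add: cinner_self norm_power)
  also have "\<dots> = cmod (cinner (T ?z) y)" by (simp add: cinner_cadjoint[OF T])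
  also have "\<dots> \<le> norm (T ?z) * norm y" by (rule cmod_cinner_le)
  also have "\<dots> \<le> onorm T * norm ?z * norm y"
    by (intro mult_right_mono bop_norm_le T) simp
  finally have "norm ?z * norm ?z \<le> (onorm T * norm y) * norm ?z"
    by (simp add: power2_eq_square mult_ac)
  then show ?thesis using False by simp
qed (use T in simp)

lemma bop_cadjoint:
  assumes T: "bop T"
  shows "bop (cadjoint T)"
proof (rule bopI)
  show "norm (cadjoint T x) \<le> onorm T * norm x" for x by (rule norm_cadjoint_le[OF T])
  show "cadjoint T (x + y) = cadjoint T x + cadjoint T y" for x y
    by (rule cinner_eqI2) (simp add: cinner_add_right flip: cinner_cadjoint[OF T])
  show "cadjoint T (c *\<^sub>C x) = c *\<^sub>C cadjoint T x" for c x
    by (rule cinner_eqI2) (simp add: cinner_scaleC_right flip: cinner_cadjoint[OF T])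
qed

lemma cadjoint_cadjoint: "bop T \<Longrightarrow> cadjoint (cadjoint T) = T"
  by (rule cadjoint_eqI) (simp_all add: bop_cadjoint cinner_cadjoint2)

lemma cadjoint_plus: "\<lbrakk>bop S; bop T\<rbrakk> \<Longrightarrow> cadjoint (\<lambda>x. S x + T x) = (\<lambda>x. cadjoint S x + cadjoint T x)"
  by (rule cadjoint_eqI) (simp_all add: bop_plus cinner_add_left cinner_add_right cinner_cadjoint)

lemma cadjoint_scale: "bop T \<Longrightarrow> cadjoint (\<lambda>x. c *\<^sub>C T x) = (\<lambda>x. cnj c *\<^sub>C cadjoint T x)"
  by (rule cadjoint_eqI) (simp_all add: bop_scale cinner_scaleC_left cinner_scaleC_right cinner_cadjoint)

lemma cadjoint_comp: "\<lbrakk>bop S; bop T\<rbrakk> \<Longrightarrow> cadjoint (S \<circ> T) = cadjoint T \<circ> cadjoint S"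
  by (rule cadjoint_eqI) (simp_all add: bop_comp cinner_cadjoint)

lemma cadjoint_zero: "cadjoint (\<lambda>_. 0) = (\<lambda>_. 0)"
  by (rule cadjoint_eqI) (simp_all add: bop_zero)

lemma onorm_cadjoint_mult:
  assumes T: "bop T"
  shows "onorm (cadjoint T \<circ> T) = (onorm T)\<^sup>2"
proof (rule antisym)
  have T': "bop (cadjoint T)" by (rule bop_cadjoint[OF T])
  have "onorm (cadjoint T) \<le> onorm T"
    by (rule onorm_bound) (use T norm_cadjoint_le[OF T] in auto)
  then show "onorm (cadjoint T \<circ> T) \<le> (onorm T)\<^sup>2"
    using onorm_compose[OF bop_bounded_linear[OF T'] bop_bounded_linear[OF T]] T
      mult_right_mono[of "onorm (cadjoint T)" "onorm T" "onorm T"]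
    by (simp add: power2_eq_square)
  have "onorm T \<le> sqrt (onorm (cadjoint T \<circ> T))"
  proof (rule onorm_bound)
    fix x
    have "(norm (T x))\<^sup>2 = cmod (cinner (T x) (T x))" by (simp add: cinner_self norm_power)
    also have "\<dots> = cmod (cinner x ((cadjoint T \<circ> T) x))" by (simp add: cinner_cadjoint[OF T])
    also have "\<dots> \<le> norm x * norm ((cadjoint T \<circ> T) x)" by (rule cmod_cinner_le)
    also have "\<dots> \<le> norm x * (onorm (cadjoint T \<circ> T) * norm x)"
      by (intro mult_left_mono bop_norm_le bop_comp T T') simp
    finally have "(norm (T x))\<^sup>2 \<le> onorm (cadjoint T \<circ> T) * (norm x)\<^sup>2"
      by (simp add: power2_eq_square mult_ac)
    then have "norm (T x) \<le> sqrt (onorm (cadjoint T \<circ> T) * (norm x)\<^sup>2)" by (rule real_le_rsqrt)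
    then show "norm (T x) \<le> sqrt (onorm (cadjoint T \<circ> T)) * norm x"
      by (simp add: real_sqrt_mult)
  qed (use bop_comp[OF T' T] in simp)
  then have "(onorm T)\<^sup>2 \<le> (sqrt (onorm (cadjoint T \<circ> T)))\<^sup>2"
    using T by (intro power_mono) auto
  then show "(onorm T)\<^sup>2 \<le> onorm (cadjoint T \<circ> T)"
    using bop_comp[OF T' T] by simp
qed

lemma norm_le_if_in_closure:
  assumes z: "z \<in> closure V" and bound: "\<And>v. v \<in> V \<Longrightarrow> cmod (cinner v z) \<le> C * norm v" and C: "0 \<le> C"
  shows "norm (z :: 'x::complex_hilbert_space) \<le> C"
proof -
  obtain X where X: "\<And>n. X n \<in> V" "X \<longlonglongrightarrow> z" using z closure_sequential by blast
  have "cmod (cinner z z) \<le> C * norm z"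
  proof (rule LIMSEQ_le)
    show "(\<lambda>n. cmod (cinner (X n) z)) \<longlonglongrightarrow> cmod (cinner z z)"
      by (intro tendsto_norm tendsto_cinner_left X)
    show "(\<lambda>n. C * norm (X n)) \<longlonglongrightarrow> C * norm z"
      by (intro tendsto_intros X)
  qed (use bound X(1) in auto)
  then have "norm z * norm z \<le> C * norm z"
    by (simp add: cinner_self norm_mult power2_eq_square)
  then show ?thesis using C by (cases "z = 0") auto
qed

text \<open>
  A bounded operator defined on a subspace extends by zero on the orthogonal complement. The adjoint
  of the extension is obtained from the representation of functionals.
\<close>

lemma operator_extension:
  fixes V :: "'x::complex_hilbert_space set"
  assumes V: "csubspace V" and t_add: "\<And>x y. x \<in> V \<Longrightarrow> y \<in> V \<Longrightarrow> t (x + y) = t x + t y"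
    and t_scale: "\<And>c x. x \<in> V \<Longrightarrow> t (c *\<^sub>C x) = c *\<^sub>C t x"
    and t_bound: "\<And>x. x \<in> V \<Longrightarrow> norm (t x) \<le> C * norm x" and C: "0 \<le> C"
  shows "\<exists>T. bop T \<and> (\<forall>x\<in>V. T x = t x) \<and> onorm T \<le> C \<and> (\<forall>x. (\<forall>v\<in>V. cinner v x = 0) \<longrightarrow> T x = 0)"
proof -
  note V' = csubspaceD[OF V]
  have "\<exists>z\<in>closure V. \<forall>v\<in>V. cinner (t v) y = cinner v z" for y
  proof (rule riesz_on_subspace[OF V])
    fix x assume "x \<in> V"
    then have "norm (t x) * norm y \<le> C * norm x * norm y"
      by (intro mult_right_mono t_bound) auto
    then show "cmod (cinner (t x) y) \<le> (C * norm y) * norm x"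
      using cmod_cinner_le[of "t x" y] by (simp add: mult_ac)
  qed (simp_all add: t_add t_scale cinner_add_left cinner_scaleC_left)
  then obtain S where S: "\<And>y. S y \<in> closure V" "\<And>y v. v \<in> V \<Longrightarrow> cinner (t v) y = cinner v (S y)"
    by metis
  have dense: "cinner a w = cinner b w"
    if eq: "\<And>v. v \<in> V \<Longrightarrow> cinner a v = cinner b v" and w: "w \<in> closure V" for a b w
  proof -
    obtain X where X: "\<And>n. X n \<in> V" "X \<longlonglongrightarrow> w" using w closure_sequential by blast
    have "(\<lambda>n. cinner a (X n)) \<longlonglongrightarrow> cinner a w" "(\<lambda>n. cinner b (X n)) \<longlonglongrightarrow> cinner b w"
      using X(2) by (auto intro: tendsto_cinner_right)
    moreover have "(\<lambda>n. cinner a (X n)) = (\<lambda>n. cinner b (X n))" using eq X(1) by simp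
    ultimately show ?thesis using LIMSEQ_unique by metis
  qed
  have clV: "csubspace (closure V)"
    unfolding csubspace_def
  proof (intro conjI ballI allI)
    show "0 \<in> closure V" using V'(1) closure_subset by blast
    fix x y assume "x \<in> closure V" "y \<in> closure V"
    then obtain X Y where "\<And>n. X n \<in> V" "X \<longlonglongrightarrow> x" "\<And>n. Y n \<in> V" "Y \<longlonglongrightarrow> y"
      unfolding closure_sequential by blast
    then show "x + y \<in> closure V"
      unfolding closure_sequential using V'(2) by (intro exI[of _ "\<lambda>n. X n + Y n"]) (auto intro: tendsto_add)
  next
    fix c x assume "x \<in> closure V"
    then obtain X where "\<And>n. X n \<in> V" "X \<longlonglongrightarrow> x"
      unfolding closure_sequential by blast
    then show "c *\<^sub>C x \<in> closure V"
      unfolding closure_sequential using V'(3) bounded_linear.tendsto[OF bounded_linear_scaleC]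
      by (intro exI[of _ "\<lambda>n. c *\<^sub>C X n"]) auto
  qed
  note clV = csubspaceD[OF clV]
  have uniq: "a = b"
    if ab: "a \<in> closure V" "b \<in> closure V" and eq: "\<And>v. v \<in> V \<Longrightarrow> cinner v a = cinner v b" for a b
  proof -
    have "cinner (a - b) (a - b) = cinner 0 (a - b)"
    proof (rule dense)
      show "cinner (a - b) v = cinner 0 v" if "v \<in> V" for v
        using eq[OF that] by (simp add: cinner_diff_left) (metis cinner_commute)
      show "a - b \<in> closure V" using ab clV by auto
    qed
    then show ?thesis by (simp add: cinner_self)
  qed
  have S_bound: "norm (S y) \<le> C * norm y" for y
  proof -
    have "cmod (cinner v (S y)) \<le> C * norm y * norm v" if "v \<in> V" for v
    proof -
      have "cmod (cinner v (S y)) \<le> norm (t v) * norm y"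
        using S(2)[OF that, of y] cmod_cinner_le[of "t v" y] by simp
      also have "\<dots> \<le> C * norm v * norm y" by (intro mult_right_mono t_bound that) simp
      finally show ?thesis by (simp add: mult_ac)
    qed
    then show ?thesis
      by (rule norm_le_if_in_closure[OF S(1)]) (auto intro: mult_nonneg_nonneg C)
  qed
  have bopS: "bop S"
  proof (rule bopI)
    show "norm (S x) \<le> C * norm x" for x by (rule S_bound)
    show "S (x + y) = S x + S y" for x y
      by (rule uniq) (use S clV in \<open>auto simp: cinner_add_right simp flip: S(2)\<close>)
    show "S (c *\<^sub>C x) = c *\<^sub>C S x" for c x
      by (rule uniq) (use S clV in \<open>auto simp: cinner_scaleC_right simp flip: S(2)\<close>)
  qed
  define T where "T = cadjoint S"
  have T: "bop T" unfolding T_def by (rule bop_cadjoint[OF bopS])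
  have "T v = t v" if "v \<in> V" for v
    by (rule cinner_eqI) (simp add: T_def cinner_cadjoint2[OF bopS] S(2)[OF that])
  moreover have "T x = 0" if "\<forall>v\<in>V. cinner v x = 0" for x
  proof (rule cinner_eqI)
    fix y
    have "cinner x (S y) = cinner 0 (S y)"
    proof (rule dense[OF _ S(1)])
      show "cinner x v = cinner 0 v" if "v \<in> V" for v
        using that \<open>\<forall>v\<in>V. cinner v x = 0\<close> cinner_commute[of x v] by simp
    qed
    then show "cinner (T x) y = cinner 0 y" by (simp add: T_def cinner_cadjoint2[OF bopS])
  qed
  moreover have "onorm T \<le> C"
  proof (rule onorm_bound[OF C])
    have "onorm S \<le> C" by (rule onorm_bound[OF C S_bound])
    then show "norm (T x) \<le> C * norm x" for x
      unfolding T_def by (intro order_trans[OF norm_cadjoint_le[OF bopS]] mult_right_mono) auto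
  qed
  ultimately show ?thesis using T by blast
qed

text \<open>Every vector is the sum of one in the closure of \<open>V\<close> and one orthogonal to \<open>V\<close>.\<close>

lemma bop_eq_if_eq_on_subspace:
  assumes V: "csubspace V" and S: "bop S" and T: "bop T" and eq: "\<And>v. v \<in> V \<Longrightarrow> S v = T v"
    and perp: "\<And>x. (\<forall>v\<in>V. cinner v x = 0) \<Longrightarrow> S x = T x"
  shows "S = T"
proof
  fix x
  obtain z where z: "z \<in> closure V" "\<And>v. v \<in> V \<Longrightarrow> cinner v x = cinner v z"
    using riesz_on_subspace[OF V, of "\<lambda>v. cinner v x" "norm x"] cmod_cinner_le[of _ x]
    by (auto simp: cinner_add_left cinner_scaleC_left mult.commute)
  have "S (x - z) = T (x - z)" by (rule perp) (simp add: cinner_diff_right z)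
  moreover have "S z = T z"
  proof -
    obtain X where X: "\<And>n. X n \<in> V" "X \<longlonglongrightarrow> z" using z(1) closure_sequential by blast
    have "(\<lambda>n. S (X n)) \<longlonglongrightarrow> S z" "(\<lambda>n. T (X n)) \<longlonglongrightarrow> T z"
      using X(2) S T by (auto intro: bounded_linear.tendsto[OF bop_bounded_linear])
    moreover have "(\<lambda>n. S (X n)) = (\<lambda>n. T (X n))" using eq X(1) by auto
    ultimately show ?thesis using LIMSEQ_unique by metis
  qed
  ultimately show "S x = T x" using bop_diff[OF S, of x z] bop_diff[OF T, of x z] by simp
qed


section \<open>Vectors with a prescribed Gram matrix\<close>

definition ket :: "'i \<Rightarrow> 'i ell2" where
  "ket i = Abs_ell2 (\<lambda>j. if j = i then 1 else 0)"

lemma Rep_ket: "Rep_ell2 (ket i) j = (if j = i then 1 else 0)"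
proof -
  have "(\<lambda>j. (cmod (if j = i then 1 else 0))\<^sup>2) summable_on UNIV \<longleftrightarrow> (\<lambda>_. 1::real) summable_on {i}"
    by (rule summable_on_cong_neutral) auto
  then show ?thesis by (simp add: ket_def Abs_ell2_inverse)
qed

lemma cinner_ket_right: "cinner x (ket i) = Rep_ell2 x i"
proof -
  have "cinner x (ket i) = (\<Sum>\<^sub>\<infinity>j. Rep_ell2 x j * cnj (Rep_ell2 (ket i) j))"
    by (simp add: cinner_ell2_def ell2_cinner_def)
  also have "\<dots> = (\<Sum>\<^sub>\<infinity>j\<in>{i}. Rep_ell2 x j)"
    by (rule infsum_cong_neutral) (auto simp: Rep_ket)
  finally show ?thesis by simp
qed

lemma cinner_ket_left: "cinner (ket i) x = cnj (Rep_ell2 x i)"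
  by (metis cinner_commute cinner_ket_right)

lemma Rep_ell2_closure_zero:
  assumes "z \<in> closure V" "\<And>v. v \<in> V \<Longrightarrow> Rep_ell2 v j = 0"
  shows "Rep_ell2 z j = 0"
proof -
  obtain X where X: "\<And>n. X n \<in> V" "X \<longlonglongrightarrow> z" using assms(1) closure_sequential by blast
  have "(\<lambda>n. cinner (X n) (ket j)) \<longlonglongrightarrow> cinner z (ket j)" by (intro tendsto_cinner_left X)
  moreover have "(\<lambda>n. cinner (X n) (ket j)) = (\<lambda>_. 0)"
    using assms(2) X(1) by (simp add: cinner_ket_right)
  ultimately show ?thesis using LIMSEQ_const_iff by (metis cinner_ket_right)
qed

text \<open>
  A positive semidefinite kernel on an index type is the Gram matrix of vectors indexed by it. The
  vectors are found one after the other, as in the Cholesky decomposition: the vector with index \<open>w\<close> is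
  the sum of one that has the right inner products with the vectors chosen before, and a multiple
  of the basis vector \<open>ket w\<close>, which is orthogonal to all of them. Zorn's lemma replaces a well-ordering.
\<close>

theorem gram_vectors:
  fixes k :: "'i \<Rightarrow> 'i \<Rightarrow> complex"
  assumes herm: "\<And>i j. k i j = cnj (k j i)"
    and psd: "\<And>F c. finite F \<Longrightarrow> 0 \<le> Re (\<Sum>i\<in>F. \<Sum>j\<in>F. c i * cnj (c j) * k i j)"
  shows "\<exists>T :: 'i \<Rightarrow> 'i ell2. \<forall>i j. cinner (T i) (T j) = k i j"
proof -
  define A :: "('i \<times> 'i ell2) set set" where
    "A = {M. (\<forall>a\<in>M. \<forall>b\<in>M. cinner (snd a) (snd b) = k (fst a) (fst b)) \<and>
       (\<forall>a\<in>M. \<forall>j. Rep_ell2 (snd a) j \<noteq> 0 \<longrightarrow> j \<in> fst ` M)}"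
  have "\<exists>M\<in>A. \<forall>X\<in>A. M \<subseteq> X \<longrightarrow> X = M"
  proof (rule subset_Zorn_nonempty)
    show "A \<noteq> {}" by (auto simp: A_def intro!: exI[of _ "{}"])
    fix C assume C: "C \<noteq> {}" "subset.chain A C"
    have CA: "M \<in> A" if "M \<in> C" for M using C(2) that by (auto simp: subset_chain_def)
    show "\<Union>C \<in> A"
      unfolding A_def
    proof (intro CollectI conjI ballI allI impI)
      fix a b assume "a \<in> \<Union>C" "b \<in> \<Union>C"
      then obtain M1 M2 where "M1 \<in> C" "a \<in> M1" "M2 \<in> C" "b \<in> M2" by blast
      moreover from this have "M1 \<subseteq> M2 \<or> M2 \<subseteq> M1" using C(2) unfolding subset_chain_def by blast
      ultimately obtain M where "M \<in> C" "a \<in> M" "b \<in> M" by blast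
      then show "cinner (snd a) (snd b) = k (fst a) (fst b)" using CA[of M] by (simp add: A_def)
    next
      fix a j assume "a \<in> \<Union>C" and j: "Rep_ell2 (snd a) j \<noteq> 0"
      then obtain M where "M \<in> C" "a \<in> M" by blast
      then have "j \<in> fst ` M" using CA[of M] j by (simp add: A_def)
      then show "j \<in> fst ` \<Union>C" using \<open>M \<in> C\<close> by blast
    qed
  qed
  then obtain M where MA: "M \<in> A" and max: "\<forall>X\<in>A. M \<subseteq> X \<longrightarrow> X = M" by (rule bexE)
  define D where "D = fst ` M"
  have "\<forall>s\<in>D. \<exists>v. (s, v) \<in> M" by (auto simp: D_def)
  then obtain T where T: "\<And>s. s \<in> D \<Longrightarrow> (s, T s) \<in> M" by metis
  have TG: "cinner (T s) (T t) = k s t" if "s \<in> D" "t \<in> D" for s t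
    using MA T[OF that(1)] T[OF that(2)] by (fastforce simp: A_def)
  have Tsupp: "Rep_ell2 (T s) j = 0" if "s \<in> D" "j \<notin> D" for s j
    using MA T[OF that(1)] that(2) by (fastforce simp: A_def D_def)
  have "D = UNIV"
  proof (rule ccontr)
    assume "D \<noteq> UNIV"
    then obtain w where w: "w \<notin> D" by blast
    \<comment> \<open>The pairs of a combination \<open>v\<close> of the vectors chosen before and its inner product with the new vector.\<close>
    define R where "R = {(\<Sum>s\<in>F. c s *\<^sub>C T s, \<Sum>s\<in>F. c s * k s w) |F c. finite F \<and> F \<subseteq> D}"
    have R_E: thesis
      if "(v, a) \<in> R"
        "\<And>F c. \<lbrakk>finite F; F \<subseteq> D; v = (\<Sum>s\<in>F. c s *\<^sub>C T s); a = (\<Sum>s\<in>F. c s * k s w)\<rbrakk> \<Longrightarrow> thesis"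
      for v a thesis
      using that(1) unfolding R_def mem_Collect_eq prod.inject by (elim exE conjE) (rule that(2))
    have R_add: "(v + v', a + a') \<in> R" if va: "(v, a) \<in> R" and va': "(v', a') \<in> R" for v a v' a'
    proof -
      obtain F c where F: "finite F" "F \<subseteq> D" and eq: "v = (\<Sum>s\<in>F. c s *\<^sub>C T s)" "a = (\<Sum>s\<in>F. c s * k s w)"
        by (rule R_E[OF va])
      obtain F' c' where F': "finite F'" "F' \<subseteq> D" and eq': "v' = (\<Sum>s\<in>F'. c' s *\<^sub>C T s)" "a' = (\<Sum>s\<in>F'. c' s * k s w)"
        by (rule R_E[OF va'])
      let ?c = "\<lambda>s. if s \<in> F then c s else 0" and ?c' = "\<lambda>s. if s \<in> F' then c' s else 0"
      have "v = (\<Sum>s\<in>F \<union> F'. ?c s *\<^sub>C T s)" "a = (\<Sum>s\<in>F \<union> F'. ?c s * k s w)"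
        unfolding eq by (rule sum.mono_neutral_cong_left; use F F' in simp)+
      moreover have "v' = (\<Sum>s\<in>F \<union> F'. ?c' s *\<^sub>C T s)" "a' = (\<Sum>s\<in>F \<union> F'. ?c' s * k s w)"
        unfolding eq' by (rule sum.mono_neutral_cong_left; use F F' in simp)+
      ultimately have "v + v' = (\<Sum>s\<in>F \<union> F'. (?c s + ?c' s) *\<^sub>C T s)" "a + a' = (\<Sum>s\<in>F \<union> F'. (?c s + ?c' s) * k s w)"
        by (simp_all only: sum.distrib[symmetric] scaleC_add_left distrib_right)
      then show ?thesis
        unfolding R_def using F F' by (intro CollectI exI[of _ "F \<union> F'"] exI[of _ "\<lambda>s. ?c s + ?c' s"]) simp
    qed
    have R_scale: "(b *\<^sub>C v, b * a) \<in> R" if va: "(v, a) \<in> R" for v a b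
    proof -
      obtain F c where "finite F" "F \<subseteq> D" "v = (\<Sum>s\<in>F. c s *\<^sub>C T s)" "a = (\<Sum>s\<in>F. c s * k s w)"
        by (rule R_E[OF va])
      then show ?thesis
        unfolding R_def
        by (intro CollectI exI[of _ F] exI[of _ "\<lambda>s. b * c s"])
           (simp add: scaleC_sum_right scaleC_scaleC sum_distrib_left mult.assoc)
    qed
    have kww: "k w w = complex_of_real (Re (k w w))" "0 \<le> Re (k w w)"
      using herm[of w w] psd[of "{w}" "\<lambda>_. 1"] by (auto simp: complex_eq_iff)
    have quad: "0 \<le> (norm v)\<^sup>2 + 2 * Re (cnj l * a) + (cmod l)\<^sup>2 * Re (k w w)" if va: "(v, a) \<in> R" for v a l
    proof -
      obtain F c where F: "finite F" "F \<subseteq> D" and eq: "v = (\<Sum>s\<in>F. c s *\<^sub>C T s)" "a = (\<Sum>s\<in>F. c s * k s w)"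
        by (rule R_E[OF va])
      have wF: "w \<notin> F" using F w by blast
      let ?c = "c(w := l)"
      have "(\<Sum>i\<in>insert w F. \<Sum>j\<in>insert w F. ?c i * cnj (?c j) * k i j) =
          l * cnj l * k w w + l * (\<Sum>j\<in>F. cnj (c j) * k w j) + cnj l * (\<Sum>i\<in>F. c i * k i w) +
          (\<Sum>i\<in>F. \<Sum>j\<in>F. c i * cnj (c j) * k i j)"
      proof -
        have "?c i = c i" if "i \<in> F" for i using that wF by auto
        then show ?thesis
          using F wF by (simp add: sum.distrib sum_distrib_left algebra_simps cong: sum.cong)
      qed
      also have "(\<Sum>j\<in>F. cnj (c j) * k w j) = cnj a"
        unfolding eq cnj_sum by (rule sum.cong) (auto simp: herm[of w])
      also have "(\<Sum>i\<in>F. \<Sum>j\<in>F. c i * cnj (c j) * k i j) = cinner v v"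
      proof -
        have "cinner v v = (\<Sum>i\<in>F. \<Sum>j\<in>F. cinner (c i *\<^sub>C T i) (c j *\<^sub>C T j))"
          unfolding eq by (subst cinner_sum_left) (simp only: cinner_sum_right)
        also have "\<dots> = (\<Sum>i\<in>F. \<Sum>j\<in>F. c i * cnj (c j) * k i j)"
          by (intro sum.cong refl) (use F TG in \<open>auto simp: cinner_scaleC_left cinner_scaleC_right\<close>)
        finally show ?thesis by simp
      qed
      also have "(\<Sum>i\<in>F. c i * k i w) = a" using eq by simp
      also have "l * cnj l * k w w = complex_of_real ((cmod l)\<^sup>2 * Re (k w w))"
        by (subst kww(1)) (simp only: complex_norm_square of_real_mult)
      finally have "0 \<le> Re (complex_of_real ((cmod l)\<^sup>2 * Re (k w w)) + l * cnj a + cnj l * a + cinner v v)"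
        using psd[of "insert w F" ?c] F by simp
      then show ?thesis by (simp add: cinner_self algebra_simps)
    qed
    define C where "C = sqrt (Re (k w w))"
    have bound: "cmod a \<le> C * norm v" if va: "(v, a) \<in> R" for v a
    proof -
      let ?q = "Re (k w w)"
      have "(cmod a)\<^sup>2 \<le> ?q * (norm v)\<^sup>2"
      proof (cases "?q = 0")
        case True
        have ineq: "2 * t * (cmod a)\<^sup>2 \<le> (norm v)\<^sup>2" for t
        proof -
          have "Re (cnj (- complex_of_real t * a) * a) = - (t * (cmod a)\<^sup>2)"
            unfolding cmod_power2 by (simp add: power2_eq_square algebra_simps)
          then show ?thesis using quad[OF va, of "- complex_of_real t * a"] True by simp
        qed
        have "(cmod a)\<^sup>2 = 0"
        proof (rule ccontr)
          assume "(cmod a)\<^sup>2 \<noteq> 0"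
          then show False
            using ineq[of "((norm v)\<^sup>2 + 1) / (2 * (cmod a)\<^sup>2)"] by simp
        qed
        then show ?thesis using True by simp
      next
        case False
        then have q: "0 < ?q" using kww by simp
        have e1: "Re (cnj (- a / complex_of_real ?q) * a) = - ((cmod a)\<^sup>2 / ?q)"
          unfolding cmod_power2 by (simp add: power2_eq_square add_divide_distrib)
        have e2: "(cmod (- a / complex_of_real ?q))\<^sup>2 * ?q = (cmod a)\<^sup>2 / ?q"
          using q by (simp add: norm_divide power_divide power2_eq_square)
        have "(cmod a)\<^sup>2 / ?q \<le> (norm v)\<^sup>2"
          using quad[OF va, of "- a / complex_of_real ?q"] unfolding e1 e2 by simp
        then show ?thesis using q by (simp add: divide_le_eq mult.commute)
      qed
      then have "cmod a \<le> sqrt (?q * (norm v)\<^sup>2)" by (rule real_le_rsqrt)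
      then show ?thesis by (simp add: C_def real_sqrt_mult)
    qed
    have uniq: "a = a'" if "(v, a) \<in> R" "(v, a') \<in> R" for v a a'
    proof -
      have "(v + (- 1) *\<^sub>C v, a + (- 1) * a') \<in> R" using that by (intro R_add R_scale)
      from bound[OF this] show ?thesis by (simp add: scaleC_minus_one)
    qed
    define V where "V = fst ` R"
    define f where "f v = (THE a. (v, a) \<in> R)" for v
    have f_eq: "f v = a" if "(v, a) \<in> R" for v a
      unfolding f_def using uniq that by blast
    have fR: "(v, f v) \<in> R" if "v \<in> V" for v
      using that f_eq unfolding V_def by force
    have R0: "(0, 0) \<in> R" unfolding R_def by (intro CollectI exI[of _ "{}"]) simp
    have V: "csubspace V"
    proof -
      have VI: "v \<in> V" if "(v, a) \<in> R" for v a using image_eqI[of v fst "(v, a)" R] that by (simp add: V_def)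
      show ?thesis
        unfolding csubspace_def
        by (intro conjI ballI allI VI[OF R0] VI[OF R_add[OF fR fR]] VI[OF R_scale[OF fR]])
    qed
    obtain z where z: "z \<in> closure V" "\<And>y. y \<in> V \<Longrightarrow> f y = cinner y z"
    proof -
      have "\<exists>z\<in>closure V. \<forall>y\<in>V. f y = cinner y z"
      proof (rule riesz_on_subspace[OF V])
        show "f (x + y) = f x + f y" if "x \<in> V" "y \<in> V" for x y
          by (intro f_eq R_add fR that)
        show "f (c *\<^sub>C x) = c * f x" if "x \<in> V" for c x
          by (intro f_eq R_scale fR that)
        show "cmod (f x) \<le> C * norm x" if "x \<in> V" for x
          by (intro bound fR that)
      qed
      then obtain z where "z \<in> closure V" "\<forall>y\<in>V. f y = cinner y z" by (rule bexE)
      then show thesis using that by simp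
    qed
    have TV: "(T s, k s w) \<in> R" if "s \<in> D" for s
      unfolding R_def using that by (intro CollectI exI[of _ "{s}"] exI[of _ "\<lambda>_. 1"]) simp
    have Tz: "cinner (T s) z = k s w" if "s \<in> D" for s
    proof -
      have "T s \<in> V" using image_eqI[of "T s" fst "(T s, k s w)" R] TV[OF that] by (simp add: V_def)
      then show ?thesis using z(2)[of "T s"] f_eq[OF TV[OF that]] by simp
    qed
    have zC: "norm z \<le> C"
    proof (rule norm_le_if_in_closure[OF z(1)])
      show "cmod (cinner v z) \<le> C * norm v" if "v \<in> V" for v
        using bound[OF fR[OF that]] z(2)[OF that] by simp
    qed (simp add: C_def kww(2))
    have V_supp: "Rep_ell2 v j = 0" if vV: "v \<in> V" and j: "j \<notin> D" for v j
    proof -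
      obtain F c where F: "F \<subseteq> D" "v = (\<Sum>s\<in>F. c s *\<^sub>C T s)" by (rule R_E[OF fR[OF vV]]) (rule that)
      have "cinner v (ket j) = (\<Sum>s\<in>F. c s * cinner (T s) (ket j))"
        unfolding F(2) by (subst cinner_sum_left) (simp only: cinner_scaleC_left)
      also have "\<dots> = 0"
        using F(1) Tsupp j by (intro sum.neutral) (auto simp: cinner_ket_right)
      finally show ?thesis by (simp add: cinner_ket_right)
    qed
    have z_supp: "Rep_ell2 z j = 0" if "j \<notin> D" for j
      using Rep_ell2_closure_zero[OF z(1)] V_supp that by blast
    define b where "b = sqrt (Re (k w w) - (norm z)\<^sup>2)"
    have b: "b\<^sup>2 = Re (k w w) - (norm z)\<^sup>2"
    proof -
      have "(norm z)\<^sup>2 \<le> C\<^sup>2" using zC by (intro power_mono) auto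
      then show ?thesis using kww(2) by (simp add: b_def C_def)
    qed
    define u where "u = z + complex_of_real b *\<^sub>C ket w"
    have Tu: "cinner (T s) u = k s w" if "s \<in> D" for s
      using Tz[OF that] Tsupp[OF that w]
      by (simp add: u_def cinner_add_right cinner_scaleC_right cinner_ket_right)
    have uu: "cinner u u = k w w"
    proof -
      have "cinner u u = complex_of_real ((norm z)\<^sup>2 + b\<^sup>2)"
        using z_supp[OF w]
        by (simp add: u_def cinner_add_left cinner_add_right cinner_scaleC_left cinner_scaleC_right
            cinner_ket_right cinner_ket_left cinner_self[of z] Rep_ket power2_eq_square)
      then show ?thesis using b kww(1)[symmetric] by simp
    qed
    have Msnd: "v = T s" if "(s, v) \<in> M" for s v
    proof -
      have s: "s \<in> D" using that by (force simp: D_def)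
      have in_M: "cinner (snd a) (snd b) = k (fst a) (fst b)" if "a \<in> M" "b \<in> M" for a b
        using MA that by (simp add: A_def)
      have "cinner (v - T s) (v - T s) = 0"
        using in_M[OF that that] in_M[OF that T[OF s]] in_M[OF T[OF s] that] in_M[OF T[OF s] T[OF s]]
        by (simp add: cinner_diff_left cinner_diff_right)
      then show ?thesis by (simp add: cinner_self)
    qed
    have uT: "cinner u (T s) = k w s" if "s \<in> D" for s
      using Tu[OF that] herm[of w s] cinner_commute[of u "T s"] by simp
    have "insert (w, u) M \<in> A"
      unfolding A_def
    proof (intro CollectI conjI ballI allI impI)
      fix a a' assume "a \<in> insert (w, u) M" "a' \<in> insert (w, u) M"
      moreover have "fst a \<in> insert w D \<and> snd a = (T(w := u)) (fst a)" if "a \<in> insert (w, u) M" for a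
      proof (cases "a = (w, u)")
        case False
        then have "(fst a, snd a) \<in> M" using that by simp
        then have "snd a = T (fst a)" "fst a \<in> D" by (rule Msnd, simp add: D_def image_eqI[of _ fst "(fst a, snd a)"])
        then show ?thesis using w by auto
      qed simp
      ultimately have "fst a \<in> insert w D" "fst a' \<in> insert w D"
        "snd a = (T(w := u)) (fst a)" "snd a' = (T(w := u)) (fst a')" by blast+
      moreover have "cinner ((T(w := u)) s) ((T(w := u)) t) = k s t" if "s \<in> insert w D" "t \<in> insert w D" for s t
        using that uu uT Tu TG w by auto
      ultimately show "cinner (snd a) (snd a') = k (fst a) (fst a')" by simp
    next
      fix a j assume a: "a \<in> insert (w, u) M" and j: "Rep_ell2 (snd a) j \<noteq> 0"
      have "j \<in> insert w D"
      proof (cases "a = (w, u)")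
        case True
        then show ?thesis using j z_supp[of j] by (auto simp: u_def Rep_ket split: if_splits)
      next
        case False
        then show ?thesis using a j MA by (auto simp: A_def D_def)
      qed
      then show "j \<in> fst ` insert (w, u) M" by (simp add: D_def)
    qed
    then have "insert (w, u) M = M" using max by blast
    then have "w \<in> D" by (force simp: D_def)
    then show False using w by simp
  qed
  then show ?thesis using TG by blast
qed

section \<open>Algebras of operators\<close>

typedef 'i lop = "carrier bounded_ops :: ('i ell2 \<Rightarrow> 'i ell2) set"
  using bop_zero by blast

lemma bop_Rep [simp, intro]: "bop (Rep_lop T)"
  by (rule Rep_lop)

lemma lop_eqI: "(\<And>x. Rep_lop S x = Rep_lop T x) \<Longrightarrow> S = T"
  by (metis Rep_lop_inject ext)

lemma ket_nonzero: "ket i \<noteq> 0"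
proof
  assume "ket i = 0"
  then have "Rep_ell2 (ket i) i = 0" by simp
  then show False by (simp add: Rep_ket)
qed

instantiation lop :: (type) complex_star_algebra
begin
definition "0 = Abs_lop (\<lambda>_. 0)"
definition "1 = Abs_lop id"
definition "S + T = Abs_lop (\<lambda>x. Rep_lop S x + Rep_lop T x)"
definition "- T = Abs_lop (\<lambda>x. (-1) *\<^sub>C Rep_lop T x)"
definition "S - T = S + - (T :: 'a lop)"
definition "S * T = Abs_lop (Rep_lop S \<circ> Rep_lop T)"
definition "c \<odot> T = Abs_lop (\<lambda>x. c *\<^sub>C Rep_lop T x)"
definition "adj T = Abs_lop (cadjoint (Rep_lop T))"

lemma Rep_lop_0: "Rep_lop 0 = (\<lambda>_. 0)"
  and Rep_lop_1: "Rep_lop 1 = id"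
  and Rep_lop_plus: "Rep_lop (S + T) = (\<lambda>x. Rep_lop S x + Rep_lop T x)"
  and Rep_lop_uminus: "Rep_lop (- T) = (\<lambda>x. (-1) *\<^sub>C Rep_lop T x)"
  and Rep_lop_times: "Rep_lop (S * T) = Rep_lop S \<circ> Rep_lop T"
  and Rep_lop_scl: "Rep_lop (c \<odot> T) = (\<lambda>x. c *\<^sub>C Rep_lop T x)"
  and Rep_lop_adj: "Rep_lop (adj T) = cadjoint (Rep_lop T)"
  unfolding zero_lop_def one_lop_def plus_lop_def uminus_lop_def times_lop_def scl_lop_def adj_lop_def
  by (rule Abs_lop_inverse; intro bop_zero bop_id bop_plus bop_scale bop_comp bop_cadjoint bop_Rep)+

lemma Rep_lop_minus: "Rep_lop (S - T) = (\<lambda>x. Rep_lop S x - Rep_lop T x)"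
  by (simp add: minus_lop_def Rep_lop_plus Rep_lop_uminus scaleC_minus_one)

lemmas Rep_lop_simps = Rep_lop_0 Rep_lop_1 Rep_lop_plus Rep_lop_uminus Rep_lop_minus
  Rep_lop_times Rep_lop_scl

instance
proof
  show "(0 :: 'a lop) \<noteq> 1"
  proof
    assume eq: "(0 :: 'a lop) = 1"
    obtain x :: "'a ell2" where x: "x \<noteq> 0" using ket_nonzero by (rule that)
    have "Rep_lop (0 :: 'a lop) x = Rep_lop (1 :: 'a lop) x" by (simp only: eq)
    then show False using x by (simp add: Rep_lop_simps)
  qed
  fix S T U :: "'a lop" and c d :: complex
  show "adj (S + T) = adj S + adj T"
    by (rule lop_eqI) (simp add: Rep_lop_adj Rep_lop_plus cadjoint_plus)
  show "adj (c \<odot> T) = cnj c \<odot> adj T"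
    by (rule lop_eqI) (simp add: Rep_lop_adj Rep_lop_scl cadjoint_scale)
  show "adj (S * T) = adj T * adj S"
    by (rule lop_eqI) (simp add: Rep_lop_adj Rep_lop_times cadjoint_comp)
  show "adj (adj T) = T"
    by (rule lop_eqI) (simp add: Rep_lop_adj cadjoint_cadjoint)
qed (rule lop_eqI; simp add: Rep_lop_simps bop_add bop_scaleC scaleC_minus_one scaleC_add_right
      scaleC_add_left scaleC_scaleC algebra_simps)+
end

definition lnorm :: "'i lop \<Rightarrow> real" where
  "lnorm T = onorm (Rep_lop T)"

lemma lnorm_apply: "norm (Rep_lop T x) \<le> lnorm T * norm x"
  unfolding lnorm_def by (rule bop_norm_le) simp

lemma lnorm_le: "\<lbrakk>0 \<le> c; \<And>x. norm (Rep_lop T x) \<le> c * norm x\<rbrakk> \<Longrightarrow> lnorm T \<le> c"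
  unfolding lnorm_def by (rule onorm_bound)

lemma star_sub_UNIV: "star_sub UNIV"
  by standard simp_all

lemma cstar_normed_lnorm: "cstar_normed (UNIV :: 'i lop set) lnorm"
proof (intro cstar_normed.intro cstar_seminormed.intro star_sub_UNIV)
  show "cstar_normed_axioms (UNIV :: 'i lop set) lnorm"
  proof
    fix T :: "'i lop" assume "lnorm T = 0"
    then have "Rep_lop T x = 0" for x using lnorm_apply[of T x] by simp
    then show "T = 0" by (intro lop_eqI) (simp add: Rep_lop_0)
  qed
  show "cstar_seminormed_axioms (UNIV :: 'i lop set) lnorm"
  proof
    fix S T :: "'i lop" and c
    show nn: "0 \<le> lnorm T" for T :: "'i lop" by (simp add: lnorm_def)
    show "lnorm (S + T) \<le> lnorm S + lnorm T"
      unfolding lnorm_def Rep_lop_plus by (intro onorm_triangle bop_bounded_linear bop_Rep)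
    show "lnorm (S * T) \<le> lnorm S * lnorm T"
      unfolding lnorm_def Rep_lop_times by (intro onorm_compose bop_bounded_linear bop_Rep)
    show "lnorm (adj T * T) = (lnorm T)\<^sup>2"
      unfolding lnorm_def Rep_lop_times Rep_lop_adj by (rule onorm_cadjoint_mult) simp
    have le: "lnorm (c \<odot> T) \<le> cmod c * lnorm T" for c and T :: "'i lop"
      by (rule lnorm_le) (use nn lnorm_apply[of T] in
          \<open>auto simp: Rep_lop_scl norm_scaleC mult.assoc intro!: mult_left_mono\<close>)
    show "lnorm (c \<odot> T) = cmod c * lnorm T"
    proof (cases "c = 0")
      case True
      then show ?thesis using le[of 0 T] nn[of "0 \<odot> T"] by simp
    next
      case False
      have "lnorm T = lnorm ((1 / c) \<odot> c \<odot> T)" using False by simp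
      also have "\<dots> \<le> cmod (1 / c) * lnorm (c \<odot> T)" by (rule le)
      finally have "cmod c * lnorm T \<le> lnorm (c \<odot> T)"
        using False by (simp add: norm_divide field_simps)
      then show ?thesis using le[of c T] by simp
    qed
  qed
qed

interpretation lop: cstar_normed "UNIV :: 'i lop set" lnorm
  by (rule cstar_normed_lnorm)

lemma lop_complete:
  fixes X :: "nat \<Rightarrow> 'i lop"
  assumes X: "\<And>e. 0 < e \<Longrightarrow> \<exists>K. \<forall>m\<ge>K. \<forall>n\<ge>K. lnorm (X m - X n) < e"
  shows "\<exists>T. \<forall>e>0. \<exists>K. \<forall>n\<ge>K. lnorm (X n - T) \<le> e"
proof -
  have cauchy: "Cauchy (\<lambda>n. Rep_lop (X n) x)" for x
  proof (rule metric_CauchyI)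
    fix e :: real assume "0 < e"
    then have "0 < e / (norm x + 1)" by (simp add: add_nonneg_pos)
    then obtain K where K: "\<And>m n. m \<ge> K \<Longrightarrow> n \<ge> K \<Longrightarrow> lnorm (X m - X n) < e / (norm x + 1)"
      using X by blast
    have "dist (Rep_lop (X m) x) (Rep_lop (X n) x) < e" if "m \<ge> K" "n \<ge> K" for m n
    proof -
      have "dist (Rep_lop (X m) x) (Rep_lop (X n) x) \<le> lnorm (X m - X n) * norm x"
        using lnorm_apply[of "X m - X n" x] by (simp add: dist_norm Rep_lop_minus)
      also have "\<dots> \<le> lnorm (X m - X n) * (norm x + 1)"
        by (intro mult_left_mono) auto
      also have "\<dots> < e"
        using K[OF that] by (simp add: less_divide_eq add_nonneg_pos)
      finally show ?thesis .
    qed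
    then show "\<exists>M. \<forall>m\<ge>M. \<forall>n\<ge>M. dist (Rep_lop (X m) x) (Rep_lop (X n) x) < e" by blast
  qed
  then obtain L where L: "\<And>x. (\<lambda>n. Rep_lop (X n) x) \<longlonglongrightarrow> L x"
    unfolding Cauchy_convergent_iff convergent_def by metis
  have close: "norm (Rep_lop (X m) x - L x) \<le> e * norm x"
    if K: "\<And>m n. m \<ge> K \<Longrightarrow> n \<ge> K \<Longrightarrow> lnorm (X m - X n) < e" and m: "m \<ge> K" for K e m x
  proof (rule LIMSEQ_le_const2)
    show "(\<lambda>n. norm (Rep_lop (X m) x - Rep_lop (X n) x)) \<longlonglongrightarrow> norm (Rep_lop (X m) x - L x)"
      by (intro tendsto_intros L)
    have "norm (Rep_lop (X m) x - Rep_lop (X n) x) \<le> e * norm x" if "n \<ge> K" for n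
    proof -
      have "norm (Rep_lop (X m) x - Rep_lop (X n) x) \<le> lnorm (X m - X n) * norm x"
        using lnorm_apply[of "X m - X n" x] by (simp add: Rep_lop_minus)
      also have "\<dots> \<le> e * norm x" using K[OF m that] by (intro mult_right_mono) auto
      finally show ?thesis .
    qed
    then show "\<exists>N. \<forall>n\<ge>N. norm (Rep_lop (X m) x - Rep_lop (X n) x) \<le> e * norm x" by blast
  qed
  obtain K1 where K1: "\<And>m n. m \<ge> K1 \<Longrightarrow> n \<ge> K1 \<Longrightarrow> lnorm (X m - X n) < 1"
    using X[of 1] by auto
  have "bop L"
  proof (rule bopI)
    show "L (x + y) = L x + L y" for x y
      using L[of "x + y"] tendsto_add[OF L[of x] L[of y]]
      by (intro LIMSEQ_unique[of "\<lambda>n. Rep_lop (X n) (x + y)"]) (simp_all add: bop_add)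
    show "L (c *\<^sub>C x) = c *\<^sub>C L x" for c x
      using L[of "c *\<^sub>C x"] bounded_linear.tendsto[OF bounded_linear_scaleC L[of x], of c]
      by (intro LIMSEQ_unique[of "\<lambda>n. Rep_lop (X n) (c *\<^sub>C x)"]) (simp_all add: bop_scaleC)
    show "norm (L x) \<le> (lnorm (X K1) + 1) * norm x" for x
    proof -
      have "norm (L x) \<le> norm (Rep_lop (X K1) x) + norm (Rep_lop (X K1) x - L x)"
        by (metis norm_minus_commute norm_triangle_sub)
      also have "\<dots> \<le> lnorm (X K1) * norm x + 1 * norm x"
        by (intro add_mono lnorm_apply close[OF K1]) auto
      finally show ?thesis by (simp add: distrib_right)
    qed
  qed
  then have Rep: "Rep_lop (Abs_lop L) = L" by (simp add: Abs_lop_inverse)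
  have "\<exists>K. \<forall>n\<ge>K. lnorm (X n - Abs_lop L) \<le> e" if "0 < e" for e
  proof -
    obtain K where K: "\<And>m n. m \<ge> K \<Longrightarrow> n \<ge> K \<Longrightarrow> lnorm (X m - X n) < e"
      using X[OF \<open>0 < e\<close>] by blast
    have "lnorm (X n - Abs_lop L) \<le> e" if "n \<ge> K" for n
      by (rule lnorm_le) (use \<open>0 < e\<close> close[OF K that] in \<open>auto simp: Rep_lop_minus Rep\<close>)
    then show ?thesis by blast
  qed
  then show ?thesis by blast
qed

subsection \<open>Bounded families\<close>

definition fams :: "'r set \<Rightarrow> ('r \<Rightarrow> 'i lop) set" where
  "fams R = {a. (\<forall>\<rho>. \<rho> \<notin> R \<longrightarrow> a \<rho> = 0) \<and> bdd_above ((\<lambda>\<rho>. lnorm (a \<rho>)) ` R)}"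

definition fnorm :: "'r set \<Rightarrow> ('r \<Rightarrow> 'i lop) \<Rightarrow> real" where
  "fnorm R a = (SUP \<rho>\<in>R. lnorm (a \<rho>))"

lemma lnorm_le_fnorm: "\<lbrakk>a \<in> fams R; \<rho> \<in> R\<rbrakk> \<Longrightarrow> lnorm (a \<rho>) \<le> fnorm R a"
  unfolding fnorm_def by (rule cSUP_upper) (simp_all add: fams_def)

lemma fnorm_le: "\<lbrakk>R \<noteq> {}; \<And>\<rho>. \<rho> \<in> R \<Longrightarrow> lnorm (a \<rho>) \<le> c\<rbrakk> \<Longrightarrow> fnorm R a \<le> c"
  unfolding fnorm_def by (rule cSUP_least)

lemma famsI: "\<lbrakk>\<And>\<rho>. \<rho> \<notin> R \<Longrightarrow> a \<rho> = 0; \<And>\<rho>. \<rho> \<in> R \<Longrightarrow> lnorm (a \<rho>) \<le> c\<rbrakk> \<Longrightarrow> a \<in> fams R"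
  unfolding fams_def by (auto intro!: bdd_aboveI2)

lemma cstar_complete_fnorm:
  assumes R: "R \<noteq> {}"
  shows "cstar_complete (fams R :: ('r \<Rightarrow> 'i lop) set) (fnorm R)"
proof -
  have sub: "star_sub (fams R :: ('r \<Rightarrow> 'i lop) set)"
  proof
    fix a b :: "'r \<Rightarrow> 'i lop" and c
    show "0 \<in> (fams R :: ('r \<Rightarrow> 'i lop) set)" by (rule famsI[where c = 0]) simp_all
    assume a: "a \<in> fams R"
    then have a0: "\<And>\<rho>. \<rho> \<notin> R \<Longrightarrow> a \<rho> = 0" by (simp add: fams_def)
    show "c \<odot> a \<in> fams R"
      by (rule famsI[where c = "cmod c * fnorm R a"])
         (use a a0 in \<open>auto simp: lop.nu_scl intro!: mult_left_mono lnorm_le_fnorm\<close>)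
    show "adj a \<in> fams R"
      by (rule famsI[where c = "fnorm R a"]) (use a a0 in \<open>auto intro!: lnorm_le_fnorm\<close>)
    assume b: "b \<in> fams R"
    then have b0: "\<And>\<rho>. \<rho> \<notin> R \<Longrightarrow> b \<rho> = 0" by (simp add: fams_def)
    show "a + b \<in> fams R"
    proof (rule famsI[where c = "fnorm R a + fnorm R b"])
      show "lnorm ((a + b) \<rho>) \<le> fnorm R a + fnorm R b" if "\<rho> \<in> R" for \<rho>
        using lop.nu_add[of "a \<rho>" "b \<rho>"] lnorm_le_fnorm[OF a that] lnorm_le_fnorm[OF b that] by simp
    qed (use a0 b0 in simp)
    show "a * b \<in> fams R"
    proof (rule famsI[where c = "fnorm R a * fnorm R b"])
      show "lnorm ((a * b) \<rho>) \<le> fnorm R a * fnorm R b" if r: "\<rho> \<in> R" for \<rho>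
      proof -
        have "lnorm ((a * b) \<rho>) \<le> lnorm (a \<rho>) * lnorm (b \<rho>)" by (simp add: lop.nu_mult)
        also have "\<dots> \<le> fnorm R a * fnorm R b"
          using lnorm_le_fnorm[OF a r] lnorm_le_fnorm[OF b r] lop.nu_nonneg[of "a \<rho>"]
          by (intro mult_mono) (auto intro: order_trans[OF lop.nu_nonneg])
        finally show ?thesis .
      qed
    qed (use a0 b0 in simp)
  qed
  interpret star_sub "fams R :: ('r \<Rightarrow> 'i lop) set" by (rule sub)
  have semi: "cstar_seminormed (fams R :: ('r \<Rightarrow> 'i lop) set) (fnorm R)"
  proof
    fix a b :: "'r \<Rightarrow> 'i lop" and c
    assume a: "a \<in> fams R"
    obtain \<rho>0 where \<rho>0: "\<rho>0 \<in> R" using R by blast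
    show nn: "0 \<le> fnorm R a" if "a \<in> fams R" for a :: "'r \<Rightarrow> 'i lop"
      using order_trans[OF lop.nu_nonneg lnorm_le_fnorm[OF that \<rho>0]] by simp
    have le: "fnorm R (c \<odot> a) \<le> cmod c * fnorm R a" if "a \<in> fams R" for c and a :: "'r \<Rightarrow> 'i lop"
      using lnorm_le_fnorm[OF that] by (intro fnorm_le[OF R]) (auto simp: lop.nu_scl intro!: mult_left_mono)
    show "fnorm R (c \<odot> a) = cmod c * fnorm R a"
    proof (cases "c = 0")
      case True
      then show ?thesis using le[OF a, of 0] nn[of "0 \<odot> a"] by simp
    next
      case False
      have "fnorm R a = fnorm R ((1 / c) \<odot> c \<odot> a)" using False by simp
      also have "\<dots> \<le> cmod (1 / c) * fnorm R (c \<odot> a)" using a by (intro le) auto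
      finally have "cmod c * fnorm R a \<le> fnorm R (c \<odot> a)"
        using False by (simp add: norm_divide field_simps)
      then show ?thesis using le[OF a, of c] by simp
    qed
    show "fnorm R (adj a * a) = (fnorm R a)\<^sup>2"
    proof (rule antisym)
      show "fnorm R (adj a * a) \<le> (fnorm R a)\<^sup>2"
      proof (rule fnorm_le[OF R])
        show "lnorm ((adj a * a) \<rho>) \<le> (fnorm R a)\<^sup>2" if "\<rho> \<in> R" for \<rho>
          using lnorm_le_fnorm[OF a that] by (simp add: lop.nu_cstar power_mono)
      qed
      have aa: "adj a * a \<in> fams R" using a by auto
      have "fnorm R a \<le> sqrt (fnorm R (adj a * a))"
      proof (rule fnorm_le[OF R])
        fix \<rho> assume "\<rho> \<in> R"
        then have "(lnorm (a \<rho>))\<^sup>2 \<le> fnorm R (adj a * a)"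
          using lnorm_le_fnorm[OF aa, of \<rho>] by (simp add: lop.nu_cstar)
        then show "lnorm (a \<rho>) \<le> sqrt (fnorm R (adj a * a))" by (rule real_le_rsqrt)
      qed
      then have "(fnorm R a)\<^sup>2 \<le> (sqrt (fnorm R (adj a * a)))\<^sup>2"
        using nn[OF a] by (intro power_mono)
      then show "(fnorm R a)\<^sup>2 \<le> fnorm R (adj a * a)" using nn[OF aa] by simp
    qed
    assume b: "b \<in> fams R"
    show "fnorm R (a + b) \<le> fnorm R a + fnorm R b"
    proof (rule fnorm_le[OF R])
      show "lnorm ((a + b) \<rho>) \<le> fnorm R a + fnorm R b" if "\<rho> \<in> R" for \<rho>
        using lop.nu_add[of "a \<rho>" "b \<rho>"] lnorm_le_fnorm[OF a that] lnorm_le_fnorm[OF b that] by simp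
    qed
    show "fnorm R (a * b) \<le> fnorm R a * fnorm R b"
    proof (rule fnorm_le[OF R])
      fix \<rho> assume r: "\<rho> \<in> R"
      have "lnorm ((a * b) \<rho>) \<le> lnorm (a \<rho>) * lnorm (b \<rho>)" by (simp add: lop.nu_mult)
      also have "\<dots> \<le> fnorm R a * fnorm R b"
        using lnorm_le_fnorm[OF a r] lnorm_le_fnorm[OF b r] nn[OF a] by (intro mult_mono) auto
      finally show "lnorm ((a * b) \<rho>) \<le> fnorm R a * fnorm R b" .
    qed
  qed
  have zero: "a = 0" if a: "a \<in> fams R" "fnorm R a = 0" for a :: "'r \<Rightarrow> 'i lop"
  proof
    fix \<rho>
    show "a \<rho> = 0 \<rho>"
    proof (cases "\<rho> \<in> R")
      case True
      then show ?thesis using lnorm_le_fnorm[OF a(1) True] a(2) by (simp add: lop.eq_zero_if_le)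
    qed (use a(1) in \<open>simp add: fams_def\<close>)
  qed
  interpret cstar_seminormed "fams R :: ('r \<Rightarrow> 'i lop) set" "fnorm R" by (rule semi)
  show ?thesis
  proof
    show "a = 0" if "a \<in> fams R" "fnorm R a = 0" for a :: "'r \<Rightarrow> 'i lop"
      using zero that by blast
    fix X :: "nat \<Rightarrow> 'r \<Rightarrow> 'i lop"
    assume X: "\<And>n. X n \<in> fams R" and cauchy: "cauchy_seq X"
    have C: "lnorm (X m \<rho> - X n \<rho>) < e"
      if "fnorm R (X m - X n) < e" "\<rho> \<in> R" for m n e \<rho>
      using lnorm_le_fnorm[OF diff_mem[OF X X], of \<rho> m n] that by simp
    have "\<exists>T. \<forall>e>0. \<exists>K. \<forall>n\<ge>K. lnorm (X n \<rho> - T) \<le> e" if "\<rho> \<in> R" for \<rho>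
    proof (rule lop_complete)
      fix e :: real assume "0 < e"
      then show "\<exists>K. \<forall>m\<ge>K. \<forall>n\<ge>K. lnorm (X m \<rho> - X n \<rho>) < e"
        using cauchy C[OF _ \<open>\<rho> \<in> R\<close>] unfolding cauchy_seq_def by meson
    qed
    then obtain L0 where L0: "\<And>\<rho> e. \<rho> \<in> R \<Longrightarrow> 0 < e \<Longrightarrow> \<exists>K. \<forall>n\<ge>K. lnorm (X n \<rho> - L0 \<rho>) \<le> e"
      by metis
    define L where "L \<rho> = (if \<rho> \<in> R then L0 \<rho> else 0)" for \<rho>
    have close: "lnorm (X n \<rho> - L \<rho>) \<le> e"
      if K: "\<And>m n. m \<ge> K \<Longrightarrow> n \<ge> K \<Longrightarrow> fnorm R (X m - X n) < e" and n: "n \<ge> K" and r: "\<rho> \<in> R" for e K n \<rho>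
    proof (rule field_le_epsilon)
      fix d :: real assume "0 < d"
      then obtain K' where K': "\<And>m. m \<ge> K' \<Longrightarrow> lnorm (X m \<rho> - L0 \<rho>) \<le> d" using L0[OF r] by blast
      let ?m = "max K K'"
      have "lnorm (X n \<rho> - L0 \<rho>) \<le> lnorm (X n \<rho> - X ?m \<rho>) + lnorm (X ?m \<rho> - L0 \<rho>)"
        using lop.nu_add[of "X n \<rho> - X ?m \<rho>" "X ?m \<rho> - L0 \<rho>"] by simp
      also have "\<dots> \<le> e + d"
        using C[OF K[OF n, of ?m] r] K'[of ?m] by simp
      finally show "lnorm (X n \<rho> - L \<rho>) \<le> e + d" using r by (simp add: L_def)
    qed
    have L: "L \<in> fams R"
    proof -
      obtain K where K: "\<And>m n. m \<ge> K \<Longrightarrow> n \<ge> K \<Longrightarrow> fnorm R (X m - X n) < 1"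
        using cauchy unfolding cauchy_seq_def by (meson zero_less_one)
      show ?thesis
      proof (rule famsI[where c = "fnorm R (X K) + 1"])
        fix \<rho> assume r: "\<rho> \<in> R"
        have "lnorm (L \<rho>) \<le> lnorm (X K \<rho>) + lnorm (X K \<rho> - L \<rho>)"
          using lop.nu_diff[of "X K \<rho>" "X K \<rho> - L \<rho>"] by simp
        also have "\<dots> \<le> fnorm R (X K) + 1"
          by (intro add_mono lnorm_le_fnorm X r close[OF K]) auto
        finally show "lnorm (L \<rho>) \<le> fnorm R (X K) + 1" .
      qed (simp add: L_def)
    qed
    have "(\<lambda>n. fnorm R (X n - L)) \<longlonglongrightarrow> 0"
    proof (rule LIMSEQ_I)
      fix e :: real assume e: "0 < e"
      then obtain K where K: "\<And>m n. m \<ge> K \<Longrightarrow> n \<ge> K \<Longrightarrow> fnorm R (X m - X n) < e / 2"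
        using cauchy unfolding cauchy_seq_def by (meson half_gt_zero)
      have "fnorm R (X n - L) \<le> e / 2" if "n \<ge> K" for n
        by (rule fnorm_le[OF R]) (use close[OF K that] in simp)
      then have "norm (fnorm R (X n - L) - 0) < e" if "n \<ge> K" for n
        using that e nu_nonneg[of "X n - L"] X L by fastforce
      then show "\<exists>no. \<forall>n\<ge>no. norm (fnorm R (X n - L) - 0) < e" by blast
    qed
    then show "\<exists>x\<in>fams R. (\<lambda>n. fnorm R (X n - x)) \<longlonglongrightarrow> 0" using L by blast
  qed
qed

subsection \<open>Closures and extension of representations\<close>

context cstar_seminormed
begin

definition cls :: "'a set \<Rightarrow> 'a set" where
  "cls X = {x \<in> S. \<forall>e>0. \<exists>y\<in>X. \<nu> (x - y) < e}"

lemma cls_seqE: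
  assumes "x \<in> cls X" "X \<subseteq> S"
  obtains f where "\<And>n. f n \<in> X" "(\<lambda>n. \<nu> (x - f n)) \<longlonglongrightarrow> 0"
proof -
  have "\<exists>y\<in>X. \<nu> (x - y) < inverse (real (Suc n))" for n
    using assms(1) by (simp add: cls_def)
  then obtain f where f: "\<And>n. f n \<in> X" "\<And>n. \<nu> (x - f n) < inverse (real (Suc n))"
    by metis
  have "(\<lambda>n. \<nu> (x - f n)) \<longlonglongrightarrow> 0"
  proof (rule tendsto_sandwich[OF _ _ tendsto_const LIMSEQ_inverse_real_of_nat])
    show "\<forall>\<^sub>F n in sequentially. 0 \<le> \<nu> (x - f n)"
      using assms f(1) by (intro always_eventually allI nu_nonneg diff_mem) (auto simp: cls_def)
    show "\<forall>\<^sub>F n in sequentially. \<nu> (x - f n) \<le> inverse (real (Suc n))"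
      using f(2) by (intro always_eventually allI less_imp_le)
  qed
  then show thesis using that f(1) by blast
qed

lemma clsI_seq:
  assumes "x \<in> S" "\<And>n. f n \<in> X" "(\<lambda>n. \<nu> (x - f n)) \<longlonglongrightarrow> 0"
  shows "x \<in> cls X"
proof -
  have "\<exists>y\<in>X. \<nu> (x - y) < e" if "0 < e" for e
  proof -
    have "\<forall>\<^sub>F n in sequentially. \<nu> (x - f n) < e"
      using assms(3) that by (rule order_tendstoD(2))
    then show ?thesis using assms(2) by (auto simp: eventually_sequentially)
  qed
  then show ?thesis using assms(1) by (simp add: cls_def)
qed

lemma cls_subset: "cls X \<subseteq> S"
  by (auto simp: cls_def)

lemma subset_cls: "X \<subseteq> S \<Longrightarrow> X \<subseteq> cls X"
  by (auto simp: cls_def intro!: bexI)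

lemma null_add:
  assumes "\<And>n. f n \<in> S" "\<And>n. g n \<in> S" "x \<in> S" "y \<in> S"
    "(\<lambda>n. \<nu> (x - f n)) \<longlonglongrightarrow> 0" "(\<lambda>n. \<nu> (y - g n)) \<longlonglongrightarrow> 0"
  shows "(\<lambda>n. \<nu> (x + y - (f n + g n))) \<longlonglongrightarrow> 0"
proof (rule tendsto_sandwich[OF _ _ tendsto_const tendsto_add_zero[OF assms(5,6)]])
  show "\<forall>\<^sub>F n in sequentially. \<nu> (x + y - (f n + g n)) \<le> \<nu> (x - f n) + \<nu> (y - g n)"
  proof (intro always_eventually allI)
    fix n show "\<nu> (x + y - (f n + g n)) \<le> \<nu> (x - f n) + \<nu> (y - g n)"
      using nu_add[of "x - f n" "y - g n"] assms(1-4) by (simp add: algebra_simps)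
  qed
qed (use assms(1-4) in auto)

lemma null_mult:
  assumes "\<And>n. f n \<in> S" "\<And>n. g n \<in> S" "x \<in> S" "y \<in> S"
    "(\<lambda>n. \<nu> (x - f n)) \<longlonglongrightarrow> 0" "(\<lambda>n. \<nu> (y - g n)) \<longlonglongrightarrow> 0"
  shows "(\<lambda>n. \<nu> (x * y - f n * g n)) \<longlonglongrightarrow> 0"
proof (rule tendsto_sandwich[OF _ _ tendsto_const])
  show "(\<lambda>n. \<nu> x * \<nu> (y - g n) + \<nu> (x - f n) * (\<nu> y + \<nu> (y - g n))) \<longlonglongrightarrow> 0"
  proof -
    have "(\<lambda>n. \<nu> x * \<nu> (y - g n) + \<nu> (x - f n) * (\<nu> y + \<nu> (y - g n))) \<longlonglongrightarrow> \<nu> x * 0 + 0 * (\<nu> y + 0)"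
      by (intro tendsto_intros assms(5,6))
    then show ?thesis by simp
  qed
  show "\<forall>\<^sub>F n in sequentially. \<nu> (x * y - f n * g n) \<le> \<nu> x * \<nu> (y - g n) + \<nu> (x - f n) * (\<nu> y + \<nu> (y - g n))"
  proof (intro always_eventually allI)
    fix n
    have "x * y - f n * g n = x * (y - g n) + (x - f n) * (y - (y - g n))"
      by (simp add: algebra_simps)
    also have "\<nu> \<dots> \<le> \<nu> (x * (y - g n)) + \<nu> ((x - f n) * (y - (y - g n)))"
      using assms(1-4) by (intro nu_add) auto
    also have "\<dots> \<le> \<nu> x * \<nu> (y - g n) + \<nu> (x - f n) * \<nu> (y - (y - g n))"
      using assms(1-4) by (intro add_mono nu_mult) auto
    also have "\<dots> \<le> \<nu> x * \<nu> (y - g n) + \<nu> (x - f n) * (\<nu> y + \<nu> (y - g n))"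
      using assms(1-4) by (intro add_mono mult_left_mono nu_diff) auto
    finally show "\<nu> (x * y - f n * g n) \<le> \<dots>" .
  qed
qed (use assms(1-4) in auto)

lemma null_scl:
  assumes "\<And>n. f n \<in> S" "x \<in> S" "(\<lambda>n. \<nu> (x - f n)) \<longlonglongrightarrow> 0"
  shows "(\<lambda>n. \<nu> (c \<odot> x - c \<odot> f n)) \<longlonglongrightarrow> 0"
  using tendsto_mult_right_zero[OF assms(3), of "cmod c"] assms(1,2)
  by (simp add: nu_scl flip: scl_diff_right)

lemma null_adj:
  assumes "\<And>n. f n \<in> S" "x \<in> S" "(\<lambda>n. \<nu> (x - f n)) \<longlonglongrightarrow> 0"
  shows "(\<lambda>n. \<nu> (adj x - adj (f n))) \<longlonglongrightarrow> 0"
  using assms(3) nu_adj[OF diff_mem[OF assms(2,1)]] by simp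

lemma star_sub_cls:
  assumes X: "star_sub X" and XS: "X \<subseteq> S"
  shows "star_sub (cls X)"
proof -
  interpret X: star_sub X by fact
  show ?thesis
  proof
    show "0 \<in> cls X" using subset_cls[OF XS] by auto
    fix x y c assume x: "x \<in> cls X"
    then have xS: "x \<in> S" using cls_subset by auto
    obtain f where f: "\<And>n. f n \<in> X" "(\<lambda>n. \<nu> (x - f n)) \<longlonglongrightarrow> 0" using cls_seqE[OF x XS] by blast
    have fS: "f n \<in> S" for n using f XS by auto
    show "c \<odot> x \<in> cls X" by (rule clsI_seq[OF _ _ null_scl[OF fS xS f(2)]]) (use xS f in auto)
    show "adj x \<in> cls X" by (rule clsI_seq[OF _ _ null_adj[OF fS xS f(2)]]) (use xS f in auto)
    assume y: "y \<in> cls X"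
    then have yS: "y \<in> S" using cls_subset by auto
    obtain g where g: "\<And>n. g n \<in> X" "(\<lambda>n. \<nu> (y - g n)) \<longlonglongrightarrow> 0" using cls_seqE[OF y XS] by blast
    have gS: "g n \<in> S" for n using g XS by auto
    show "x + y \<in> cls X"
      by (rule clsI_seq[OF _ _ null_add[OF fS gS xS yS f(2) g(2)]]) (use xS yS f g in auto)
    show "x * y \<in> cls X"
      by (rule clsI_seq[OF _ _ null_mult[OF fS gS xS yS f(2) g(2)]]) (use xS yS f g in auto)
  qed
qed

lemma cls_cls:
  assumes XS: "X \<subseteq> S"
  shows "cls (cls X) \<subseteq> cls X"
proof
  fix x assume x: "x \<in> cls (cls X)"
  then have xS: "x \<in> S" by (auto simp: cls_def)
  have "\<exists>y\<in>X. \<nu> (x - y) < e" if "0 < e" for e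
  proof -
    obtain z where z: "z \<in> cls X" "\<nu> (x - z) < e / 2"
      using x half_gt_zero[OF \<open>0 < e\<close>] unfolding cls_def[of "cls X"] by blast
    obtain y where y: "y \<in> X" "\<nu> (z - y) < e / 2"
      using z(1) half_gt_zero[OF \<open>0 < e\<close>] unfolding cls_def by blast
    have "\<nu> (x - y) \<le> \<nu> (x - z) + \<nu> (z - y)"
      using nu_add[of "x - z" "z - y"] xS z y XS cls_subset by auto
    then show ?thesis using y z by (intro bexI[of _ y]) auto
  qed
  then show "x \<in> cls X" using xS by (simp add: cls_def)
qed

lemma cstar_seminormed_subset: "\<lbrakk>star_sub B; B \<subseteq> S\<rbrakk> \<Longrightarrow> cstar_seminormed B \<nu>"
  by (intro cstar_seminormed.intro cstar_seminormed_axioms.intro)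
     (auto simp: nu_scl nu_cstar subset_iff intro: nu_add nu_mult)

end

lemma (in cstar_normed) cstar_normed_subset: "\<lbrakk>star_sub B; B \<subseteq> S\<rbrakk> \<Longrightarrow> cstar_normed B \<nu>"
  by (intro cstar_normed.intro cstar_normed_axioms.intro cstar_seminormed_subset)
     (auto simp: subset_iff intro: nu_eq_zero)

lemma (in cstar_complete) cstar_complete_subset:
  assumes B: "star_sub B" "B \<subseteq> S" "cls B \<subseteq> B"
  shows "cstar_complete B \<nu>"
proof -
  interpret B: cstar_normed B \<nu> by (rule cstar_normed_subset[OF B(1,2)])
  show ?thesis
  proof
    fix X :: "nat \<Rightarrow> 'a" assume X: "\<And>n. X n \<in> B" and "B.cauchy_seq X"
    then have "cauchy_seq X" by (simp add: cauchy_seq_def B.cauchy_seq_def)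
    then obtain x where x: "x \<in> S" "(\<lambda>n. \<nu> (X n - x)) \<longlonglongrightarrow> 0"
      using complete[of X] X B(2) by blast
    have "(\<lambda>n. \<nu> (X n - x)) = (\<lambda>n. \<nu> (x - X n))"
      using x X B(2) by (intro ext nu_diff_commute) auto
    then have "x \<in> cls B" using x X by (intro clsI_seq[of x X]) auto
    then show "\<exists>x\<in>B. (\<lambda>n. \<nu> (X n - x)) \<longlonglongrightarrow> 0" using x B(3) by blast
  qed
qed

definition hom_on :: "'a::complex_star_algebra set \<Rightarrow> ('a \<Rightarrow> 'x::complex_hilbert_space \<Rightarrow> 'x) \<Rightarrow> bool" where
  "hom_on C \<phi> \<longleftrightarrow> (\<forall>a\<in>C. bop (\<phi> a)) \<and>
     (\<forall>a\<in>C. \<forall>b\<in>C. \<phi> (a + b) = (\<lambda>x. \<phi> a x + \<phi> b x)) \<and>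
     (\<forall>c. \<forall>a\<in>C. \<phi> (c \<odot> a) = (\<lambda>x. c *\<^sub>C \<phi> a x)) \<and>
     (\<forall>a\<in>C. \<forall>b\<in>C. \<phi> (a * b) = \<phi> a \<circ> \<phi> b) \<and>
     (\<forall>a\<in>C. \<phi> (adj a) = cadjoint (\<phi> a))"

lemma hom_onD:
  assumes "hom_on C \<phi>"
  shows hom_on_bop: "a \<in> C \<Longrightarrow> bop (\<phi> a)"
    and hom_on_add: "a \<in> C \<Longrightarrow> b \<in> C \<Longrightarrow> \<phi> (a + b) x = \<phi> a x + \<phi> b x"
    and hom_on_scl: "a \<in> C \<Longrightarrow> \<phi> (c \<odot> a) x = c *\<^sub>C \<phi> a x"
    and hom_on_mult: "a \<in> C \<Longrightarrow> b \<in> C \<Longrightarrow> \<phi> (a * b) x = \<phi> a (\<phi> b x)"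
    and hom_on_adj: "a \<in> C \<Longrightarrow> \<phi> (adj a) = cadjoint (\<phi> a)"
  using assms unfolding hom_on_def by (metis comp_apply)+

lemma hom_on_diff:
  assumes "hom_on C \<phi>" "star_sub C" "a \<in> C" "b \<in> C"
  shows "\<phi> (a - b) x = \<phi> a x - \<phi> b x"
proof -
  have "\<phi> (a + (-1) \<odot> b) x = \<phi> a x + (-1) *\<^sub>C \<phi> b x"
    using assms star_sub.scl_mem[of C b "-1"] by (simp only: hom_on_add hom_on_scl)
  then show ?thesis by (simp add: scaleC_minus_one)
qed

lemma onorm_scaleC:
  assumes T: "bop (T :: 'x::complex_hilbert_space \<Rightarrow> 'x)"
  shows "onorm (\<lambda>x. c *\<^sub>C T x) = cmod c * onorm T"
proof -
  have le: "onorm (\<lambda>x. c *\<^sub>C T x) \<le> cmod c * onorm T" if T: "bop T" for c and T :: "'x \<Rightarrow> 'x"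
    using T bop_norm_le[OF T] by (intro onorm_bound) (auto simp: norm_scaleC mult.assoc intro!: mult_left_mono)
  show ?thesis
  proof (cases "c = 0")
    case False
    have "onorm T = onorm (\<lambda>x. (1 / c) *\<^sub>C c *\<^sub>C T x)" using False by (simp add: scaleC_scaleC)
    also have "\<dots> \<le> cmod (1 / c) * onorm (\<lambda>x. c *\<^sub>C T x)" by (intro le bop_scale T)
    finally have "cmod c * onorm T \<le> onorm (\<lambda>x. c *\<^sub>C T x)"
      using False by (simp add: norm_divide field_simps)
    then show ?thesis using le[OF T, of c] by simp
  qed (use onorm_zero in simp)
qed

lemma hom_on_seminorm:
  assumes C: "star_sub C" and \<phi>: "hom_on C \<phi>"
  shows "cstar_seminormed C (\<lambda>a. onorm (\<phi> a))"
proof -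
  interpret star_sub C by fact
  note h = hom_on_bop[OF \<phi>] hom_on_adj[OF \<phi>]
  have e: "\<phi> (a + b) = (\<lambda>x. \<phi> a x + \<phi> b x)" "\<phi> (c \<odot> a) = (\<lambda>x. c *\<^sub>C \<phi> a x)" "\<phi> (a * b) = \<phi> a \<circ> \<phi> b"
    if "a \<in> C" "b \<in> C" for a b c
    using \<phi> that unfolding hom_on_def by blast+
  show ?thesis
  proof
    fix a b c assume a: "a \<in> C"
    show "0 \<le> onorm (\<phi> a)" using h(1)[OF a] by simp
    show "onorm (\<phi> (c \<odot> a)) = cmod c * onorm (\<phi> a)" using a h(1) by (simp add: e onorm_scaleC)
    show "onorm (\<phi> (adj a * a)) = (onorm (\<phi> a))\<^sup>2" using a h by (simp add: e onorm_cadjoint_mult)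
    assume b: "b \<in> C"
    show "onorm (\<phi> (a + b)) \<le> onorm (\<phi> a) + onorm (\<phi> b)"
      using a b h(1) by (simp add: e onorm_triangle bop_bounded_linear)
    show "onorm (\<phi> (a * b)) \<le> onorm (\<phi> a) * onorm (\<phi> b)"
      using a b h(1) by (simp add: e onorm_compose bop_bounded_linear)
  qed
qed

lemma (in cstar_seminormed) hom_extension:
  fixes \<phi> :: "'a \<Rightarrow> 'x::complex_hilbert_space \<Rightarrow> 'x"
  assumes B: "star_sub B" "B \<subseteq> S" and dense: "cls B = S"
    and \<phi>: "hom_on B \<phi>" and bound: "\<And>b. b \<in> B \<Longrightarrow> onorm (\<phi> b) \<le> \<nu> b"
  shows "\<exists>\<Phi>. hom_on S \<Phi> \<and> (\<forall>b\<in>B. \<Phi> b = \<phi> b)"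
proof -
  interpret B: star_sub B by fact
  have lip: "norm (\<phi> b x) \<le> \<nu> b * norm x" if "b \<in> B" for b x
    using bop_norm_le[OF hom_on_bop[OF \<phi> that], of x] bound[OF that]
    by (meson mult_right_mono norm_ge_zero order_trans)
  have "\<exists>f. (\<forall>n. f n \<in> B) \<and> (\<lambda>n. \<nu> (a - f n)) \<longlonglongrightarrow> 0" if "a \<in> S" for a
  proof -
    have "a \<in> cls B" using that dense by simp
    then obtain f where "\<And>n. f n \<in> B" "(\<lambda>n. \<nu> (a - f n)) \<longlonglongrightarrow> 0" using B(2) by (rule cls_seqE) (rule that)
    then show ?thesis by (intro exI conjI allI)
  qed
  then obtain s where s: "\<And>a n. a \<in> S \<Longrightarrow> s a n \<in> B" "\<And>a. a \<in> S \<Longrightarrow> (\<lambda>n. \<nu> (a - s a n)) \<longlonglongrightarrow> 0"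
    by metis
  have conv: "\<exists>l. (\<lambda>n. \<phi> (s a n) x) \<longlonglongrightarrow> l" if a: "a \<in> S" for a x
  proof -
    have "Cauchy (\<lambda>n. \<phi> (s a n) x)"
    proof (rule metric_CauchyI)
      fix e :: real assume e: "0 < e"
      define r where "r = norm x + 1"
      define d where "d = e / (2 * r)"
      have r: "0 < r" by (simp add: r_def add_nonneg_pos)
      have d: "0 < d" "2 * d * r = e" using e r by (auto simp: d_def)
      have "\<forall>\<^sub>F n in sequentially. \<nu> (a - s a n) < d" using s(2)[OF a] d by (intro order_tendstoD(2))
      then obtain K where K: "\<And>n. n \<ge> K \<Longrightarrow> \<nu> (a - s a n) < d" by (auto simp: eventually_sequentially)
      have "dist (\<phi> (s a m) x) (\<phi> (s a n) x) < e" if "m \<ge> K" "n \<ge> K" for m n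
      proof -
        have "\<nu> (s a m - s a n) \<le> \<nu> (a - s a n) + \<nu> (a - s a m)"
          using nu_diff[of "a - s a n" "a - s a m"] a s(1)[OF a] B(2) by auto
        then have le: "\<nu> (s a m - s a n) \<le> 2 * d" using K[OF that(1)] K[OF that(2)] by simp
        have "dist (\<phi> (s a m) x) (\<phi> (s a n) x) = norm (\<phi> (s a m - s a n) x)"
          using hom_on_diff[OF \<phi> B(1)] s(1)[OF a] by (simp add: dist_norm)
        also have "\<dots> \<le> \<nu> (s a m - s a n) * norm x" using s(1)[OF a] by (intro lip) auto
        also have "\<dots> \<le> 2 * d * norm x" using le by (intro mult_right_mono) auto
        also have "\<dots> < e" unfolding d(2)[symmetric] using d(1) by (simp add: r_def)
        finally show ?thesis .
      qed
      then show "\<exists>M. \<forall>m\<ge>M. \<forall>n\<ge>M. dist (\<phi> (s a m) x) (\<phi> (s a n) x) < e" by blast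
    qed
    then show ?thesis by (simp add: Cauchy_convergent_iff convergent_def)
  qed
  define \<Phi> where "\<Phi> a x = lim (\<lambda>n. \<phi> (s a n) x)" for a x
  have s_lim: "(\<lambda>n. \<phi> (s a n) x) \<longlonglongrightarrow> \<Phi> a x" if "a \<in> S" for a x
    unfolding \<Phi>_def using conv[OF that, of x] by (metis limI)
  have \<Phi>_lim: "(\<lambda>n. \<phi> (f n) x) \<longlonglongrightarrow> \<Phi> a x"
    if a: "a \<in> S" and f: "\<And>n. f n \<in> B" and l: "(\<lambda>n. \<nu> (a - f n)) \<longlonglongrightarrow> 0" for a f x
  proof -
    have "(\<lambda>n. \<phi> (f n) x - \<phi> (s a n) x) \<longlonglongrightarrow> 0"
    proof (rule Lim_null_comparison)
      show "(\<lambda>n. (\<nu> (a - s a n) + \<nu> (a - f n)) * norm x) \<longlonglongrightarrow> 0"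
        using tendsto_mult_left_zero[OF tendsto_add_zero[OF s(2)[OF a] l], of "norm x"] .
      show "\<forall>\<^sub>F n in sequentially. norm (\<phi> (f n) x - \<phi> (s a n) x) \<le> (\<nu> (a - s a n) + \<nu> (a - f n)) * norm x"
      proof (intro always_eventually allI)
        fix n
        have "norm (\<phi> (f n) x - \<phi> (s a n) x) = norm (\<phi> (f n - s a n) x)"
          using hom_on_diff[OF \<phi> B(1)] s(1)[OF a] f by simp
        also have "\<dots> \<le> \<nu> (f n - s a n) * norm x" using s(1)[OF a] f by (intro lip) auto
        also have "\<nu> (f n - s a n) \<le> \<nu> (a - s a n) + \<nu> (a - f n)"
          using nu_diff[of "a - s a n" "a - f n"] a s(1)[OF a] f B(2) by auto
        finally show "norm (\<phi> (f n) x - \<phi> (s a n) x) \<le> (\<nu> (a - s a n) + \<nu> (a - f n)) * norm x"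
          by (simp add: mult_right_mono)
      qed
    qed
    from tendsto_add[OF this s_lim[OF a, of x]] show ?thesis by simp
  qed
  have \<Phi>_ext: "\<Phi> b = \<phi> b" if "b \<in> B" for b
  proof
    fix x
    have "(\<lambda>n. \<phi> b x) \<longlonglongrightarrow> \<Phi> b x" using that B(2) by (intro \<Phi>_lim[of b "\<lambda>_. b"]) auto
    then show "\<Phi> b x = \<phi> b x" by (simp add: LIMSEQ_const_iff)
  qed
  have BS: "b \<in> S" if "b \<in> B" for b using that B(2) by blast
  note sS = BS[OF s(1)]
  have \<Phi>_norm: "norm (\<Phi> a x) \<le> \<nu> a * norm x" if a: "a \<in> S" for a x
  proof (rule LIMSEQ_le)
    show "(\<lambda>n. norm (\<phi> (s a n) x)) \<longlonglongrightarrow> norm (\<Phi> a x)" by (intro tendsto_norm s_lim a)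
    have "(\<lambda>n. \<nu> (s a n)) \<longlonglongrightarrow> \<nu> a"
    proof (rule Lim_transform[OF tendsto_const])
      show "(\<lambda>n. \<nu> (s a n) - \<nu> a) \<longlonglongrightarrow> 0"
      proof (rule Lim_null_comparison[OF _ s(2)[OF a]])
        show "\<forall>\<^sub>F n in sequentially. norm (\<nu> (s a n) - \<nu> a) \<le> \<nu> (a - s a n)"
          using nu_triangle_reverse[OF a sS[OF a]] by (intro always_eventually allI) (simp add: abs_minus_commute)
      qed
    qed
    then show "(\<lambda>n. \<nu> (s a n) * norm x) \<longlonglongrightarrow> \<nu> a * norm x" by (intro tendsto_mult_right)
  qed (use lip s(1)[OF a] in auto)
  have \<Phi>_bop: "bop (\<Phi> a)" if a: "a \<in> S" for a
  proof (rule bopI[OF _ _ \<Phi>_norm[OF a]])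
    note bop = hom_on_bop[OF \<phi> s(1)[OF a]]
    show "\<Phi> a (x + y) = \<Phi> a x + \<Phi> a y" for x y
      using s_lim[OF a, of "x + y"] tendsto_add[OF s_lim[OF a, of x] s_lim[OF a, of y]]
      by (intro LIMSEQ_unique[of "\<lambda>n. \<phi> (s a n) (x + y)"]) (simp_all add: bop_add[OF bop])
    show "\<Phi> a (c *\<^sub>C x) = c *\<^sub>C \<Phi> a x" for c x
      using s_lim[OF a, of "c *\<^sub>C x"] bounded_linear.tendsto[OF bounded_linear_scaleC s_lim[OF a, of x], of c]
      by (intro LIMSEQ_unique[of "\<lambda>n. \<phi> (s a n) (c *\<^sub>C x)"]) (simp_all add: bop_scaleC[OF bop])
  qed
  have "hom_on S \<Phi>"
    unfolding hom_on_def
  proof (intro conjI ballI allI ext)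
    fix a b c x assume a: "a \<in> S"
    show "bop (\<Phi> a)" by (rule \<Phi>_bop[OF a])
    show "\<Phi> (c \<odot> a) x = c *\<^sub>C \<Phi> a x"
    proof (rule LIMSEQ_unique)
      show "(\<lambda>n. \<phi> (c \<odot> s a n) x) \<longlonglongrightarrow> \<Phi> (c \<odot> a) x"
        using a s(1)[OF a] by (intro \<Phi>_lim null_scl sS s(2)) auto
      show "(\<lambda>n. \<phi> (c \<odot> s a n) x) \<longlonglongrightarrow> c *\<^sub>C \<Phi> a x"
        using bounded_linear.tendsto[OF bounded_linear_scaleC s_lim[OF a]] s(1)[OF a]
        by (simp add: hom_on_scl[OF \<phi>])
    qed
    assume b: "b \<in> S"
    show "\<Phi> (a + b) x = \<Phi> a x + \<Phi> b x"
    proof (rule LIMSEQ_unique)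
      show "(\<lambda>n. \<phi> (s a n + s b n) x) \<longlonglongrightarrow> \<Phi> (a + b) x"
        using a b s(1) by (intro \<Phi>_lim null_add sS s(2)) auto
      show "(\<lambda>n. \<phi> (s a n + s b n) x) \<longlonglongrightarrow> \<Phi> a x + \<Phi> b x"
        using tendsto_add[OF s_lim[OF a] s_lim[OF b]] s(1) a b by (simp add: hom_on_add[OF \<phi>])
    qed
    show "\<Phi> (a * b) x = (\<Phi> a \<circ> \<Phi> b) x"
    proof (rule LIMSEQ_unique)
      show "(\<lambda>n. \<phi> (s a n * s b n) x) \<longlonglongrightarrow> \<Phi> (a * b) x"
        using a b s(1) by (intro \<Phi>_lim null_mult sS s(2)) auto
      have "(\<lambda>n. \<phi> (s a n) (\<phi> (s b n) x - \<Phi> b x)) \<longlonglongrightarrow> 0"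
      proof (rule Lim_null_comparison)
        have "(\<lambda>n. norm (\<phi> (s b n) x - \<Phi> b x)) \<longlonglongrightarrow> 0"
          using tendsto_diff[OF s_lim[OF b, of x] tendsto_const[of "\<Phi> b x"]]
          by (intro tendsto_norm_zero) simp
        moreover have "(\<lambda>n. \<nu> a + \<nu> (a - s a n)) \<longlonglongrightarrow> \<nu> a + 0"
          by (intro tendsto_add tendsto_const s(2) a)
        ultimately show "(\<lambda>n. (\<nu> a + \<nu> (a - s a n)) * norm (\<phi> (s b n) x - \<Phi> b x)) \<longlonglongrightarrow> 0"
          using tendsto_mult by fastforce
        show "\<forall>\<^sub>F n in sequentially. norm (\<phi> (s a n) (\<phi> (s b n) x - \<Phi> b x)) \<le>
            (\<nu> a + \<nu> (a - s a n)) * norm (\<phi> (s b n) x - \<Phi> b x)"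
        proof (intro always_eventually allI)
          fix n
          have "\<nu> (s a n) \<le> \<nu> a + \<nu> (a - s a n)"
            using nu_diff[of a "a - s a n"] a sS[OF a] by auto
          then show "norm (\<phi> (s a n) (\<phi> (s b n) x - \<Phi> b x)) \<le>
              (\<nu> a + \<nu> (a - s a n)) * norm (\<phi> (s b n) x - \<Phi> b x)"
            using lip[OF s(1)[OF a]] by (meson mult_right_mono norm_ge_zero order_trans)
        qed
      qed
      from tendsto_add[OF this s_lim[OF a, of "\<Phi> b x"]]
      show "(\<lambda>n. \<phi> (s a n * s b n) x) \<longlonglongrightarrow> (\<Phi> a \<circ> \<Phi> b) x"
        using s(1) a b by (simp add: hom_on_mult[OF \<phi>] bop_diff[OF hom_on_bop[OF \<phi>]])
    qed
  next
    fix a assume a: "a \<in> S"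
    have "cadjoint (\<Phi> a) = \<Phi> (adj a)"
    proof (rule cadjoint_eqI[OF \<Phi>_bop[OF a]])
      fix x y
      show "cinner (\<Phi> a x) y = cinner x (\<Phi> (adj a) y)"
      proof (rule LIMSEQ_unique)
        show "(\<lambda>n. cinner (\<phi> (s a n) x) y) \<longlonglongrightarrow> cinner (\<Phi> a x) y"
          by (intro tendsto_cinner_left s_lim a)
        have "(\<lambda>n. \<phi> (adj (s a n)) y) \<longlonglongrightarrow> \<Phi> (adj a) y"
          using a s(1)[OF a] by (intro \<Phi>_lim null_adj sS s(2)) auto
        then have "(\<lambda>n. cinner x (\<phi> (adj (s a n)) y)) \<longlonglongrightarrow> cinner x (\<Phi> (adj a) y)"
          by (intro tendsto_cinner_right)
        then show "(\<lambda>n. cinner (\<phi> (s a n) x) y) \<longlonglongrightarrow> cinner x (\<Phi> (adj a) y)"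
          using s(1)[OF a] by (simp add: hom_on_adj[OF \<phi>] cinner_cadjoint[OF hom_on_bop[OF \<phi>]])
      qed
    qed
    then show "\<Phi> (adj a) x = cadjoint (\<Phi> a) x" for x by simp
  qed
  then show ?thesis using \<Phi>_ext by blast
qed

text \<open>
  Homomorphisms into bounded operators are automatically continuous on a complete algebra.
\<close>

lemma (in cstar_complete) hom_unique:
  fixes \<Phi> \<Psi> :: "'a \<Rightarrow> 'x::complex_hilbert_space \<Rightarrow> 'x"
  assumes B: "B \<subseteq> S" "cls B = S" and h: "hom_on S \<Phi>" "hom_on S \<Psi>"
    and eq: "\<And>b. b \<in> B \<Longrightarrow> \<Phi> b = \<Psi> b" and a: "a \<in> S"
  shows "\<Phi> a = \<Psi> a"
proof
  fix x
  have le: "norm (\<Theta> c x) \<le> \<nu> c * norm x" if "hom_on S \<Theta>" "c \<in> S" for \<Theta> :: "'a \<Rightarrow> 'x \<Rightarrow> 'x" and c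
    using contractive[OF hom_on_seminorm[OF star_sub_axioms that(1)] that(2)]
      bop_norm_le[OF hom_on_bop[OF that], of x]
    by (meson mult_right_mono norm_ge_zero order_trans)
  have "a \<in> cls B" using a B(2) by simp
  then obtain f where f: "\<And>n. f n \<in> B" "(\<lambda>n. \<nu> (a - f n)) \<longlonglongrightarrow> 0" using B(1) by (rule cls_seqE) (rule that)
  have "norm (\<Phi> a x - \<Psi> a x) \<le> 2 * norm x * \<nu> (a - f n)" for n
  proof -
    have fS: "f n \<in> S" using f B by blast
    have "\<Phi> a x - \<Psi> a x = \<Phi> (a - f n) x - \<Psi> (a - f n) x"
      using a fS eq[OF f(1)] by (simp add: hom_on_diff[OF h(1) star_sub_axioms] hom_on_diff[OF h(2) star_sub_axioms])
    then have "norm (\<Phi> a x - \<Psi> a x) \<le> norm (\<Phi> (a - f n) x) + norm (\<Psi> (a - f n) x)"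
      by (simp only: norm_triangle_ineq4)
    also have "\<dots> \<le> \<nu> (a - f n) * norm x + \<nu> (a - f n) * norm x"
      using a fS by (intro add_mono le h) auto
    finally show ?thesis by (simp add: algebra_simps)
  qed
  then have "norm (\<Phi> a x - \<Psi> a x) \<le> 0"
    using tendsto_mult_right_zero[OF f(2), of "2 * norm x"] by (rule le_zero_if_le_null_sequence)
  then show "\<Phi> a x = \<Psi> a x" by simp
qed

subsection \<open>Star-algebras given by records\<close>

text \<open>
  A record algebra \<open>S\<close> whose carrier is the injective image under \<open>t\<close> of a set \<open>C\<close> of elements of a
  star-algebra that is a type, with the operations of that type.
\<close>

locale represented = star_sub C for C :: "'a::complex_star_algebra set" +
  fixes S :: "('b, 'm) star_alg_scheme" and t :: "'a \<Rightarrow> 'b"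
  assumes rep_carrier: "carrier S = t ` C"
    and rep_inj: "inj_on t C"
    and rep_zero: "sa_zero S = t 0"
    and rep_add: "\<lbrakk>a \<in> C; b \<in> C\<rbrakk> \<Longrightarrow> sa_add S (t a) (t b) = t (a + b)"
    and rep_mult: "\<lbrakk>a \<in> C; b \<in> C\<rbrakk> \<Longrightarrow> sa_mult S (t a) (t b) = t (a * b)"
    and rep_scale: "a \<in> C \<Longrightarrow> sa_scale S c (t a) = t (c \<odot> a)"
    and rep_star: "a \<in> C \<Longrightarrow> sa_star S (t a) = t (adj a)"
begin

lemma rep_diff: "\<lbrakk>a \<in> C; b \<in> C\<rbrakk> \<Longrightarrow> sa_diff S (t a) (t b) = t (a - b)"
  by (simp add: sa_diff_def rep_scale rep_add)

lemma rep_eq_iff: "\<lbrakk>a \<in> C; b \<in> C\<rbrakk> \<Longrightarrow> t a = t b \<longleftrightarrow> a = b"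
  using rep_inj by (auto simp: inj_on_def)

lemmas rep_simps = rep_carrier rep_zero rep_add rep_mult rep_scale rep_star

lemma star_algebra: "star_algebra S"
proof (rule star_algebra.intro)
  show "comm_group \<lparr>carrier = carrier S, mult = sa_add S, one = sa_zero S\<rparr>"
  proof -
    have inv: "\<exists>b\<in>C. t (a + b) = t 0" if "a \<in> C" for a
      using that by (intro bexI[of _ "- a"]) auto
    show ?thesis
      by (rule comm_groupI) (auto simp: rep_simps add_ac inv)
  qed
qed (auto simp: rep_simps scl_distribs algebra_simps)

lemma cstar_norm_iff: "cstar_norm S \<mu> \<longleftrightarrow> cstar_normed C (\<lambda>a. \<mu> (t a))"
proof
  assume *: "cstar_norm S \<mu>"
  show "cstar_normed C (\<lambda>a. \<mu> (t a))"
  proof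
    fix a b c assume a: "a \<in> C"
    then have tS: "t a \<in> carrier S" by (simp add: rep_carrier)
    show "0 \<le> \<mu> (t a)" using * tS unfolding cstar_norm_def by blast
    show "\<mu> (t (c \<odot> a)) = cmod c * \<mu> (t a)"
      using * tS unfolding cstar_norm_def rep_scale[OF a, symmetric] by blast
    show "\<mu> (t (adj a * a)) = (\<mu> (t a))\<^sup>2"
    proof -
      have "t (adj a * a) = sa_mult S (sa_star S (t a)) (t a)" using a by (simp add: rep_star rep_mult)
      then show ?thesis using * tS unfolding cstar_norm_def by simp
    qed
    show "a = 0" if "\<mu> (t a) = 0"
      using * tS that a rep_eq_iff[of a 0] unfolding cstar_norm_def rep_zero by auto
    assume b: "b \<in> C"
    then have tS': "t b \<in> carrier S" by (simp add: rep_carrier)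
    show "\<mu> (t (a + b)) \<le> \<mu> (t a) + \<mu> (t b)"
      using * tS tS' unfolding cstar_norm_def rep_add[OF a b, symmetric] by blast
    show "\<mu> (t (a * b)) \<le> \<mu> (t a) * \<mu> (t b)"
      using * tS tS' unfolding cstar_norm_def rep_mult[OF a b, symmetric] by blast
  qed
next
  assume "cstar_normed C (\<lambda>a. \<mu> (t a))"
  then interpret n: cstar_normed C "\<lambda>a. \<mu> (t a)" .
  have "\<mu> (t 0) = 0" by (rule n.nu_zero)
  then show "cstar_norm S \<mu>"
    unfolding cstar_norm_def
    by (auto simp: rep_simps n.nu_scl n.nu_add n.nu_mult n.nu_cstar rep_eq_iff dest: n.nu_eq_zero)
qed

lemma represented_subset:
  "\<lbrakk>star_sub B; B \<subseteq> C\<rbrakk> \<Longrightarrow> represented B (S\<lparr>carrier := t ` B\<rparr>) t"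
  by (intro represented.intro represented_axioms.intro)
     (auto simp: rep_simps subset_iff intro: inj_on_subset[OF rep_inj])

lemma star_subalgebra_iff:
  assumes "B \<subseteq> C"
  shows "star_subalgebra S (t ` B) \<longleftrightarrow> star_sub B"
proof -
  have mem: "t a \<in> t ` B \<longleftrightarrow> a \<in> B" if "a \<in> C" for a
    using that assms rep_eq_iff by blast
  have BC: "b \<in> C" if "b \<in> B" for b using that assms by blast
  show ?thesis
    unfolding star_subalgebra_def linear_subspace_def star_sub_def
    using assms BC by (auto simp: rep_simps mem)
qed

lemma linear_subspace_iff:
  assumes "B \<subseteq> C"
  shows "linear_subspace S (t ` B) \<longleftrightarrow> 0 \<in> B \<and> (\<forall>x\<in>B. \<forall>y\<in>B. x + y \<in> B) \<and> (\<forall>c. \<forall>x\<in>B. c \<odot> x \<in> B)"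
proof -
  have mem: "t a \<in> t ` B \<longleftrightarrow> a \<in> B" if "a \<in> C" for a
    using that assms rep_eq_iff by blast
  have BC: "b \<in> C" if "b \<in> B" for b using that assms by blast
  show ?thesis
    unfolding linear_subspace_def using assms BC by (auto simp: rep_simps mem)
qed

lemma star_hom_iff:
  "star_hom S (bounded_ops :: ('x::complex_hilbert_space \<Rightarrow> 'x) normed_star_alg) \<phi> \<longleftrightarrow> hom_on C (\<lambda>a. \<phi> (t a))"
proof -
  have o: "sa_add bounded_ops = (\<lambda>S T x. S x + T x)" "sa_scale bounded_ops = (\<lambda>c T x. c *\<^sub>C T x)"
    "sa_mult bounded_ops = (\<circ>)" "sa_star bounded_ops = cadjoint" for S T :: "'x \<Rightarrow> 'x"
    by (simp_all add: bounded_ops_def)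
  show ?thesis
    unfolding star_hom_def hom_on_def o by (auto simp: rep_simps Pi_iff)
qed

end

lemma cstar_algebra_if_represented:
  fixes S :: "('b, 'm) normed_star_alg_scheme"
  assumes r: "represented C S t" and c: "cstar_complete C (\<lambda>a. sa_norm S (t a))"
  shows "cstar_algebra S"
proof -
  interpret represented C S t by fact
  interpret c: cstar_complete C "\<lambda>a. sa_norm S (t a)" by fact
  show ?thesis
    unfolding cstar_algebra_def
  proof (intro conjI allI impI)
    show "star_algebra S" by (rule star_algebra)
    show "cstar_norm S (sa_norm S)" unfolding cstar_norm_iff by (rule c.cstar_normed_axioms)
    fix X :: "nat \<Rightarrow> 'b"
    assume X: "(\<forall>n. X n \<in> carrier S) \<and>
        (\<forall>e>0. \<exists>K. \<forall>m\<ge>K. \<forall>n\<ge>K. sa_norm S (sa_diff S (X m) (X n)) < e)"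
    then have "\<forall>n. \<exists>a\<in>C. X n = t a" by (auto simp: rep_carrier)
    then obtain Y where Y: "\<And>n. Y n \<in> C" "\<And>n. X n = t (Y n)" by metis
    have "c.cauchy_seq Y"
      using X unfolding c.cauchy_seq_def by (simp add: Y rep_diff)
    then obtain y where "y \<in> C" "(\<lambda>n. sa_norm S (t (Y n - y))) \<longlonglongrightarrow> 0"
      using c.complete[of Y] Y by blast
    then show "\<exists>x\<in>carrier S. (\<lambda>n. sa_norm S (sa_diff S (X n) x)) \<longlonglongrightarrow> 0"
      by (intro bexI[of _ "t y"]) (simp_all add: Y rep_diff rep_carrier)
  qed
qed

lemma sa_closure_if_represented:
  fixes S :: "('b, 'm) normed_star_alg_scheme"
  assumes r: "represented C S t" and c: "cstar_seminormed C (\<lambda>a. sa_norm S (t a))" and B: "B \<subseteq> C"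
  shows "sa_closure S (t ` B) = t ` cstar_seminormed.cls C (\<lambda>a. sa_norm S (t a)) B"
proof -
  interpret represented C S t by fact
  interpret c: cstar_seminormed C "\<lambda>a. sa_norm S (t a)" by fact
  have "sa_diff S (t a) (t b) = t (a - b)" if "a \<in> C" "b \<in> B" for a b
    using that B by (intro rep_diff) auto
  then show ?thesis
    unfolding sa_closure_def c.cls_def rep_carrier by auto
qed

section \<open>The action on cosets\<close>

context semidirect_setting
begin

lemma N_subgroup: "subgroup N G"
  using N_normal by (simp add: normal_def)

lemma N_closed [simp]: "x \<in> N \<Longrightarrow> x \<in> carrier G"
  and H_closed [simp]: "a \<in> H \<Longrightarrow> a \<in> carrier G"
  using subgroup.subset[OF N_subgroup] subgroup.subset[OF H_subgroup] by auto

lemmas N_simps [simp] = subgroup.m_closed[OF N_subgroup] subgroup.m_inv_closed[OF N_subgroup] subgroup.one_closed[OF N_subgroup]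
lemmas H_simps [simp] = subgroup.m_closed[OF H_subgroup] subgroup.m_inv_closed[OF H_subgroup] subgroup.one_closed[OF H_subgroup]

lemma inv_cancel [simp]: "\<lbrakk>x \<in> carrier G; y \<in> carrier G\<rbrakk> \<Longrightarrow> inv x \<otimes> (x \<otimes> y) = y"
  and inv_cancel' [simp]: "\<lbrakk>x \<in> carrier G; y \<in> carrier G\<rbrakk> \<Longrightarrow> x \<otimes> (inv x \<otimes> y) = y"
  by (simp_all flip: m_assoc)

lemma conj_N [simp]: "\<lbrakk>g \<in> carrier G; x \<in> N\<rbrakk> \<Longrightarrow> g \<otimes> x \<otimes> inv g \<in> N"
  by (rule normal.inv_op_closed2[OF N_normal])

lemma M_subgroup: "subgroup M G"
  using M_normal N_subgroup by (auto simp: normal_def intro: incl_subgroup)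

lemma M_subset_N: "M \<subseteq> N"
  using M_normal subgroup.subset[of M "G\<lparr>carrier := N\<rparr>"] by (simp add: normal_def)

lemma M_closed [simp]: "x \<in> M \<Longrightarrow> x \<in> N"
  using M_subset_N by blast

lemma conj_M: "\<lbrakk>n \<in> N; x \<in> M\<rbrakk> \<Longrightarrow> n \<otimes> x \<otimes> inv n \<in> M"
  using normal.inv_op_closed2[OF M_normal, of n x] m_inv_consistent[OF N_subgroup] by simp

lemma decompose:
  assumes "g \<in> carrier G"
  obtains x a where "x \<in> N" "a \<in> H" "g = x \<otimes> a"
  using assms N_mult_H unfolding set_mult_def by blast

lemma decompose_unique:
  assumes "x \<in> N" "a \<in> H" "x' \<in> N" "a' \<in> H" "x \<otimes> a = x' \<otimes> a'"
  shows "x = x' \<and> a = a'"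
proof -
  have "inv x' \<otimes> x = inv x' \<otimes> (x \<otimes> a) \<otimes> inv a" using assms(1-4) by (simp add: m_assoc)
  also have "\<dots> = inv x' \<otimes> (x' \<otimes> a') \<otimes> inv a" by (simp only: assms(5))
  also have "\<dots> = a' \<otimes> inv a" using assms(1-4) by (simp add: m_assoc)
  finally have *: "inv x' \<otimes> x = a' \<otimes> inv a" .
  then have "inv x' \<otimes> x \<in> N \<inter> H" using assms by (metis IntI H_simps(1,2) N_simps(1,2))
  then have "inv x' \<otimes> x = \<one>" using N_Int_H by simp
  moreover from this * have "a' \<otimes> inv a = \<one>" by simp
  ultimately show ?thesis
    using assms by (metis H_closed N_closed inv_closed inv_equality inv_inv inv_unique)
qed

abbreviation act :: "'g \<Rightarrow> 'g \<Rightarrow> 'g" where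
  "act \<equiv> act_pt G N H"

lemma act_eq:
  assumes "x \<in> N" "a \<in> H"
  shows "act (x \<otimes> a) y = x \<otimes> a \<otimes> y \<otimes> inv a"
  unfolding act_pt_def
proof (rule the_equality)
  show "\<exists>x'\<in>N. \<exists>a'\<in>H. x \<otimes> a = x' \<otimes> a' \<and> x \<otimes> a \<otimes> y \<otimes> inv a = x' \<otimes> a' \<otimes> y \<otimes> inv a'"
    using assms by blast
  show "z = x \<otimes> a \<otimes> y \<otimes> inv a"
    if "\<exists>x'\<in>N. \<exists>a'\<in>H. x \<otimes> a = x' \<otimes> a' \<and> z = x' \<otimes> a' \<otimes> y \<otimes> inv a'" for z
    using that decompose_unique[OF assms] by metis
qed

lemma act_eq': "\<lbrakk>x \<in> N; a \<in> H; y \<in> N\<rbrakk> \<Longrightarrow> act (x \<otimes> a) y = x \<otimes> (a \<otimes> y \<otimes> inv a)"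
  by (simp add: act_eq m_assoc)

lemma act_mem [simp]: "\<lbrakk>g \<in> carrier G; y \<in> N\<rbrakk> \<Longrightarrow> act g y \<in> N"
  by (erule decompose) (simp add: act_eq')

lemma act_mult:
  assumes "g \<in> carrier G" "h \<in> carrier G" "y \<in> N"
  shows "act (g \<otimes> h) y = act g (act h y)"
proof -
  obtain x a x' a' where d: "x \<in> N" "a \<in> H" "g = x \<otimes> a" "x' \<in> N" "a' \<in> H" "h = x' \<otimes> a'"
    using assms(1,2) by (metis decompose)
  have "g \<otimes> h = (x \<otimes> (a \<otimes> x' \<otimes> inv a)) \<otimes> (a \<otimes> a')"
    using d by (simp add: m_assoc)
  then have "act (g \<otimes> h) y = (x \<otimes> (a \<otimes> x' \<otimes> inv a)) \<otimes> ((a \<otimes> a') \<otimes> y \<otimes> inv (a \<otimes> a'))"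
    using d assms by (simp add: act_eq')
  also have "\<dots> = x \<otimes> (a \<otimes> (x' \<otimes> (a' \<otimes> y \<otimes> inv a')) \<otimes> inv a)"
    using d assms by (simp add: inv_mult_group m_assoc)
  finally show ?thesis using d assms by (simp add: act_eq')
qed

lemma act_one [simp]: "y \<in> N \<Longrightarrow> act \<one> y = y"
  using act_eq'[of \<one> \<one> y] by simp

lemma act_inv [simp]: "\<lbrakk>g \<in> carrier G; y \<in> N\<rbrakk> \<Longrightarrow> act (inv g) (act g y) = y"
  and act_inv' [simp]: "\<lbrakk>g \<in> carrier G; y \<in> N\<rbrakk> \<Longrightarrow> act g (act (inv g) y) = y"
  by (simp_all flip: act_mult)

definition cM :: "'g \<Rightarrow> 'g set" where
  "cM a = (\<lambda>s. a \<otimes> s \<otimes> inv a) ` M"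

lemma conj_family_eq: "conj_family G H M = cM ` H"
  by (simp add: conj_family_def cM_def)

lemma mem_cM:
  assumes "a \<in> H" "y \<in> N"
  shows "y \<in> cM a \<longleftrightarrow> inv a \<otimes> y \<otimes> a \<in> M"
proof
  assume "y \<in> cM a"
  then obtain s where "s \<in> M" "y = a \<otimes> s \<otimes> inv a" by (auto simp: cM_def)
  moreover from this have "inv a \<otimes> y \<otimes> a = s"
    using assms by (simp add: m_assoc)
  ultimately show "inv a \<otimes> y \<otimes> a \<in> M" by simp
next
  assume "inv a \<otimes> y \<otimes> a \<in> M"
  moreover have "y = a \<otimes> (inv a \<otimes> y \<otimes> a) \<otimes> inv a"
    using assms by (simp add: m_assoc)
  ultimately show "y \<in> cM a" unfolding cM_def by blast
qed

lemma cM_subset_N: "a \<in> H \<Longrightarrow> cM a \<subseteq> N"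
  by (auto simp: cM_def)

lemma cM_memN [simp]: "\<lbrakk>y \<in> cM a; a \<in> H\<rbrakk> \<Longrightarrow> y \<in> N"
  using cM_subset_N by blast

lemma cM_one [simp]: "a \<in> H \<Longrightarrow> \<one> \<in> cM a"
  by (simp add: mem_cM subgroup.one_closed[OF M_subgroup])

lemma cM_mult:
  assumes "a \<in> H" "y \<in> cM a" "z \<in> cM a"
  shows "y \<otimes> z \<in> cM a"
proof -
  have N: "y \<in> N" "z \<in> N" using assms by auto
  have "inv a \<otimes> (y \<otimes> z) \<otimes> a = (inv a \<otimes> y \<otimes> a) \<otimes> (inv a \<otimes> z \<otimes> a)"
    using assms(1) N by (simp add: m_assoc)
  then show ?thesis
    using assms N by (simp add: mem_cM subgroup.m_closed[OF M_subgroup])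
qed

lemma cM_inv:
  assumes "a \<in> H" "y \<in> cM a"
  shows "inv y \<in> cM a"
proof -
  have N: "y \<in> N" using assms by auto
  have "inv (inv a \<otimes> y \<otimes> a) = inv a \<otimes> inv y \<otimes> a"
    using assms(1) N by (simp add: inv_mult_group m_assoc)
  then show ?thesis
    using assms N subgroup.m_inv_closed[OF M_subgroup, of "inv a \<otimes> y \<otimes> a"] by (simp add: mem_cM)
qed

lemma cM_conj_N:
  assumes "a \<in> H" "n \<in> N" "y \<in> cM a"
  shows "n \<otimes> y \<otimes> inv n \<in> cM a"
proof -
  have N: "y \<in> N" using assms by auto
  let ?n = "inv a \<otimes> n \<otimes> a"
  have n: "?n \<in> N" using conj_N[of "inv a" n] assms by simp
  have "inv a \<otimes> (n \<otimes> y \<otimes> inv n) \<otimes> a = ?n \<otimes> (inv a \<otimes> y \<otimes> a) \<otimes> inv ?n"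
    using assms(1,2) N by (simp add: inv_mult_group m_assoc)
  then show ?thesis
    using conj_M[OF n, of "inv a \<otimes> y \<otimes> a"] assms N by (simp add: mem_cM)
qed

lemma mem_cM_conj:
  assumes "a \<in> H" "h \<in> H" "y \<in> N"
  shows "y \<in> cM (h \<otimes> a) \<longleftrightarrow> inv h \<otimes> y \<otimes> h \<in> cM a"
proof -
  have "inv h \<otimes> y \<otimes> h \<in> N" using conj_N[of "inv h" y] assms by simp
  moreover have "inv (h \<otimes> a) \<otimes> y \<otimes> (h \<otimes> a) = inv a \<otimes> (inv h \<otimes> y \<otimes> h) \<otimes> a"
    using assms by (simp add: inv_mult_group m_assoc)
  ultimately show ?thesis
    using mem_cM[of "h \<otimes> a" y] mem_cM[of a "inv h \<otimes> y \<otimes> h"] assms by (simp only: H_simps)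
qed

definition bset :: "'g \<Rightarrow> 'g set" where
  "bset g = act g ` M"

lemma bset_subset_N: "g \<in> carrier G \<Longrightarrow> bset g \<subseteq> N"
  by (auto simp: bset_def)

lemma bset_one: "bset \<one> = M"
  by (force simp: bset_def)

lemma mem_bset_act:
  assumes "g \<in> carrier G" "s \<in> carrier G" "y \<in> N"
  shows "y \<in> bset (s \<otimes> g) \<longleftrightarrow> act (inv s) y \<in> bset g"
proof
  assume "y \<in> bset (s \<otimes> g)"
  then obtain m where "m \<in> M" "y = act (s \<otimes> g) m" by (auto simp: bset_def)
  then show "act (inv s) y \<in> bset g" using assms by (simp add: act_mult bset_def)
next
  assume "act (inv s) y \<in> bset g"
  then obtain m where "m \<in> M" "act (inv s) y = act g m" by (auto simp: bset_def)
  then have "y = act (s \<otimes> g) m" using assms by (metis M_closed act_inv' act_mult)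
  then show "y \<in> bset (s \<otimes> g)" using \<open>m \<in> M\<close> by (simp add: bset_def)
qed

lemma mem_bset:
  assumes "x \<in> N" "a \<in> H" "y \<in> N"
  shows "y \<in> bset (x \<otimes> a) \<longleftrightarrow> inv x \<otimes> y \<in> cM a"
proof
  assume "y \<in> bset (x \<otimes> a)"
  then obtain s where "s \<in> M" "y = x \<otimes> (a \<otimes> s \<otimes> inv a)" using assms by (auto simp: bset_def act_eq')
  then show "inv x \<otimes> y \<in> cM a" using assms by (auto simp: cM_def simp flip: m_assoc)
next
  assume "inv x \<otimes> y \<in> cM a"
  then obtain s where s: "s \<in> M" "inv x \<otimes> y = a \<otimes> s \<otimes> inv a" by (auto simp: cM_def)
  then have "y = x \<otimes> (a \<otimes> s \<otimes> inv a)" using assms by (metis N_closed inv_solve_left m_closed N_simps(2) inv_inv)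
  then show "y \<in> bset (x \<otimes> a)" using s assms by (auto simp: bset_def act_eq' image_iff intro!: bexI[of _ s])
qed

lemma bset_eq_coset: "\<lbrakk>x \<in> N; a \<in> H\<rbrakk> \<Longrightarrow> bset (x \<otimes> a) = x <# cM a"
  unfolding bset_def cM_def l_coset_def by (auto simp: act_eq')

lemma coset_indicators_eq: "coset_indicators G N H M = (\<lambda>g. indicator (bset g) :: 'g \<Rightarrow> complex) ` carrier G"
proof (rule subset_antisym; rule subsetI)
  fix f :: "'g \<Rightarrow> complex" assume "f \<in> coset_indicators G N H M"
  then obtain x a where "x \<in> N" "a \<in> H" "f = indicator (x <# cM a)"
    unfolding coset_indicators_def conj_family_eq by blast
  then show "f \<in> (\<lambda>g. indicator (bset g)) ` carrier G"
    by (intro image_eqI[of _ _ "x \<otimes> a"]) (simp_all add: bset_eq_coset)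
next
  fix f :: "'g \<Rightarrow> complex" assume "f \<in> (\<lambda>g. indicator (bset g)) ` carrier G"
  then obtain g where g: "g \<in> carrier G" "f = indicator (bset g)" by blast
  obtain x a where "x \<in> N" "a \<in> H" "g = x \<otimes> a" using g(1) by (rule decompose)
  then show "f \<in> coset_indicators G N H M"
    unfolding coset_indicators_def conj_family_eq using g by (auto simp: bset_eq_coset)
qed

lemma bset_eq_or_disjoint:
  assumes "x \<in> N" "x' \<in> N" "a \<in> H"
  shows "bset (x \<otimes> a) = bset (x' \<otimes> a) \<or> bset (x \<otimes> a) \<inter> bset (x' \<otimes> a) = {}"
proof -
  have sub: "bset (x \<otimes> a) \<subseteq> bset (x' \<otimes> a)"
    if z: "z \<in> bset (x \<otimes> a)" "z \<in> bset (x' \<otimes> a)" and x: "x \<in> N" "x' \<in> N" for x x' z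
  proof
    fix y assume y: "y \<in> bset (x \<otimes> a)"
    have N: "y \<in> N" "z \<in> N" using y z bset_subset_N[of "x \<otimes> a"] x assms(3) by auto
    have "inv x' \<otimes> y = (inv x' \<otimes> z) \<otimes> inv (inv x \<otimes> z) \<otimes> (inv x \<otimes> y)"
      using N x by (simp add: inv_mult_group m_assoc)
    also have "\<dots> \<in> cM a"
      using y z N x assms(3) by (intro cM_mult[OF _ cM_mult] cM_inv[of a "inv x \<otimes> z"]) (simp_all add: mem_bset)
    finally show "y \<in> bset (x' \<otimes> a)" using N x assms(3) by (simp add: mem_bset)
  qed
  show ?thesis
    using sub[of _ x x'] sub[of _ x' x] assms by blast
qed

lemma bset_self: "\<lbrakk>x \<in> N; a \<in> H\<rbrakk> \<Longrightarrow> x \<in> bset (x \<otimes> a)"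
  by (simp add: mem_bset)

lemma bset_eq_if_mem: "\<lbrakk>x \<in> N; a \<in> H; y \<in> bset (x \<otimes> a)\<rbrakk> \<Longrightarrow> bset (y \<otimes> a) = bset (x \<otimes> a)"
  using bset_eq_or_disjoint[of y x a] bset_self[of y a] bset_subset_N[of "x \<otimes> a"] by auto

lemma common_subgroup:
  assumes "finite F" "F \<subseteq> H"
  shows "\<exists>b\<in>H. \<forall>a\<in>F. cM b \<subseteq> cM a"
  using assms
proof (induction F rule: finite_induct)
  case empty
  then show ?case using H_simps(3) by blast
next
  case (insert a F)
  then obtain b where b: "b \<in> H" "\<forall>a\<in>F. cM b \<subseteq> cM a" by auto
  have "\<exists>W\<in>conj_family G H M. W \<subseteq> cM a \<inter> cM b"
    using insert.prems b by (intro filter_base) (auto simp: conj_family_eq)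
  then obtain c where "c \<in> H" "cM c \<subseteq> cM a \<inter> cM b" by (auto simp: conj_family_eq)
  then show ?case using b(2) by (intro bexI[of _ c]) auto
qed

lemma finite_coset_cover:
  assumes fin: "finite_quotients G H M" and ab: "a \<in> H" "b \<in> H" "cM b \<subseteq> cM a"
  shows "\<exists>C. finite C \<and> C \<subseteq> cM a \<and> (\<forall>y\<in>cM a. \<exists>c\<in>C. inv c \<otimes> y \<in> cM b)"
proof -
  have "finite (carrier (G\<lparr>carrier := cM a\<rparr> Mod cM b))"
    using fin ab unfolding finite_quotients_def conj_family_eq by blast
  then have fin: "finite ((\<lambda>u. cM b #> u) ` cM a)"
    by (auto simp: FactGroup_def RCOSETS_def r_coset_def image_def elim!: rev_finite_subset)
  then obtain C where C: "finite C" "C \<subseteq> cM a" "(\<lambda>u. cM b #> u) ` C = (\<lambda>u. cM b #> u) ` cM a"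
    by (metis finite_subset_image order_refl)
  have "\<exists>c\<in>C. inv c \<otimes> y \<in> cM b" if y: "y \<in> cM a" for y
  proof -
    obtain c where c: "c \<in> C" "cM b #> y = cM b #> c" using C(3) y by (metis imageE imageI)
    have N: "y \<in> N" "c \<in> N" using y c C ab by auto
    have "y \<in> cM b #> y" using N ab by (force simp: r_coset_def)
    then obtain w where w: "w \<in> cM b" "y = w \<otimes> c" using c by (auto simp: r_coset_def)
    then have "inv c \<otimes> y = inv c \<otimes> w \<otimes> inv (inv c)" using N ab by (simp add: m_assoc)
    also have "\<dots> \<in> cM b" using w N ab by (intro cM_conj_N) auto
    finally show ?thesis using c by blast
  qed
  then show ?thesis using C by blast
qed

text \<open>
  By the filter base property some group \<open>cM b\<close> is contained in all groups whose cosets occur in \<open>F\<close>, and it has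
  finite index in each of them.
\<close>

lemma common_partition:
  assumes fin: "finite_quotients G H M" and F: "finite F" "F \<subseteq> carrier G"
  obtains K where "finite K" "K \<subseteq> carrier G"
    "\<And>k k'. k \<in> K \<Longrightarrow> k' \<in> K \<Longrightarrow> k \<noteq> k' \<Longrightarrow> bset k \<inter> bset k' = {}"
    "\<And>g. g \<in> F \<Longrightarrow> \<exists>L\<subseteq>K. bset g = (\<Union>k\<in>L. bset k)"
proof -
  have "\<forall>g\<in>F. \<exists>x a. x \<in> N \<and> a \<in> H \<and> g = x \<otimes> a" using F(2) decompose by (metis subsetD)
  then obtain px pa where dec: "\<And>g. g \<in> F \<Longrightarrow> px g \<in> N \<and> pa g \<in> H \<and> g = px g \<otimes> pa g" by metis
  have "pa ` F \<subseteq> H" using dec by blast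
  then obtain b where b: "b \<in> H" "\<And>g. g \<in> F \<Longrightarrow> cM b \<subseteq> cM (pa g)"
    using common_subgroup[of "pa ` F"] F(1) by auto
  have "\<forall>g\<in>F. \<exists>C. finite C \<and> C \<subseteq> cM (pa g) \<and> (\<forall>y\<in>cM (pa g). \<exists>c\<in>C. inv c \<otimes> y \<in> cM b)"
    using finite_coset_cover[OF fin _ b(1) b(2)] dec by blast
  then obtain C where C: "\<And>g. g \<in> F \<Longrightarrow> finite (C g) \<and> C g \<subseteq> cM (pa g)"
    "\<And>g y. g \<in> F \<Longrightarrow> y \<in> cM (pa g) \<Longrightarrow> \<exists>c\<in>C g. inv c \<otimes> y \<in> cM b" by metis
  define X where "X = (\<Union>g\<in>F. (\<lambda>c. px g \<otimes> c) ` C g)"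
  have X: "finite X" using F C by (auto simp: X_def)
  have XN: "X \<subseteq> N" using C dec cM_memN unfolding X_def by (smt (verit) N_simps(1) UN_E imageE subsetD subsetI)
  have sub: "bset (px g \<otimes> c \<otimes> b) \<subseteq> bset g" if g: "g \<in> F" and c: "c \<in> C g" for g c
  proof
    fix y assume y: "y \<in> bset (px g \<otimes> c \<otimes> b)"
    have d: "px g \<in> N" "pa g \<in> H" "g = px g \<otimes> pa g" using dec[OF g] by auto
    have cc: "c \<in> cM (pa g)" "c \<in> N" using C(1)[OF g] c d by auto
    have yN: "y \<in> N" using y bset_subset_N[of "px g \<otimes> c \<otimes> b"] d cc b(1) by auto
    have "inv (px g \<otimes> c) \<otimes> y \<in> cM b" using y yN d cc b(1) by (simp add: mem_bset)
    then have "c \<otimes> (inv (px g \<otimes> c) \<otimes> y) \<in> cM (pa g)" using b(2)[OF g] cc d by (intro cM_mult[of "pa g" c "inv (px g \<otimes> c) \<otimes> y"]) auto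
    also have "c \<otimes> (inv (px g \<otimes> c) \<otimes> y) = inv (px g) \<otimes> y"
      using d cc yN by (simp add: inv_mult_group m_assoc)
    finally have "y \<in> bset (px g \<otimes> pa g)" using d(1,2) yN by (simp add: mem_bset)
    then show "y \<in> bset g" by (simp only: d(3)[symmetric])
  qed
  have cover: "\<exists>x\<in>X. y \<in> bset (x \<otimes> b) \<and> bset (x \<otimes> b) \<subseteq> bset g" if g: "g \<in> F" and y: "y \<in> bset g" for g y
  proof -
    have d: "px g \<in> N" "pa g \<in> H" "g = px g \<otimes> pa g" using dec[OF g] by auto
    have yN: "y \<in> N" using y bset_subset_N[of g] g F by auto
    have "inv (px g) \<otimes> y \<in> cM (pa g)" using y yN d by (metis mem_bset)
    then obtain c where c: "c \<in> C g" "inv c \<otimes> (inv (px g) \<otimes> y) \<in> cM b" using C(2)[OF g] by blast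
    have cN: "c \<in> N" using C(1)[OF g] c d by auto
    have "inv (px g \<otimes> c) \<otimes> y \<in> cM b" using c d cN yN by (simp add: inv_mult_group m_assoc)
    then have "y \<in> bset (px g \<otimes> c \<otimes> b)" using d cN yN b(1) by (simp add: mem_bset)
    moreover have "px g \<otimes> c \<in> X" using g c by (auto simp: X_def)
    ultimately show ?thesis using sub[OF g c(1)] by blast
  qed
  \<comment> \<open>One representative for each coset.\<close>
  let ?f = "\<lambda>x. bset (x \<otimes> b)"
  have "\<exists>Y\<subseteq>X. inj_on ?f Y \<and> ?f ` X = ?f ` Y" by (simp only: subset_image_inj[symmetric] order_refl)
  then obtain Y where Y: "Y \<subseteq> X" "inj_on ?f Y" "?f ` Y = ?f ` X" by auto
  show thesis
  proof (rule that[of "(\<lambda>x. x \<otimes> b) ` Y"])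
    show "finite ((\<lambda>x. x \<otimes> b) ` Y)" using X Y finite_subset by blast
    show "(\<lambda>x. x \<otimes> b) ` Y \<subseteq> carrier G" using XN Y b(1) by auto
    fix k k' assume "k \<in> (\<lambda>x. x \<otimes> b) ` Y" "k' \<in> (\<lambda>x. x \<otimes> b) ` Y" "k \<noteq> k'"
    then obtain x x' where x: "x \<in> Y" "x' \<in> Y" "k = x \<otimes> b" "k' = x' \<otimes> b" "x \<noteq> x'" by auto
    then have "bset k \<noteq> bset k'" using Y(2) by (auto simp: inj_on_def)
    then show "bset k \<inter> bset k' = {}" using bset_eq_or_disjoint[of x x' b] x XN Y(1) b(1) by auto
  next
    fix g assume g: "g \<in> F"
    let ?L = "{k \<in> (\<lambda>x. x \<otimes> b) ` Y. bset k \<subseteq> bset g}"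
    have "y \<in> (\<Union>k\<in>?L. bset k)" if y: "y \<in> bset g" for y
    proof -
      obtain x where x: "x \<in> X" "y \<in> bset (x \<otimes> b)" "bset (x \<otimes> b) \<subseteq> bset g" using cover[OF g y] by blast
      then obtain x' where "x' \<in> Y" "bset (x' \<otimes> b) = bset (x \<otimes> b)" using Y(3) by (metis (no_types, lifting) imageE imageI)
      then show ?thesis using x by auto
    qed
    then show "\<exists>L\<subseteq>(\<lambda>x. x \<otimes> b) ` Y. bset g = (\<Union>k\<in>L. bset k)"
      by (intro exI[of _ ?L]) auto
  qed
qed

text \<open>
  Effectiveness makes the action topologically free: an element \<open>x a \<noteq> \<one>\<close> that fixes every point of a
  coset of \<open>cM b\<close> would have \<open>a\<close> commute with \<open>cM b\<close>, so that \<open>a = \<one>\<close> and then \<open>x = \<one>\<close>.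
\<close>

lemma moved_point:
  assumes eff: "acts_effectively G H M" and g: "g \<in> carrier G" "g \<noteq> \<one>" and y: "y \<in> N" and b: "b \<in> H"
  shows "\<exists>z\<in>bset (y \<otimes> b). act g z \<noteq> z"
proof (rule ccontr)
  assume no: "\<not> ?thesis"
  obtain x a where d: "x \<in> N" "a \<in> H" "g = x \<otimes> a" using g(1) by (rule decompose)
  have fix_y: "x \<otimes> (a \<otimes> y \<otimes> inv a) = y"
    using no bset_self[OF y b] act_eq'[OF d(1,2) y] d by auto
  have comm: "a \<otimes> w \<otimes> inv a = w" if w: "w \<in> cM b" for w
  proof -
    have wN: "w \<in> N" using w b by simp
    have "y \<otimes> w \<in> bset (y \<otimes> b)" using y b w wN by (simp add: mem_bset m_assoc[symmetric])
    then have "x \<otimes> (a \<otimes> (y \<otimes> w) \<otimes> inv a) = y \<otimes> w" using no d y wN act_eq'[of x a "y \<otimes> w"] by auto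
    moreover have "x \<otimes> (a \<otimes> (y \<otimes> w) \<otimes> inv a) = (x \<otimes> (a \<otimes> y \<otimes> inv a)) \<otimes> (a \<otimes> w \<otimes> inv a)"
      using d y wN by (simp add: m_assoc)
    ultimately have "inv y \<otimes> (y \<otimes> (a \<otimes> w \<otimes> inv a)) = inv y \<otimes> (y \<otimes> w)" by (simp add: fix_y)
    then show ?thesis using y wN d by simp
  qed
  let ?c = "inv b \<otimes> a \<otimes> b"
  have c: "?c \<in> H" using b d by simp
  have "?c \<otimes> s \<otimes> inv ?c = s" if s: "s \<in> M" for s
  proof -
    have sN: "s \<in> N" using s by simp
    have "?c \<otimes> s \<otimes> inv ?c = inv b \<otimes> (a \<otimes> (b \<otimes> s \<otimes> inv b) \<otimes> inv a) \<otimes> b"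
      using b d sN by (simp add: inv_mult_group m_assoc)
    also have "a \<otimes> (b \<otimes> s \<otimes> inv b) \<otimes> inv a = b \<otimes> s \<otimes> inv b"
      using s by (intro comm) (simp add: cM_def)
    also have "inv b \<otimes> (b \<otimes> s \<otimes> inv b) \<otimes> b = s"
      using b sN by (simp add: m_assoc)
    finally show ?thesis .
  qed
  then have "?c = \<one>" using eff c unfolding acts_effectively_def by blast
  then have "b \<otimes> ?c \<otimes> inv b = \<one>" using b by simp
  then have a1: "a = \<one>" using b d by (simp add: m_assoc)
  then have "x \<otimes> y = y" using fix_y d y by simp
  then have "x = \<one>" using d y by simp
  then show False using g d a1 by simp
qed

text \<open>
  A point that is moved by \<open>g\<close> is separated from its image by the cosets of some group \<open>cM c\<close>; passing to a
  smaller group makes the whole coset of the point move.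
\<close>

lemma moved_coset:
  assumes eff: "acts_effectively G H M" and g: "g \<in> carrier G" "g \<noteq> \<one>" and k: "k \<in> carrier G"
  shows "\<exists>k'\<in>carrier G. bset k' \<subseteq> bset k \<and> bset (g \<otimes> k') \<inter> bset k' = {}"
proof -
  obtain y b where kd: "y \<in> N" "b \<in> H" "k = y \<otimes> b" using k by (rule decompose)
  obtain x a where d: "x \<in> N" "a \<in> H" "g = x \<otimes> a" using g(1) by (rule decompose)
  obtain z where z: "z \<in> bset k" "act g z \<noteq> z" using moved_point[OF eff g kd(1,2)] kd by blast
  have zN: "z \<in> N" using z bset_subset_N[OF k] by blast
  let ?w = "inv z \<otimes> act g z"
  have w: "?w \<in> N" "?w \<noteq> \<one>"
  proof -
    show "?w \<noteq> \<one>"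
    proof
      assume "?w = \<one>"
      then have "z \<otimes> ?w = z" using zN by simp
      moreover have "z \<otimes> ?w = act g z" using zN g(1) by (simp flip: m_assoc)
      ultimately show False using z by simp
    qed
  qed (use zN g in simp)
  then obtain c where c: "c \<in> H" "?w \<notin> cM c" using separating unfolding conj_family_eq by blast
  obtain e where e: "e \<in> H" "cM e \<subseteq> cM c" "cM e \<subseteq> cM b" "cM e \<subseteq> cM (inv a \<otimes> c)"
    using common_subgroup[of "{c, b, inv a \<otimes> c}"] c kd d by auto
  have ze: "bset (z \<otimes> e) \<subseteq> bset k"
  proof
    fix v assume v: "v \<in> bset (z \<otimes> e)"
    have vN: "v \<in> N" using v bset_subset_N[of "z \<otimes> e"] zN e by auto
    have "v \<in> bset (z \<otimes> b)" using v vN zN e kd by (auto simp: mem_bset)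
    then show "v \<in> bset k" using bset_eq_if_mem[of y b z] z kd by simp
  qed
  have "bset (g \<otimes> (z \<otimes> e)) \<inter> bset (z \<otimes> e) = {}"
  proof (rule ccontr)
    assume "\<not> ?thesis"
    then obtain v where v: "v \<in> bset (g \<otimes> (z \<otimes> e))" "v \<in> bset (z \<otimes> e)" by blast
    have vN: "v \<in> N" using v bset_subset_N[of "z \<otimes> e"] zN e by auto
    have v2: "inv z \<otimes> v \<in> cM c" using v vN zN e by (auto simp: mem_bset)
    have "act (inv g) v \<in> bset (z \<otimes> e)" using v(1) vN zN e g by (simp add: mem_bset_act)
    then have u: "inv z \<otimes> act (inv g) v \<in> cM e" using vN zN e g by (simp add: mem_bset)
    define u where "u = inv z \<otimes> act (inv g) v"
    have uN: "u \<in> N" using u e by (simp add: u_def)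
    have "v = act g (z \<otimes> u)" using vN zN g(1) by (simp add: u_def flip: m_assoc)
    also have "\<dots> = act g z \<otimes> (a \<otimes> u \<otimes> inv a)"
      using d zN uN by (simp add: act_eq' m_assoc)
    finally have vv: "v = act g z \<otimes> (a \<otimes> u \<otimes> inv a)" .
    have auN: "a \<otimes> u \<otimes> inv a \<in> N" using d uN by simp
    have "u \<in> cM (inv a \<otimes> c)" using u e by (auto simp: u_def)
    then have au: "a \<otimes> u \<otimes> inv a \<in> cM c" using mem_cM_conj[of c "inv a" u] c d uN by simp
    have "?w = (inv z \<otimes> v) \<otimes> inv (a \<otimes> u \<otimes> inv a)"
      using vv zN g(1) auN by (simp add: m_assoc)
    also have "\<dots> \<in> cM c" by (rule cM_mult[OF c(1) v2 cM_inv[OF c(1) au]])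
    finally show False using c by simp
  qed
  then show ?thesis using ze zN e by (intro bexI[of _ "z \<otimes> e"]) auto
qed

lemma free_coset:
  assumes eff: "acts_effectively G H M" and F: "finite F" "F \<subseteq> carrier G - {\<one>}" and k: "k \<in> carrier G"
  shows "\<exists>k'\<in>carrier G. bset k' \<subseteq> bset k \<and> (\<forall>g\<in>F. bset (g \<otimes> k') \<inter> bset k' = {})"
  using F
proof (induction F rule: finite_induct)
  case empty
  then show ?case using k by blast
next
  case (insert g F)
  then obtain k1 where k1: "k1 \<in> carrier G" "bset k1 \<subseteq> bset k" "\<And>g. g \<in> F \<Longrightarrow> bset (g \<otimes> k1) \<inter> bset k1 = {}"
    by blast
  obtain k2 where k2: "k2 \<in> carrier G" "bset k2 \<subseteq> bset k1" "bset (g \<otimes> k2) \<inter> bset k2 = {}"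
    using moved_coset[OF eff _ _ k1(1), of g] insert.prems by auto
  have mono: "bset (h \<otimes> k2) \<subseteq> bset (h \<otimes> k1)" if h: "h \<in> carrier G" for h
  proof
    fix y assume y: "y \<in> bset (h \<otimes> k2)"
    have "y \<in> N" using y bset_subset_N[of "h \<otimes> k2"] h k2 by auto
    then show "y \<in> bset (h \<otimes> k1)" using y h k1 k2 by (auto simp: mem_bset_act)
  qed
  have "bset (h \<otimes> k2) \<inter> bset k2 = {}" if "h \<in> insert g F" for h
    using that k2 k1(3)[of h] mono[of h] insert.prems by (cases "h = g") blast+
  then show ?case using k1 k2 by (intro bexI[of _ k2]) auto
qed

end

section \<open>The algebra of coset indicators\<close>

inductive_set cspan :: "'a::complex_star_algebra set \<Rightarrow> 'a set" for X where
  cspan_0: "0 \<in> cspan X"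
| cspan_step: "\<lbrakk>x \<in> X; y \<in> cspan X\<rbrakk> \<Longrightarrow> c \<odot> x + y \<in> cspan X"

lemma cspan_base: "x \<in> X \<Longrightarrow> x \<in> cspan X"
  using cspan_step[OF _ cspan_0, of x X 1] by simp

lemma cspan_add: "x \<in> cspan X \<Longrightarrow> y \<in> cspan X \<Longrightarrow> x + y \<in> cspan X"
  by (induction rule: cspan.induct) (auto simp: add.assoc intro: cspan_step)

lemma cspan_scl: "x \<in> cspan X \<Longrightarrow> c \<odot> x \<in> cspan X"
  by (induction rule: cspan.induct) (auto simp: scl_add_right intro: cspan_0 cspan_step)

lemma cspan_sum: "(\<And>i. i \<in> I \<Longrightarrow> f i \<in> cspan X) \<Longrightarrow> sum f I \<in> cspan X"
  by (induction I rule: infinite_finite_induct) (auto intro: cspan_0 cspan_add)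

lemma cspan_least:
  assumes "X \<subseteq> L" "0 \<in> L" "\<And>x y. x \<in> L \<Longrightarrow> y \<in> L \<Longrightarrow> x + y \<in> L" "\<And>c x. x \<in> L \<Longrightarrow> c \<odot> x \<in> L"
  shows "cspan X \<subseteq> L"
proof
  fix x assume "x \<in> cspan X"
  then show "x \<in> L" by (induction rule: cspan.induct) (use assms in auto)
qed

lemma cspan_subset_cspan: "X \<subseteq> cspan Y \<Longrightarrow> cspan X \<subseteq> cspan Y"
  by (rule cspan_least) (auto intro: cspan_0 cspan_add cspan_scl)

lemma star_sub_cspan:
  assumes mult: "\<And>x y. x \<in> X \<Longrightarrow> y \<in> X \<Longrightarrow> x * y \<in> cspan X" and adj: "\<And>x. x \<in> X \<Longrightarrow> adj x \<in> cspan X"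
  shows "star_sub (cspan X)"
proof
  have 1: "x * y \<in> cspan X" if x: "x \<in> X" and y: "y \<in> cspan X" for x y
    using y by (induction rule: cspan.induct) (auto simp: distrib_left intro: cspan_0 cspan_add cspan_scl mult x)
  show "x * y \<in> cspan X" if "x \<in> cspan X" "y \<in> cspan X" for x y
    using that by (induction rule: cspan.induct) (auto simp: distrib_right intro: cspan_0 cspan_add cspan_scl 1)
  show "adj x \<in> cspan X" if "x \<in> cspan X" for x
    using that by (induction rule: cspan.induct) (auto intro: cspan_0 cspan_add cspan_scl adj)
qed (auto intro: cspan_0 cspan_add cspan_scl)

lemma (in represented) sa_span_eq:
  assumes X: "X \<subseteq> C"
  shows "sa_span S (t ` X) = t ` cspan X"
proof
  have sub: "cspan X \<subseteq> C" using X by (intro cspan_least) auto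
  have "linear_subspace S (t ` cspan X)"
    unfolding linear_subspace_iff[OF sub] by (auto intro: cspan_0 cspan_add cspan_scl)
  moreover have "t ` X \<subseteq> t ` cspan X" by (auto intro: cspan_base)
  ultimately show "sa_span S (t ` X) \<subseteq> t ` cspan X" unfolding sa_span_def by blast
  show "t ` cspan X \<subseteq> sa_span S (t ` X)"
    unfolding sa_span_def
  proof (intro Inter_greatest subsetI)
    fix L b assume "L \<in> {L. linear_subspace S L \<and> t ` X \<subseteq> L}" and "b \<in> t ` cspan X"
    then obtain a where L: "linear_subspace S L" "t ` X \<subseteq> L" and a: "a \<in> cspan X" "b = t a" by blast
    have "t a \<in> L" using a(1)
    proof (induction rule: cspan.induct)
      case cspan_0
      then show ?case using L(1) by (simp add: linear_subspace_def rep_zero)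
    next
      case (cspan_step x y c)
      have "x \<in> C" "y \<in> C" using cspan_step X sub by auto
      moreover have "sa_add S (sa_scale S c (t x)) (t y) \<in> L"
        using L cspan_step unfolding linear_subspace_def by blast
      ultimately show ?case by (simp add: rep_scale rep_add)
    qed
    then show "b \<in> L" by (simp add: a)
  qed
qed

definition linf :: "'g set \<Rightarrow> ('g \<Rightarrow> complex) set" where
  "linf N = carrier (ell_infinity N)"

definition supn :: "'g set \<Rightarrow> ('g \<Rightarrow> complex) \<Rightarrow> real" where
  "supn N = sa_norm (ell_infinity N)"

lemma mem_linf: "f \<in> linf N \<longleftrightarrow> bounded (f ` N) \<and> (\<forall>y. y \<notin> N \<longrightarrow> f y = 0)"
  and supn_eq: "supn N f = (SUP y\<in>N. cmod (f y))"
  by (simp_all add: linf_def supn_def ell_infinity_def)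

lemma linfI: "\<lbrakk>\<And>y. y \<notin> N \<Longrightarrow> f y = 0; \<And>y. y \<in> N \<Longrightarrow> cmod (f y) \<le> c\<rbrakk> \<Longrightarrow> f \<in> linf N"
  unfolding mem_linf by (auto intro!: boundedI)

lemma cmod_le_supn: "\<lbrakk>f \<in> linf N; y \<in> N\<rbrakk> \<Longrightarrow> cmod (f y) \<le> supn N f"
proof -
  assume f: "f \<in> linf N" "y \<in> N"
  then obtain c where "\<forall>x\<in>f ` N. cmod x \<le> c" unfolding mem_linf bounded_iff by blast
  then have "bdd_above ((\<lambda>y. cmod (f y)) ` N)" by (intro bdd_aboveI2[where M = c]) auto
  then show ?thesis unfolding supn_eq using f by (intro cSUP_upper)
qed

lemma supn_le: "\<lbrakk>N \<noteq> {}; \<And>y. y \<in> N \<Longrightarrow> cmod (f y) \<le> c\<rbrakk> \<Longrightarrow> supn N f \<le> c"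
  unfolding supn_eq by (rule cSUP_least)

lemma star_sub_linf: "star_sub (linf N)"
proof
  fix f h :: "'a \<Rightarrow> complex" and c
  show "0 \<in> (linf N)" by (rule linfI[where c = 0]) auto
  assume f: "f \<in> linf N"
  then have f0: "\<And>y. y \<notin> N \<Longrightarrow> f y = 0" by (simp add: mem_linf)
  show "c \<odot> f \<in> linf N"
    by (rule linfI[where c = "cmod c * supn N f"])
       (use f f0 in \<open>auto simp: scl_complex_def norm_mult intro!: mult_left_mono cmod_le_supn\<close>)
  show "adj f \<in> linf N"
    by (rule linfI[where c = "supn N f"]) (use f f0 in \<open>auto simp: adj_complex_def intro!: cmod_le_supn\<close>)
  assume h: "h \<in> linf N"
  then have h0: "\<And>y. y \<notin> N \<Longrightarrow> h y = 0" by (simp add: mem_linf)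
  show "f + h \<in> linf N"
    by (rule linfI[where c = "supn N f + supn N h"])
       (use f h f0 h0 in \<open>auto intro!: order_trans[OF norm_triangle_ineq] add_mono cmod_le_supn\<close>)
  show "f * h \<in> linf N"
    by (rule linfI[where c = "supn N f * supn N h"])
       (use f h f0 h0 in \<open>auto simp: norm_mult intro!: mult_mono cmod_le_supn order_trans[OF norm_ge_zero cmod_le_supn]\<close>)
qed

lemma represented_linf: "represented (linf N) (ell_infinity N) (\<lambda>f. f)"
proof (intro represented.intro star_sub_linf represented_axioms.intro)
qed (auto simp: linf_def ell_infinity_def fun_eq_iff scl_complex_def adj_complex_def inj_on_def)

lemma cstar_complete_linf:
  assumes N: "N \<noteq> {}"
  shows "cstar_complete (linf N) (supn N)"
proof -
  interpret star_sub "linf N" by (rule star_sub_linf)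
  obtain y0 where y0: "y0 \<in> N" using N by blast
  have nn: "0 \<le> supn N f" if "f \<in> linf N" for f
    by (rule order_trans[OF norm_ge_zero cmod_le_supn[OF that y0]])
  have semi: "cstar_seminormed (linf N) (supn N)"
  proof
    fix f h :: "'a \<Rightarrow> complex" and c
    assume f: "f \<in> linf N"
    note fb = cmod_le_supn[OF f]
    show "0 \<le> supn N f" by (rule nn[OF f])
    have le: "supn N (c \<odot> f) \<le> cmod c * supn N f" if "f \<in> linf N" for c f
      by (rule supn_le[OF N]) (use cmod_le_supn[OF that] in \<open>auto simp: scl_complex_def norm_mult intro!: mult_left_mono\<close>)
    show "supn N (c \<odot> f) = cmod c * supn N f"
    proof (cases "c = 0")
      case True
      then show ?thesis using le[OF f, of 0] nn[of "0 \<odot> f"] by simp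
    next
      case False
      have "supn N f = supn N ((1 / c) \<odot> c \<odot> f)" using False by simp
      also have "\<dots> \<le> cmod (1 / c) * supn N (c \<odot> f)" using f by (intro le) auto
      finally have "cmod c * supn N f \<le> supn N (c \<odot> f)"
        using False by (simp add: norm_divide field_simps)
      then show ?thesis using le[OF f, of c] by simp
    qed
    show "supn N (adj f * f) = (supn N f)\<^sup>2"
    proof (rule antisym)
      show "supn N (adj f * f) \<le> (supn N f)\<^sup>2"
        by (rule supn_le[OF N]) (use fb nn[OF f] in \<open>auto simp: adj_complex_def norm_mult power2_eq_square intro!: mult_mono\<close>)
      have aa: "adj f * f \<in> linf N" using f by auto
      have "supn N f \<le> sqrt (supn N (adj f * f))"
        by (rule supn_le[OF N], rule real_le_rsqrt)
           (use cmod_le_supn[OF aa] in \<open>auto simp: adj_complex_def norm_mult power2_eq_square\<close>)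
      then have "(supn N f)\<^sup>2 \<le> (sqrt (supn N (adj f * f)))\<^sup>2" using nn[OF f] by (intro power_mono)
      then show "(supn N f)\<^sup>2 \<le> supn N (adj f * f)" using nn[OF aa] by simp
    qed
    assume h: "h \<in> linf N"
    show "supn N (f + h) \<le> supn N f + supn N h"
      by (rule supn_le[OF N]) (use f h in \<open>auto intro!: order_trans[OF norm_triangle_ineq] add_mono cmod_le_supn\<close>)
    show "supn N (f * h) \<le> supn N f * supn N h"
      by (rule supn_le[OF N]) (use f h nn in \<open>auto simp: norm_mult intro!: mult_mono cmod_le_supn\<close>)
  qed
  interpret cstar_seminormed "linf N" "supn N" by (rule semi)
  show ?thesis
  proof
    fix f :: "'a \<Rightarrow> complex" assume f: "f \<in> linf N" "supn N f = 0"
    have "f y = 0" for y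
      using cmod_le_supn[OF f(1), of y] f by (cases "y \<in> N") (auto simp: mem_linf)
    then show "f = 0" by (simp add: fun_eq_iff)
  next
    fix X :: "nat \<Rightarrow> 'a \<Rightarrow> complex" assume X: "\<And>n. X n \<in> linf N" and cauchy: "cauchy_seq X"
    have C: "cmod (X m y - X n y) < e" if "supn N (X m - X n) < e" "y \<in> N" for m n e y
      using cmod_le_supn[OF diff_mem[OF X X], of y m n] that by simp
    have "\<exists>l. (\<lambda>n. X n y) \<longlonglongrightarrow> l" if y: "y \<in> N" for y
    proof -
      have "Cauchy (\<lambda>n. X n y)"
        by (rule metric_CauchyI) (use cauchy C[OF _ y] in \<open>unfold cauchy_seq_def dist_norm, meson\<close>)
      then show ?thesis by (simp add: Cauchy_convergent_iff convergent_def)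
    qed
    then obtain L0 where L0: "\<And>y. y \<in> N \<Longrightarrow> (\<lambda>n. X n y) \<longlonglongrightarrow> L0 y" by metis
    define L where "L y = (if y \<in> N then L0 y else 0)" for y
    have close: "cmod (X n y - L y) \<le> e"
      if K: "\<And>m n. m \<ge> K \<Longrightarrow> n \<ge> K \<Longrightarrow> supn N (X m - X n) < e" and n: "n \<ge> K" and y: "y \<in> N" for e K n y
    proof (rule LIMSEQ_le_const2)
      show "(\<lambda>m. cmod (X n y - X m y)) \<longlonglongrightarrow> cmod (X n y - L y)"
        using L0[OF y] y by (auto simp: L_def intro!: tendsto_intros)
      show "\<exists>M. \<forall>m\<ge>M. cmod (X n y - X m y) \<le> e" using C[OF K[OF n] y] less_imp_le by blast
    qed
    obtain K1 where K1: "\<And>m n. m \<ge> K1 \<Longrightarrow> n \<ge> K1 \<Longrightarrow> supn N (X m - X n) < 1"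
      using cauchy unfolding cauchy_seq_def by (meson zero_less_one)
    have L: "L \<in> linf N"
    proof (rule linfI[where c = "supn N (X K1) + 1"])
      fix y assume y: "y \<in> N"
      have "cmod (L y) \<le> cmod (X K1 y) + cmod (X K1 y - L y)"
        by (metis norm_minus_commute norm_triangle_sub)
      also have "\<dots> \<le> supn N (X K1) + 1" by (intro add_mono cmod_le_supn X y close[OF K1]) auto
      finally show "cmod (L y) \<le> supn N (X K1) + 1" .
    qed (simp add: L_def)
    have "(\<lambda>n. supn N (X n - L)) \<longlonglongrightarrow> 0"
    proof (rule LIMSEQ_I)
      fix e :: real assume e: "0 < e"
      then obtain K where K: "\<And>m n. m \<ge> K \<Longrightarrow> n \<ge> K \<Longrightarrow> supn N (X m - X n) < e / 2"
        using cauchy unfolding cauchy_seq_def by (meson half_gt_zero)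
      have "norm (supn N (X n - L) - 0) < e" if "n \<ge> K" for n
      proof -
        have "supn N (X n - L) \<le> e / 2" by (rule supn_le[OF N]) (use close[OF K that] in simp)
        then show ?thesis using e nn[of "X n - L"] X L by simp
      qed
      then show "\<exists>no. \<forall>n\<ge>no. norm (supn N (X n - L) - 0) < e" by blast
    qed
    then show "\<exists>x\<in>linf N. (\<lambda>n. supn N (X n - x)) \<longlonglongrightarrow> 0" using L by blast
  qed
qed

context semidirect_setting
begin

definition chi :: "'g \<Rightarrow> 'g \<Rightarrow> complex" where
  "chi g = indicator (bset g)"

abbreviation D0 :: "('g \<Rightarrow> complex) set" where "D0 \<equiv> D0_alg G N H M"
abbreviation D :: "('g \<Rightarrow> complex) set" where "D \<equiv> D_alg G N H M"

lemma chi_linf: "g \<in> carrier G \<Longrightarrow> chi g \<in> linf N"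
  using bset_subset_N[of g] by (intro linfI[where c = 1]) (auto simp: chi_def indicator_def)

lemma coset_indicators_chi: "coset_indicators G N H M = chi ` carrier G"
  unfolding coset_indicators_eq chi_def ..

lemma D0_eq: "D0 = cspan (chi ` carrier G)"
proof -
  interpret represented "linf N" "ell_infinity N" "\<lambda>f. f" by (rule represented_linf)
  have "sa_span (ell_infinity N) ((\<lambda>f. f) ` chi ` carrier G) = (\<lambda>f. f) ` cspan (chi ` carrier G)"
    by (rule sa_span_eq) (auto intro: chi_linf)
  then show ?thesis by (simp add: D0_alg_def coset_indicators_chi)
qed

lemma D0_subset_linf: "D0 \<subseteq> linf N"
  unfolding D0_eq using star_sub_linf[of N] chi_linf
  by (intro cspan_least) (auto simp: star_sub_def)

lemma chi_D0 [simp]: "g \<in> carrier G \<Longrightarrow> chi g \<in> D0"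
  unfolding D0_eq by (intro cspan_base) auto

lemma D0_zero [simp]: "0 \<in> D0"
  and D0_add [simp]: "d \<in> D0 \<Longrightarrow> d' \<in> D0 \<Longrightarrow> d + d' \<in> D0"
  and D0_scl [simp]: "d \<in> D0 \<Longrightarrow> c \<odot> d \<in> D0"
  and D0_sum: "(\<And>i. i \<in> I \<Longrightarrow> f i \<in> D0) \<Longrightarrow> sum f I \<in> D0"
  unfolding D0_eq by (auto intro: cspan_0 cspan_add cspan_scl cspan_sum)

lemma sum_fun_apply: "(\<Sum>i\<in>I. f i) y = (\<Sum>i\<in>I. f i y :: complex)"
  by (induction I rule: infinite_finite_induct) simp_all

lemma sum_chi_disjoint:
  assumes L: "finite L" and disj: "\<And>k k'. k \<in> L \<Longrightarrow> k' \<in> L \<Longrightarrow> k \<noteq> k' \<Longrightarrow> bset k \<inter> bset k' = {}"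
  shows "(\<Sum>k\<in>L. c k * chi k y) = (if \<exists>k\<in>L. y \<in> bset k then c (THE k. k \<in> L \<and> y \<in> bset k) else 0)"
proof (cases "\<exists>k\<in>L. y \<in> bset k")
  case True
  then obtain k where k: "k \<in> L" "y \<in> bset k" by blast
  then have u: "k' = k" if "k' \<in> L" "y \<in> bset k'" for k' using disj[of k' k] that by blast
  have "(\<Sum>k\<in>L. c k * chi k y) = (\<Sum>k'\<in>L. if k' = k then c k' else 0)"
  proof (intro sum.cong refl)
    fix k' assume "k' \<in> L"
    then show "c k' * chi k' y = (if k' = k then c k' else 0)"
      using u[of k'] k by (cases "y \<in> bset k'") (auto simp: chi_def indicator_def)
  qed
  also have "\<dots> = c k" using k L by simp
  finally have "(\<Sum>k\<in>L. c k * chi k y) = c k" .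
  moreover have "(THE k. k \<in> L \<and> y \<in> bset k) = k" by (rule the_equality) (use k u in blast)+
  ultimately show ?thesis using True by simp
qed (auto simp: chi_def intro!: sum.neutral)

lemma act_one_mem_bset: "k \<in> carrier G \<Longrightarrow> act k \<one> \<in> bset k"
  unfolding bset_def by (intro imageI subgroup.one_closed[OF M_subgroup])

text \<open>
  On each member \<open>bset k\<close> of a common partition for the cosets of a linear combination, the combination is
  constant; \<open>act k \<one>\<close> is a point of this member.
\<close>

lemma D0_normal_form:
  assumes fin: "finite_quotients G H M" and d: "d \<in> D0"
  obtains K where "finite K" "K \<subseteq> carrier G"
    "\<And>k k'. k \<in> K \<Longrightarrow> k' \<in> K \<Longrightarrow> k \<noteq> k' \<Longrightarrow> bset k \<inter> bset k' = {}"
    "d = (\<Sum>k\<in>K. d (act k \<one>) \<odot> chi k)"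
proof -
  have "\<exists>F. finite F \<and> F \<subseteq> carrier G \<and> (\<forall>y. d y \<noteq> 0 \<longrightarrow> (\<exists>g\<in>F. y \<in> bset g)) \<and>
      (\<forall>y y'. (\<forall>g\<in>F. y \<in> bset g \<longleftrightarrow> y' \<in> bset g) \<longrightarrow> d y = d y')"
    using d unfolding D0_eq
  proof (induction rule: cspan.induct)
    case cspan_0
    then show ?case by (intro exI[of _ "{}"]) simp
  next
    case (cspan_step x d c)
    from cspan_step.hyps(1) obtain g where g: "g \<in> carrier G" "x = chi g" by blast
    obtain F where F: "finite F" "F \<subseteq> carrier G" "\<forall>y. d y \<noteq> 0 \<longrightarrow> (\<exists>g\<in>F. y \<in> bset g)"
      "\<forall>y y'. (\<forall>g\<in>F. y \<in> bset g \<longleftrightarrow> y' \<in> bset g) \<longrightarrow> d y = d y'"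
      using cspan_step.IH by (elim exE conjE) (rule that)
    have "(c \<odot> x + d) y = (c \<odot> x + d) y'" if "\<forall>h\<in>insert g F. y \<in> bset h \<longleftrightarrow> y' \<in> bset h" for y y'
      using F(4)[rule_format, of y y'] that by (simp add: g chi_def indicator_def)
    moreover have "\<exists>h\<in>insert g F. y \<in> bset h" if "(c \<odot> x + d) y \<noteq> 0" for y
      using F(3)[rule_format, of y] that by (cases "d y = 0") (auto simp: g chi_def indicator_def scl_complex_def split: if_splits)
    ultimately show ?case using F(1,2) g(1) by (intro exI[of _ "insert g F"]) blast
  qed
  then obtain F where F: "finite F" "F \<subseteq> carrier G" "\<forall>y. d y \<noteq> 0 \<longrightarrow> (\<exists>g\<in>F. y \<in> bset g)"
      "\<forall>y y'. (\<forall>g\<in>F. y \<in> bset g \<longleftrightarrow> y' \<in> bset g) \<longrightarrow> d y = d y'"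
    by (elim exE conjE) (rule that)
  obtain K where K: "finite K" "K \<subseteq> carrier G"
    "\<And>k k'. k \<in> K \<Longrightarrow> k' \<in> K \<Longrightarrow> k \<noteq> k' \<Longrightarrow> bset k \<inter> bset k' = {}"
    "\<And>g. g \<in> F \<Longrightarrow> \<exists>L\<subseteq>K. bset g = (\<Union>k\<in>L. bset k)"
    by (rule common_partition[OF fin F(1,2)]) (rule that)
  have const: "d y = d (act k \<one>)" if k: "k \<in> K" "y \<in> bset k" for k y
  proof (rule F(4)[rule_format])
    fix g assume "g \<in> F"
    then obtain L where L: "L \<subseteq> K" "bset g = (\<Union>k\<in>L. bset k)" using K(4) by blast
    have "z \<in> bset g \<longleftrightarrow> k \<in> L" if "z \<in> bset k" for z
      using L K(3)[OF _ k(1)] that k(1) by blast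
    then show "y \<in> bset g \<longleftrightarrow> act k \<one> \<in> bset g"
      using k act_one_mem_bset[of k] K(2) by blast
  qed
  have "d y = (\<Sum>k\<in>K. d (act k \<one>) * chi k y)" for y
  proof (cases "\<exists>k\<in>K. y \<in> bset k")
    case True
    then obtain k where k: "k \<in> K" "y \<in> bset k" by blast
    have "(THE k. k \<in> K \<and> y \<in> bset k) = k" using k K(3) by (intro the_equality) blast+
    then show ?thesis using sum_chi_disjoint[OF K(1,3), of "\<lambda>k. d (act k \<one>)" y] True const[OF k] by simp
  next
    case False
    then have "d y = 0" using F(3) K(4) by blast
    then show ?thesis using sum_chi_disjoint[OF K(1,3), of "\<lambda>k. d (act k \<one>)" y] False by simp
  qed
  then have "d y = (\<Sum>k\<in>K. d (act k \<one>) \<odot> chi k) y" for y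
    unfolding sum_fun_apply scl_fun_apply scl_complex_def .
  then have "d = (\<Sum>k\<in>K. d (act k \<one>) \<odot> chi k)" by (rule ext)
  with K(1-3) show thesis by (rule that)
qed

lemma chi_mult:
  assumes fin: "finite_quotients G H M" and g: "g \<in> carrier G" "h \<in> carrier G"
  shows "\<exists>L\<subseteq>carrier G. finite L \<and> chi g * chi h = (\<Sum>k\<in>L. chi k)"
proof -
  obtain K where K: "finite K" "K \<subseteq> carrier G"
    "\<And>k k'. k \<in> K \<Longrightarrow> k' \<in> K \<Longrightarrow> k \<noteq> k' \<Longrightarrow> bset k \<inter> bset k' = {}"
    "\<And>g'. g' \<in> {g, h} \<Longrightarrow> \<exists>L\<subseteq>K. bset g' = (\<Union>k\<in>L. bset k)"
    by (rule common_partition[OF fin, of "{g, h}"]) (use g in \<open>auto intro: that\<close>)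
  obtain L L' where L: "L \<subseteq> K" "bset g = (\<Union>k\<in>L. bset k)" "L' \<subseteq> K" "bset h = (\<Union>k\<in>L'. bset k)"
    using K(4)[of g] K(4)[of h] by auto
  have fin: "finite (L \<inter> L')" using K(1) L finite_subset by blast
  have mem: "y \<in> bset g \<and> y \<in> bset h \<longleftrightarrow> (\<exists>k\<in>L \<inter> L'. y \<in> bset k)" for y
  proof
    assume "y \<in> bset g \<and> y \<in> bset h"
    then obtain k k' where k: "k \<in> L" "y \<in> bset k" "k' \<in> L'" "y \<in> bset k'" using L by blast
    then have "k = k'" using K(3)[of k k'] L by blast
    then show "\<exists>k\<in>L \<inter> L'. y \<in> bset k" using k by blast
  qed (use L in blast)
  have disj: "bset k \<inter> bset k' = {}" if "k \<in> L \<inter> L'" "k' \<in> L \<inter> L'" "k \<noteq> k'" for k k'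
    using that K(3) L by blast
  have "(\<Sum>k\<in>L \<inter> L'. chi k y) = (if y \<in> bset g \<and> y \<in> bset h then 1 else 0)" for y
    unfolding mem by (rule sum_chi_disjoint[OF fin, of "\<lambda>_. 1" y, unfolded mult_1_left]) (rule disj)
  then have "(\<Sum>k\<in>L \<inter> L'. chi k y) = chi g y * chi h y" for y
    by (simp add: chi_def indicator_def)
  then show ?thesis using fin L K(2) by (intro exI[of _ "L \<inter> L'"]) (auto simp: fun_eq_iff sum_fun_apply)
qed

lemma star_sub_D0:
  assumes fin: "finite_quotients G H M"
  shows "star_sub D0"
  unfolding D0_eq
proof (rule star_sub_cspan)
  fix x y assume "x \<in> chi ` carrier G" "y \<in> chi ` carrier G"
  then obtain g h where g: "g \<in> carrier G" "h \<in> carrier G" "x = chi g" "y = chi h" by blast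
  obtain L where "L \<subseteq> carrier G" "chi g * chi h = (\<Sum>k\<in>L. chi k)"
    using chi_mult[OF fin g(1,2)] by blast
  then show "x * y \<in> cspan (chi ` carrier G)"
    using g by (simp only:) (rule cspan_sum, rule cspan_base, blast)
next
  fix x assume "x \<in> chi ` carrier G"
  moreover have "adj (chi g) = chi g" for g
    by (simp add: fun_eq_iff chi_def indicator_def adj_complex_def)
  ultimately show "adj x \<in> cspan (chi ` carrier G)" by (auto intro: cspan_base)
qed

lemma adj_chi [simp]: "adj (chi g) = chi g"
  by (simp add: fun_eq_iff chi_def indicator_def adj_complex_def)

lemma D_eq:
  assumes fin: "finite_quotients G H M"
  shows "D = cstar_seminormed.cls (linf N) (supn N) D0"
proof -
  interpret r: represented "linf N" "ell_infinity N" "\<lambda>f. f" by (rule represented_linf)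
  have "\<one> \<in> N" by simp
  then interpret c: cstar_complete "linf N" "supn N" by (intro cstar_complete_linf) blast
  have cl: "sa_closure (ell_infinity N) B = c.cls B" if "B \<subseteq> linf N" for B
    using sa_closure_if_represented[OF represented_linf, of N B] that c.cstar_seminormed_axioms by (simp add: supn_def)
  have sub: "star_subalgebra (ell_infinity N) B \<longleftrightarrow> star_sub B" if "B \<subseteq> linf N" for B
    using r.star_subalgebra_iff[OF that] by simp
  have D0: "star_sub D0" "D0 \<subseteq> linf N" using star_sub_D0[OF fin] D0_subset_linf by auto
  show ?thesis
  proof
    have "star_subalgebra (ell_infinity N) (c.cls D0)"
      using sub[OF c.cls_subset] c.star_sub_cls[OF D0] by blast
    moreover have "sa_closure (ell_infinity N) (c.cls D0) \<subseteq> c.cls D0"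
      using cl[OF c.cls_subset] c.cls_cls[OF D0(2)] by simp
    moreover have "coset_indicators G N H M \<subseteq> c.cls D0"
      using c.subset_cls[OF D0(2)] by (auto simp: coset_indicators_chi)
    ultimately show "D \<subseteq> c.cls D0" unfolding D_alg_def generated_cstar_def by blast
    show "c.cls D0 \<subseteq> D"
      unfolding D_alg_def generated_cstar_def
    proof (intro Inter_greatest)
      fix B assume "B \<in> {B. star_subalgebra (ell_infinity N) B \<and> sa_closure (ell_infinity N) B \<subseteq> B \<and> coset_indicators G N H M \<subseteq> B}"
      then have B: "star_subalgebra (ell_infinity N) B" "sa_closure (ell_infinity N) B \<subseteq> B" "chi ` carrier G \<subseteq> B"
        by (auto simp: coset_indicators_chi)
      have BN: "B \<subseteq> linf N" using B(1) by (simp add: star_subalgebra_def linear_subspace_def linf_def)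
      have sB: "star_sub B" using sub[OF BN] B(1) by blast
      have "D0 \<subseteq> B" unfolding D0_eq using B(3) sB by (intro cspan_least) (auto simp: star_sub_def)
      then have "c.cls D0 \<subseteq> c.cls B" unfolding c.cls_def by blast
      then show "c.cls D0 \<subseteq> B" using cl[OF BN] B(2) by simp
    qed
  qed
qed

lemma D_facts:
  assumes fin: "finite_quotients G H M"
  shows "D \<subseteq> linf N" "D0 \<subseteq> D" "star_sub D" "cstar_complete D (supn N)"
    "cstar_seminormed.cls D (supn N) D0 = D"
proof -
  have "\<one> \<in> N" by simp
  then interpret c: cstar_complete "linf N" "supn N" by (intro cstar_complete_linf) blast
  note D0 = star_sub_D0[OF fin] D0_subset_linf
  show 1: "D \<subseteq> linf N" "D0 \<subseteq> D" "star_sub D"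
    unfolding D_eq[OF fin] using c.cls_subset c.subset_cls[OF D0(2)] c.star_sub_cls[OF D0] by auto
  show "cstar_complete D (supn N)"
    by (rule c.cstar_complete_subset[OF 1(3,1)]) (simp add: D_eq[OF fin] c.cls_cls[OF D0(2)])
  then interpret d: cstar_complete D "supn N" .
  have "d.cls D0 = {x \<in> D. x \<in> c.cls D0}" unfolding d.cls_def c.cls_def using 1(1) by blast
  then show "d.cls D0 = D" unfolding D_eq[OF fin, symmetric] by simp
qed

lemma act_fun_apply: "act_fun G N H g f y = (if y \<in> N then f (act (inv g) y) else 0)"
  by (simp add: act_fun_def)

lemma act_fun_chi: "\<lbrakk>s \<in> carrier G; g \<in> carrier G\<rbrakk> \<Longrightarrow> act_fun G N H s (chi g) = chi (s \<otimes> g)"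
  using bset_subset_N[of "s \<otimes> g"] by (auto simp: fun_eq_iff act_fun_apply chi_def indicator_def mem_bset_act)

lemma act_fun_add: "act_fun G N H s (d + d') = act_fun G N H s d + act_fun G N H s d'"
  and act_fun_scl: "act_fun G N H s (c \<odot> d) = c \<odot> act_fun G N H s d"
  and act_fun_zero: "act_fun G N H s 0 = 0"
  by (auto simp: fun_eq_iff act_fun_apply scl_complex_def)

lemma act_fun_D0:
  assumes s: "s \<in> carrier G" and d: "d \<in> D0"
  shows "act_fun G N H s d \<in> D0"
  using d unfolding D0_eq
proof (induction rule: cspan.induct)
  case (cspan_step x y c)
  then obtain g where "g \<in> carrier G" "x = chi g" by blast
  then show ?case
    using cspan_step.IH s by (simp only: act_fun_add act_fun_scl act_fun_chi) (rule cspan.cspan_step, simp_all)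
qed (simp only: act_fun_zero cspan_0)

end

section \<open>Positive functionals\<close>

definition posfun :: "'a::complex_star_algebra set \<Rightarrow> ('a \<Rightarrow> complex) \<Rightarrow> bool" where
  "posfun S f \<longleftrightarrow> (\<forall>u\<in>S. \<forall>v\<in>S. f (u + v) = f u + f v) \<and> (\<forall>k. \<forall>u\<in>S. f (k \<odot> u) = k * f u) \<and>
     (\<forall>u\<in>S. 0 \<le> Re (f (adj u * u)) \<and> Im (f (adj u * u)) = 0)"

lemma posfunD:
  assumes "posfun S f"
  shows posfun_add: "u \<in> S \<Longrightarrow> v \<in> S \<Longrightarrow> f (u + v) = f u + f v"
    and posfun_scl: "u \<in> S \<Longrightarrow> f (k \<odot> u) = k * f u"
    and posfun_nonneg: "u \<in> S \<Longrightarrow> 0 \<le> Re (f (adj u * u))"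
    and posfun_real: "u \<in> S \<Longrightarrow> Im (f (adj u * u)) = 0"
  using assms unfolding posfun_def by auto

context star_sub
begin

lemma posfun_0: "posfun S f \<Longrightarrow> f 0 = 0"
  using posfun_scl[of S f 0 0] by simp

lemma posfun_diff: "\<lbrakk>posfun S f; u \<in> S; v \<in> S\<rbrakk> \<Longrightarrow> f (u - v) = f u - f v"
  using posfun_add[of S f u "(-1) \<odot> v"] posfun_scl[of S f v "-1"] by simp

lemma posfun_sum: "\<lbrakk>posfun S f; \<And>i. i \<in> I \<Longrightarrow> g i \<in> S\<rbrakk> \<Longrightarrow> f (sum g I) = (\<Sum>i\<in>I. f (g i))"
  by (induction I rule: infinite_finite_induct) (simp_all add: posfun_0 posfun_add sum_mem)

lemma posfun_hermitian:
  assumes f: "posfun S f" and x: "x \<in> S" and y: "y \<in> S"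
  shows "f (adj y * x) = cnj (f (adj x * y))"
proof -
  note f_add = posfun_add[OF f] and f_scl = posfun_scl[OF f]
  have S: "adj x * y \<in> S" "adj y * x \<in> S" "adj x * x \<in> S" "adj y * y \<in> S" using x y by auto
  have 1: "adj (x + y) * (x + y) = (adj x * x + adj y * y) + (adj x * y + adj y * x)"
    by (simp add: algebra_simps)
  have "f (adj (x + y) * (x + y)) = (f (adj x * x) + f (adj y * y)) + (f (adj x * y) + f (adj y * x))"
    unfolding 1 using S by (simp add: f_add)
  then have im: "Im (f (adj x * y)) + Im (f (adj y * x)) = 0"
    using posfun_real[OF f, of "x + y"] posfun_real[OF f x] posfun_real[OF f y] x y by simp
  have 2: "adj (x + \<i> \<odot> y) * (x + \<i> \<odot> y) = (adj x * x + adj y * y) + (\<i> \<odot> (adj x * y) + (- \<i>) \<odot> (adj y * x))"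
    by (simp add: algebra_simps scl_distribs)
  have "f (adj (x + \<i> \<odot> y) * (x + \<i> \<odot> y)) =
      (f (adj x * x) + f (adj y * y)) + (\<i> * f (adj x * y) + (- \<i>) * f (adj y * x))"
    unfolding 2 using S by (simp only: f_add f_scl add_mem scl_mem)
  then have re: "Re (f (adj x * y)) - Re (f (adj y * x)) = 0"
    using posfun_real[OF f, of "x + \<i> \<odot> y"] posfun_real[OF f x] posfun_real[OF f y] x y by simp
  show ?thesis using re im by (simp add: complex_eq_iff)
qed

lemma posfun_gram:
  assumes f: "posfun S f" and a: "\<And>i. a i \<in> S"
  shows "\<exists>T :: 'i \<Rightarrow> 'i ell2. \<forall>i j. cinner (T i) (T j) = f (adj (a j) * a i)"
proof (rule gram_vectors)
  show "f (adj (a j) * a i) = cnj (f (adj (a i) * a j))" for i j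
    by (rule posfun_hermitian[OF f a a])
  fix F :: "'i set" and c
  assume "finite F"
  let ?x = "\<Sum>i\<in>F. c i \<odot> a i"
  have x: "?x \<in> S" using a by (intro sum_mem scl_mem)
  have "adj ?x * ?x = (\<Sum>j\<in>F. \<Sum>i\<in>F. (cnj (c j) \<odot> adj (a j)) * (c i \<odot> a i))"
    unfolding adj_sum sum_product adj_scl ..
  also have "\<dots> = (\<Sum>i\<in>F. \<Sum>j\<in>F. (cnj (c j) \<odot> adj (a j)) * (c i \<odot> a i))"
    by (rule sum.swap)
  also have "\<dots> = (\<Sum>i\<in>F. \<Sum>j\<in>F. (c i * cnj (c j)) \<odot> (adj (a j) * a i))"
    by (intro sum.cong refl) (simp add: mult.commute)
  finally have "adj ?x * ?x = (\<Sum>i\<in>F. \<Sum>j\<in>F. (c i * cnj (c j)) \<odot> (adj (a j) * a i))" .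
  then have "f (adj ?x * ?x) = (\<Sum>i\<in>F. \<Sum>j\<in>F. c i * cnj (c j) * f (adj (a j) * a i))"
    using a by (simp add: posfun_sum[OF f] posfun_scl[OF f] sum_mem)
  then show "0 \<le> Re (\<Sum>i\<in>F. \<Sum>j\<in>F. c i * cnj (c j) * f (adj (a j) * a i))"
    using posfun_nonneg[OF f x] by simp
qed

lemma posfun_cauchy_schwarz:
  assumes f: "posfun S f" and x: "x \<in> S" and y: "y \<in> S"
  shows "(cmod (f (adj y * x)))\<^sup>2 \<le> Re (f (adj x * x)) * Re (f (adj y * y))"
proof -
  have "\<exists>T :: bool \<Rightarrow> bool ell2. \<forall>i j. cinner (T i) (T j) = f (adj (if j then x else y) * (if i then x else y))"
    by (rule posfun_gram[OF f, of "\<lambda>i :: bool. if i then x else y"]) (simp add: x y)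
  then obtain T :: "bool \<Rightarrow> bool ell2"
    where T: "\<forall>i j. cinner (T i) (T j) = f (adj (if j then x else y) * (if i then x else y))"
    by (rule exE)
  have n: "(norm (T True))\<^sup>2 = Re (f (adj x * x))" "(norm (T False))\<^sup>2 = Re (f (adj y * y))"
    using arg_cong[OF T[rule_format, of True True], of Re] arg_cong[OF T[rule_format, of False False], of Re]
    by (simp_all add: cinner_self del: of_real_power)
  have "(cmod (f (adj y * x)))\<^sup>2 \<le> (norm (T True) * norm (T False))\<^sup>2"
    using cmod_cinner_le[of "T True" "T False"] T[rule_format, of True False] by (intro power_mono) auto
  then show ?thesis by (simp add: power_mult_distrib n)
qed

end

text \<open>
  The left regular representation of a C*-seminorm that dominates the positive functional \<open>f\<close> is
  bounded by the seminorm. With \<open>x = b\<^sup>* b\<close>, the Cauchy-Schwarz inequality bounds \<open>f (c\<^sup>* x c)\<close> by the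
  geometric mean of \<open>f (c\<^sup>* c)\<close> and \<open>f (c\<^sup>* x\<^sup>2 c)\<close>; in the iterated inequality the power of \<open>f (c\<^sup>* c)\<close> tends to \<open>1\<close>
  and the constant in \<open>f (c\<^sup>* x\<^sup>n c) \<le> \<parallel>c\<parallel>\<^sup>2 \<parallel>x\<parallel>\<^sup>n\<close> disappears.
\<close>

lemma (in cstar_seminormed) posfun_bound:
  assumes f: "posfun S f" and dom: "\<And>x. x \<in> S \<Longrightarrow> cmod (f x) \<le> \<nu> x" and b: "b \<in> S" and c: "c \<in> S"
  shows "Re (f (adj c * (adj b * b) * c)) \<le> (\<nu> b)\<^sup>2 * Re (f (adj c * c))"
proof -
  define X where "X = rec_nat (adj b * b) (\<lambda>_ y. y * y)"
  have X0: "X 0 = adj b * b" and XSuc: "X (Suc n) = X n * X n" for n by (simp_all add: X_def)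
  have XS: "X n \<in> S \<and> adj (X n) = X n" for n
    by (induction n) (use b in \<open>auto simp: X0 XSuc\<close>)
  define v where "v = (\<nu> b)\<^sup>2"
  have v: "0 \<le> v" by (simp add: v_def)
  have Xnu: "\<nu> (X n) = v ^ (2 ^ n)" for n
    by (induction n) (use b XS in \<open>auto simp: X0 XSuc v_def nu_cstar nu_square power_mult[symmetric] mult.commute\<close>)
  define g where "g n = Re (f (adj c * X n * c))" for n
  define q where "q = Re (f (adj c * c))"
  have q: "0 \<le> q" using posfun_nonneg[OF f c] by (simp add: q_def)
  have step: "g n * g n \<le> q * g (Suc n)" for n
  proof -
    have Xc: "X n * c \<in> S" using XS c by auto
    have "(cmod (f (adj c * (X n * c))))\<^sup>2 \<le> Re (f (adj (X n * c) * (X n * c))) * q"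
      unfolding q_def by (rule posfun_cauchy_schwarz[OF f Xc c])
    moreover have "adj (X n * c) * (X n * c) = adj c * X (Suc n) * c"
      using XS by (simp add: XSuc mult.assoc)
    moreover have "g n * g n \<le> (cmod (f (adj c * (X n * c))))\<^sup>2"
      using abs_Re_le_cmod[of "f (adj c * (X n * c))"] power_mono[of "\<bar>g n\<bar>" "cmod (f (adj c * (X n * c)))" 2]
      by (simp add: g_def mult.assoc power2_eq_square)
    ultimately show ?thesis by (simp add: g_def mult.commute)
  qed
  define K where "K = (\<nu> c)\<^sup>2"
  have gK: "g n \<le> K * v ^ (2 ^ n)" for n
  proof -
    have "g n \<le> cmod (f (adj c * X n * c))" unfolding g_def by (rule complex_Re_le_cmod)
    also have "\<dots> \<le> \<nu> (adj c * X n * c)" using XS c by (intro dom) auto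
    also have "\<dots> \<le> \<nu> (adj c) * \<nu> (X n) * \<nu> c"
      using XS c by (intro order_trans[OF nu_mult] mult_right_mono nu_mult) auto
    finally show ?thesis using c by (simp add: Xnu K_def power2_eq_square mult_ac)
  qed
  have g0: "g 0 = Re (f (adj c * (adj b * b) * c))" by (simp add: g_def X0)
  show ?thesis
  proof (cases "0 < g 0")
    case False
    then show ?thesis using mult_nonneg_nonneg[OF v q] by (simp add: g0[symmetric] q_def[symmetric] v_def)
  next
    case True
    have q0: "0 < q"
    proof (rule ccontr)
      assume "\<not> 0 < q"
      then have "q = 0" using q by simp
      then have "g 0 * g 0 \<le> 0" using step[of 0] by simp
      then show False using True mult_pos_pos[OF True True] by linarith
    qed
    have iter: "g 0 ^ (2 ^ n) * q \<le> q ^ (2 ^ n) * g n" for n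
    proof (induction n)
      case (Suc n)
      have nn: "0 \<le> g 0 ^ (2 ^ n) * q" using True q0 by simp
      have "(g 0 ^ (2 ^ n) * q) * (g 0 ^ (2 ^ n) * q) \<le> (q ^ (2 ^ n) * g n) * (q ^ (2 ^ n) * g n)"
        by (rule mult_mono[OF Suc.IH Suc.IH order_trans[OF nn Suc.IH] nn])
      also have "\<dots> = (q ^ (2 ^ n) * q ^ (2 ^ n)) * (g n * g n)" by (simp add: mult_ac)
      also have "\<dots> \<le> (q ^ (2 ^ n) * q ^ (2 ^ n)) * (q * g (Suc n))"
        using step[of n] q0 by (intro mult_left_mono) auto
      finally have "(g 0 ^ (2 ^ Suc n) * q) * q \<le> (q ^ (2 ^ Suc n) * g (Suc n)) * q"
        by (simp add: power_add[symmetric] mult_ac mult_2)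
      then show ?case using q0 by simp
    qed simp
    have "(g 0 / q) ^ (2 ^ n) * q \<le> K * v ^ (2 ^ n)" for n
    proof -
      have "(g 0 / q) ^ (2 ^ n) * q = g 0 ^ (2 ^ n) * q / q ^ (2 ^ n)" by (simp add: power_divide)
      also have "\<dots> \<le> g n" using iter[of n] q0 by (simp add: divide_le_eq mult.commute)
      finally show ?thesis using gK[of n] by simp
    qed
    note bound = this
    have "g 0 / q \<le> v"
    proof (rule ccontr)
      assume gt: "\<not> g 0 / q \<le> v"
      define r where "r = g 0 / q"
      have r: "v < r" "0 < r" using gt True q0 by (auto simp: r_def)
      have lim: "(\<lambda>n. K * (v / r) ^ (2 ^ n)) \<longlonglongrightarrow> 0"
      proof (rule tendsto_mult_right_zero)
        have "(\<lambda>n. (v / r) ^ n) \<longlonglongrightarrow> 0" using r v by (intro LIMSEQ_realpow_zero) auto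
        moreover have "strict_mono (\<lambda>n. 2 ^ n :: nat)" by (rule strict_monoI) simp
        ultimately show "(\<lambda>n. (v / r) ^ (2 ^ n)) \<longlonglongrightarrow> 0"
          using LIMSEQ_subseq_LIMSEQ[of "\<lambda>n. (v / r) ^ n" 0 "\<lambda>n. 2 ^ n"] by (simp add: o_def)
      qed
      have "q \<le> K * (v / r) ^ (2 ^ n)" for n
        using bound[of n] r by (simp add: r_def[symmetric] power_divide le_divide_eq mult.commute)
      then have "q \<le> 0" using lim by (rule le_zero_if_le_null_sequence)
      then show False using q0 by simp
    qed
    then show ?thesis using q0 by (simp add: g0[symmetric] q_def[symmetric] v_def[symmetric] divide_le_eq)
  qed
qed

section \<open>Covariant systems over the coset indicators\<close>

text \<open>
  The group elements \<open>U g\<close> belong to the ambient type only; the algebra \<open>A0\<close> is spanned by their products with \<open>J d\<close>, and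
  \<open>U \<one>\<close> is a unit for those, but in general not for the ambient type.
\<close>

locale coset_algebra = semidirect_setting G N H M
  for G :: "('g, 'm) monoid_scheme" (structure) and N H M +
  fixes U :: "'g \<Rightarrow> 'a::complex_star_algebra" and J :: "('g \<Rightarrow> complex) \<Rightarrow> 'a"
  assumes fin: "finite_quotients G H M"
    and U_mult: "\<lbrakk>g \<in> carrier G; h \<in> carrier G\<rbrakk> \<Longrightarrow> U g * U h = U (g \<otimes> h)"
    and U_adj: "g \<in> carrier G \<Longrightarrow> adj (U g) = U (inv g)"
    and J_add: "\<lbrakk>d \<in> D0; d' \<in> D0\<rbrakk> \<Longrightarrow> J (d + d') = J d + J d'"
    and J_scl: "d \<in> D0 \<Longrightarrow> J (c \<odot> d) = c \<odot> J d"
    and J_mult: "\<lbrakk>d \<in> D0; d' \<in> D0\<rbrakk> \<Longrightarrow> J (d * d') = J d * J d'"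
    and J_adj: "d \<in> D0 \<Longrightarrow> J (adj d) = adj (J d)"
    and U_one_J: "d \<in> D0 \<Longrightarrow> U \<one> * J d = J d"
    and J_cov: "\<lbrakk>s \<in> carrier G; d \<in> D0\<rbrakk> \<Longrightarrow> U s * J d * U (inv s) = J (act_fun G N H s d)"
begin

lemma U_mult': "\<lbrakk>g \<in> carrier G; h \<in> carrier G\<rbrakk> \<Longrightarrow> U g * (U h * x) = U (g \<otimes> h) * x"
  by (simp add: U_mult flip: mult.assoc)

lemma J_0 [simp]: "J 0 = 0"
  using J_scl[of 0 0] by simp

lemma J_sum: "(\<And>i. i \<in> I \<Longrightarrow> d i \<in> D0) \<Longrightarrow> J (sum d I) = (\<Sum>i\<in>I. J (d i))"
  by (induction I rule: infinite_finite_induct) (simp_all add: J_add D0_sum)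

definition P :: "'g \<Rightarrow> 'a" where "P g = J (chi g)"
abbreviation p :: 'a where "p \<equiv> P \<one>"

lemma P_adj [simp]: "g \<in> carrier G \<Longrightarrow> adj (P g) = P g"
  using J_adj[of "chi g"] by (simp add: P_def)

lemma P_idem [simp]: "g \<in> carrier G \<Longrightarrow> P g * P g = P g"
proof -
  assume "g \<in> carrier G"
  moreover have "chi g * chi g = chi g" by (auto simp: fun_eq_iff chi_def indicator_def)
  ultimately show ?thesis using J_mult[of "chi g" "chi g"] by (simp add: P_def)
qed

lemma P_idem' [simp]: "g \<in> carrier G \<Longrightarrow> P g * (P g * x) = P g * x"
  by (simp flip: mult.assoc)

lemma U_one_P [simp]: "g \<in> carrier G \<Longrightarrow> U \<one> * P g = P g"
  by (simp add: P_def U_one_J)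

lemma P_U_one [simp]: "g \<in> carrier G \<Longrightarrow> P g * U \<one> = P g"
proof -
  assume g: "g \<in> carrier G"
  then have "P g * U \<one> = adj (U \<one> * P g)" by (simp del: U_one_P add: U_adj)
  then show ?thesis using g by simp
qed

lemma P_U_one' [simp]: "g \<in> carrier G \<Longrightarrow> P g * (U \<one> * x) = P g * x"
  by (simp flip: mult.assoc)

lemma P_cov: "\<lbrakk>s \<in> carrier G; g \<in> carrier G\<rbrakk> \<Longrightarrow> U s * (P g * U (inv s)) = P (s \<otimes> g)"
  using J_cov[of s "chi g"] by (simp add: P_def act_fun_chi mult.assoc)

lemma U_P: "\<lbrakk>s \<in> carrier G; g \<in> carrier G\<rbrakk> \<Longrightarrow> U s * P g = P (s \<otimes> g) * U s"
  using arg_cong[OF P_cov, of s g "\<lambda>x. x * U s"] by (simp add: mult.assoc U_mult)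

lemma P_U: "\<lbrakk>s \<in> carrier G; g \<in> carrier G\<rbrakk> \<Longrightarrow> P g * U s = U s * P (inv s \<otimes> g)"
  using U_P[of s "inv s \<otimes> g"] by simp

lemma P_eq: "g \<in> carrier G \<Longrightarrow> P g = U g * (p * U (inv g))"
  using P_cov[of g \<one>] by simp

definition gens :: "'a set" where "gens = {U s * P g |s g. s \<in> carrier G \<and> g \<in> carrier G}"
definition A0 :: "'a set" where "A0 = cspan gens"
definition B0 :: "'a set" where "B0 = {p * (a * p) |a. a \<in> A0}"

lemma gen_A0 [simp]: "\<lbrakk>s \<in> carrier G; g \<in> carrier G\<rbrakk> \<Longrightarrow> U s * P g \<in> A0"
  unfolding A0_def gens_def by (rule cspan_base) blast

lemma P_mult_sum:
  assumes "g \<in> carrier G" "h \<in> carrier G"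
  shows "\<exists>L\<subseteq>carrier G. finite L \<and> P g * P h = (\<Sum>k\<in>L. P k)"
proof -
  obtain L where L: "L \<subseteq> carrier G" "finite L" "chi g * chi h = (\<Sum>k\<in>L. chi k)"
    using chi_mult[OF fin assms] by (elim exE conjE) (rule that)
  have "J (\<Sum>k\<in>L. chi k) = (\<Sum>k\<in>L. J (chi k))" using L(1) by (intro J_sum) auto
  then have "P g * P h = (\<Sum>k\<in>L. P k)"
    using J_mult[of "chi g" "chi h"] assms by (simp add: P_def L(3))
  then show ?thesis using L by blast
qed

lemma star_sub_A0: "star_sub A0"
  unfolding A0_def
proof (rule star_sub_cspan)
  fix x y assume "x \<in> gens" "y \<in> gens"
  then obtain s g s' g' where x: "s \<in> carrier G" "g \<in> carrier G" "s' \<in> carrier G" "g' \<in> carrier G"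
    "x = U s * P g" "y = U s' * P g'" unfolding gens_def by blast
  have "x * y = U s * ((P g * U s') * P g')" by (simp only: x mult.assoc)
  also have "\<dots> = U s * (U s' * (P (inv s' \<otimes> g) * P g'))"
    using x P_U[of s' g] by (simp add: mult.assoc)
  finally have xy: "x * y = U (s \<otimes> s') * (P (inv s' \<otimes> g) * P g')"
    using x by (simp add: U_mult')
  obtain L where L: "L \<subseteq> carrier G" "P (inv s' \<otimes> g) * P g' = (\<Sum>k\<in>L. P k)"
    using P_mult_sum[of "inv s' \<otimes> g" g'] x by auto
  have "x * y = (\<Sum>k\<in>L. U (s \<otimes> s') * P k)" by (simp add: xy L(2) sum_distrib_left)
  also have "\<dots> \<in> cspan gens"
    using x L(1) by (intro cspan_sum cspan_base) (auto simp: gens_def)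
  finally show "x * y \<in> cspan gens" .
next
  fix x assume "x \<in> gens"
  then obtain s g where x: "s \<in> carrier G" "g \<in> carrier G" "x = U s * P g" unfolding gens_def by blast
  have "adj x = U (inv s) * P (s \<otimes> g)" using x P_U[of "inv s" g] by (simp add: U_adj)
  then show "adj x \<in> cspan gens" using x by (intro cspan_base) (auto simp: gens_def)
qed

sublocale A0: star_sub A0
  by (rule star_sub_A0)

lemma U_A0 [simp]:
  assumes s: "s \<in> carrier G" and a: "a \<in> A0"
  shows "U s * a \<in> A0"
  using a unfolding A0_def
proof (induction rule: cspan.induct)
  case (cspan_step x y c)
  then obtain t g where "t \<in> carrier G" "g \<in> carrier G" "x = U t * P g" unfolding gens_def by blast
  then have "U s * x \<in> cspan gens" using s gen_A0[of "s \<otimes> t" g] by (simp add: U_mult' A0_def)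
  then show ?case using cspan_step.IH by (simp add: distrib_left cspan_add cspan_scl)
qed (simp add: cspan_0)

lemma U_one_A0: "a \<in> A0 \<Longrightarrow> U \<one> * a = a"
  unfolding A0_def
proof (induction rule: cspan.induct)
  case (cspan_step x y c)
  then obtain t g where "t \<in> carrier G" "g \<in> carrier G" "x = U t * P g" unfolding gens_def by blast
  then have "U \<one> * x = x" by (simp add: U_mult')
  then show ?case using cspan_step.IH by (simp add: distrib_left)
qed simp

lemma P_A0 [simp]: "g \<in> carrier G \<Longrightarrow> P g \<in> A0"
  using gen_A0[of \<one> g] by simp

lemma UJ_A0:
  assumes s: "s \<in> carrier G" and d: "d \<in> D0"
  shows "U s * J d \<in> A0"
  using d unfolding D0_eq
proof (induction rule: cspan.induct)
  case (cspan_step x y c)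
  then obtain g where g: "g \<in> carrier G" "x = chi g" by blast
  have "J (c \<odot> x + y) = c \<odot> P g + J y"
    using g cspan_step.hyps(2) by (simp add: J_add J_scl P_def D0_eq[symmetric])
  then have "U s * J (c \<odot> x + y) = U s * (c \<odot> P g + J y)" by (simp only:)
  also have "\<dots> = c \<odot> (U s * P g) + U s * J y" by (simp add: distrib_left)
  finally show ?case using cspan_step.IH g(1) s by (simp only: A0.add_mem A0.scl_mem gen_A0)
next
  case cspan_0
  show ?case by (simp only: J_0 mult_zero_right A0.zero_mem)
qed

lemma J_A0 [simp]: "d \<in> D0 \<Longrightarrow> J d \<in> A0"
  using UJ_A0[of \<one> d] by (simp add: U_one_J)

lemma A0_eq: "A0 = cspan {U s * J d |s d. s \<in> carrier G \<and> d \<in> D0}"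
proof
  show "A0 \<subseteq> cspan {U s * J d |s d. s \<in> carrier G \<and> d \<in> D0}"
    unfolding A0_def
  proof (rule cspan_subset_cspan, rule subsetI)
    fix x assume "x \<in> gens"
    then obtain s g where "s \<in> carrier G" "g \<in> carrier G" "x = U s * J (chi g)" unfolding gens_def P_def by blast
    then show "x \<in> cspan {U s * J d |s d. s \<in> carrier G \<and> d \<in> D0}"
      using chi_D0[of g] by (intro cspan_base) blast
  qed
  show "cspan {U s * J d |s d. s \<in> carrier G \<and> d \<in> D0} \<subseteq> A0"
    using UJ_A0 by (intro cspan_least) auto
qed

lemma mem_B0: "b \<in> B0 \<longleftrightarrow> b \<in> A0 \<and> p * b = b \<and> b * p = b"
proof
  assume "b \<in> B0"
  then obtain a where a: "a \<in> A0" "b = p * (a * p)" unfolding B0_def by blast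
  then show "b \<in> A0 \<and> p * b = b \<and> b * p = b" by (simp add: mult.assoc)
next
  assume b: "b \<in> A0 \<and> p * b = b \<and> b * p = b"
  then have "b = p * (b * p)" by simp
  then show "b \<in> B0" unfolding B0_def using b by blast
qed

lemma B0I: "a \<in> A0 \<Longrightarrow> p * (a * p) \<in> B0"
  unfolding B0_def by blast

lemma B0_A0: "b \<in> B0 \<Longrightarrow> b \<in> A0"
  by (simp add: mem_B0)

lemma star_sub_B0: "star_sub B0"
proof
  fix x y c assume x: "x \<in> B0"
  then have px: "p * x = x" "x * p = x" "x \<in> A0" by (auto simp: mem_B0)
  show "adj x \<in> B0"
    using arg_cong[OF px(1), of adj] arg_cong[OF px(2), of adj] px(3) by (simp add: mem_B0)
  show "c \<odot> x \<in> B0" using px by (simp add: mem_B0)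
  assume y: "y \<in> B0"
  then have py: "p * y = y" "y * p = y" "y \<in> A0" by (auto simp: mem_B0)
  show "x + y \<in> B0" using px py by (simp add: mem_B0 distrib_left distrib_right)
  have "p * (x * y) = x * y" "x * y * p = x * y" using px py by (metis mult.assoc)+
  then show "x * y \<in> B0" using px py by (simp add: mem_B0)
qed (simp add: mem_B0)

lemma p_B0: "p \<in> B0"
  by (simp add: mem_B0)

definition disjoint_cover :: "'g set \<Rightarrow> 'g set \<Rightarrow> bool" where
  "disjoint_cover K F \<longleftrightarrow> finite K \<and> K \<subseteq> carrier G \<and>
     (\<forall>k\<in>K. \<forall>k'\<in>K. k \<noteq> k' \<longrightarrow> bset k \<inter> bset k' = {}) \<and> (\<forall>g\<in>F. \<exists>L\<subseteq>K. bset g = (\<Union>k\<in>L. bset k))"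

lemma ex_disjoint_cover: "\<lbrakk>finite F; F \<subseteq> carrier G\<rbrakk> \<Longrightarrow> \<exists>K. disjoint_cover K F"
proof -
  assume F: "finite F" "F \<subseteq> carrier G"
  obtain K where K: "finite K" "K \<subseteq> carrier G"
    "\<And>k k'. k \<in> K \<Longrightarrow> k' \<in> K \<Longrightarrow> k \<noteq> k' \<Longrightarrow> bset k \<inter> bset k' = {}"
    "\<And>g. g \<in> F \<Longrightarrow> \<exists>L\<subseteq>K. bset g = (\<Union>k\<in>L. bset k)"
    by (rule common_partition[OF fin F]) (rule that)
  have "disjoint_cover K F"
    unfolding disjoint_cover_def
  proof (intro conjI ballI impI)
    show "bset k \<inter> bset k' = {}" if "k \<in> K" "k' \<in> K" "k \<noteq> k'" for k k'
      by (rule K(3)[OF that])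
    show "\<exists>L\<subseteq>K. bset g = (\<Union>k\<in>L. bset k)" if "g \<in> F" for g by (rule K(4)[OF that])
  qed (fact K(1) K(2))+
  then show ?thesis by (rule exI)
qed

lemma sum_P_cover:
  assumes K: "disjoint_cover K F" and g: "g \<in> F" "g \<in> carrier G"
  shows "(\<Sum>k\<in>K. P k) * P g = P g"
proof -
  have K': "finite K" "K \<subseteq> carrier G" "\<And>k k'. k \<in> K \<Longrightarrow> k' \<in> K \<Longrightarrow> k \<noteq> k' \<Longrightarrow> bset k \<inter> bset k' = {}"
    using K unfolding disjoint_cover_def by blast+
  have "\<exists>L\<subseteq>K. bset g = (\<Union>k\<in>L. bset k)" using K g(1) unfolding disjoint_cover_def by blast
  then obtain L where L: "L \<subseteq> K" "bset g = (\<Union>k\<in>L. bset k)" by (elim exE conjE) (rule that)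
  have "(\<Sum>k\<in>K. chi k) * chi g = chi g"
  proof
    fix y
    have "y \<in> bset g \<Longrightarrow> \<exists>k\<in>K. y \<in> bset k" using L by blast
    moreover have "(\<Sum>k\<in>K. chi k y) = (if \<exists>k\<in>K. y \<in> bset k then 1 else 0)"
      by (rule sum_chi_disjoint[OF K'(1), of "\<lambda>_. 1" y, unfolded mult_1_left]) (rule K'(3))
    ultimately show "((\<Sum>k\<in>K. chi k) * chi g) y = chi g y"
      by (cases "y \<in> bset g") (simp_all add: sum_fun_apply chi_def)
  qed
  moreover have "J ((\<Sum>k\<in>K. chi k) * chi g) = J (\<Sum>k\<in>K. chi k) * J (chi g)"
    using K'(2) g by (intro J_mult D0_sum) auto
  moreover have "J (\<Sum>k\<in>K. chi k) = (\<Sum>k\<in>K. P k)"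
    using K'(2) unfolding P_def by (intro J_sum) auto
  ultimately show ?thesis by (simp add: P_def)
qed

lemma local_unit:
  assumes "a \<in> A0"
  shows "\<exists>F. finite F \<and> F \<subseteq> carrier G \<and> (\<forall>K. disjoint_cover K F \<longrightarrow> (\<Sum>k\<in>K. P k) * a = a)"
  using assms unfolding A0_def
proof (induction rule: cspan.induct)
  case cspan_0
  show ?case by (rule exI[of _ "{}"]) simp
next
  case (cspan_step x y c)
  then obtain s g where x: "s \<in> carrier G" "g \<in> carrier G" "x = U s * P g" unfolding gens_def by blast
  obtain F where F: "finite F" "F \<subseteq> carrier G" "\<forall>K. disjoint_cover K F \<longrightarrow> (\<Sum>k\<in>K. P k) * y = y"
    using cspan_step.IH by (elim exE conjE) (rule that)
  have "(\<Sum>k\<in>K. P k) * (c \<odot> x + y) = c \<odot> x + y" if K: "disjoint_cover K (insert (s \<otimes> g) F)" for K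
  proof -
    have "disjoint_cover K F" using K by (simp add: disjoint_cover_def)
    then have 1: "(\<Sum>k\<in>K. P k) * y = y" using F(3) by blast
    have "x = P (s \<otimes> g) * U s" using x U_P by simp
    then have "(\<Sum>k\<in>K. P k) * x = ((\<Sum>k\<in>K. P k) * P (s \<otimes> g)) * U s" by (simp only: mult.assoc)
    then have 2: "(\<Sum>k\<in>K. P k) * x = x" using sum_P_cover[OF K, of "s \<otimes> g"] x U_P by simp
    show ?thesis by (simp add: distrib_left 1 2)
  qed
  then show ?case using F(1,2) x by (intro exI[of _ "insert (s \<otimes> g) F"]) simp
qed

text \<open>
  A positive functional on the corner extends to a positive functional: for \<open>c = a p\<close>, covering the
  range of \<open>c\<close> by disjoint cosets writes \<open>c\<^sup>* c\<close> as a sum of squares of elements of the corner, because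
  the projection of each coset is equivalent to \<open>p\<close>.
\<close>

lemma posfun_corner_extend:
  assumes f: "posfun B0 f"
  shows "posfun A0 (\<lambda>c. f (p * (c * p)))"
  unfolding posfun_def
proof (intro conjI ballI allI)
  interpret B0: star_sub B0 by (rule star_sub_B0)
  fix u k assume u: "u \<in> A0"
  show "f (p * (k \<odot> u * p)) = k * f (p * (u * p))"
    using posfun_scl[OF f B0I[OF u]] by simp
  show "f (p * ((u + v) * p)) = f (p * (u * p)) + f (p * (v * p))" if v: "v \<in> A0" for v
    using posfun_add[OF f B0I[OF u] B0I[OF v]] by (simp add: distrib_left distrib_right)
  define c where "c = u * p"
  have cA: "c \<in> A0" using u by (simp add: c_def)
  obtain F where F: "finite F" "F \<subseteq> carrier G" "\<forall>K. disjoint_cover K F \<longrightarrow> (\<Sum>k\<in>K. P k) * c = c"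
    using local_unit[OF cA] by (elim exE conjE) (rule that)
  obtain K where K: "disjoint_cover K F" using ex_disjoint_cover[OF F(1,2)] by (rule exE)
  define b where "b k = p * ((U (inv k) * u) * p)" for k
  have KG: "k \<in> carrier G" if "k \<in> K" for k using K that by (auto simp: disjoint_cover_def)
  have b: "b k \<in> B0" if "k \<in> K" for k unfolding b_def using KG[OF that] u by (intro B0I) simp
  have bb: "adj (b k) * b k = adj c * (P k * c)" if k: "k \<in> K" for k
  proof -
    have "b k = p * (U (inv k) * c)" by (simp add: b_def c_def mult.assoc)
    then have "adj (b k) * b k = adj c * ((U k * (p * U (inv k))) * c)"
      using KG[OF k] by (simp add: U_adj mult.assoc)
    then show ?thesis using P_eq[OF KG[OF k]] by simp
  qed
  have "p * (adj u * u * p) = adj c * c" by (simp add: c_def mult.assoc)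
  also have "\<dots> = adj c * ((\<Sum>k\<in>K. P k) * c)" using F(3) K by simp
  also have "\<dots> = (\<Sum>k\<in>K. adj (b k) * b k)"
    by (simp add: sum_distrib_right sum_distrib_left bb)
  finally have eq: "f (p * (adj u * u * p)) = (\<Sum>k\<in>K. f (adj (b k) * b k))"
    using b by (simp add: B0.posfun_sum[OF f])
  show "0 \<le> Re (f (p * (adj u * u * p)))"
    unfolding eq Re_sum using posfun_nonneg[OF f b] by (intro sum_nonneg)
  show "Im (f (p * (adj u * u * p))) = 0"
    unfolding eq Im_sum using posfun_real[OF f b] by (intro sum.neutral) simp
qed

text \<open>
  A linear combination \<open>d\<close> of disjoint indicators with sum \<open>e\<close> satisfies \<open>d\<^sup>* d + h\<^sup>* h = \<parallel>d\<parallel>\<^sup>2 e\<close> for another such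
  combination \<open>h\<close>, so that multiplication by \<open>d\<close> is bounded for each positive functional.
\<close>

lemma posfun_J_bound:
  assumes F: "posfun A0 F" and d: "d \<in> D0" and a: "a \<in> A0"
  shows "Re (F (adj (J d * a) * (J d * a))) \<le> (supn N d)\<^sup>2 * Re (F (adj a * a))"
proof -
  obtain K where K: "finite K" "K \<subseteq> carrier G"
    "\<And>k k'. k \<in> K \<Longrightarrow> k' \<in> K \<Longrightarrow> k \<noteq> k' \<Longrightarrow> bset k \<inter> bset k' = {}"
    and dK: "d = (\<Sum>k\<in>K. d (act k \<one>) \<odot> chi k)"
    by (rule D0_normal_form[OF fin d]) (rule that)
  let ?s = "supn N d"
  have le: "cmod (d (act k \<one>)) \<le> ?s" if "k \<in> K" for k
    using that K(2) D0_subset_linf d by (intro cmod_le_supn) auto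
  define r where "r k = sqrt (?s\<^sup>2 - (cmod (d (act k \<one>)))\<^sup>2)" for k
  have r: "complex_of_real (r k) * complex_of_real (r k) + cnj (d (act k \<one>)) * d (act k \<one>) = complex_of_real (?s\<^sup>2)"
    if "k \<in> K" for k
  proof -
    have "(cmod (d (act k \<one>)))\<^sup>2 \<le> ?s\<^sup>2" using le[OF that] by (intro power_mono) auto
    then have "r k * r k = ?s\<^sup>2 - (cmod (d (act k \<one>)))\<^sup>2" by (simp add: r_def flip: power2_eq_square)
    moreover have "cnj (d (act k \<one>)) * d (act k \<one>) = complex_of_real ((cmod (d (act k \<one>)))\<^sup>2)"
      by (simp only: complex_norm_square mult.commute)
    ultimately show ?thesis by (simp only: of_real_mult[symmetric] of_real_add[symmetric]) simp
  qed
  define h where "h = (\<Sum>k\<in>K. complex_of_real (r k) \<odot> chi k)"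
  define e where "e = (\<Sum>k\<in>K. chi k)"
  have D: "h \<in> D0" "e \<in> D0" unfolding h_def e_def using K(2) by (auto intro!: D0_sum)
  interpret D0: star_sub D0 by (rule star_sub_D0[OF fin])
  have at: "(\<Sum>k\<in>K. c k * chi k y) = (if \<exists>k\<in>K. y \<in> bset k then c (THE k. k \<in> K \<and> y \<in> bset k) else 0)" for c y
    by (rule sum_chi_disjoint[OF K(1)]) (rule K(3))
  have fun_eq: "adj h * h + adj d * d = complex_of_real (?s\<^sup>2) \<odot> e"
  proof
    fix y
    let ?k = "THE k. k \<in> K \<and> y \<in> bset k"
    have dy: "d y = (if \<exists>k\<in>K. y \<in> bset k then d (act ?k \<one>) else 0)"
      using at[of "\<lambda>k. d (act k \<one>)" y] fun_cong[OF dK, of y] unfolding sum_fun_apply scl_fun_apply scl_complex_def by (rule trans[rotated])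
    have hy: "h y = (if \<exists>k\<in>K. y \<in> bset k then complex_of_real (r ?k) else 0)"
      using at[of "\<lambda>k. complex_of_real (r k)" y] by (simp only: h_def sum_fun_apply scl_fun_apply scl_complex_def)
    have ey: "e y = (if \<exists>k\<in>K. y \<in> bset k then 1 else 0)"
      using at[of "\<lambda>_. 1" y] by (simp only: e_def sum_fun_apply mult_1_left)
    show "(adj h * h + adj d * d) y = (complex_of_real (?s\<^sup>2) \<odot> e) y"
    proof (cases "\<exists>k\<in>K. y \<in> bset k")
      case True
      then obtain k where k: "k \<in> K" "y \<in> bset k" by blast
      have "?k = k" by (rule the_equality) (use k K(3) in blast)+
      then have "h y = complex_of_real (r k)" "d y = d (act k \<one>)" "e y = 1"
        using True hy dy ey by presburger+
      then show ?thesis using r[OF k(1)] by (simp add: adj_complex_def scl_complex_def)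
    next
      case False
      then show ?thesis using hy dy ey by (simp add: adj_complex_def scl_complex_def)
    qed
  qed
  let ?q = "J e"
  have Jeq: "adj (J h) * J h + adj (J d) * J d = complex_of_real (?s\<^sup>2) \<odot> ?q"
  proof -
    have "J (adj h * h + adj d * d) = J (complex_of_real (?s\<^sup>2) \<odot> e)" by (simp only: fun_eq)
    then show ?thesis using D d by (simp only: J_add J_mult J_adj J_scl D0.mult_mem D0.adj_mem)
  qed
  have ee: "adj e * e = e" "adj e = e"
  proof -
    have ey: "e y = (if \<exists>k\<in>K. y \<in> bset k then 1 else 0)" for y
      using at[of "\<lambda>_. 1" y] by (simp only: e_def sum_fun_apply mult_1_left)
    show "adj e = e" by (rule ext) (simp add: ey adj_complex_def)
    show "adj e * e = e" by (rule ext) (simp add: ey adj_complex_def)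
  qed
  have e2: "e * e = e" using ee by simp
  have q2: "?q * ?q = ?q" using J_mult[OF D(2) D(2), unfolded e2] by (rule sym)
  have qq: "adj ?q = ?q" using J_adj[OF D(2), unfolded ee(2)] by (rule sym)
  define G where "G x = Re (F (adj x * x))" for x
  have Gnn: "0 \<le> G x" if "x \<in> A0" for x unfolding G_def by (rule posfun_nonneg[OF F that])
  have in_A0: "?q * a \<in> A0" "J h * a \<in> A0" "J d * a \<in> A0" using D d a by auto
  have 1: "G (J h * a) + G (J d * a) = ?s\<^sup>2 * G (?q * a)"
  proof -
    have "adj (J h * a) * (J h * a) + adj (J d * a) * (J d * a) = adj a * ((adj (J h) * J h + adj (J d) * J d) * a)"
      by (simp add: distrib_left distrib_right mult.assoc)
    also have "\<dots> = complex_of_real (?s\<^sup>2) \<odot> (adj (?q * a) * (?q * a))"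
      unfolding Jeq using q2 by (simp add: qq mult.assoc) (metis mult.assoc q2)
    finally have "F (adj (J h * a) * (J h * a) + adj (J d * a) * (J d * a)) = complex_of_real (?s\<^sup>2) * F (adj (?q * a) * (?q * a))"
      using in_A0 by (simp only: posfun_scl[OF F] A0.mult_mem A0.adj_mem)
    then have "F (adj (J h * a) * (J h * a)) + F (adj (J d * a) * (J d * a)) = complex_of_real (?s\<^sup>2) * F (adj (?q * a) * (?q * a))"
      using in_A0 by (simp only: posfun_add[OF F] A0.mult_mem A0.adj_mem)
    from arg_cong[OF this, of Re] show ?thesis
      unfolding G_def plus_complex.sel Re_complex_of_real times_complex.sel Im_complex_of_real by simp
  qed
  have 2: "G (?q * a) \<le> G a"
  proof -
    have "adj (a - ?q * a) * (a - ?q * a) = adj a * a - adj (?q * a) * (?q * a)"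
    proof -
      have "?q * (?q * a) = ?q * a" using q2 by (metis mult.assoc)
      then show ?thesis by (simp add: algebra_simps qq)
    qed
    then have "F (adj (a - ?q * a) * (a - ?q * a)) = F (adj a * a) - F (adj (?q * a) * (?q * a))"
      using in_A0 a by (simp only: A0.posfun_diff[OF F] A0.mult_mem A0.adj_mem)
    then have "G (a - ?q * a) = G a - G (?q * a)" by (simp add: G_def)
    then show ?thesis using Gnn[of "a - ?q * a"] in_A0 a by simp
  qed
  have "G (J d * a) \<le> ?s\<^sup>2 * G (?q * a)" using 1 Gnn[OF in_A0(2)] by simp
  also have "\<dots> \<le> ?s\<^sup>2 * G a" using 2 by (intro mult_left_mono) auto
  finally show ?thesis by (simp add: G_def)
qed

text \<open>
  Compressing \<open>a\<close> to a small enough coset near \<open>\<one>\<close> that is moved by the relevant elements of \<open>G\<close> leaves only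
  the scalar \<open>\<tau> a\<close>, where \<open>\<tau>\<close> evaluates the coefficient of \<open>\<one>\<close> at the point \<open>\<one>\<close>.
\<close>

lemma compress:
  assumes \<tau>_add: "\<And>a b. a \<in> A0 \<Longrightarrow> b \<in> A0 \<Longrightarrow> \<tau> (a + b) = \<tau> a + \<tau> b"
    and \<tau>_scl: "\<And>c a. a \<in> A0 \<Longrightarrow> \<tau> (c \<odot> a) = c * \<tau> a"
    and \<tau>_gen: "\<And>s g. s \<in> carrier G \<Longrightarrow> g \<in> carrier G \<Longrightarrow> \<tau> (U s * P g) = (if s = \<one> then chi g \<one> else 0)"
    and a: "a \<in> A0"
  shows "\<exists>\<Gamma> b. finite \<Gamma> \<and> \<Gamma> \<subseteq> carrier G - {\<one>} \<and> b \<in> H \<and>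
    (\<forall>k\<in>carrier G. bset k \<subseteq> cM b \<longrightarrow> (\<forall>g\<in>\<Gamma>. bset (g \<otimes> k) \<inter> bset k = {}) \<longrightarrow> P k * (a * P k) = \<tau> a \<odot> P k)"
  using a unfolding A0_def
proof (induction rule: cspan.induct)
  case cspan_0
  have "\<tau> 0 = 0" using \<tau>_scl[of 0 0] by simp
  then show ?case using H_simps(3) by (intro exI[of _ "{}"] exI[of _ \<one>]) simp
next
  case (cspan_step x y c)
  obtain s g where x: "s \<in> carrier G" "g \<in> carrier G" "x = U s * P g"
    using cspan_step.hyps(1) unfolding gens_def by blast
  have yA: "y \<in> A0" "x \<in> A0" using cspan_step.hyps(2) x by (auto simp: A0_def[symmetric])
  obtain \<Gamma> b where IH: "finite \<Gamma>" "\<Gamma> \<subseteq> carrier G - {\<one>}" "b \<in> H"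
    "\<forall>k\<in>carrier G. bset k \<subseteq> cM b \<longrightarrow> (\<forall>g\<in>\<Gamma>. bset (g \<otimes> k) \<inter> bset k = {}) \<longrightarrow> P k * (y * P k) = \<tau> y \<odot> P k"
    using cspan_step.IH by (elim exE conjE) (rule that)
  obtain z b1 where g: "z \<in> N" "b1 \<in> H" "g = z \<otimes> b1" using x(2) by (rule decompose)
  obtain b2 where b2: "b2 \<in> H" "cM b2 \<subseteq> cM b" "cM b2 \<subseteq> cM b1"
    using common_subgroup[of "{b, b1}"] IH(3) g(2) by auto
  define \<Gamma>2 where "\<Gamma>2 = (if s = \<one> then \<Gamma> else insert (inv s) \<Gamma>)"
  have "inv s \<noteq> \<one>" if "s \<noteq> \<one>" using that x(1) inv_eq_1_iff by blast
  then have \<Gamma>2: "finite \<Gamma>2" "\<Gamma>2 \<subseteq> carrier G - {\<one>}" "\<Gamma> \<subseteq> \<Gamma>2" "s \<noteq> \<one> \<Longrightarrow> inv s \<in> \<Gamma>2"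
    using IH(1,2) x(1) by (auto simp: \<Gamma>2_def)
  have "P k * ((c \<odot> x + y) * P k) = \<tau> (c \<odot> x + y) \<odot> P k"
    if k: "k \<in> carrier G" and kb: "bset k \<subseteq> cM b2" and free: "\<forall>g\<in>\<Gamma>2. bset (g \<otimes> k) \<inter> bset k = {}" for k
  proof -
    have y: "P k * (y * P k) = \<tau> y \<odot> P k"
      using IH(4) k kb free b2(2) \<Gamma>2(3) by blast
    have x': "P k * (x * P k) = \<tau> x \<odot> P k"
    proof (cases "s = \<one>")
      case False
      have "chi (inv s \<otimes> k) * (chi g * chi k) = 0"
        using free \<Gamma>2(4)[OF False] by (auto simp: fun_eq_iff chi_def indicator_def)
      moreover have "J (chi (inv s \<otimes> k) * (chi g * chi k)) = P (inv s \<otimes> k) * (P g * P k)"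
        using k x star_sub.mult_mem[OF star_sub_D0[OF fin]] by (simp add: J_mult P_def)
      ultimately have z: "P (inv s \<otimes> k) * (P g * P k) = 0" by simp
      have "P k * (x * P k) = (P k * U s) * (P g * P k)" by (simp add: x mult.assoc)
      also have "\<dots> = U s * (P (inv s \<otimes> k) * (P g * P k))" using x k by (simp add: P_U mult.assoc)
      finally show ?thesis using z False x \<tau>_gen[of s g] by simp
    next
      case True
      have b1c: "bset (\<one> \<otimes> b1) = cM b1"
        using g(2) by (simp add: bset_def cM_def act_eq[of \<one> b1, simplified] image_def)
      have "chi k * (chi g * chi k) = chi g \<one> \<odot> chi k"
      proof (cases "\<one> \<in> bset g")
        case 1: True
        have "bset (\<one> \<otimes> b1) = bset g"
          unfolding g(3) by (rule bset_eq_if_mem) (use g 1 in simp_all)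
        then have "bset g = cM b1" by (simp only: b1c)
        then have "bset k \<subseteq> bset g" using kb b2(3) by blast
        then show ?thesis using 1 by (auto simp: fun_eq_iff chi_def indicator_def scl_complex_def)
      next
        case 2: False
        have "bset g \<inter> cM b1 = {}"
          using bset_eq_or_disjoint[of z \<one> b1] 2 g b1c cM_one[of b1] by auto
        then have "bset k \<inter> bset g = {}" using kb b2(3) by blast
        then show ?thesis using 2 by (auto simp: fun_eq_iff chi_def indicator_def scl_complex_def)
      qed
      then have "P k * (P g * P k) = chi g \<one> \<odot> P k"
        using J_mult[of "chi k" "chi g * chi k"] J_mult[of "chi g" "chi k"] J_scl[of "chi k" "chi g \<one>"] k x
          star_sub.mult_mem[OF star_sub_D0[OF fin], of "chi g" "chi k"]
        by (simp add: P_def)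
      then show ?thesis using \<tau>_gen[of \<one> g] x True by simp
    qed
    have "P k * ((c \<odot> x + y) * P k) = c \<odot> (P k * (x * P k)) + P k * (y * P k)"
      by (simp add: distrib_left distrib_right)
    also have "\<dots> = (c * \<tau> x + \<tau> y) \<odot> P k" by (simp add: x' y scl_distribs)
    also have "c * \<tau> x + \<tau> y = \<tau> (c \<odot> x + y)" using yA by (simp add: \<tau>_add \<tau>_scl)
    finally show ?thesis .
  qed
  then show ?case using \<Gamma>2(1,2) b2(1) by (intro exI[of _ \<Gamma>2] exI[of _ b2]) simp
qed

end

section \<open>The Gelfand-Naimark-Segal construction\<close>

lemma functional_eq_zero_if_on_subspace:
  fixes f :: "'x::complex_hilbert_space \<Rightarrow> complex"
  assumes V: "csubspace V" and add: "\<And>x y. f (x + y) = f x + f y" and scale: "\<And>c x. f (c *\<^sub>C x) = c * f x"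
    and bound: "\<And>x. cmod (f x) \<le> C * norm x"
    and onV: "\<And>v. v \<in> V \<Longrightarrow> f v = 0" and perp: "\<And>x. (\<And>v. v \<in> V \<Longrightarrow> cinner v x = 0) \<Longrightarrow> f x = 0"
  shows "f y = 0"
proof -
  have "bop (\<lambda>x. f x *\<^sub>C y)"
    by (rule bopI[where K = "C * norm y"])
       (use bound mult_right_mono[OF bound norm_ge_zero[of y]] in
         \<open>auto simp: add scale scaleC_add_left scaleC_scaleC norm_scaleC mult_ac\<close>)
  then have "(\<lambda>x. f x *\<^sub>C y) = (\<lambda>_. 0)"
    by (rule bop_eq_if_eq_on_subspace[OF V _ bop_zero]) (simp_all add: onV perp)
  then have "f y *\<^sub>C y = 0" by (rule fun_cong)
  then have "cmod (f y) * norm y = 0" using norm_scaleC[of "f y" y] by simp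
  moreover have "f y = 0" if "y = 0" using scale[of 0 y] that by simp
  ultimately show ?thesis by auto
qed

lemma cadjoint_eqI_subspace:
  assumes V: "csubspace V" and T: "bop T" and T': "bop T'"
    and eq: "\<And>v v'. v \<in> V \<Longrightarrow> v' \<in> V \<Longrightarrow> cinner (T v) v' = cinner v (T' v')"
    and inv: "\<And>v. v \<in> V \<Longrightarrow> T v \<in> V" "\<And>v. v \<in> V \<Longrightarrow> T' v \<in> V"
    and perp: "\<And>x. (\<And>v. v \<in> V \<Longrightarrow> cinner v x = 0) \<Longrightarrow> T x = 0" "\<And>x. (\<And>v. v \<in> V \<Longrightarrow> cinner v x = 0) \<Longrightarrow> T' x = 0"
  shows "cadjoint T = T'"
proof (rule cadjoint_eqI[OF T])
  define g where "g x y = cinner (T x) y - cinner x (T' y)" for x y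
  have bound: "cmod (g x y) \<le> (onorm T + onorm T') * norm x * norm y" for x y
  proof -
    have "cmod (g x y) \<le> cmod (cinner (T x) y) + cmod (cinner x (T' y))"
      unfolding g_def by (rule norm_triangle_ineq4)
    also have "\<dots> \<le> norm (T x) * norm y + norm x * norm (T' y)" by (intro add_mono cmod_cinner_le)
    also have "\<dots> \<le> (onorm T * norm x) * norm y + norm x * (onorm T' * norm y)"
      by (intro add_mono mult_right_mono mult_left_mono bop_norm_le T T') auto
    finally show ?thesis by (simp add: algebra_simps)
  qed
  have row: "g x y = 0" if z: "\<And>y. y \<in> V \<Longrightarrow> g x y = 0" "\<And>y. (\<And>v. v \<in> V \<Longrightarrow> cinner v y = 0) \<Longrightarrow> g x y = 0" for x y
  proof -
    have "cnj (g x y) = 0"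
    proof (rule functional_eq_zero_if_on_subspace[OF V, where f = "\<lambda>y. cnj (g x y)"])
      show "cnj (g x (y + z)) = cnj (g x y) + cnj (g x z)" for y z
        by (simp add: g_def cinner_add_right bop_add[OF T'])
      show "cnj (g x (c *\<^sub>C y)) = c * cnj (g x y)" for c y
        by (simp add: g_def cinner_scaleC_right bop_scaleC[OF T'] algebra_simps)
      show "cmod (cnj (g x y)) \<le> ((onorm T + onorm T') * norm x) * norm y" for y using bound[of x y] by simp
    qed (simp_all add: z)
    then show ?thesis by simp
  qed
  have V0: "g x y = 0" if x: "x \<in> V" for x y
  proof (rule row)
    show "g x y = 0" if "y \<in> V" for y using eq[OF x that] by (simp add: g_def)
    show "g x y = 0" if "\<And>v. v \<in> V \<Longrightarrow> cinner v y = 0" for y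
      using that[OF inv(1)[OF x]] perp(2)[OF that] by (simp add: g_def)
  qed
  have perp0: "g x y = 0" if x: "\<And>v. v \<in> V \<Longrightarrow> cinner v x = 0" for x y
  proof (rule row)
    have x': "cinner x v = 0" if "v \<in> V" for v using x[OF that] cinner_commute[of x v] by simp
    show "g x y = 0" if "y \<in> V" for y using perp(1)[OF x] x'[OF inv(2)[OF that]] by (simp add: g_def)
    show "g x y = 0" if "\<And>v. v \<in> V \<Longrightarrow> cinner v y = 0" for y
      using perp(1)[OF x] perp(2)[OF that] by (simp add: g_def)
  qed
  fix x y
  have "g x y = 0"
  proof (rule functional_eq_zero_if_on_subspace[OF V, where f = "\<lambda>x. g x y"])
    show "g (x + z) y = g x y + g z y" for x z by (simp add: g_def cinner_add_left bop_add[OF T])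
    show "g (c *\<^sub>C x) y = c * g x y" for c x by (simp add: g_def cinner_scaleC_left bop_scaleC[OF T] algebra_simps)
    show "cmod (g x y) \<le> ((onorm T + onorm T') * norm y) * norm x" for x using bound[of x y] by (simp add: mult_ac)
  qed (rule V0, assumption, rule perp0, blast)
  then show "cinner (T x) y = cinner x (T' y)" by (simp add: g_def)
qed

text \<open>
  The target is the Hilbert space over the generators rather than a quotient of \<open>S\<close>, so that its dimension is controlled. A
  vector for \<open>a\<close> is pinned down by the first condition on \<open>Q a x\<close>; the second one carries the induction.
\<close>

lemma (in star_sub) gns_vectors:
  fixes g :: "'i \<Rightarrow> 'a"
  assumes F: "posfun S F" and S: "S = cspan (range g)"
  shows "\<exists>w :: 'a \<Rightarrow> 'i ell2. \<forall>a\<in>S. \<forall>b\<in>S. cinner (w a) (w b) = F (adj b * a)"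
proof -
  have g: "g i \<in> S" for i unfolding S by (rule cspan_base) simp
  obtain T :: "'i \<Rightarrow> 'i ell2" where T: "\<forall>i j. cinner (T i) (T j) = F (adj (g j) * g i)"
    using posfun_gram[OF F g] by (rule exE)
  define Q where "Q a x \<longleftrightarrow> (\<forall>j. cinner x (T j) = F (adj (g j) * a)) \<and>
    (\<forall>b z. b \<in> S \<longrightarrow> (\<forall>j. cinner z (T j) = F (adj (g j) * b)) \<longrightarrow> cinner z x = F (adj a * b))" for a x
  have "\<exists>x. Q a x" if "a \<in> S" for a
    using that unfolding S
  proof (induction rule: cspan.induct)
    case cspan_0
    show ?case by (rule exI[of _ 0]) (simp add: Q_def posfun_0[OF F])
  next
    case (cspan_step x y c)
    obtain i where i: "x = g i" using cspan_step.hyps(1) by blast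
    obtain v where v: "Q y v" using cspan_step.IH by (rule exE)
    have y: "y \<in> S" unfolding S by (rule cspan_step.hyps(2))
    have 1: "cinner (c *\<^sub>C T i + v) (T j) = F (adj (g j) * (c \<odot> x + y))" for j
    proof -
      have "F (adj (g j) * (c \<odot> x + y)) = c * F (adj (g j) * g i) + F (adj (g j) * y)"
        using g y by (simp add: distrib_left i posfun_add[OF F] posfun_scl[OF F])
      then show ?thesis using T v by (simp add: cinner_add_left cinner_scaleC_left Q_def)
    qed
    have 2: "cinner z (c *\<^sub>C T i + v) = F (adj (c \<odot> x + y) * b)"
      if b: "b \<in> S" and z: "\<forall>j. cinner z (T j) = F (adj (g j) * b)" for b z
    proof -
      have "F (adj (c \<odot> x + y) * b) = cnj c * F (adj (g i) * b) + F (adj y * b)"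
        using g y b by (simp add: distrib_right i posfun_add[OF F] posfun_scl[OF F])
      moreover have "cinner z v = F (adj y * b)" using v b z unfolding Q_def by blast
      ultimately show ?thesis using z by (simp add: cinner_add_right cinner_scaleC_right)
    qed
    show ?case using 1 2 unfolding Q_def by (intro exI[of _ "c *\<^sub>C T i + v"]) blast
  qed
  then have "\<forall>a. \<exists>x. a \<in> S \<longrightarrow> Q a x" by blast
  then obtain w where w: "\<forall>a. a \<in> S \<longrightarrow> Q a (w a)" by (rule choice[THEN exE])
  have "cinner (w a) (w b) = F (adj b * a)" if "a \<in> S" "b \<in> S" for a b
  proof -
    have "\<forall>j. cinner (w a) (T j) = F (adj (g j) * a)" using w that(1) unfolding Q_def by blast
    then show ?thesis using w that unfolding Q_def by blast
  qed
  then show ?thesis by blast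
qed

locale gns = star_sub S for S :: "'a::complex_star_algebra set" +
  fixes F :: "'a \<Rightarrow> complex" and w :: "'a \<Rightarrow> 'i ell2"
  assumes posF: "posfun S F" and gram: "\<lbrakk>a \<in> S; b \<in> S\<rbrakk> \<Longrightarrow> cinner (w a) (w b) = F (adj b * a)"
begin

lemma w_eqI:
  assumes x: "x = w b + c *\<^sub>C w b'" and b: "b \<in> S" "b' \<in> S" and a: "a \<in> S"
    and eq: "\<And>d. d \<in> S \<Longrightarrow> F (adj d * a) = F (adj d * b) + c * F (adj d * b')"
  shows "w a = w b + c *\<^sub>C w b'"
proof -
  let ?d = "w a - (w b + c *\<^sub>C w b')"
  have z: "cinner ?d (w d) = 0" if "d \<in> S" for d
    using that a b eq[OF that] by (simp add: cinner_diff_left cinner_add_left cinner_scaleC_left gram)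
  have "cinner ?d ?d = 0"
    using z[OF a] z[OF b(1)] z[OF b(2)] by (simp only: cinner_diff_right cinner_add_right cinner_scaleC_right) simp
  then show ?thesis by (simp add: cinner_self)
qed

lemma w_add: "\<lbrakk>a \<in> S; b \<in> S\<rbrakk> \<Longrightarrow> w (a + b) = w a + w b"
  using w_eqI[OF refl, of a b "a + b" 1] by (simp add: distrib_left posfun_add[OF posF])

lemma w_0: "w 0 = 0"
  using w_add[of 0 0] by simp

lemma w_scl: "a \<in> S \<Longrightarrow> w (c \<odot> a) = c *\<^sub>C w a"
  using w_eqI[OF refl, of 0 a "c \<odot> a" c] by (simp add: posfun_scl[OF posF] posfun_0[OF posF] w_0)

lemma norm_w: "a \<in> S \<Longrightarrow> (norm (w a))\<^sup>2 = Re (F (adj a * a))"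
  using arg_cong[OF gram[of a a], of Re] by (simp add: cinner_self)

definition V :: "'i ell2 set" where "V = w ` S"

lemma V_subspace: "csubspace V"
  unfolding csubspace_def V_def
proof (intro conjI ballI allI)
  show "0 \<in> w ` S" by (rule image_eqI[of _ _ 0]) (simp_all add: w_0)
  fix x c assume "x \<in> w ` S"
  then obtain a where a: "a \<in> S" "x = w a" by blast
  then show "c *\<^sub>C x \<in> w ` S" by (intro image_eqI[of _ _ "c \<odot> a"]) (simp_all add: w_scl)
  fix y assume "y \<in> w ` S"
  then obtain b where "b \<in> S" "y = w b" by blast
  then show "x + y \<in> w ` S" using a by (intro image_eqI[of _ _ "a + b"]) (simp_all add: w_add)
qed

definition is_L :: "'a \<Rightarrow> 'i lop \<Rightarrow> bool" where
  "is_L m T \<longleftrightarrow> (\<forall>a\<in>S. Rep_lop T (w a) = w (m * a)) \<and> (\<forall>x. (\<forall>v\<in>V. cinner v x = 0) \<longrightarrow> Rep_lop T x = 0)"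

text \<open>Multipliers of \<open>S\<close> whose left multiplication is bounded for the seminorm of \<open>F\<close>.\<close>

definition bmult :: "real \<Rightarrow> 'a \<Rightarrow> bool" where
  "bmult C m \<longleftrightarrow> 0 \<le> C \<and> (\<forall>a\<in>S. m * a \<in> S \<and> Re (F (adj (m * a) * (m * a))) \<le> C\<^sup>2 * Re (F (adj a * a)))"

definition L :: "'a \<Rightarrow> 'i lop" where "L m = (THE T. is_L m T)"

lemma is_L_unique: "\<lbrakk>is_L m T; is_L m T'\<rbrakk> \<Longrightarrow> T = T'"
proof -
  assume T: "is_L m T" "is_L m T'"
  have "Rep_lop T = Rep_lop T'"
  proof (rule bop_eq_if_eq_on_subspace[OF V_subspace bop_Rep bop_Rep])
    show "Rep_lop T v = Rep_lop T' v" if "v \<in> V" for v using that T by (auto simp: V_def is_L_def)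
    show "Rep_lop T x = Rep_lop T' x" if "\<forall>v\<in>V. cinner v x = 0" for x using that T by (auto simp: is_L_def)
  qed
  then show ?thesis by (simp add: Rep_lop_inject)
qed

lemma L_eqI: "is_L m T \<Longrightarrow> L m = T"
  unfolding L_def by (rule the_equality) (auto intro: is_L_unique)

lemma is_L_L:
  assumes m: "bmult C m"
  shows "is_L m (L m)" "lnorm (L m) \<le> C"
proof -
  have C: "0 \<le> C" and mS: "\<And>a. a \<in> S \<Longrightarrow> m * a \<in> S" using m by (auto simp: bmult_def)
  have le: "norm (w (m * a)) \<le> C * norm (w a)" if a: "a \<in> S" for a
  proof (rule power2_le_imp_le)
    show "(norm (w (m * a)))\<^sup>2 \<le> (C * norm (w a))\<^sup>2"
      using m a by (simp add: norm_w mS power_mult_distrib bmult_def)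
  qed (use C in simp)
  define pick where "pick x = (SOME a. a \<in> S \<and> w a = x)" for x
  have pick: "pick x \<in> S \<and> w (pick x) = x" if "x \<in> V" for x
    unfolding pick_def by (rule someI_ex) (use that in \<open>auto simp: V_def\<close>)
  have well: "w (m * a) = w (m * b)" if "a \<in> S" "b \<in> S" "w a = w b" for a b
  proof -
    have "w (a + (-1) \<odot> b) = 0" using that by (simp only: w_add w_scl scl_mem) (simp add: scaleC_minus_one)
    then have "w (m * (a + (-1) \<odot> b)) = 0" using le[of "a + (-1) \<odot> b"] that(1,2) by simp
    moreover have "w (m * (a + (-1) \<odot> b)) = w (m * a) - w (m * b)"
      unfolding distrib_left scl_mult_right using that mS
      by (simp only: w_add w_scl scl_mem) (simp add: scaleC_minus_one)
    ultimately show ?thesis by simp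
  qed
  define t where "t x = w (m * pick x)" for x
  have t: "t (w a) = w (m * a)" if "a \<in> S" for a
    unfolding t_def using pick[of "w a"] that by (intro well) (auto simp: V_def)
  have "\<exists>T. bop T \<and> (\<forall>x\<in>V. T x = t x) \<and> onorm T \<le> C \<and> (\<forall>x. (\<forall>v\<in>V. cinner v x = 0) \<longrightarrow> T x = 0)"
  proof (rule operator_extension[OF V_subspace _ _ _ C])
    fix x c assume "x \<in> V"
    then obtain a where a: "a \<in> S" "x = w a" by (auto simp: V_def)
    show "t (c *\<^sub>C x) = c *\<^sub>C t x"
      using t[of "c \<odot> a"] a mS by (simp add: w_scl t)
    show "norm (t x) \<le> C * norm x" using le[OF a(1)] a by (simp add: t)
    fix y assume "y \<in> V"
    then obtain b where b: "b \<in> S" "y = w b" by (auto simp: V_def)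
    show "t (x + y) = t x + t y"
      using t[of "a + b"] a b mS by (simp add: w_add t distrib_left)
  qed
  then obtain T where T: "bop T" "\<forall>x\<in>V. T x = t x" "onorm T \<le> C" "\<forall>x. (\<forall>v\<in>V. cinner v x = 0) \<longrightarrow> T x = 0"
    by (elim exE conjE) (rule that)
  have R: "Rep_lop (Abs_lop T) = T" using T(1) by (simp add: Abs_lop_inverse)
  have "is_L m (Abs_lop T)" unfolding is_L_def R using T(2,4) t by (auto simp: V_def)
  moreover from L_eqI[OF this] have "L m = Abs_lop T" .
  ultimately show "is_L m (L m)" "lnorm (L m) \<le> C" using T(3) by (simp_all add: lnorm_def R)
qed

lemma L_w: "\<lbrakk>bmult C m; a \<in> S\<rbrakk> \<Longrightarrow> Rep_lop (L m) (w a) = w (m * a)"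
  using is_L_L(1)[of C m] by (simp add: is_L_def)

lemma L_perp: "\<lbrakk>bmult C m; \<forall>v\<in>V. cinner v x = 0\<rbrakk> \<Longrightarrow> Rep_lop (L m) x = 0"
  using is_L_L(1)[of C m] by (simp add: is_L_def)

lemma bmult_mem: "\<lbrakk>bmult C m; a \<in> S\<rbrakk> \<Longrightarrow> m * a \<in> S"
  by (simp add: bmult_def)

lemma
  assumes m: "bmult C m"
  shows L_scl: "L (c \<odot> m) = c \<odot> L m"
    and L_mult: "bmult C' m' \<Longrightarrow> L (m * m') = L m * L m'"
    and L_add: "bmult C' m' \<Longrightarrow> L (m + m') = L m + L m'"
proof -
  note m_simps = L_w[OF m] L_perp[OF m] bmult_mem[OF m] is_L_def Rep_lop_simps
  show "L (c \<odot> m) = c \<odot> L m"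
    by (rule L_eqI) (simp add: m_simps w_scl)
  assume m': "bmult C' m'"
  note m_simps = m_simps L_w[OF m'] L_perp[OF m'] bmult_mem[OF m']
  show "L (m * m') = L m * L m'"
    by (rule L_eqI) (simp add: m_simps mult.assoc bop_0)
  show "L (m + m') = L m + L m'"
    by (rule L_eqI) (simp add: m_simps distrib_right w_add)
qed

lemma L_adj:
  assumes m: "bmult C m" and m': "bmult C' (adj m)"
  shows "L (adj m) = adj (L m)"
proof -
  have "cadjoint (Rep_lop (L m)) = Rep_lop (L (adj m))"
  proof (rule cadjoint_eqI_subspace[OF V_subspace bop_Rep bop_Rep])
    have mS: "m * a \<in> S" "adj m * a \<in> S" if "a \<in> S" for a using m m' that by (auto simp: bmult_def)
    fix v assume "v \<in> V"
    then obtain a where a: "a \<in> S" "v = w a" by (auto simp: V_def)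
    show "Rep_lop (L m) v \<in> V" "Rep_lop (L (adj m)) v \<in> V"
      using a mS by (auto simp: L_w[OF m] L_w[OF m'] V_def)
    fix v' assume "v' \<in> V"
    then obtain b where b: "b \<in> S" "v' = w b" by (auto simp: V_def)
    show "cinner (Rep_lop (L m) v) v' = cinner v (Rep_lop (L (adj m)) v')"
      using a b mS by (simp add: L_w[OF m] L_w[OF m'] gram mult.assoc)
  qed (use L_perp[OF m] L_perp[OF m'] in blast)+
  then show ?thesis by (intro lop_eqI) (simp add: Rep_lop_adj)
qed

end

context semidirect_setting
begin

lemma act_fun_linf:
  assumes s: "s \<in> carrier G" and f: "f \<in> linf N"
  shows "act_fun G N H s f \<in> linf N" "supn N (act_fun G N H s f) \<le> supn N f"
proof -
  have le: "cmod (act_fun G N H s f y) \<le> supn N f" if "y \<in> N" for y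
    unfolding act_fun_apply using that s f act_mem[of "inv s" y] by (simp add: cmod_le_supn)
  show "act_fun G N H s f \<in> linf N"
    by (rule linfI[where c = "supn N f"]) (use le in \<open>auto simp: act_fun_apply\<close>)
  have "N \<noteq> {}" using N_simps(3) by blast
  then show "supn N (act_fun G N H s f) \<le> supn N f" by (rule supn_le) (rule le)
qed

lemma act_fun_mult: "act_fun G N H s (d * d') = act_fun G N H s d * act_fun G N H s d'"
  and act_fun_adj: "act_fun G N H s (adj d) = adj (act_fun G N H s d)"
  by (auto simp: fun_eq_iff act_fun_apply adj_complex_def)

lemma act_fun_diff: "act_fun G N H s (d - d') = act_fun G N H s d - act_fun G N H s d'"
  by (auto simp: fun_eq_iff act_fun_apply)

lemma act_fun_D:
  assumes fin: "finite_quotients G H M" and s: "s \<in> carrier G" and d: "d \<in> D"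
  shows "act_fun G N H s d \<in> D"
proof -
  have one: "\<one> \<in> N" by simp
  then interpret c: cstar_complete "linf N" "supn N" by (intro cstar_complete_linf) blast
  have dl: "d \<in> linf N" using d D_facts(1)[OF fin] by blast
  have "\<exists>y\<in>D0. supn N (act_fun G N H s d - y) < e" if e: "0 < e" for e
  proof -
    obtain y where y: "y \<in> D0" "supn N (d - y) < e"
      using d e unfolding D_eq[OF fin] c.cls_def by blast
    have "supn N (act_fun G N H s (d - y)) \<le> supn N (d - y)"
      using dl y D0_subset_linf by (intro act_fun_linf s) auto
    then show ?thesis using y act_fun_D0[OF s y(1)] by (intro bexI[of _ "act_fun G N H s y"]) (simp_all add: act_fun_diff)
  qed
  then show ?thesis unfolding D_eq[OF fin] c.cls_def using act_fun_linf(1)[OF s dl] by blast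
qed

lemma represented_D:
  assumes fin: "finite_quotients G H M"
  shows "represented D ((ell_infinity N)\<lparr>carrier := D\<rparr>) (\<lambda>f. f)"
  using represented.represented_subset[OF represented_linf D_facts(3,1)[OF fin]] by simp

lemma star_hom_D_iff:
  assumes fin: "finite_quotients G H M"
  shows "star_hom ((ell_infinity N)\<lparr>carrier := D\<rparr>) (bounded_ops :: ('x::complex_hilbert_space \<Rightarrow> 'x) normed_star_alg) \<pi>
    \<longleftrightarrow> hom_on D \<pi>"
  using represented.star_hom_iff[OF represented_D[OF fin], of \<pi>] by simp

end

text \<open>
  The generators \<open>U s * P g\<close> are indexed by pairs, while the space of the universal representation is spanned by
  a basis indexed by \<open>'g \<times> nat\<close>.
\<close>

lemma ex_surj_pairs: "\<exists>h :: 'g \<times> nat \<Rightarrow> 'g \<times> 'g. surj h"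
proof (cases "finite (UNIV :: 'g set)")
  case True
  then have "countable (UNIV :: ('g \<times> 'g) set)"
    by (simp add: countable_finite flip: UNIV_Times_UNIV)
  then have "range (from_nat_into (UNIV :: ('g \<times> 'g) set)) = UNIV" by (intro range_from_nat_into) auto
  moreover have "surj (snd :: 'g \<times> nat \<Rightarrow> nat)" by (simp add: surj_def)
  ultimately have "surj (from_nat_into (UNIV :: ('g \<times> 'g) set) \<circ> (snd :: 'g \<times> nat \<Rightarrow> nat))"
    by (intro comp_surj)
  then show ?thesis by blast
next
  case False
  obtain f :: "'g \<times> 'g \<Rightarrow> 'g" where f: "bij_betw f (UNIV \<times> UNIV) UNIV"
    using card_of_Times_same_infinite[OF False] by (auto simp flip: card_of_ordIso)
  have "surj (inv_into UNIV f)" using bij_betw_imp_inj_on[OF f] by (simp add: inj_imp_surj_inv)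
  moreover have "surj (fst :: 'g \<times> nat \<Rightarrow> 'g)" by (simp add: surj_def)
  ultimately have "surj (inv_into UNIV f \<circ> (fst :: 'g \<times> nat \<Rightarrow> 'g))" by (intro comp_surj)
  then show ?thesis by blast
qed

lemma (in coset_algebra) A0_eq_cspan_range: "\<exists>e :: 'g \<times> nat \<Rightarrow> 'a. A0 = cspan (range e)"
proof -
  obtain h :: "'g \<times> nat \<Rightarrow> 'g \<times> 'g" where h: "surj h" using ex_surj_pairs by (rule exE)
  define e where "e i = (let (s, g) = h i in if s \<in> carrier G \<and> g \<in> carrier G then U s * P g else 0)" for i
  have "gens \<subseteq> range e"
  proof
    fix x assume "x \<in> gens"
    then obtain s g where x: "x = U s * P g" "s \<in> carrier G" "g \<in> carrier G" unfolding gens_def by blast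
    obtain i where "(s, g) = h i" using h unfolding surj_def by blast
    then have "x = e i" using x by (simp add: e_def flip: \<open>(s, g) = h i\<close>)
    then show "x \<in> range e" by blast
  qed
  then have 1: "gens \<subseteq> cspan (range e)" by (auto intro: cspan_base)
  have 2: "range e \<subseteq> cspan gens"
  proof (rule image_subsetI)
    fix i
    obtain s g where sg: "h i = (s, g)" by (cases "h i")
    show "e i \<in> cspan gens" using gen_A0[of s g] cspan_0[of gens] by (simp add: e_def sg A0_def)
  qed
  have "A0 = cspan (range e)"
    unfolding A0_def using cspan_subset_cspan[OF 1] cspan_subset_cspan[OF 2] by (rule equalityI)
  then show ?thesis by blast
qed

locale coset_gns = coset_algebra G N H M U J
  for G :: "('g, 'm) monoid_scheme" (structure) and N H M
    and U :: "'g \<Rightarrow> 'a::complex_star_algebra" and J +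
  fixes F :: "'a \<Rightarrow> complex" and w :: "'a \<Rightarrow> 'i ell2"
  assumes posF: "posfun A0 F" and gram: "\<And>a b. \<lbrakk>a \<in> A0; b \<in> A0\<rbrakk> \<Longrightarrow> cinner (w a) (w b) = F (adj b * a)"
begin

sublocale gns A0 F w
  by unfold_locales (fact posF, rule gram)

lemma bmult_U: "s \<in> carrier G \<Longrightarrow> bmult 1 (U s)"
  unfolding bmult_def by (simp add: U_adj mult.assoc U_mult' U_one_A0)

lemma bmult_J: "d \<in> D0 \<Longrightarrow> bmult (supn N d) (J d)"
proof -
  assume d: "d \<in> D0"
  have one: "\<one> \<in> N" by simp
  then interpret c: cstar_complete "linf N" "supn N" by (intro cstar_complete_linf) blast
  have "0 \<le> supn N d" using d D0_subset_linf by (intro c.nu_nonneg) blast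
  then show ?thesis
    unfolding bmult_def using d posfun_J_bound[OF posF d] by (intro conjI ballI A0.mult_mem J_A0) simp_all
qed

lemma bmult_mult:
  assumes m: "bmult C m" and m': "bmult C' m'"
  shows "bmult (C * C') (m * m')"
  unfolding bmult_def
proof (intro conjI ballI)
  show "0 \<le> C * C'" using m m' by (simp add: bmult_def)
  fix a assume a: "a \<in> A0"
  have m'a: "m' * a \<in> A0" by (rule bmult_mem[OF m' a])
  show "m * m' * a \<in> A0" using bmult_mem[OF m m'a] by (simp add: mult.assoc)
  have "Re (F (adj (m * (m' * a)) * (m * (m' * a)))) \<le> C\<^sup>2 * Re (F (adj (m' * a) * (m' * a)))"
    using m m'a unfolding bmult_def by blast
  also have "\<dots> \<le> C\<^sup>2 * (C'\<^sup>2 * Re (F (adj a * a)))"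
    using m' a unfolding bmult_def by (intro mult_left_mono) auto
  finally show "Re (F (adj (m * m' * a) * (m * m' * a))) \<le> (C * C')\<^sup>2 * Re (F (adj a * a))"
    by (simp only: mult.assoc power_mult_distrib)
qed

text \<open>The group acts trivially on the orthogonal complement of the representation space.\<close>

definition u :: "'g \<Rightarrow> 'i lop" where "u s = L (U s) + 1 - L (U \<one>)"

lemma LU_mult: "\<lbrakk>s \<in> carrier G; t \<in> carrier G\<rbrakk> \<Longrightarrow> L (U s) * L (U t) = L (U (s \<otimes> t))"
  using L_mult[OF bmult_U bmult_U, of s t] by (simp add: U_mult)

lemma u_mult: "\<lbrakk>s \<in> carrier G; t \<in> carrier G\<rbrakk> \<Longrightarrow> u s * u t = u (s \<otimes> t)"
  unfolding u_def by (simp add: algebra_simps LU_mult)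

lemma u_one: "u \<one> = 1"
  by (simp add: u_def)

lemma u_adj: "s \<in> carrier G \<Longrightarrow> adj (u s) = u (inv s)"
  using L_adj[of 1 "U s" 1] L_adj[of 1 "U \<one>" 1] bmult_U[of s] bmult_U[of "inv s"] bmult_U[of \<one>]
  by (simp add: u_def U_adj)

lemma LJ_hom: "hom_on D0 (\<lambda>d. Rep_lop (L (J d)))"
proof -
  have D0: "star_sub D0" by (rule star_sub_D0[OF fin])
  have "L (J (a + b)) = L (J a) + L (J b)" "L (J (a * b)) = L (J a) * L (J b)" "L (J (c \<odot> a)) = c \<odot> L (J a)"
    "L (J (adj a)) = adj (L (J a))" if "a \<in> D0" "b \<in> D0" for a b c
    using that L_add[OF bmult_J bmult_J, of a b] L_mult[OF bmult_J bmult_J, of a b] L_scl[OF bmult_J, of a c]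
      L_adj[OF bmult_J, of a "supn N (adj a)"] bmult_J[of "adj a"] star_sub.adj_mem[OF D0, of a]
    by (simp_all add: J_add J_mult J_scl J_adj)
  then show ?thesis unfolding hom_on_def by (simp add: Rep_lop_simps Rep_lop_adj)
qed

lemma u_LJ:
  assumes s: "s \<in> carrier G" and d: "d \<in> D0"
  shows "u s * L (J d) = L (U s) * L (J d)"
proof -
  have "L (U \<one>) * L (J d) = L (J d)"
    using L_mult[OF bmult_U bmult_J, of \<one> d] d by (simp add: U_one_J)
  then show ?thesis by (simp add: u_def algebra_simps)
qed

lemma LJ_cov:
  assumes s: "s \<in> carrier G" and d: "d \<in> D0"
  shows "u s * L (J d) * adj (u s) = L (J (act_fun G N H s d))"
proof -
  interpret D0: star_sub D0 by (rule star_sub_D0[OF fin])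
  have JA: "adj (L (J d)) = L (J (adj d))" if "d \<in> D0" for d
    using L_adj[OF bmult_J[OF that], of "supn N (adj d)"] bmult_J[of "adj d"] that by (simp add: J_adj)
  have "L (J (adj d)) = adj (L (J d))" using JA[OF d] by simp
  have "L (J d) * adj (u s) = adj (u s * L (J (adj d)))" using JA[of "adj d"] d by simp
  also have "\<dots> = adj (L (U s) * L (J (adj d)))" using s d by (simp add: u_LJ)
  also have "\<dots> = L (J d) * L (U (inv s))"
    using JA[of "adj d"] d L_adj[OF bmult_U[OF s], of 1] bmult_U[of "inv s"] s by (simp add: U_adj)
  finally have 1: "L (J d) * adj (u s) = L (J d) * L (U (inv s))" .
  have "u s * L (J d) * adj (u s) = u s * (L (J d) * adj (u s))" by (simp only: mult.assoc)
  also have "\<dots> = (u s * L (J d)) * L (U (inv s))" by (simp only: 1 mult.assoc)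
  also have "\<dots> = L (U s * J d) * L (U (inv s))"
    using s d by (simp only: u_LJ L_mult[OF bmult_U bmult_J])
  also have "\<dots> = L (U s * J d * U (inv s))"
    by (rule L_mult[OF bmult_mult[OF bmult_U[OF s] bmult_J[OF d]] bmult_U[OF inv_closed[OF s]], symmetric])
  finally show ?thesis using J_cov[OF s d] by simp
qed

lemma unitary_u:
  assumes s: "s \<in> carrier G"
  shows "unitary_op (Rep_lop (u s))"
proof -
  have "u s * adj (u s) = 1" "adj (u s) * u s = 1" using s by (simp_all add: u_adj u_mult u_one)
  then have "Rep_lop (u s * adj (u s)) = id" "Rep_lop (adj (u s) * u s) = id" by (simp_all add: Rep_lop_1)
  then show ?thesis by (simp add: unitary_op_def Rep_lop_times Rep_lop_adj)
qed

text \<open>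
  The representation of \<open>D0\<close> by left multiplication is contractive and therefore extends to \<open>D\<close>; covariance passes to
  \<open>D\<close> because both sides are homomorphisms that agree on a dense subalgebra.
\<close>

theorem gns_covariant:
  "\<exists>\<rho>\<in>covariant_reps G N H M. \<forall>s\<in>carrier G. \<forall>g\<in>carrier G. \<forall>a\<in>A0. snd \<rho> s (fst \<rho> (chi g) (w a)) = w (U s * (P g * a))"
proof -
  note Df = D_facts[OF fin]
  interpret Dn: cstar_complete D "supn N" by (rule Df(4))
  obtain \<pi> where \<pi>: "hom_on D \<pi>" "\<forall>d\<in>D0. \<pi> d = Rep_lop (L (J d))"
    using Dn.hom_extension[OF star_sub_D0[OF fin] Df(2) Df(5) LJ_hom] is_L_L(2)[OF bmult_J]
    unfolding lnorm_def by blast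
  let ?\<rho> = "(\<pi>, \<lambda>s. Rep_lop (u s))"
  have "\<pi> (act_fun G N H s d) = Rep_lop (u s) \<circ> \<pi> d \<circ> cadjoint (Rep_lop (u s))"
    if s: "s \<in> carrier G" and d: "d \<in> D" for s d
  proof (rule Dn.hom_unique[OF Df(2) Df(5) _ _ _ d, of "\<lambda>d. \<pi> (act_fun G N H s d)" "\<lambda>d. Rep_lop (u s) \<circ> \<pi> d \<circ> cadjoint (Rep_lop (u s))"])
    note h = \<pi>(1)[unfolded hom_on_def]
    note aD = act_fun_D[OF fin s]
    show "hom_on D (\<lambda>d. \<pi> (act_fun G N H s d))"
      unfolding hom_on_def act_fun_add act_fun_scl act_fun_mult act_fun_adj using h aD by blast
    let ?c = "\<lambda>d. Rep_lop (u s) \<circ> \<pi> d \<circ> cadjoint (Rep_lop (u s))"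
    have un: "cadjoint (Rep_lop (u s)) (Rep_lop (u s) x) = x" for x
      using unitary_u[OF s] unfolding unitary_op_def by (metis comp_apply id_apply)
    have bu: "bop (Rep_lop (u s))" "bop (cadjoint (Rep_lop (u s)))" by (simp_all add: bop_cadjoint)
    show "hom_on D ?c"
      unfolding hom_on_def
    proof (intro conjI ballI allI)
      fix a b c assume a: "a \<in> D"
      have ba: "bop (\<pi> a)" by (rule hom_on_bop[OF \<pi>(1) a])
      show "bop (?c a)" by (intro bop_comp bu ba)
      show "?c (c \<odot> a) = (\<lambda>x. c *\<^sub>C ?c a x)"
        using a by (simp add: fun_eq_iff hom_on_scl[OF \<pi>(1)] bop_scaleC)
      show "?c (adj a) = cadjoint (?c a)"
        using a ba bu by (simp add: cadjoint_comp bop_comp cadjoint_cadjoint hom_on_adj[OF \<pi>(1)] o_assoc)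
      assume b: "b \<in> D"
      show "?c (a + b) = (\<lambda>x. ?c a x + ?c b x)"
        using a b by (simp add: fun_eq_iff hom_on_add[OF \<pi>(1)] bop_add)
      show "?c (a * b) = ?c a \<circ> ?c b"
        using a b by (simp add: fun_eq_iff hom_on_mult[OF \<pi>(1)] un)
    qed
    show "\<pi> (act_fun G N H s d) = ?c d" if "d \<in> D0" for d
      using that \<pi>(2) LJ_cov[OF s that] act_fun_D0[OF s that]
      by (simp add: Rep_lop_times Rep_lop_adj o_assoc flip: LJ_cov[OF s that])
  qed
  then have "?\<rho> \<in> covariant_reps G N H M"
    unfolding covariant_reps_def
    using \<pi>(1) unitary_u by (simp add: star_hom_D_iff[OF fin] Rep_lop_times flip: u_mult)
  moreover have "Rep_lop (u s) (\<pi> (chi g) (w a)) = w (U s * (P g * a))"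
    if s: "s \<in> carrier G" and g: "g \<in> carrier G" and a: "a \<in> A0" for s g a
  proof -
    have "Rep_lop (u s) (\<pi> (chi g) (w a)) = Rep_lop (u s * L (J (chi g))) (w a)"
      using \<pi>(2) g by (simp add: Rep_lop_times)
    also have "\<dots> = Rep_lop (L (U s)) (Rep_lop (L (J (chi g))) (w a))"
      using s g by (simp add: u_LJ Rep_lop_times)
    also have "\<dots> = w (U s * (P g * a))"
      using s g a by (simp add: L_w[OF bmult_J] L_w[OF bmult_U] P_def)
    finally show ?thesis .
  qed
  ultimately show ?thesis by (intro bexI[of _ ?\<rho>]) simp_all
qed

end

section \<open>The full crossed product and its corner\<close>

lemma represented_fams:
  "represented (fams R) (op_families R) (\<lambda>(a :: 'r \<Rightarrow> 'i lop) \<rho>. Rep_lop (a \<rho>))" if R: "R \<noteq> {}" for R :: "'r set"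
proof -
  interpret cstar_complete "fams R :: ('r \<Rightarrow> 'i lop) set" "fnorm R" by (rule cstar_complete_fnorm[OF R])
  show ?thesis
  proof (intro represented.intro star_sub_axioms represented_axioms.intro)
    show "carrier (op_families R) = (\<lambda>(a :: 'r \<Rightarrow> 'i lop) \<rho>. Rep_lop (a \<rho>)) ` fams R"
    proof
      show "(\<lambda>(a :: 'r \<Rightarrow> 'i lop) \<rho>. Rep_lop (a \<rho>)) ` fams R \<subseteq> carrier (op_families R)"
        by (auto simp: op_families_def fams_def lnorm_def Rep_lop_0)
      show "carrier (op_families R) \<subseteq> (\<lambda>(a :: 'r \<Rightarrow> 'i lop) \<rho>. Rep_lop (a \<rho>)) ` fams R"
      proof
        fix E :: "'r \<Rightarrow> 'i ell2 \<Rightarrow> 'i ell2" assume "E \<in> carrier (op_families R)"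
        then have E: "\<forall>\<rho>\<in>R. bop (E \<rho>)" "\<forall>\<rho>. \<rho> \<notin> R \<longrightarrow> E \<rho> = (\<lambda>_. 0)" "bdd_above ((\<lambda>\<rho>. onorm (E \<rho>)) ` R)"
          by (auto simp: op_families_def)
        have bE: "bop (E \<rho>)" for \<rho> using E(1,2) bop_zero by (cases "\<rho> \<in> R") auto
        have rep: "Rep_lop (Abs_lop (E \<rho>)) = E \<rho>" for \<rho> using bE by (simp add: Abs_lop_inverse)
        have "(\<lambda>\<rho>. Abs_lop (E \<rho>)) \<in> fams R"
          using E(2,3) by (simp add: fams_def lnorm_def rep zero_lop_def)
        then show "E \<in> (\<lambda>(a :: 'r \<Rightarrow> 'i lop) \<rho>. Rep_lop (a \<rho>)) ` fams R"
          by (intro image_eqI[of _ _ "\<lambda>\<rho>. Abs_lop (E \<rho>)"]) (simp_all add: rep)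
      qed
    qed
    show "inj_on (\<lambda>(a :: 'r \<Rightarrow> 'i lop) \<rho>. Rep_lop (a \<rho>)) (fams R)"
      by (rule inj_onI) (simp add: fun_eq_iff Rep_lop_inject[symmetric])
  qed (simp_all add: op_families_def fun_eq_iff Rep_lop_simps Rep_lop_adj)
qed

lemma op_families_norm: "sa_norm (op_families R) (\<lambda>\<rho>. Rep_lop (a \<rho>)) = fnorm R a"
  by (simp add: op_families_def fnorm_def lnorm_def)

locale crossed = semidirect_setting G N H M
  for G :: "('g, 'm) monoid_scheme" (structure) and N H M +
  assumes finq: "finite_quotients G H M"
begin

abbreviation R :: "'g univ_rep set" where "R \<equiv> covariant_reps G N H M"

lemma R_D:
  assumes "\<rho> \<in> R"
  shows R_hom: "hom_on D (fst \<rho>)"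
    and R_unitary: "s \<in> carrier G \<Longrightarrow> unitary_op (snd \<rho> s)"
    and R_mult: "s \<in> carrier G \<Longrightarrow> t \<in> carrier G \<Longrightarrow> snd \<rho> (s \<otimes> t) = snd \<rho> s \<circ> snd \<rho> t"
    and R_cov: "s \<in> carrier G \<Longrightarrow> d \<in> D \<Longrightarrow> fst \<rho> (act_fun G N H s d) = snd \<rho> s \<circ> fst \<rho> d \<circ> cadjoint (snd \<rho> s)"
  using assms unfolding covariant_reps_def by (auto simp: star_hom_D_iff[OF finq])

lemma R_bop: "\<lbrakk>\<rho> \<in> R; s \<in> carrier G\<rbrakk> \<Longrightarrow> bop (snd \<rho> s)"
  using R_unitary by (simp add: unitary_op_def)

lemma R_one: "\<rho> \<in> R \<Longrightarrow> snd \<rho> \<one> = id"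
proof -
  assume r: "\<rho> \<in> R"
  have c: "cadjoint (snd \<rho> \<one>) \<circ> snd \<rho> \<one> = id" using R_unitary[OF r one_closed] by (simp add: unitary_op_def)
  have "snd \<rho> \<one> = (cadjoint (snd \<rho> \<one>) \<circ> snd \<rho> \<one>) \<circ> snd \<rho> \<one>" by (simp add: c)
  also have "\<dots> = cadjoint (snd \<rho> \<one>) \<circ> (snd \<rho> \<one> \<circ> snd \<rho> \<one>)" by (simp add: o_assoc)
  also have "snd \<rho> \<one> \<circ> snd \<rho> \<one> = snd \<rho> \<one>" using R_mult[OF r one_closed one_closed] by simp
  finally show ?thesis using c by (rule trans)
qed

lemma R_adj: "\<lbrakk>\<rho> \<in> R; s \<in> carrier G\<rbrakk> \<Longrightarrow> cadjoint (snd \<rho> s) = snd \<rho> (inv s)"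
proof -
  assume r: "\<rho> \<in> R" and s: "s \<in> carrier G"
  have c: "cadjoint (snd \<rho> s) \<circ> snd \<rho> s = id" using R_unitary[OF r s] by (simp add: unitary_op_def)
  have "snd \<rho> s \<circ> snd \<rho> (inv s) = id" using R_mult[OF r s, of "inv s"] s R_one[OF r] by simp
  then have "cadjoint (snd \<rho> s) = cadjoint (snd \<rho> s) \<circ> (snd \<rho> s \<circ> snd \<rho> (inv s))" by simp
  also have "\<dots> = (cadjoint (snd \<rho> s) \<circ> snd \<rho> s) \<circ> snd \<rho> (inv s)" by (simp only: o_assoc)
  finally show ?thesis by (simp add: c)
qed

lemma R_nonempty: "R \<noteq> {}"
proof -
  have id: "cadjoint (id :: 'g univ_space \<Rightarrow> _) = id" by (rule cadjoint_eqI[OF bop_id]) simp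
  have "((\<lambda>_ _. 0), (\<lambda>_. id)) \<in> R"
    unfolding covariant_reps_def
    by (auto simp: star_hom_D_iff[OF finq] hom_on_def unitary_op_def bop_zero bop_id id cadjoint_zero o_def)
  then show ?thesis by blast
qed

definition iD :: "('g \<Rightarrow> complex) \<Rightarrow> 'g univ_rep \<Rightarrow> ('g \<times> nat) lop" where
  "iD d = (\<lambda>\<rho>. if \<rho> \<in> R then Abs_lop (fst \<rho> d) else 0)"

definition iG :: "'g \<Rightarrow> 'g univ_rep \<Rightarrow> ('g \<times> nat) lop" where
  "iG s = (\<lambda>\<rho>. if \<rho> \<in> R then Abs_lop (snd \<rho> s) else 0)"

lemma Rep_iD: "\<lbrakk>\<rho> \<in> R; d \<in> D\<rbrakk> \<Longrightarrow> Rep_lop (iD d \<rho>) = fst \<rho> d"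
  using hom_on_bop[OF R_hom] by (simp add: iD_def Abs_lop_inverse)

lemma Rep_iG: "\<lbrakk>\<rho> \<in> R; s \<in> carrier G\<rbrakk> \<Longrightarrow> Rep_lop (iG s \<rho>) = snd \<rho> s"
  using R_bop by (simp add: iG_def Abs_lop_inverse)

lemma fam_eqI:
  assumes "\<And>\<rho>. \<rho> \<notin> R \<Longrightarrow> a \<rho> = b \<rho>" "\<And>\<rho>. \<rho> \<in> R \<Longrightarrow> Rep_lop (a \<rho>) = Rep_lop (b \<rho>)"
  shows "a = b"
  using assms by (intro ext) (metis Rep_lop_inject)

lemma iD_hom:
  assumes d: "d \<in> D" "d' \<in> D"
  shows "iD (d + d') = iD d + iD d'" "iD (c \<odot> d) = c \<odot> iD d" "iD (d * d') = iD d * iD d'" "iD (adj d) = adj (iD d)"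
proof -
  interpret D: star_sub D by (rule D_facts(3)[OF finq])
  have h: "\<forall>\<rho>\<in>R. hom_on D (fst \<rho>)" using R_hom by blast
  show "iD (d + d') = iD d + iD d'" "iD (c \<odot> d) = c \<odot> iD d" "iD (d * d') = iD d * iD d'" "iD (adj d) = adj (iD d)"
    by (rule fam_eqI; use d h in \<open>simp add: Rep_iD Rep_lop_simps Rep_lop_adj hom_on_def\<close>; simp add: iD_def)+
qed

sublocale coset_algebra G N H M iG iD
proof unfold_locales
  note sub = subsetD[OF D_facts(2)[OF finq]]
  show "finite_quotients G H M" by (rule finq)
  fix g h assume g: "g \<in> carrier G"
  show "adj (iG g) = iG (inv g)"
    by (rule fam_eqI) (use g in \<open>simp_all add: Rep_iG Rep_lop_adj R_adj\<close>, simp add: iG_def)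
  show "iG g * iG h = iG (g \<otimes> h)" if "h \<in> carrier G"
    by (rule fam_eqI) (use g that in \<open>simp_all add: Rep_iG Rep_lop_times R_mult\<close>, simp add: iG_def)
next
  note sub = subsetD[OF D_facts(2)[OF finq]]
  fix d d' c assume d: "d \<in> D0"
  show "iD (c \<odot> d) = c \<odot> iD d" "iD (adj d) = adj (iD d)" using iD_hom[OF sub[OF d] sub[OF d]] by auto
  show "iG \<one> * iD d = iD d"
    by (rule fam_eqI) (use sub[OF d] in \<open>simp_all add: Rep_iG Rep_iD Rep_lop_times R_one\<close>, simp add: iG_def iD_def)
  show "iG s * iD d * iG (inv s) = iD (act_fun G N H s d)" if "s \<in> carrier G" for s
    by (rule fam_eqI)
       (use that sub[OF d] sub[OF act_fun_D0[OF that d]] in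
         \<open>simp_all add: Rep_iG Rep_iD Rep_lop_times R_cov R_adj\<close>, simp add: iG_def iD_def)
  assume d': "d' \<in> D0"
  show "iD (d + d') = iD d + iD d'" "iD (d * d') = iD d * iD d'"
    using iD_hom[OF sub[OF d] sub[OF d']] by auto
qed

sublocale C: cstar_complete "fams R :: ('g univ_rep \<Rightarrow> ('g \<times> nat) lop) set" "fnorm R"
  by (rule cstar_complete_fnorm[OF R_nonempty])

lemma iD_fams:
  assumes d: "d \<in> D"
  shows "iD d \<in> fams R" "fnorm R (iD d) \<le> supn N d"
proof -
  interpret Dn: cstar_complete D "supn N" by (rule D_facts(4)[OF finq])
  have le: "lnorm (iD d \<rho>) \<le> supn N d" if "\<rho> \<in> R" for \<rho>
    using Dn.contractive[OF hom_on_seminorm[OF D_facts(3)[OF finq] R_hom[OF that]] d] that d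
    by (simp add: lnorm_def Rep_iD)
  show "iD d \<in> fams R" by (rule famsI[where c = "supn N d"]) (use le in \<open>auto simp: iD_def\<close>)
  show "fnorm R (iD d) \<le> supn N d" by (rule fnorm_le[OF R_nonempty le])
qed

lemma iG_fams:
  assumes s: "s \<in> carrier G"
  shows "iG s \<in> fams R" "fnorm R (iG s) \<le> 1"
proof -
  have le: "lnorm (iG s \<rho>) \<le> 1" if "\<rho> \<in> R" for \<rho>
  proof -
    have "Rep_lop (adj (iG s \<rho>) * iG s \<rho>) = id"
      using R_unitary[OF that s] that s by (simp add: Rep_lop_times Rep_lop_adj Rep_iG unitary_op_def)
    then have "lnorm (adj (iG s \<rho>) * iG s \<rho>) \<le> 1" by (intro lnorm_le) simp_all
    then have "(lnorm (iG s \<rho>))\<^sup>2 \<le> 1" by (simp add: lop.nu_cstar)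
    then show ?thesis by (simp add: abs_square_le_1 abs_le_iff)
  qed
  show "iG s \<in> fams R" by (rule famsI[where c = 1]) (use le in \<open>auto simp: iG_def\<close>)
  show "fnorm R (iG s) \<le> 1" by (rule fnorm_le[OF R_nonempty le])
qed

definition AD where "AD = cspan {iG s * iD d |s d. s \<in> carrier G \<and> d \<in> D}"
definition A where "A = C.cls AD"

lemma AD_fams: "AD \<subseteq> fams R"
  unfolding AD_def by (rule cspan_least) (auto intro!: C.mult_mem iG_fams iD_fams)

lemma A0_AD: "A0 \<subseteq> AD"
  unfolding AD_def A0_eq using D_facts(2)[OF finq] by (intro cspan_subset_cspan subsetI cspan_base) blast

lemma A0_fams: "A0 \<subseteq> fams R"
  using A0_AD AD_fams by blast

lemma cls_mono: "X \<subseteq> Y \<Longrightarrow> C.cls X \<subseteq> C.cls Y"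
  unfolding C.cls_def by blast

lemma A_eq: "A = C.cls A0"
proof
  show "C.cls A0 \<subseteq> A" unfolding A_def by (rule cls_mono[OF A0_AD])
  interpret cl: star_sub "C.cls A0" by (rule C.star_sub_cls[OF star_sub_A0 A0_fams])
  have "AD \<subseteq> C.cls A0"
    unfolding AD_def
  proof (rule cspan_least)
    show "{iG s * iD d |s d. s \<in> carrier G \<and> d \<in> D} \<subseteq> C.cls A0"
    proof
      fix x assume "x \<in> {iG s * iD d |s d. s \<in> carrier G \<and> d \<in> D}"
      then obtain s d where x: "x = iG s * iD d" and s: "s \<in> carrier G" and d: "d \<in> D" by blast
      have xf: "x \<in> fams R" unfolding x using s d by (intro C.mult_mem iG_fams iD_fams)
      interpret Dn: cstar_complete D "supn N" by (rule D_facts(4)[OF finq])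
      have "\<exists>y\<in>A0. fnorm R (x - y) < e" if e: "0 < e" for e
      proof -
        obtain d0 where d0: "d0 \<in> D0" "supn N (d - d0) < e"
          using d e D_facts(5)[OF finq] unfolding Dn.cls_def by blast
        have d0D: "d0 \<in> D" using d0(1) D_facts(2)[OF finq] by blast
        have "iD (d - d0) = iD d - iD d0"
          using iD_hom(1)[OF d, of "(-1) \<odot> d0"] iD_hom(2)[OF d0D d0D, of "-1"] Dn.scl_mem[OF d0D, of "-1"] by simp
        then have eq: "x - iG s * iD d0 = iG s * iD (d - d0)" by (simp only: x right_diff_distrib)
        have dd: "d - d0 \<in> D" using d d0D by auto
        have "fnorm R (iG s * iD (d - d0)) \<le> fnorm R (iG s) * fnorm R (iD (d - d0))"
          using s dd by (intro C.nu_mult iG_fams iD_fams)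
        also have "\<dots> \<le> 1 * supn N (d - d0)"
          using iG_fams[OF s] iD_fams[OF dd] C.nu_nonneg[OF iD_fams(1)[OF dd]] by (intro mult_mono) auto
        finally show ?thesis using d0 UJ_A0[OF s d0(1)] by (intro bexI[of _ "iG s * iD d0"]) (simp_all add: eq)
      qed
      then show "x \<in> C.cls A0" unfolding C.cls_def using xf by blast
    qed
  qed auto
  from cls_mono[OF this] show "A \<subseteq> C.cls A0" unfolding A_def using C.cls_cls[OF A0_fams] by simp
qed

lemma A_facts: "A \<subseteq> fams R" "star_sub A" "C.cls A \<subseteq> A" "A0 \<subseteq> A"
  unfolding A_eq using C.cls_subset C.star_sub_cls[OF star_sub_A0 A0_fams] C.cls_cls[OF A0_fams] C.subset_cls[OF A0_fams]
  by auto

definition B where "B = {p * (a * p) |a. a \<in> A}"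

lemma p_A: "p \<in> A"
  using A_facts(4) P_A0[OF one_closed] by blast

lemma mem_B: "b \<in> B \<longleftrightarrow> b \<in> A \<and> p * b = b \<and> b * p = b"
proof
  interpret A: star_sub A by (rule A_facts(2))
  assume "b \<in> B"
  then obtain a where a: "a \<in> A" "b = p * (a * p)" unfolding B_def by blast
  then show "b \<in> A \<and> p * b = b \<and> b * p = b" using p_A by (simp add: mult.assoc)
next
  assume b: "b \<in> A \<and> p * b = b \<and> b * p = b"
  then have "b = p * (b * p)" by simp
  then show "b \<in> B" unfolding B_def using b by blast
qed

lemma star_sub_B: "star_sub B"
proof -
  interpret A: star_sub A by (rule A_facts(2))
  show ?thesis
  proof
    fix x y c assume x: "x \<in> B"
    then have px: "p * x = x" "x * p = x" "x \<in> A" by (auto simp: mem_B)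
    show "adj x \<in> B"
      using arg_cong[OF px(1), of adj] arg_cong[OF px(2), of adj] px(3) by (simp add: mem_B)
    show "c \<odot> x \<in> B" using px by (simp add: mem_B)
    assume y: "y \<in> B"
    then have py: "p * y = y" "y * p = y" "y \<in> A" by (auto simp: mem_B)
    show "x + y \<in> B" using px py by (simp add: mem_B distrib_left distrib_right)
    have "p * x * y = x * y" "x * (y * p) = x * y" by (simp_all only: px py)
    then have "p * (x * y) = x * y" "x * y * p = x * y" by (simp_all only: mult.assoc)
    then show "x * y \<in> B" using px py by (simp add: mem_B)
  qed (simp add: mem_B)
qed

lemma norm_p: "fnorm R p \<le> 1"
proof -
  have pf: "p \<in> fams R" using p_A A_facts(1) by blast
  have "(fnorm R p)\<^sup>2 = fnorm R p" using C.nu_cstar[OF pf] by simp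
  then show ?thesis by (auto simp: power2_eq_square)
qed

lemma norm_compress: "a \<in> fams R \<Longrightarrow> fnorm R (p * (a * p)) \<le> fnorm R a"
proof -
  assume a: "a \<in> fams R"
  have pf: "p \<in> fams R" using p_A A_facts(1) by blast
  have "fnorm R (p * (a * p)) \<le> fnorm R p * (fnorm R a * fnorm R p)"
    using a pf by (intro order_trans[OF C.nu_mult] mult_left_mono C.nu_mult) auto
  also have "\<dots> \<le> 1 * (fnorm R a * 1)" using a pf norm_p by (intro mult_mono) auto
  finally show ?thesis by simp
qed

lemma B_facts: "B \<subseteq> A" "B0 \<subseteq> B" "cstar_complete B (fnorm R)" "cstar_seminormed.cls B (fnorm R) B0 = B"
proof -
  interpret A: star_sub A by (rule A_facts(2))
  show BA: "B \<subseteq> A" by (auto simp: mem_B)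
  show BB: "B0 \<subseteq> B" using A_facts(4) by (auto simp: mem_B mem_B0)
  have pf: "p \<in> fams R" using p_A A_facts(1) by blast
  have Bf: "B \<subseteq> fams R" using BA A_facts(1) by blast
  have "C.cls B \<subseteq> B"
  proof
    fix x assume x: "x \<in> C.cls B"
    then have xA: "x \<in> A" by (rule subsetD[OF A_facts(3) subsetD[OF cls_mono[OF BA]]])
    have xf: "x \<in> fams R" using xA A_facts(1) by blast
    have "fnorm R (x - p * (x * p)) \<le> 0"
    proof (rule field_le_epsilon)
      fix e :: real assume e: "0 < e"
      have "\<forall>e>0. \<exists>b\<in>B. fnorm R (x - b) < e" using x unfolding C.cls_def by (rule CollectE) (rule conjunct2)
      from this[rule_format, OF half_gt_zero[OF e]] have "\<exists>b\<in>B. fnorm R (x - b) < e / 2" .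
      then obtain b where b: "b \<in> B" "fnorm R (x - b) < e / 2" by (elim bexE) (rule that)
      have bf: "b \<in> fams R" using b Bf by blast
      have pbp: "p * (b * p) = b" using b(1) by (simp add: mem_B)
      have eq: "x - p * (x * p) = (x - b) - p * ((x - b) * p)"
        by (simp add: left_diff_distrib right_diff_distrib pbp)
      have xb: "x - b \<in> fams R" by (rule C.diff_mem[OF xf bf])
      have "fnorm R (x - p * (x * p)) \<le> fnorm R (x - b) + fnorm R (p * ((x - b) * p))"
        unfolding eq by (intro C.nu_diff xb C.mult_mem pf)
      then show "fnorm R (x - p * (x * p)) \<le> 0 + e"
        using norm_compress[OF xb] b(2) by linarith
    qed
    then have "x - p * (x * p) = 0" using xf pf by (intro C.eq_zero_if_le) auto
    then have "x = p * (x * p)" by simp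
    then show "x \<in> B" unfolding B_def using xA by blast
  qed
  then show c: "cstar_complete B (fnorm R)" by (intro C.cstar_complete_subset star_sub_B Bf)
  then interpret Bn: cstar_complete B "fnorm R" .
  have "b \<in> Bn.cls B0" if b: "b \<in> B" for b
  proof -
    have bf: "b \<in> C.cls A0" using subsetD[OF BA b] unfolding A_eq .
    have "\<exists>y\<in>B0. fnorm R (b - y) < e" if e: "0 < e" for e
    proof -
      obtain a where a: "a \<in> A0" "fnorm R (b - a) < e" using bf e unfolding C.cls_def by blast
      have "b - a \<in> fams R" using b Bf a(1) A0_fams by blast
      then have "fnorm R (p * ((b - a) * p)) < e" using norm_compress[of "b - a"] a(2) by simp
      moreover have "b - p * (a * p) = p * ((b - a) * p)"
      proof -
        have "p * (b * p) = b" using b by (simp add: mem_B)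
        then show ?thesis by (simp only: left_diff_distrib right_diff_distrib)
      qed
      ultimately show ?thesis using B0I[OF a(1)] by (intro bexI[of _ "p * (a * p)"]) simp_all
    qed
    then show ?thesis using b unfolding Bn.cls_def by blast
  qed
  then show "Bn.cls B0 = B" using Bn.cls_subset by blast
qed

text \<open>
  Every positive functional on the corner is bounded by the norm of the full crossed product, since its
  extension to the algebraic crossed product comes from a covariant representation.
\<close>

theorem posfun_corner_le:
  assumes f: "posfun B0 f" and b: "b \<in> B0"
  shows "Re (f (adj b * b)) \<le> (fnorm R b)\<^sup>2 * Re (f p)"
proof -
  define F where "F c = f (p * (c * p))" for c
  have F: "posfun A0 F" unfolding F_def by (rule posfun_corner_extend[OF f])
  obtain e :: "'g \<times> nat \<Rightarrow> 'g univ_rep \<Rightarrow> ('g \<times> nat) lop" where e: "A0 = cspan (range e)"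
    using A0_eq_cspan_range by (rule exE)
  obtain w :: "_ \<Rightarrow> 'g univ_space" where w: "\<forall>a\<in>A0. \<forall>b\<in>A0. cinner (w a) (w b) = F (adj b * a)"
    using A0.gns_vectors[OF F e] by (rule exE)
  interpret g: coset_gns G N H M iG iD F w
  proof unfold_locales
    show "posfun A0 F" by (rule F)
    show "cinner (w a) (w b) = F (adj b * a)" if "a \<in> A0" "b \<in> A0" for a b using w that by blast
  qed
  obtain \<rho> where \<rho>: "\<rho> \<in> R"
    "\<forall>s\<in>carrier G. \<forall>g\<in>carrier G. \<forall>a\<in>A0. snd \<rho> s (fst \<rho> (chi g) (w a)) = w (iG s * (P g * a))"
    using g.gns_covariant by (rule bexE)
  have act: "Rep_lop (a \<rho>) (w c) = w (a * c)" if a: "a \<in> A0" and c: "c \<in> A0" for a c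
    using a unfolding A0_def
  proof (induction rule: cspan.induct)
    case cspan_0
    have "Rep_lop ((0 :: 'g univ_rep \<Rightarrow> ('g \<times> nat) lop) \<rho>) (w c) = 0" by (simp add: Rep_lop_0)
    then show ?case by (simp only: mult_zero_left g.w_0)
  next
    case (cspan_step x y k)
    obtain s h where x: "s \<in> carrier G" "h \<in> carrier G" "x = iG s * P h"
      using cspan_step.hyps(1) unfolding gens_def by blast
    have y: "y \<in> A0" unfolding A0_def by (rule cspan_step.hyps(2))
    have hD: "chi h \<in> D" using x(2) D_facts(2)[OF finq] by auto
    have "Rep_lop (x \<rho>) (w c) = w (x * c)"
      using \<rho> x c hD by (simp add: Rep_lop_times Rep_iG Rep_iD P_def mult.assoc)
    moreover have "w ((k \<odot> x + y) * c) = k *\<^sub>C w (x * c) + w (y * c)"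
      using x y c by (simp add: distrib_right g.w_add g.w_scl)
    moreover have "Rep_lop ((k \<odot> x + y) \<rho>) (w c) = k *\<^sub>C Rep_lop (x \<rho>) (w c) + Rep_lop (y \<rho>) (w c)"
      by (simp add: Rep_lop_simps)
    ultimately show ?case by (simp only: cspan_step.IH)
  qed
  have pA: "p \<in> A0" by simp
  have bA: "b \<in> A0" "b * p = b" "p * b = b" using b by (auto simp: mem_B0)
  have bf: "b \<in> fams R" using bA A0_fams by blast
  have "norm (w b) \<le> lnorm (b \<rho>) * norm (w p)"
    using lnorm_apply[of "b \<rho>" "w p"] act[OF bA(1) pA] bA(2) by simp
  also have "\<dots> \<le> fnorm R b * norm (w p)"
    using lnorm_le_fnorm[OF bf \<rho>(1)] by (intro mult_right_mono) auto
  finally have "(norm (w b))\<^sup>2 \<le> (fnorm R b * norm (w p))\<^sup>2" by (intro power_mono) auto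
  then have "Re (F (adj b * b)) \<le> (fnorm R b)\<^sup>2 * Re (F (adj p * p))"
    using bA(1) pA by (simp only: g.norm_w power_mult_distrib)
  moreover have "p * (adj b * b * p) = adj b * b"
  proof -
    have "p * adj b = adj b" using arg_cong[OF bA(2), of adj] by simp
    then have "p * (adj b * (b * p)) = adj b * b" by (simp only: mult.assoc[symmetric]) (simp only: mult.assoc bA(2))
    then show ?thesis by (simp only: mult.assoc)
  qed
  ultimately show ?thesis by (simp add: F_def)
qed

end

section \<open>The regular representation\<close>

lemma cstar_complete_lnorm: "cstar_complete (UNIV :: 'i lop set) lnorm"
proof
  fix X :: "nat \<Rightarrow> 'i lop" assume "lop.cauchy_seq X"
  then have "\<And>e. 0 < e \<Longrightarrow> \<exists>K. \<forall>m\<ge>K. \<forall>n\<ge>K. lnorm (X m - X n) < e" unfolding lop.cauchy_seq_def by blast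
  then obtain T where T: "\<forall>e>0. \<exists>K. \<forall>n\<ge>K. lnorm (X n - T) \<le> e" using lop_complete[of X] by blast
  have "(\<lambda>n. lnorm (X n - T)) \<longlonglongrightarrow> 0"
  proof (rule LIMSEQ_I)
    fix e :: real assume e: "0 < e"
    obtain K where "\<forall>n\<ge>K. lnorm (X n - T) \<le> e / 2" using T[rule_format, OF half_gt_zero[OF e]] by (rule exE)
    then have "\<forall>n\<ge>K. norm (lnorm (X n - T) - 0) < e" using e by fastforce
    then show "\<exists>no. \<forall>n\<ge>no. norm (lnorm (X n - T) - 0) < e" by (rule exI)
  qed
  then show "\<exists>x\<in>UNIV. (\<lambda>n. lnorm (X n - x)) \<longlonglongrightarrow> 0" by blast
qed

lemma represented_lop: "represented UNIV (bounded_ops :: ('i ell2 \<Rightarrow> 'i ell2) normed_star_alg) Rep_lop"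
proof (intro represented.intro star_sub_UNIV represented_axioms.intro)
  show "carrier bounded_ops = range (Rep_lop :: 'i lop \<Rightarrow> _)"
    by (rule type_definition.Rep_range[OF type_definition_lop, symmetric])
  show "inj (Rep_lop :: 'i lop \<Rightarrow> _)" by (simp add: inj_def Rep_lop_inject)
qed (simp_all add: bounded_ops_def Rep_lop_simps Rep_lop_adj)

definition tf :: "('r \<Rightarrow> 'i lop) \<Rightarrow> 'r \<Rightarrow> 'i ell2 \<Rightarrow> 'i ell2" where
  "tf a = (\<lambda>\<rho>. Rep_lop (a \<rho>))"

lemma norm_sum_orthogonal:
  fixes v :: "'j \<Rightarrow> 'x::complex_hilbert_space"
  assumes "finite I" "\<And>i j. i \<in> I \<Longrightarrow> j \<in> I \<Longrightarrow> i \<noteq> j \<Longrightarrow> cinner (v i) (v j) = 0"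
  shows "(norm (sum v I))\<^sup>2 = (\<Sum>i\<in>I. (norm (v i))\<^sup>2)"
  using assms
proof (induction I rule: finite_induct)
  case (insert i I)
  have "v i \<bullet> sum v I = (\<Sum>j\<in>I. v i \<bullet> v j)" by (rule inner_sum_right)
  also have "\<dots> = 0"
  proof (rule sum.neutral, rule ballI)
    fix j assume j: "j \<in> I"
    then have "i \<noteq> j" using insert.hyps(2) by blast
    then show "v i \<bullet> v j = 0" using insert.prems[of i j] j by (simp add: inner_eq_Re_cinner)
  qed
  finally have 0: "v i \<bullet> sum v I = 0" .
  have "(norm (v i + sum v I))\<^sup>2 = (norm (v i))\<^sup>2 + (norm (sum v I))\<^sup>2"
    using 0 by (simp add: power2_norm_eq_inner inner_add_left inner_add_right inner_commute)
  moreover have "(norm (sum v I))\<^sup>2 = (\<Sum>i\<in>I. (norm (v i))\<^sup>2)" by (rule insert.IH, rule insert.prems) auto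
  ultimately show ?case using insert.hyps by simp
qed simp

lemma ket_orthogonal: "i \<noteq> j \<Longrightarrow> cinner (ket i) (ket j) = 0" and norm_ket: "norm (ket i) = 1"
proof -
  show "i \<noteq> j \<Longrightarrow> cinner (ket i) (ket j) = 0" by (simp add: cinner_ket_right Rep_ket)
  have "cinner (ket i) (ket i) = 1" by (simp add: cinner_ket_right Rep_ket)
  then have sq: "(norm (ket i))\<^sup>2 = 1" using cinner_self[of "ket i"] by (metis of_real_1 of_real_eq_iff)
  show "norm (ket i) = 1" by (rule power2_eq_imp_eq[of _ 1]) (simp_all add: sq)
qed

lemma finite_support_dense: "closure {x :: 'i ell2. finite {i. Rep_ell2 x i \<noteq> 0}} = UNIV"
proof -
  let ?W = "{x :: 'i ell2. finite {i. Rep_ell2 x i \<noteq> 0}}"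
  have W: "csubspace ?W"
    unfolding csubspace_def
  proof (intro conjI ballI allI)
    fix x y c assume x: "x \<in> ?W"
    show "c *\<^sub>C x \<in> ?W" using x by (auto intro: finite_subset[rotated])
    assume y: "y \<in> ?W"
    have "{i. Rep_ell2 (x + y) i \<noteq> 0} \<subseteq> {i. Rep_ell2 x i \<noteq> 0} \<union> {i. Rep_ell2 y i \<noteq> 0}" by auto
    then show "x + y \<in> ?W" using x y by (auto intro: finite_subset)
  qed simp
  have "x \<in> closure ?W" for x
  proof -
    have "\<exists>z\<in>closure ?W. \<forall>v\<in>?W. cinner v x = cinner v z"
      by (rule riesz_on_subspace[OF W, where C = "norm x"])
         (use cmod_cinner_le[of _ x] in \<open>auto simp: cinner_add_left cinner_scaleC_left mult.commute\<close>)
    then obtain z where z: "z \<in> closure ?W" "\<forall>v\<in>?W. cinner v x = cinner v z" by (rule bexE)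
    have "Rep_ell2 x i = Rep_ell2 z i" for i
    proof -
      have "ket i \<in> ?W" by (simp add: Rep_ket)
      then have "cinner (ket i) x = cinner (ket i) z" using z(2) by blast
      then show ?thesis by (simp add: cinner_ket_left)
    qed
    then have "x = z" by (rule ell2_eqI)
    then show ?thesis using z(1) by simp
  qed
  then show ?thesis by blast
qed

lemma finite_support_sum:
  assumes "finite F" "\<And>i. i \<notin> F \<Longrightarrow> Rep_ell2 x i = 0"
  shows "x = (\<Sum>i\<in>F. Rep_ell2 x i *\<^sub>C ket i)"
proof (rule ell2_eqI)
  fix j
  have "Rep_ell2 (\<Sum>i\<in>F. Rep_ell2 x i *\<^sub>C ket i) j = (\<Sum>i\<in>F. Rep_ell2 x i * Rep_ell2 (ket i) j)"
    using cinner_sum_left[of "\<lambda>i. Rep_ell2 x i *\<^sub>C ket i" F "ket j"] by (simp add: cinner_ket_right)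
  also have "\<dots> = (\<Sum>i\<in>F. if i = j then Rep_ell2 x i else 0)" by (intro sum.cong refl) (simp add: Rep_ket)
  also have "\<dots> = Rep_ell2 x j" using assms by (simp add: sum.delta)
  finally show "Rep_ell2 x j = Rep_ell2 (\<Sum>i\<in>F. Rep_ell2 x i *\<^sub>C ket i) j" ..
qed

context crossed
begin

lemma represented_tf: "represented (fams R) (op_families R) (tf :: ('g univ_rep \<Rightarrow> ('g \<times> nat) lop) \<Rightarrow> _)"
  using represented_fams[OF R_nonempty] unfolding tf_def[abs_def] .

lemma tf_i: "s \<in> carrier G \<Longrightarrow> tf (iG s) = i_G G N H M s" "d \<in> D \<Longrightarrow> tf (iD d) = i_D G N H M d"
  by (auto simp: fun_eq_iff tf_def i_G_def i_D_def Rep_iG Rep_iD) (simp_all add: iG_def iD_def Rep_lop_0)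

lemma alg_crossed_product_eq:
  assumes E: "E \<subseteq> D"
  shows "alg_crossed_product G N H M E = tf ` cspan {iG s * iD d |s d. s \<in> carrier G \<and> d \<in> E}"
proof -
  interpret r: represented "fams R" "op_families R" "tf :: ('g univ_rep \<Rightarrow> ('g \<times> nat) lop) \<Rightarrow> _"
    by (rule represented_tf)
  let ?X = "{iG s * iD d |s d. s \<in> carrier G \<and> d \<in> E}"
  have el: "sa_mult (op_families R) (i_G G N H M s) (i_D G N H M d) = tf (iG s * iD d)"
    if "s \<in> carrier G" "d \<in> E" for s d
  proof -
    have d: "d \<in> D" using that E by blast
    show ?thesis
      using r.rep_mult[OF iG_fams(1)[OF that(1)] iD_fams(1)[OF d]] by (simp only: tf_i that(1) d)
  qed
  have set_eq: "{sa_mult (op_families R) (i_G G N H M s) (i_D G N H M d) |s d. s \<in> carrier G \<and> d \<in> E} = tf ` ?X"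
  proof
    show "{sa_mult (op_families R) (i_G G N H M s) (i_D G N H M d) |s d. s \<in> carrier G \<and> d \<in> E} \<subseteq> tf ` ?X"
      using el by blast
    show "tf ` ?X \<subseteq> {sa_mult (op_families R) (i_G G N H M s) (i_D G N H M d) |s d. s \<in> carrier G \<and> d \<in> E}"
      by (rule image_subsetI) (use el in \<open>elim CollectE exE conjE, metis (mono_tags, lifting) mem_Collect_eq\<close>)
  qed
  have X: "?X \<subseteq> fams R" using E by (auto intro!: C.mult_mem iG_fams iD_fams)
  show ?thesis
    unfolding alg_crossed_product_def Let_def set_eq by (rule r.sa_span_eq[OF X])
qed

lemma full_crossed_product_eq: "full_crossed_product G N H M = (op_families R)\<lparr>carrier := tf ` A\<rparr>"
proof -
  have n: "(\<lambda>a. sa_norm (op_families R) (tf a)) = (fnorm R :: ('g univ_rep \<Rightarrow> ('g \<times> nat) lop) \<Rightarrow> real)"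
    by (simp add: tf_def op_families_norm)
  have "sa_closure (op_families R) (tf ` AD) = tf ` C.cls AD"
    using sa_closure_if_represented[OF represented_tf _ AD_fams] C.cstar_seminormed_axioms unfolding n .
  moreover have "alg_crossed_product G N H M D = tf ` AD"
    unfolding AD_def by (rule alg_crossed_product_eq) simp
  ultimately show ?thesis by (simp add: full_crossed_product_def Let_def A_def)
qed

lemma represented_A: "represented A (full_crossed_product G N H M) tf"
  unfolding full_crossed_product_eq
  by (rule represented.represented_subset[OF represented_tf A_facts(2,1)])

end

lemma (in semidirect_setting) reg_D_ket:
  "reg_D G N H d (ket (g, y)) = (if g \<in> carrier G \<and> y \<in> N then d (act g y) else 0) *\<^sub>C ket (g, y)"
proof -
  let ?c = "if g \<in> carrier G \<and> y \<in> N then d (act g y) else 0"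
  have "(\<lambda>(g', y'). if g' \<in> carrier G \<and> y' \<in> N then d (act g' y') * Rep_ell2 (ket (g, y)) (g', y') else 0)
      = Rep_ell2 (?c *\<^sub>C ket (g, y))"
    by (auto simp: fun_eq_iff Rep_ket)
  then show ?thesis unfolding reg_D_def by (simp only: Rep_ell2_inverse)
qed

lemma (in semidirect_setting) reg_G_ket:
  assumes s: "s \<in> carrier G" and g: "g \<in> carrier G"
  shows "reg_G G s (c *\<^sub>C ket (g, y)) = c *\<^sub>C ket (s \<otimes> g, y)"
proof -
  have "inv s \<otimes> g' = g \<longleftrightarrow> g' = s \<otimes> g" if "g' \<in> carrier G" for g' using s g that by (metis inv_solve_left)
  then have "(\<lambda>(g', y'). Rep_ell2 (c *\<^sub>C ket (g, y)) (if g' \<in> carrier G then inv s \<otimes> g' else g', y'))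
      = Rep_ell2 (c *\<^sub>C ket (s \<otimes> g, y))"
    using s g by (auto simp: fun_eq_iff Rep_ket)
  then show ?thesis unfolding reg_G_def by (simp only: Rep_ell2_inverse)
qed

lemma reg_G_0: "reg_G G s 0 = 0"
  by (simp add: reg_G_def zero_ell2_def[symmetric] case_prod_unfold)

locale crossed_regular = crossed G N H M
  for G :: "('g, 'm) monoid_scheme" (structure) and N H M +
  fixes \<Lambda> :: "'g univ_family \<Rightarrow> 'g reg_space \<Rightarrow> 'g reg_space"
  assumes eff: "acts_effectively G H M"
    and reg: "regular_representation G N H M \<Lambda>"
    and bij: "bij_betw \<Lambda> (carrier (full_crossed_product G N H M)) (carrier (reduced_crossed_product G N H M))"
begin

definition l :: "('g univ_rep \<Rightarrow> ('g \<times> nat) lop) \<Rightarrow> ('g \<times> 'g) lop" where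
  "l a = Abs_lop (\<Lambda> (tf a))"

lemma reduced_subset: "carrier (reduced_crossed_product G N H M) \<subseteq> carrier bounded_ops"
  by (auto simp: reduced_crossed_product_def sa_closure_def)

lemma hom_\<Lambda>: "hom_on A (\<lambda>a. \<Lambda> (tf a))"
proof -
  have "star_hom (full_crossed_product G N H M) (reduced_crossed_product G N H M) \<Lambda>"
    using reg by (simp add: regular_representation_def)
  then have "star_hom (full_crossed_product G N H M) bounded_ops \<Lambda>"
    using reduced_subset unfolding star_hom_def by (auto simp: reduced_crossed_product_def)
  then show ?thesis using represented.star_hom_iff[OF represented_A] by blast
qed

lemma Rep_l: "a \<in> A \<Longrightarrow> Rep_lop (l a) = \<Lambda> (tf a)"
  unfolding l_def by (rule Abs_lop_inverse) (rule hom_on_bop[OF hom_\<Lambda>])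

lemma
  assumes a: "a \<in> A"
  shows l_scl: "l (c \<odot> a) = c \<odot> l a" and l_adj: "l (adj a) = adj (l a)"
    and l_add: "b \<in> A \<Longrightarrow> l (a + b) = l a + l b" and l_mult: "b \<in> A \<Longrightarrow> l (a * b) = l a * l b"
proof -
  interpret A: star_sub A by (rule A_facts(2))
  note h = Rep_l hom_on_add[OF hom_\<Lambda>] hom_on_scl[OF hom_\<Lambda>] hom_on_mult[OF hom_\<Lambda>] hom_on_adj[OF hom_\<Lambda>]
    Rep_lop_simps Rep_lop_adj
  show "l (c \<odot> a) = c \<odot> l a" "l (adj a) = adj (l a)" by (rule lop_eqI; simp add: h a)+
  show "l (a + b) = l a + l b" "l (a * b) = l a * l b" if "b \<in> A" by (rule lop_eqI; simp add: h a that)+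
qed

lemma inj_l: "inj_on l A"
proof (rule inj_onI)
  interpret rA: represented A "full_crossed_product G N H M" tf by (rule represented_A)
  fix a b assume ab: "a \<in> A" "b \<in> A" "l a = l b"
  then have "\<Lambda> (tf a) = \<Lambda> (tf b)" using Rep_l by metis
  then have "tf a = tf b"
    using bij_betw_imp_inj_on[OF bij] ab(1,2) unfolding inj_on_def rA.rep_carrier by blast
  then show "a = b" using rA.rep_eq_iff ab by blast
qed

text \<open>
  The norm of \<open>A\<close>, transported by the inverse of \<open>\<Lambda>\<close>, is a C*-seminorm on the reduced crossed product, which is complete for the
  operator norm.
\<close>

lemma fnorm_le_lnorm:
  assumes a: "a \<in> A"
  shows "fnorm R a \<le> lnorm (l a)"
proof -
  interpret A: star_sub A by (rule A_facts(2))
  interpret An: cstar_seminormed A "fnorm R" by (rule C.cstar_seminormed_subset[OF A_facts(2,1)])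
  interpret LC: cstar_complete "UNIV :: ('g \<times> 'g) lop set" lnorm by (rule cstar_complete_lnorm)
  interpret rA: represented A "full_crossed_product G N H M" tf by (rule represented_A)
  interpret rl: represented UNIV "bounded_ops :: ('g reg_space \<Rightarrow> 'g reg_space) normed_star_alg" Rep_lop
    by (rule represented_lop)
  define RC where "RC = l ` A"
  let ?X = "{reg_G G s \<circ> reg_D G N H d |s d. s \<in> carrier G \<and> d \<in> D}"
  have RC: "Rep_lop ` RC = carrier (reduced_crossed_product G N H M)"
  proof -
    have "Rep_lop ` RC = (\<lambda>a. \<Lambda> (tf a)) ` A" unfolding RC_def image_image by (rule image_cong[OF refl Rep_l])
    also have "\<dots> = \<Lambda> ` carrier (full_crossed_product G N H M)" by (simp only: rA.rep_carrier image_image)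
    finally show ?thesis using bij_betw_imp_surj_on[OF bij] by simp
  qed
  have "?X \<subseteq> range Rep_lop"
  proof
    fix T assume "T \<in> ?X"
    then obtain s d where T: "T = reg_G G s \<circ> reg_D G N H d" "s \<in> carrier G" "d \<in> D" by blast
    have "iG s * iD d \<in> AD" unfolding AD_def using T(2,3) by (intro cspan_base) blast
    then have m: "iG s * iD d \<in> A" unfolding A_def using C.subset_cls[OF AD_fams] by blast
    have "T = \<Lambda> (sa_mult (full_crossed_product G N H M) (i_G G N H M s) (i_D G N H M d))"
      using reg T unfolding regular_representation_def by simp
    also have "sa_mult (full_crossed_product G N H M) (i_G G N H M s) (i_D G N H M d) = tf (iG s * iD d)"
    proof -
      interpret r: represented "fams R" "op_families R" "tf :: ('g univ_rep \<Rightarrow> ('g \<times> nat) lop) \<Rightarrow> _"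
        by (rule represented_tf)
      show ?thesis
        using r.rep_mult[OF iG_fams(1)[OF T(2)] iD_fams(1)[OF T(3)]]
        by (simp only: full_crossed_product_eq tf_i T) simp
    qed
    finally show "T \<in> range Rep_lop" using Rep_l[OF m] by (metis rangeI)
  qed
  then obtain X where X: "?X = Rep_lop ` X" by (rule subset_imageE) (rule that)
  have "carrier (reduced_crossed_product G N H M) = sa_closure bounded_ops (sa_span bounded_ops ?X)"
    by (simp add: reduced_crossed_product_def)
  also have "\<dots> = Rep_lop ` lop.cls (cspan X)"
  proof -
    have n: "(\<lambda>a. sa_norm bounded_ops (Rep_lop a)) = (lnorm :: ('g \<times> 'g) lop \<Rightarrow> real)"
      by (simp add: lnorm_def[abs_def] bounded_ops_def)
    show ?thesis
      unfolding X rl.sa_span_eq[OF subset_UNIV]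
      using sa_closure_if_represented[OF represented_lop _ subset_UNIV, of "cspan X"] lop.cstar_seminormed_axioms
      unfolding n .
  qed
  finally have "Rep_lop ` RC = Rep_lop ` lop.cls (cspan X)" using RC by simp
  then have RC_cls: "RC = lop.cls (cspan X)" using rl.rep_inj by (simp add: inj_image_eq_iff)
  have RC_sub: "star_sub RC"
  proof
    show "0 \<in> RC" unfolding RC_def by (rule image_eqI[of _ _ 0]) (use l_scl[OF A.zero_mem, of 0] in simp_all)
    fix x y c assume "x \<in> RC"
    then obtain a where a: "a \<in> A" "x = l a" by (auto simp: RC_def)
    show "c \<odot> x \<in> RC" unfolding a l_scl[OF a(1), symmetric] RC_def using a by blast
    show "adj x \<in> RC" unfolding a l_adj[OF a(1), symmetric] RC_def using a by blast
    assume "y \<in> RC"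
    then obtain b where b: "b \<in> A" "y = l b" by (auto simp: RC_def)
    show "x + y \<in> RC" unfolding a b l_add[OF a(1) b(1), symmetric] RC_def using a b by blast
    show "x * y \<in> RC" unfolding a b l_mult[OF a(1) b(1), symmetric] RC_def using a b by blast
  qed
  have "lop.cls RC \<subseteq> RC" unfolding RC_cls by (simp add: lop.cls_cls)
  then interpret RCn: cstar_complete RC lnorm by (intro LC.cstar_complete_subset RC_sub subset_UNIV)
  define n where "n T = fnorm R (inv_into A l T)" for T
  have n: "n (l a) = fnorm R a" if "a \<in> A" for a using that by (simp add: n_def inv_into_f_f[OF inj_l])
  have "cstar_seminormed RC n"
  proof
    fix x y c assume "x \<in> RC"
    then obtain a where a: "a \<in> A" "x = l a" by (auto simp: RC_def)
    show "0 \<le> n x" using a by (simp add: n)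
    show "n (c \<odot> x) = cmod c * n x" using a by (simp add: n An.nu_scl flip: l_scl)
    show "n (adj x * x) = (n x)\<^sup>2" using a by (simp add: n An.nu_cstar flip: l_adj l_mult)
    assume "y \<in> RC"
    then obtain b where b: "b \<in> A" "y = l b" by (auto simp: RC_def)
    show "n (x + y) \<le> n x + n y" using a b by (simp add: n An.nu_add flip: l_add)
    show "n (x * y) \<le> n x * n y" using a b by (simp add: n An.nu_mult flip: l_mult)
  qed
  from RCn.contractive[OF this, of "l a"] a show ?thesis by (simp add: n RC_def)
qed

lemma A0_A: "a \<in> A0 \<Longrightarrow> a \<in> A"
  using A_facts(4) by blast

lemma l_gen_ket:
  assumes s: "s \<in> carrier G" and h: "h \<in> carrier G"
  shows "Rep_lop (l (iG s * P h)) (ket (g, y)) =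
    (if g \<in> carrier G \<and> y \<in> N then chi h (act g y) *\<^sub>C ket (s \<otimes> g, y) else 0)"
proof -
  have hD: "chi h \<in> D" using D_facts(2)[OF finq] h by auto
  interpret r: represented "fams R" "op_families R" "tf :: ('g univ_rep \<Rightarrow> ('g \<times> nat) lop) \<Rightarrow> _"
    by (rule represented_tf)
  have "tf (iG s * P h) = sa_mult (full_crossed_product G N H M) (i_G G N H M s) (i_D G N H M (chi h))"
    using r.rep_mult[OF iG_fams(1)[OF s] iD_fams(1)[OF hD]]
    by (simp add: full_crossed_product_eq P_def flip: tf_i(1)[OF s] tf_i(2)[OF hD])
  then have "Rep_lop (l (iG s * P h)) = reg_G G s \<circ> reg_D G N H (chi h)"
    using reg s hD Rep_l[OF A0_A[OF gen_A0[OF s h]]] by (simp add: regular_representation_def)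
  then show ?thesis
    by (simp add: reg_D_ket reg_G_ket[OF s] reg_G_0)
qed

lemma A0_induct [consumes 1, case_names zero step]:
  assumes "a \<in> A0" and "Q 0"
    and "\<And>s h c y. \<lbrakk>s \<in> carrier G; h \<in> carrier G; y \<in> A0; Q y\<rbrakk> \<Longrightarrow> Q (c \<odot> (iG s * P h) + y)"
  shows "Q a"
  using assms(1) unfolding A0_def
proof (induction rule: cspan.induct)
  case cspan_0
  show ?case by (rule assms(2))
next
  case (cspan_step x y c)
  obtain s h where x: "s \<in> carrier G" "h \<in> carrier G" "x = iG s * P h"
    using cspan_step.hyps(1) unfolding gens_def by (elim CollectE exE conjE) (rule that)
  show ?case unfolding x(3)
    by (rule assms(3)) (use x cspan_step.hyps(2) cspan_step.IH in \<open>simp_all add: A0_def\<close>)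
qed

lemma l_0: "l 0 = 0"
  using l_scl[OF star_sub.zero_mem[OF A_facts(2)], of 0] by simp

lemma Rep_l_0: "Rep_lop (l 0) x = 0"
  by (simp only: l_0 Rep_lop_0)

lemma l_step:
  "\<lbrakk>s \<in> carrier G; h \<in> carrier G; y \<in> A0\<rbrakk> \<Longrightarrow>
    Rep_lop (l (c \<odot> (iG s * P h) + y)) x = c *\<^sub>C Rep_lop (l (iG s * P h)) x + Rep_lop (l y) x"
  using A0_A[of y] A0_A[OF gen_A0, of s h] star_sub.scl_mem[OF A_facts(2), of "iG s * P h" c]
  by (simp add: l_add l_scl Rep_lop_simps)

text \<open>
  The regular representation lets functions act on the basis vector at \<open>(g, y)\<close> by their value at
  \<open>act g y\<close>, which for \<open>g = y\<inverse>\<close> is \<open>\<one>\<close>.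
\<close>

definition \<eta> :: "'g \<Rightarrow> 'g reg_space" where "\<eta> y = ket (inv y, y)"

lemma l_gen_\<eta>: "\<lbrakk>s \<in> carrier G; h \<in> carrier G; y \<in> N\<rbrakk> \<Longrightarrow>
    Rep_lop (l (iG s * P h)) (\<eta> y) = chi h \<one> *\<^sub>C ket (s \<otimes> inv y, y)"
  using act_eq[of "inv y" \<one> y] by (simp add: \<eta>_def l_gen_ket)

definition \<tau> :: "('g univ_rep \<Rightarrow> ('g \<times> nat) lop) \<Rightarrow> complex" where
  "\<tau> a = cinner (Rep_lop (l a) (\<eta> \<one>)) (\<eta> \<one>)"

lemma l_\<eta>_\<eta>:
  assumes "a \<in> A0" "y \<in> N" "y' \<in> N"
  shows "cinner (Rep_lop (l a) (\<eta> y)) (\<eta> y') = (if y = y' then \<tau> a else 0)"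
  using assms(1)
proof (induction rule: A0_induct)
  case zero
  show ?case by (simp only: \<tau>_def Rep_l_0 cinner_zero_left if_cancel)
next
  case (step s h c z)
  have 1: "cinner (Rep_lop (l (iG s * P h)) (\<eta> v)) (\<eta> v') = (if v = v' \<and> s = \<one> then chi h \<one> else 0)"
    if "v \<in> N" "v' \<in> N" for v v'
  proof -
    have "s \<otimes> inv v = inv v \<longleftrightarrow> s = \<one>" using step(1) that by simp
    then show ?thesis
      unfolding l_gen_\<eta>[OF step(1,2) that(1)]
      using step(1,2) that by (auto simp: cinner_scaleC_left \<eta>_def cinner_ket_right Rep_ket)
  qed
  have 2: "cinner (Rep_lop (l (iG s * P h)) (\<eta> \<one>)) (\<eta> \<one>) = (if s = \<one> then chi h \<one> else 0)"
    using 1[of \<one> \<one>] by simp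
  have "\<tau> (c \<odot> (iG s * P h) + z) = c * (if s = \<one> then chi h \<one> else 0) + \<tau> z"
    by (simp only: \<tau>_def l_step[OF step(1-3)] cinner_add_left cinner_scaleC_left 2)
  then show ?case
    by (simp only: l_step[OF step(1-3)] cinner_add_left cinner_scaleC_left 1[OF assms(2,3)] step(4)) simp
qed

lemma \<tau>_facts:
  shows \<tau>_add: "\<lbrakk>a \<in> A0; b \<in> A0\<rbrakk> \<Longrightarrow> \<tau> (a + b) = \<tau> a + \<tau> b"
    and \<tau>_scl: "a \<in> A0 \<Longrightarrow> \<tau> (c \<odot> a) = c * \<tau> a"
    and \<tau>_gen: "\<lbrakk>s \<in> carrier G; h \<in> carrier G\<rbrakk> \<Longrightarrow> \<tau> (iG s * P h) = (if s = \<one> then chi h \<one> else 0)"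
  by (auto simp: \<tau>_def l_add l_scl A0_A Rep_lop_simps cinner_add_left cinner_scaleC_left l_gen_\<eta>)
     (auto simp: \<eta>_def cinner_ket_right Rep_ket)

lemma \<tau>_mult: "\<lbrakk>a \<in> A0; b \<in> A0; y \<in> N\<rbrakk> \<Longrightarrow> cinner (Rep_lop (l a) (\<eta> y)) (Rep_lop (l b) (\<eta> y)) = \<tau> (adj b * a)"
  using l_\<eta>_\<eta>[of "adj b * a" y y]
  by (simp add: A0_A l_mult l_adj Rep_lop_times Rep_lop_adj cinner_cadjoint2)

lemma \<tau>_orthogonal: "\<lbrakk>a \<in> A0; b \<in> A0; y \<in> N; y' \<in> N; y \<noteq> y'\<rbrakk> \<Longrightarrow>
    cinner (Rep_lop (l a) (\<eta> y)) (Rep_lop (l b) (\<eta> y')) = 0"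
  using l_\<eta>_\<eta>[of "adj b * a" y y']
  by (simp add: A0_A l_mult l_adj Rep_lop_times Rep_lop_adj cinner_cadjoint2)

lemma chi_one_one: "chi \<one> \<one> = 1"
  using act_one_mem_bset[of \<one>] by (simp add: chi_def act_one)

lemma P_nonzero:
  assumes k: "k \<in> carrier G"
  shows "P k \<noteq> 0"
proof
  assume "P k = 0"
  then have "p = 0" using P_cov[of "inv k" k] k by simp
  moreover have "\<tau> p = 1" using \<tau>_gen[of \<one> \<one>] by (simp add: chi_one_one)
  ultimately show False by (simp add: \<tau>_def l_0 Rep_lop_0)
qed

text \<open>
  Compressing \<open>b\<close> to a projection inside the corner leaves only \<open>\<tau> b\<close>; hence any C*-norm on the corner
  dominates the modulus of \<open>\<tau>\<close>.
\<close>

lemma \<tau>_le: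
  assumes \<nu>: "cstar_normed B0 \<nu>" and b: "b \<in> B0"
  shows "cmod (\<tau> b) \<le> \<nu> b"
proof -
  interpret cstar_normed B0 \<nu> by (rule \<nu>)
  have "\<exists>\<Gamma> c. finite \<Gamma> \<and> \<Gamma> \<subseteq> carrier G - {\<one>} \<and> c \<in> H \<and>
    (\<forall>k\<in>carrier G. bset k \<subseteq> cM c \<longrightarrow> (\<forall>g\<in>\<Gamma>. bset (g \<otimes> k) \<inter> bset k = {}) \<longrightarrow> P k * (b * P k) = \<tau> b \<odot> P k)"
    by (rule compress[OF _ _ _ B0_A0[OF b]]) (rule \<tau>_add \<tau>_scl \<tau>_gen; assumption)+
  then obtain \<Gamma> c where \<Gamma>: "finite \<Gamma>" "\<Gamma> \<subseteq> carrier G - {\<one>}" "c \<in> H"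
    "\<forall>k\<in>carrier G. bset k \<subseteq> cM c \<longrightarrow> (\<forall>g\<in>\<Gamma>. bset (g \<otimes> k) \<inter> bset k = {}) \<longrightarrow> P k * (b * P k) = \<tau> b \<odot> P k"
    by (elim exE conjE) (rule that)
  obtain a where a: "a \<in> H" "cM a \<subseteq> cM c" "cM a \<subseteq> cM \<one>"
    using common_subgroup[of "{c, \<one>}"] \<Gamma>(3) by auto
  have bs: "bset (\<one> \<otimes> d) = cM d" if "d \<in> H" for d
    using that by (simp add: bset_def cM_def act_eq[of \<one> d, simplified] image_def)
  have aG: "a \<in> carrier G" using a(1) subgroup.subset[OF H_subgroup] by blast
  obtain k where k: "k \<in> carrier G" "bset k \<subseteq> bset a" "\<forall>g\<in>\<Gamma>. bset (g \<otimes> k) \<inter> bset k = {}"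
    using free_coset[OF eff \<Gamma>(1,2) aG] by (elim bexE conjE) (rule that)
  have ba: "bset a = cM a" using bs[OF a(1)] aG by simp
  have one: "bset \<one> = cM \<one>" using bs[of \<one>] by simp
  have compr: "P k * (b * P k) = \<tau> b \<odot> P k" using \<Gamma>(4) k ba a(2) by blast
  have kM: "bset k \<subseteq> bset \<one>" using k(2) ba a(3) one by blast
  have "chi \<one> * chi k = chi k" "chi k * chi \<one> = chi k" using kM by (auto simp: fun_eq_iff chi_def indicator_def)
  then have "p * P k = P k" "P k * p = P k"
    using J_mult[of "chi \<one>" "chi k"] J_mult[of "chi k" "chi \<one>"] k(1) by (simp_all add: P_def)
  then have Pk: "P k \<in> B0" using k(1) by (simp add: mem_B0)
  have "(\<nu> (P k))\<^sup>2 = \<nu> (P k)" using nu_cstar[OF Pk] k(1) by simp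
  moreover have "\<nu> (P k) \<noteq> 0" using nu_eq_zero[OF Pk] P_nonzero[OF k(1)] by blast
  ultimately have n1: "\<nu> (P k) = 1" by (simp add: power2_eq_square)
  have "cmod (\<tau> b) = \<nu> (P k * (b * P k))" using nu_scl[OF Pk] n1 by (simp add: compr)
  also have "\<dots> \<le> \<nu> (P k) * \<nu> (b * P k)" using b Pk by (intro nu_mult) auto
  also have "\<dots> \<le> \<nu> b" using nu_mult[OF b Pk] n1 by simp
  finally show ?thesis .
qed

lemma posfun_\<tau>: "posfun B0 \<tau>"
  unfolding posfun_def
proof (intro conjI ballI allI)
  fix u v k assume u: "u \<in> B0"
  show "\<tau> (k \<odot> u) = k * \<tau> u" using u by (simp add: \<tau>_scl B0_A0)
  show "\<tau> (u + v) = \<tau> u + \<tau> v" if "v \<in> B0" using u that by (simp add: \<tau>_add B0_A0)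
  have "\<tau> (adj u * u) = complex_of_real ((norm (Rep_lop (l u) (\<eta> \<one>)))\<^sup>2)"
    using \<tau>_mult[OF B0_A0[OF u] B0_A0[OF u], of \<one>] by (simp only: cinner_self N_simps)
  then show "0 \<le> Re (\<tau> (adj u * u))" "Im (\<tau> (adj u * u)) = 0" by (simp_all only: Re_complex_of_real Im_complex_of_real) simp
qed

lemma norm_fibre_le:
  assumes \<nu>: "cstar_normed B0 \<nu>" and b: "b \<in> B0" and a: "a \<in> A0" and y: "y \<in> N"
  shows "norm (Rep_lop (l (b * (a * p))) (\<eta> y)) \<le> \<nu> b * norm (Rep_lop (l (a * p)) (\<eta> y))"
proof -
  interpret cstar_normed B0 \<nu> by (rule \<nu>)
  define c where "c = p * (a * p)"
  have c: "c \<in> B0" unfolding c_def by (rule B0I[OF a])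
  have bp: "b * p = b" using b by (simp add: mem_B0)
  have bc: "b * (a * p) = b * c" unfolding c_def by (simp only: mult.assoc[of b p "a * p", symmetric] bp)
  have sq: "(norm (Rep_lop (l x) (\<eta> y)))\<^sup>2 = Re (\<tau> (adj x * x))" if "x \<in> A0" for x
    using arg_cong[OF \<tau>_mult[OF that that y], of Re] by (simp add: cinner_self)
  have "Re (\<tau> (adj c * (adj b * b) * c)) \<le> (\<nu> b)\<^sup>2 * Re (\<tau> (adj c * c))"
    by (rule posfun_bound[OF posfun_\<tau> \<tau>_le[OF \<nu>] b c])
  moreover have "adj c * (adj b * b) * c = adj (b * c) * (b * c)" by (simp add: mult.assoc)
  ultimately have "(norm (Rep_lop (l (b * c)) (\<eta> y)))\<^sup>2 \<le> (\<nu> b * norm (Rep_lop (l c) (\<eta> y)))\<^sup>2"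
    using b c by (simp only: sq B0_A0 mult_mem power_mult_distrib)
  then have 1: "norm (Rep_lop (l (b * c)) (\<eta> y)) \<le> \<nu> b * norm (Rep_lop (l c) (\<eta> y))"
    by (rule power2_le_imp_le) (use b in simp)
  have "Rep_lop (l c) (\<eta> y) = Rep_lop (l p) (Rep_lop (l (a * p)) (\<eta> y))"
    unfolding c_def using a by (simp add: l_mult A0_A Rep_lop_times)
  then have "norm (Rep_lop (l c) (\<eta> y)) \<le> lnorm (l p) * norm (Rep_lop (l (a * p)) (\<eta> y))"
    using lnorm_apply by simp
  also have "\<dots> \<le> 1 * norm (Rep_lop (l (a * p)) (\<eta> y))"
  proof (rule mult_right_mono)
    have "adj (l p) * l p = l p" using l_adj[of p] l_mult[of p p] p_A by simp
    then have "(lnorm (l p))\<^sup>2 = lnorm (l p)" using lop.nu_cstar[of "l p"] by simp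
    then show "lnorm (l p) \<le> 1" by (auto simp: power2_eq_square)
  qed simp
  finally have 2: "norm (Rep_lop (l c) (\<eta> y)) \<le> norm (Rep_lop (l (a * p)) (\<eta> y))" by simp
  show ?thesis unfolding bc using 1 mult_left_mono[OF 2, of "\<nu> b"] b by simp
qed

text \<open>
  The vectors \<open>\<eta> y\<close> generate pairwise orthogonal subspaces that together contain all basis vectors on which
  the regular representation does not vanish.
\<close>

theorem lnorm_le_cstar_norm:
  assumes \<nu>: "cstar_normed B0 \<nu>" and b: "b \<in> B0"
  shows "lnorm (l b) \<le> \<nu> b"
proof -
  interpret n: cstar_normed B0 \<nu> by (rule \<nu>)
  have bA: "b \<in> A0" by (rule B0_A0[OF b])
  have off: "Rep_lop (l b) (ket i) = 0" if "\<not> (fst i \<in> carrier G \<and> snd i \<in> N)" for i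
    using bA
  proof (induction rule: A0_induct)
    case zero
    show ?case by (rule Rep_l_0)
  next
    case (step s h c y)
    have "Rep_lop (l (iG s * P h)) (ket i) = 0"
      using l_gen_ket[OF step(1,2), of "fst i" "snd i"] that by simp
    then show ?case by (simp only: l_step[OF step(1-3)] step(4) scaleC_zero_right add_0_left)
  qed
  have fin_bound: "norm (Rep_lop (l b) (\<Sum>i\<in>K. c i *\<^sub>C ket i)) \<le> \<nu> b * norm (\<Sum>i\<in>K. c i *\<^sub>C ket i)"
    if K: "finite K" "K \<subseteq> carrier G \<times> N" for K and c :: "'g \<times> 'g \<Rightarrow> complex"
  proof -
    define a where "a y = (\<Sum>i\<in>{i\<in>K. snd i = y}. c i \<odot> iG (fst i \<otimes> y)) * p" for y
    define a' where "a' y = (\<Sum>i\<in>{i\<in>K. snd i = y}. c i \<odot> (iG (fst i \<otimes> y) * p))" for y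
    have NG: "y \<in> carrier G" if "y \<in> N" for y using that subgroup.subset[OF N_subgroup] by blast
    have inK: "fst i \<in> carrier G" "snd i \<in> N" if "i \<in> K" for i using that K(2) by auto
    have a'A: "a' y \<in> A0" for y
      unfolding a'_def by (intro A0.sum_mem A0.scl_mem gen_A0) (use inK NG in auto)
    have a'p: "a' y * p = a' y" for y
      by (simp add: a'_def sum_distrib_right mult.assoc)
    have la': "Rep_lop (l (a' y)) (\<eta> y) = (\<Sum>i\<in>{i\<in>K. snd i = y}. c i *\<^sub>C ket i)" if y: "y \<in> N" for y
    proof -
      have "Rep_lop (l (\<Sum>i\<in>L. c i \<odot> (iG (fst i \<otimes> y) * p))) (\<eta> y) = (\<Sum>i\<in>L. c i *\<^sub>C ket i)"
        if "finite L" "L \<subseteq> {i\<in>K. snd i = y}" for L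
        using that
      proof (induction L rule: finite_induct)
        case empty
        show ?case by (simp only: sum.empty Rep_l_0)
      next
        case (insert i L)
        have i: "fst i \<in> carrier G" "snd i = y" using insert.prems inK by auto
        have "(\<Sum>i\<in>L. c i \<odot> (iG (fst i \<otimes> y) * p)) \<in> A0"
          by (intro A0.sum_mem A0.scl_mem gen_A0) (use insert.prems inK NG y in auto)
        then have "Rep_lop (l (c i \<odot> (iG (fst i \<otimes> y) * p) + (\<Sum>i\<in>L. c i \<odot> (iG (fst i \<otimes> y) * p)))) (\<eta> y)
            = c i *\<^sub>C Rep_lop (l (iG (fst i \<otimes> y) * p)) (\<eta> y) + Rep_lop (l (\<Sum>i\<in>L. c i \<odot> (iG (fst i \<otimes> y) * p))) (\<eta> y)"
          by (rule l_step[rotated 2]) (use i NG[OF y] in simp_all)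
        moreover have "Rep_lop (l (\<Sum>i\<in>L. c i \<odot> (iG (fst i \<otimes> y) * p))) (\<eta> y) = (\<Sum>i\<in>L. c i *\<^sub>C ket i)"
          by (rule insert.IH) (use insert.prems in auto)
        moreover have "Rep_lop (l (iG (fst i \<otimes> y) * p)) (\<eta> y) = ket (fst i, y)"
          using i NG[OF y] y by (simp add: l_gen_\<eta> chi_one_one m_assoc)
        moreover have "(fst i, y) = i" using i(2) by auto
        ultimately show ?case by (simp only: sum.insert[OF insert.hyps])
      qed
      then show ?thesis unfolding a'_def using K(1) by simp
    qed
    let ?Y = "snd ` K"
    have YN: "?Y \<subseteq> N" using inK by auto
    have split: "(\<Sum>i\<in>K. c i *\<^sub>C ket i) = (\<Sum>y\<in>?Y. Rep_lop (l (a' y)) (\<eta> y))"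
      unfolding sum.image_gen[OF K(1), of "\<lambda>i. c i *\<^sub>C ket i" snd] using YN by (intro sum.cong refl) (auto simp: la')
    have lb: "Rep_lop (l b) (\<Sum>i\<in>K. c i *\<^sub>C ket i) = (\<Sum>y\<in>?Y. Rep_lop (l (b * a' y)) (\<eta> y))"
      unfolding split using a'A bA by (simp add: bop_sum l_mult A0_A Rep_lop_times)
    have fY: "finite ?Y" using K(1) by simp
    have "(norm (Rep_lop (l b) (\<Sum>i\<in>K. c i *\<^sub>C ket i)))\<^sup>2 = (\<Sum>y\<in>?Y. (norm (Rep_lop (l (b * a' y)) (\<eta> y)))\<^sup>2)"
      unfolding lb by (rule norm_sum_orthogonal[OF fY]) (rule \<tau>_orthogonal, use YN a'A bA in auto)
    also have "\<dots> \<le> (\<Sum>y\<in>?Y. (\<nu> b)\<^sup>2 * (norm (Rep_lop (l (a' y)) (\<eta> y)))\<^sup>2)"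
    proof (rule sum_mono)
      fix y assume "y \<in> ?Y"
      then have y: "y \<in> N" using YN by blast
      have "norm (Rep_lop (l (b * a' y)) (\<eta> y)) \<le> \<nu> b * norm (Rep_lop (l (a' y)) (\<eta> y))"
        using norm_fibre_le[OF \<nu> b a'A y, of y] by (simp only: a'p)
      then have "(norm (Rep_lop (l (b * a' y)) (\<eta> y)))\<^sup>2 \<le> (\<nu> b * norm (Rep_lop (l (a' y)) (\<eta> y)))\<^sup>2"
        by (intro power_mono) auto
      then show "(norm (Rep_lop (l (b * a' y)) (\<eta> y)))\<^sup>2 \<le> (\<nu> b)\<^sup>2 * (norm (Rep_lop (l (a' y)) (\<eta> y)))\<^sup>2"
        by (simp only: power_mult_distrib)
    qed
    also have "\<dots> = (\<nu> b)\<^sup>2 * (norm (\<Sum>i\<in>K. c i *\<^sub>C ket i))\<^sup>2"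
    proof -
      have "(norm (\<Sum>i\<in>K. c i *\<^sub>C ket i))\<^sup>2 = (\<Sum>y\<in>?Y. (norm (Rep_lop (l (a' y)) (\<eta> y)))\<^sup>2)"
        unfolding split by (rule norm_sum_orthogonal[OF fY]) (rule \<tau>_orthogonal, use YN a'A in auto)
      then show ?thesis by (simp only: sum_distrib_left)
    qed
    finally have "(norm (Rep_lop (l b) (\<Sum>i\<in>K. c i *\<^sub>C ket i)))\<^sup>2 \<le> (\<nu> b * norm (\<Sum>i\<in>K. c i *\<^sub>C ket i))\<^sup>2"
      by (simp only: power_mult_distrib)
    then show ?thesis by (rule power2_le_imp_le) (use b in simp)
  qed
  let ?W = "{x :: ('g \<times> 'g) ell2. finite {i. Rep_ell2 x i \<noteq> 0}}"
  have W: "norm (Rep_lop (l b) x) \<le> \<nu> b * norm x" if x: "x \<in> ?W" for x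
  proof -
    define F where "F = {i. Rep_ell2 x i \<noteq> 0}"
    define K where "K = F \<inter> carrier G \<times> N"
    have fF: "finite F" using x by (simp add: F_def)
    have xs: "x = (\<Sum>i\<in>F. Rep_ell2 x i *\<^sub>C ket i)" by (rule finite_support_sum[OF fF]) (simp add: F_def)
    let ?z = "\<Sum>i\<in>K. Rep_ell2 x i *\<^sub>C ket i"
    have "Rep_lop (l b) x = (\<Sum>i\<in>F. Rep_ell2 x i *\<^sub>C Rep_lop (l b) (ket i))"
      by (subst xs) (simp add: bop_sum bop_scaleC)
    also have "\<dots> = (\<Sum>i\<in>K. Rep_ell2 x i *\<^sub>C Rep_lop (l b) (ket i))"
    proof (rule sum.mono_neutral_right[OF fF])
      show "\<forall>i\<in>F - K. Rep_ell2 x i *\<^sub>C Rep_lop (l b) (ket i) = 0"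
      proof
        fix i assume "i \<in> F - K"
        then have "\<not> (fst i \<in> carrier G \<and> snd i \<in> N)" by (simp add: K_def mem_Times_iff)
        from off[OF this] show "Rep_ell2 x i *\<^sub>C Rep_lop (l b) (ket i) = 0" by (simp only: scaleC_zero_right)
      qed
    qed (simp add: K_def)
    also have "\<dots> = Rep_lop (l b) ?z" by (simp add: bop_sum bop_scaleC)
    finally have "norm (Rep_lop (l b) x) = norm (Rep_lop (l b) ?z)" by simp
    also have "\<dots> \<le> \<nu> b * norm ?z" using fF by (intro fin_bound) (auto simp: K_def)
    also have "\<dots> \<le> \<nu> b * norm x"
    proof (rule mult_left_mono)
      have "(norm ?z)\<^sup>2 = (\<Sum>i\<in>K. (norm (Rep_ell2 x i *\<^sub>C ket i))\<^sup>2)"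
        by (rule norm_sum_orthogonal)
           (use fF in \<open>auto simp: K_def cinner_scaleC_left cinner_scaleC_right ket_orthogonal\<close>)
      also have "\<dots> \<le> (norm x)\<^sup>2"
        using sum_cmod_le_norm_ell2[of K x] fF by (simp add: norm_scaleC norm_ket K_def)
      finally show "norm ?z \<le> norm x" by (rule power2_le_imp_le) simp
    qed (use b in simp)
    finally show ?thesis .
  qed
  show ?thesis
  proof (rule lnorm_le)
    show "0 \<le> \<nu> b" using b by simp
    fix x
    have "x \<in> closure ?W" using finite_support_dense by blast
    then obtain X where X: "\<And>n. X n \<in> ?W" "X \<longlonglongrightarrow> x" unfolding closure_sequential by blast
    show "norm (Rep_lop (l b) x) \<le> \<nu> b * norm x"
    proof (rule LIMSEQ_le)
      show "(\<lambda>n. norm (Rep_lop (l b) (X n))) \<longlonglongrightarrow> norm (Rep_lop (l b) x)"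
        by (rule tendsto_norm[OF bounded_linear.tendsto[OF bop_bounded_linear[OF bop_Rep] X(2)]])
      show "(\<lambda>n. \<nu> b * norm (X n)) \<longlonglongrightarrow> \<nu> b * norm x" by (intro tendsto_mult tendsto_const tendsto_norm X(2))
    qed (use W[OF X(1)] in auto)
  qed
qed

corollary fnorm_le_cstar_norm:
  assumes \<nu>: "cstar_normed B0 \<nu>" and b: "b \<in> B0"
  shows "fnorm R b \<le> \<nu> b"
  by (rule order_trans[OF fnorm_le_lnorm[OF A0_A[OF B0_A0[OF b]]] lnorm_le_cstar_norm[OF \<nu> b]])

end

section \<open>The corner and its enveloping C*-algebra\<close>

lemma cstar_normed_cong:
  assumes n: "cstar_normed S \<nu>" and eq: "\<And>a. a \<in> S \<Longrightarrow> \<mu> a = \<nu> a"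
  shows "cstar_normed S \<mu>"
proof -
  interpret n: cstar_normed S \<nu> by (rule n)
  show ?thesis
    by unfold_locales (simp_all add: eq n.nu_scl n.nu_add n.nu_mult n.nu_cstar n.nu_eq_zero)
qed

lemma hom_on_cong:
  assumes C: "star_sub C" and h: "hom_on C \<phi>" and eq: "\<And>a. a \<in> C \<Longrightarrow> \<psi> a = \<phi> a"
  shows "hom_on C \<psi>"
proof -
  interpret star_sub C by (rule C)
  show ?thesis using h unfolding hom_on_def by (simp add: eq)
qed

text \<open>
  The vector functional of \<open>v\<close> is positive on the corner, and \<open>\<phi> p\<close> is a projection.
\<close>

lemma (in crossed) hom_corner_bounded:
  fixes \<phi> :: "_ \<Rightarrow> 'x::complex_hilbert_space \<Rightarrow> 'x"
  assumes \<phi>: "hom_on B0 \<phi>" and b: "b \<in> B0"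
  shows "onorm (\<phi> b) \<le> fnorm R b"
proof (rule onorm_bound)
  interpret B0: star_sub B0 by (rule star_sub_B0)
  have bf: "b \<in> fams R" using B0_A0[OF b] A0_fams by blast
  show nn: "0 \<le> fnorm R b" by (rule C.nu_nonneg[OF bf])
  fix v
  define f where "f c = cinner (\<phi> c v) v" for c
  have f: "f (adj c * c) = complex_of_real ((norm (\<phi> c v))\<^sup>2)" if "c \<in> B0" for c
    using that by (simp add: f_def hom_on_mult[OF \<phi>] hom_on_adj[OF \<phi>] cinner_cadjoint2 hom_on_bop[OF \<phi>] cinner_self del: of_real_power)
  have "posfun B0 f"
    unfolding posfun_def
  proof (intro conjI ballI allI)
    fix c d k assume c: "c \<in> B0"
    show "f (k \<odot> c) = k * f c" using c by (simp add: f_def hom_on_scl[OF \<phi>] cinner_scaleC_left)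
    show "f (c + d) = f c + f d" if "d \<in> B0" using c that by (simp add: f_def hom_on_add[OF \<phi>] cinner_add_left)
    show "0 \<le> Re (f (adj c * c))" "Im (f (adj c * c)) = 0"
      unfolding f[OF c] Re_complex_of_real Im_complex_of_real by simp_all
  qed
  from posfun_corner_le[OF this b]
  have 1: "(norm (\<phi> b v))\<^sup>2 \<le> (fnorm R b)\<^sup>2 * Re (f p)" unfolding f[OF b] Re_complex_of_real .
  have "f p = complex_of_real ((norm (\<phi> p v))\<^sup>2)" using f[OF p_B0] by simp
  then have fp: "Re (f p) = (norm (\<phi> p v))\<^sup>2" by (simp only: Re_complex_of_real)
  have "Re (f p) \<le> norm (\<phi> p v) * norm v"
    unfolding f_def by (rule order_trans[OF complex_Re_le_cmod cmod_cinner_le])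
  then have "norm (\<phi> p v) * norm (\<phi> p v) \<le> norm (\<phi> p v) * norm v" by (simp add: fp power2_eq_square)
  then have "norm (\<phi> p v) \<le> norm v" by (cases "norm (\<phi> p v) = 0") (simp_all add: mult_le_cancel_left)
  then have "Re (f p) \<le> (norm v)\<^sup>2" unfolding fp by (intro power_mono) auto
  then have "(fnorm R b)\<^sup>2 * Re (f p) \<le> (fnorm R b)\<^sup>2 * (norm v)\<^sup>2" by (intro mult_left_mono) auto
  with 1 have "(norm (\<phi> b v))\<^sup>2 \<le> (fnorm R b * norm v)\<^sup>2" by (simp add: power_mult_distrib)
  then show "norm (\<phi> b v) \<le> fnorm R b * norm v" by (rule power2_le_imp_le) (use nn in simp)
qed

context crossed_regular
begin

text \<open>
  The regular representation bounds a C*-norm on the corner from below, and the positive functionals that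
  compute it, being functionals of covariant representations, bound it from above.
\<close>

theorem cstar_norm_corner_eq:
  assumes \<nu>: "cstar_normed B0 \<nu>" and b: "b \<in> B0"
  shows "\<nu> b = fnorm R b"
proof (rule antisym)
  interpret n: cstar_normed B0 \<nu> by (rule \<nu>)
  interpret cstar_unital B0 \<nu> p
    by unfold_locales (use p_B0 in \<open>auto simp: mem_B0\<close>)
  have bf: "b \<in> fams R" using B0_A0[OF b] A0_fams by blast
  show "\<nu> b \<le> fnorm R b"
  proof (cases "0 < \<nu> (adj b * b)")
    case True
    obtain f where f: "positive_functional f" "f p = 1" "\<nu> (adj b * b) \<le> Re (f (adj b * b))"
      by (rule norming_positive_functional[OF b True]) (rule that)
    have "posfun B0 f" using f(1) unfolding positive_functional_def posfun_def by blast
    from posfun_corner_le[OF this b] have "(\<nu> b)\<^sup>2 \<le> (fnorm R b)\<^sup>2" using f(2,3) n.nu_cstar[OF b] by simp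
    then show ?thesis by (rule power2_le_imp_le) (rule C.nu_nonneg[OF bf])
  next
    case False
    then have "\<nu> b = 0" using n.nu_cstar[OF b] by (simp add: not_less)
    then show ?thesis using C.nu_nonneg[OF bf] by simp
  qed
  show "fnorm R b \<le> \<nu> b" by (rule fnorm_le_cstar_norm[OF \<nu> b])
qed

abbreviation (input) FA where "FA \<equiv> full_crossed_product G N H M"

lemma corner_eq: "X \<subseteq> A \<Longrightarrow> corner FA (i_D G N H M (indicator M)) (tf ` X) = tf ` {p * (a * p) |a. a \<in> X}"
proof -
  assume X: "X \<subseteq> A"
  interpret A: star_sub A by (rule A_facts(2))
  interpret rA: represented A FA tf by (rule represented_A)
  have "chi \<one> \<in> D" using D_facts(2)[OF finq] chi_D0[OF one_closed] by blast
  moreover have "chi \<one> = indicator M" by (simp add: chi_def bset_one)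
  ultimately have p: "i_D G N H M (indicator M) = tf p" using tf_i(2)[of "chi \<one>"] by (simp add: P_def)
  have "sa_mult FA (tf p) (sa_mult FA (tf a) (tf p)) = tf (p * (a * p))" if "a \<in> X" for a
    using that X p_A by (simp add: rA.rep_mult subsetD)
  then show ?thesis unfolding corner_def p image_image by (auto simp: image_iff)
qed

lemma sa_norm_FA: "sa_norm FA (tf a) = fnorm R a"
  unfolding full_crossed_product_eq by (simp add: tf_def op_families_norm)

theorem corner_unique_norm_and_enveloping:
  "has_unique_cstar_norm (FA\<lparr>carrier := corner FA (i_D G N H M (indicator M)) (alg_crossed_product G N H M D0)\<rparr>)
    \<and> enveloping_cstar TYPE('x::complex_hilbert_space)
        (FA\<lparr>carrier := corner FA (i_D G N H M (indicator M)) (carrier FA)\<rparr>)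
        (corner FA (i_D G N H M (indicator M)) (alg_crossed_product G N H M D0))"
proof -
  interpret rA: represented A FA tf by (rule represented_A)
  note BF = B_facts
  have alg: "alg_crossed_product G N H M D0 = tf ` A0"
    unfolding A0_eq by (rule alg_crossed_product_eq[OF D_facts(2)[OF finq]])
  have c0: "corner FA (i_D G N H M (indicator M)) (alg_crossed_product G N H M D0) = tf ` B0"
    unfolding alg B0_def by (rule corner_eq[OF A_facts(4)])
  have c1: "corner FA (i_D G N H M (indicator M)) (carrier FA) = tf ` B"
    unfolding rA.rep_carrier B_def by (rule corner_eq) simp
  let ?SB = "FA\<lparr>carrier := tf ` B0\<rparr>" and ?S = "FA\<lparr>carrier := tf ` B\<rparr>"
  have B0A: "B0 \<subseteq> A" using BF(1,2) by blast
  interpret r0: represented B0 ?SB tf by (rule rA.represented_subset[OF star_sub_B0 B0A])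
  interpret r: represented B ?S tf by (rule rA.represented_subset[OF star_sub_B BF(1)])
  interpret Bn: cstar_complete B "fnorm R" by (rule BF(3))
  have "has_unique_cstar_norm ?SB"
    unfolding has_unique_cstar_norm_def
  proof (rule ex_ex1I)
    have "cstar_normed B0 (fnorm R)" by (rule Bn.cstar_normed_subset[OF star_sub_B0 BF(2)])
    then have "cstar_normed B0 (\<lambda>a. restrict (sa_norm FA) (tf ` B0) (tf a))"
      by (rule cstar_normed_cong) (simp add: sa_norm_FA)
    then show "\<exists>\<nu>. \<nu> \<in> extensional (carrier ?SB) \<and> cstar_norm ?SB \<nu>"
      unfolding r0.cstar_norm_iff by (intro exI[of _ "restrict (sa_norm FA) (tf ` B0)"]) simp
    fix \<nu> \<mu> assume n: "\<nu> \<in> extensional (carrier ?SB) \<and> cstar_norm ?SB \<nu>" "\<mu> \<in> extensional (carrier ?SB) \<and> cstar_norm ?SB \<mu>"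
    then have eq: "\<nu> (tf b) = \<mu> (tf b)" if "b \<in> B0" for b
      using cstar_norm_corner_eq[OF _ that, of "\<lambda>a. \<nu> (tf a)"] cstar_norm_corner_eq[OF _ that, of "\<lambda>a. \<mu> (tf a)"]
      unfolding r0.cstar_norm_iff by simp
    show "\<nu> = \<mu>"
    proof (rule extensionalityI)
      show "\<nu> \<in> extensional (tf ` B0)" "\<mu> \<in> extensional (tf ` B0)" using n by simp_all
      show "\<nu> x = \<mu> x" if "x \<in> tf ` B0" for x using that eq by blast
    qed
  qed
  moreover have "enveloping_cstar TYPE('x) ?S (tf ` B0)"
    unfolding enveloping_cstar_def
  proof (intro conjI allI impI)
    have norm: "(\<lambda>a. sa_norm ?S (tf a)) = fnorm R" by (rule ext) (simp add: sa_norm_FA)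
    show "cstar_algebra ?S"
      by (rule cstar_algebra_if_represented[OF r.represented_axioms]) (unfold norm, rule BF(3))
    show "star_subalgebra ?S (tf ` B0)" unfolding r.star_subalgebra_iff[OF BF(2)] by (rule star_sub_B0)
    have "sa_closure ?S (tf ` B0) = tf ` Bn.cls B0"
      using sa_closure_if_represented[OF r.represented_axioms _ BF(2)] Bn.cstar_seminormed_axioms unfolding norm .
    then show "sa_closure ?S (tf ` B0) = carrier ?S" by (simp add: BF(4))
    fix \<phi> :: "_ \<Rightarrow> 'x \<Rightarrow> 'x"
    assume \<phi>: "star_hom (?S\<lparr>carrier := tf ` B0\<rparr>) bounded_ops \<phi>"
    have h: "hom_on B0 (\<lambda>a. \<phi> (tf a))"
      using \<phi> r0.star_hom_iff[of \<phi>] by simp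
    have ext: "\<exists>\<Phi>. hom_on B \<Phi> \<and> (\<forall>b\<in>B0. \<Phi> b = \<phi> (tf b))"
      by (rule Bn.hom_extension[OF star_sub_B0 BF(2,4) h]) (rule hom_corner_bounded[OF h])
    obtain \<Phi> where \<Phi>: "hom_on B \<Phi>" "\<forall>b\<in>B0. \<Phi> b = \<phi> (tf b)"
      using ext by (elim exE conjE) (rule that)
    define \<Psi> where "\<Psi> = restrict (\<lambda>x. \<Phi> (inv_into B tf x)) (tf ` B)"
    have \<Psi>: "\<Psi> (tf a) = \<Phi> a" if "a \<in> B" for a using that by (simp add: \<Psi>_def inv_into_f_f[OF r.rep_inj])
    show "\<exists>!\<Phi>. \<Phi> \<in> extensional (carrier ?S) \<and> star_hom ?S bounded_ops \<Phi> \<and> (\<forall>b\<in>tf ` B0. \<Phi> b = \<phi> b)"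
    proof (rule ex1I[of _ \<Psi>])
      have "hom_on B (\<lambda>a. \<Psi> (tf a))" by (rule hom_on_cong[OF star_sub_B \<Phi>(1)]) (rule \<Psi>)
      then have "star_hom ?S bounded_ops \<Psi>" using r.star_hom_iff[of \<Psi>] by blast
      moreover have "\<Psi> x = \<phi> x" if "x \<in> tf ` B0" for x using that \<Psi> \<Phi>(2) BF(2) by auto
      ultimately show "\<Psi> \<in> extensional (carrier ?S) \<and> star_hom ?S bounded_ops \<Psi> \<and> (\<forall>b\<in>tf ` B0. \<Psi> b = \<phi> b)"
        by (simp add: \<Psi>_def)
      fix \<Theta> assume \<Theta>: "\<Theta> \<in> extensional (carrier ?S) \<and> star_hom ?S bounded_ops \<Theta> \<and> (\<forall>b\<in>tf ` B0. \<Theta> b = \<phi> b)"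
      then have h\<Theta>: "hom_on B (\<lambda>a. \<Theta> (tf a))" using r.star_hom_iff[of \<Theta>] by blast
      have eq: "\<Theta> (tf a) = \<Psi> (tf a)" if a: "a \<in> B" for a
        unfolding \<Psi>[OF a]
        by (rule Bn.hom_unique[OF BF(2,4) h\<Theta> \<Phi>(1) _ a]) (use \<Theta> \<Phi>(2) in simp)
      show "\<Theta> = \<Psi>"
      proof (rule extensionalityI)
        show "\<Theta> \<in> extensional (tf ` B)" using \<Theta> by simp
        show "\<Psi> \<in> extensional (tf ` B)" by (simp add: \<Psi>_def)
        show "\<Theta> x = \<Psi> x" if "x \<in> tf ` B" for x using that eq by blast
      qed
    qed
  qed
  ultimately show ?thesis unfolding c0 c1 by (rule conjI)
qed

end

theorem corollary4p12:
  fixes G :: "('g, 'm) monoid_scheme" and N H M :: "'g set"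
    and \<Lambda> :: "'g univ_family \<Rightarrow> 'g reg_space \<Rightarrow> 'g reg_space"
  defines "A \<equiv> full_crossed_product G N H M"
    and "A0 \<equiv> alg_crossed_product G N H M (D0_alg G N H M)"
    and "p \<equiv> i_D G N H M (indicator M)"
  assumes "semidirect_setting G N H M"
    and "finite_quotients G H M"
    and "acts_effectively G H M"
    and "regular_representation G N H M \<Lambda>"
    and "bij_betw \<Lambda> (carrier A) (carrier (reduced_crossed_product G N H M))"
  shows "has_unique_cstar_norm (A\<lparr>carrier := corner A p A0\<rparr>)
    \<and> enveloping_cstar TYPE('x::complex_hilbert_space)
        (A\<lparr>carrier := corner A p (carrier A)\<rparr>) (corner A p A0)"
proof -
  have "crossed_regular G N H M \<Lambda>"
    by (intro crossed_regular.intro crossed.intro crossed_axioms.intro crossed_regular_axioms.intro)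
       (use assms in \<open>simp_all add: A_def\<close>)
  from crossed_regular.corner_unique_norm_and_enveloping[OF this, where 'x = 'x]
  show ?thesis unfolding A_def A0_def p_def .
qed

end
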